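(* Let $f$ be a polynomial diffeomorphism of $\mathbb C^2$ of dynamical degree $d>1$. Let $x\in\mathcal J_{j,k}'$ be a point of backward contraction. Let $\tau=[\tau^\iota(x)]$ denote the greatest integer in $\tau^\iota(x)$. Then $\tau^s(\hat x)\ge j\tau$ for all $\hat x\in\alpha(x)$.
   Context: $f:\mathbb C^2\to\mathbb C^2$ is a polynomial diffeomorphism of dynamical degree $d>1$ (up to polynomial conjugacy, a finite composition of generalized Hénon maps, of degree $d$). $K^\pm$ is the set of points with bounded forward/backward orbit, $J^\pm=\partial K^\pm$, $G^{\pm}(x)=\lim_{n\to\infty}d^{-n}\log^+\|f^{\pm n}(x)\|$. $J^*$ is the closure of the set of saddle (periodic) points. Unstable objects (superscript $u$). Fix a family $\psi_S=\{\psi_y:y\in S\}$: $S\subset J^*$ is dense with $f(S)=S$, and each $\psi_y:\mathbb C\to\mathbb C^2$ is an injective holomorphic immersion such that (i) $y\in\psi_y(\mathbb C)\subset J^-$; (ii) $f(\psi_y(\mathbb C))=\psi_{fy}(\mathbb C)$, and the sets $\psi_{y_1}(\mathbb C),\psi_{y_2}(\mathbb C)$ are disjoint or equal; (iii) $\psi_y(0)=y$, $\max_{|\zeta|\le1}G^+(\psi_y(\zeta))=1$. Let $\lambda_y$ satisfy $f(\psi_y(\zeta))=\psi_{fy}(\lambda_y\zeta)$ and $m_y(r)=\max_{|\zeta|\le r}G^+(\psi_y(\zeta))$. For $x\in J^*$ put (with $y=x$ allowed in limits) $M_x(r)=\limsup_{S\ni y\to x}m_y(r)$, $R_x=\inf\{r:M_x(r)=\infty\}$,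 $\hat\lambda_x=\liminf_{S\ni y\to x}|\lambda_y|$, and for $n\ge1$, $\hat\lambda^u(x,-n)=\prod_{i=1}^n\hat\lambda_{f^{-i}x}^{-1}$. $\Psi^u_x$ is the set of holomorphic maps on $\{|\zeta|<R_x\}$ that are locally uniform limits of $\psi_{y_j}$, $S\ni y_j\to x$. For $\psi\in\Psi^u_x$, $\mathrm{Ord}(\psi)=\min\{n\ge1:\psi^{(n)}(0)\ne0\}$ ($=\infty$ if $\psi$ is constant), and $\tau^u(x)=\sup_{\psi\in\Psi^u_x}\mathrm{Ord}(\psi)$. All non-constant $\psi\in\Psi^u_x$ define the same germ at $x$ of a complex variety (the germ of the image of a small disk about $0$), denoted $V^u_x$. Stable objects (superscript $s$): $\Psi^s_x$, $\tau^s$, $V^s_x$ are the corresponding objects for $f^{-1}$ (with $G^-$, $J^+$ replacing $G^+$, $J^-$). $\mathcal J_{j,k}=\{x\in J^*:\tau^s(x)=j,\ \tau^u(x)=k\}$ for positive integers $j,k$. $\alpha(x)$ is the set of accumulation points of $f^nx$ as $n\to-\infty$, and $\mathcal J'_{j,k}=\{x\in\mathcal J_{j,k}:\alpha(x)\cap\mathcal J_{j,k}\ne\emptyset\}$. $x$ is a point of backward contraction if $\hat\lambda^u(x,n)\to0$ as $n\to-\infty$. $\tau^\iota(x)$ is the order of contact of $V^u_x$ and $V^s_x$: the maximal value $\tau$ for which there is a holomorphic coordinate system $(z,w)$ near $x=(0,0)$ in which (local representatives of) $V^u_x\cup V^s_x$ within $\{|z|,|w|<1\}$ is contained in $\{|z|\le|w|^\tau\}$.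 Thus $\tau^\iota(x)=1$ when the tangent cones of $V^u_x$ and $V^s_x$ at $x$ differ. *)

theory Defs
  imports "HOL-Complex_Analysis.Complex_Analysis" "HOL-Computational_Algebra.Polynomial"
begin

text \<open>
  Backward iteration, and every stable object, is expressed by applying the forward or unstable
  definition to \<open>inv f\<close>, so that for instance \<open>Jplus (inv f)\<close> is \<open>J\<^sup>-\<close>.
\<close>

type_synonym C2 = "complex \<times> complex"

definition cscale :: "complex \<Rightarrow> C2 \<Rightarrow> C2" where
  "cscale c v = (c * fst v, c * snd v)"


subsection \<open>Polynomial diffeomorphisms and the dynamical degree\<close>

text \<open>An element of \<open>complex poly poly\<close> is a polynomial in the second coordinate
  whose coefficients are polynomials in the first.\<close>

definition poly2 :: "complex poly poly \<Rightarrow> C2 \<Rightarrow> complex" where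
  "poly2 P p = poly (poly P [:snd p:]) (fst p)"

definition total_degree_le :: "complex poly poly \<Rightarrow> nat \<Rightarrow> bool" where
  "total_degree_le P m \<longleftrightarrow> (\<forall>i k. coeff (coeff P i) k \<noteq> 0 \<longrightarrow> i + k \<le> m)"

definition polynomial_map :: "(C2 \<Rightarrow> C2) \<Rightarrow> bool" where
  "polynomial_map f \<longleftrightarrow> (\<exists>P Q. \<forall>p. f p = (poly2 P p, poly2 Q p))"

definition polynomial_map_degree :: "(C2 \<Rightarrow> C2) \<Rightarrow> nat" where
  "polynomial_map_degree f =
     (LEAST m. \<exists>P Q. (\<forall>p. f p = (poly2 P p, poly2 Q p)) \<and>
        total_degree_le P m \<and> total_degree_le Q m)"

definition polynomial_diffeomorphism :: "(C2 \<Rightarrow> C2) \<Rightarrow> bool" where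
  "polynomial_diffeomorphism f \<longleftrightarrow> bij f \<and> polynomial_map f \<and> polynomial_map (inv f)"

definition has_dynamical_degree :: "(C2 \<Rightarrow> C2) \<Rightarrow> real \<Rightarrow> bool" where
  "has_dynamical_degree f d \<longleftrightarrow>
     (\<lambda>n. root n (real (polynomial_map_degree (f ^^ n)))) \<longlonglongrightarrow> d"


subsection \<open>Invariant sets and the Green function\<close>

definition Kplus :: "(C2 \<Rightarrow> C2) \<Rightarrow> C2 set" where
  "Kplus f = {p. bounded (range (\<lambda>n. (f ^^ n) p))}"

definition Jplus :: "(C2 \<Rightarrow> C2) \<Rightarrow> C2 set" where
  "Jplus f = frontier (Kplus f)"

definition green :: "real \<Rightarrow> (C2 \<Rightarrow> C2) \<Rightarrow> C2 \<Rightarrow> real" where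
  "green d f p = lim (\<lambda>n. max 0 (ln (norm ((f ^^ n) p))) / d ^ n)"

definition saddle_point :: "(C2 \<Rightarrow> C2) \<Rightarrow> C2 \<Rightarrow> bool" where
  "saddle_point f p \<longleftrightarrow>
     (\<exists>n\<ge>1. (f ^^ n) p = p \<and>
       (\<exists>D. ((f ^^ n) has_derivative D) (at p) \<and>
         (\<exists>l1 l2 v1 v2. v1 \<noteq> 0 \<and> v2 \<noteq> 0 \<and> D v1 = cscale l1 v1 \<and> D v2 = cscale l2 v2 \<and>
            norm l1 < 1 \<and> 1 < norm l2)))"

definition Jstar :: "(C2 \<Rightarrow> C2) \<Rightarrow> C2 set" where
  "Jstar f = closure {p. saddle_point f p}"

text \<open>Cluster points of the backward orbit.\<close>

definition alpha_limit :: "(C2 \<Rightarrow> C2) \<Rightarrow> C2 \<Rightarrow> C2 set" where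
  "alpha_limit f x = {p. \<exists>r. strict_mono r \<and> (\<lambda>n. (inv f ^^ r n) x) \<longlonglongrightarrow> p}"


subsection \<open>Parametrized unstable curves\<close>

definition holomorphic_curve_on :: "(complex \<Rightarrow> C2) \<Rightarrow> complex set \<Rightarrow> bool" where
  "holomorphic_curve_on \<phi> A \<longleftrightarrow>
     (\<lambda>z. fst (\<phi> z)) holomorphic_on A \<and> (\<lambda>z. snd (\<phi> z)) holomorphic_on A"

definition curve_deriv :: "nat \<Rightarrow> (complex \<Rightarrow> C2) \<Rightarrow> complex \<Rightarrow> C2" where
  "curve_deriv n \<phi> z = ((deriv ^^ n) (\<lambda>t. fst (\<phi> t)) z, (deriv ^^ n) (\<lambda>t. snd (\<phi> t)) z)"

definition injective_holomorphic_immersion :: "(complex \<Rightarrow> C2) \<Rightarrow> bool" where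
  "injective_holomorphic_immersion \<phi> \<longleftrightarrow>
     inj \<phi> \<and> holomorphic_curve_on \<phi> UNIV \<and> (\<forall>z. curve_deriv 1 \<phi> z \<noteq> 0)"

definition green_max :: "real \<Rightarrow> (C2 \<Rightarrow> C2) \<Rightarrow> (complex \<Rightarrow> C2) \<Rightarrow> real \<Rightarrow> ereal" where
  "green_max d f \<phi> r = (SUP z\<in>cball 0 r. ereal (green d f (\<phi> z)))"

definition unstable_family ::
    "real \<Rightarrow> (C2 \<Rightarrow> C2) \<Rightarrow> C2 set \<Rightarrow> (C2 \<Rightarrow> complex \<Rightarrow> C2) \<Rightarrow> bool" where
  "unstable_family d f S \<psi> \<longleftrightarrow>
     S \<subseteq> Jstar f \<and> Jstar f \<subseteq> closure S \<and> f ` S = S \<and>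
     (\<forall>y\<in>S. injective_holomorphic_immersion (\<psi> y)) \<and>
     (\<forall>y\<in>S. y \<in> range (\<psi> y) \<and> range (\<psi> y) \<subseteq> Jplus (inv f)) \<and>
     (\<forall>y\<in>S. f ` range (\<psi> y) = range (\<psi> (f y))) \<and>
     (\<forall>y1\<in>S. \<forall>y2\<in>S. range (\<psi> y1) \<inter> range (\<psi> y2) = {} \<or> range (\<psi> y1) = range (\<psi> y2)) \<and>
     (\<forall>y\<in>S. \<psi> y 0 = y \<and> green_max d f (\<psi> y) 1 = 1)"

definition multipliers ::
    "(C2 \<Rightarrow> C2) \<Rightarrow> C2 set \<Rightarrow> (C2 \<Rightarrow> complex \<Rightarrow> C2) \<Rightarrow> (C2 \<Rightarrow> complex) \<Rightarrow> bool" where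
  "multipliers f S \<psi> lam \<longleftrightarrow> (\<forall>y\<in>S. \<forall>z. f (\<psi> y z) = \<psi> (f y) (lam y * z))"

text \<open>The filter of \<open>y \<rightarrow> x\<close> in \<open>S\<close>, where \<open>y = x\<close> is allowed (unlike in \<open>at x within S\<close>).\<close>

definition tends_within :: "C2 \<Rightarrow> C2 set \<Rightarrow> C2 filter" where
  "tends_within x S = inf (nhds x) (principal S)"

definition local_green_max ::
    "real \<Rightarrow> (C2 \<Rightarrow> C2) \<Rightarrow> C2 set \<Rightarrow> (C2 \<Rightarrow> complex \<Rightarrow> C2) \<Rightarrow> C2 \<Rightarrow> real \<Rightarrow> ereal" where
  "local_green_max d f S \<psi> x r = Limsup (tends_within x S) (\<lambda>y. green_max d f (\<psi> y) r)"

definition limit_radius ::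
    "real \<Rightarrow> (C2 \<Rightarrow> C2) \<Rightarrow> C2 set \<Rightarrow> (C2 \<Rightarrow> complex \<Rightarrow> C2) \<Rightarrow> C2 \<Rightarrow> ereal" where
  "limit_radius d f S \<psi> x = Inf (ereal ` {r. 0 \<le> r \<and> local_green_max d f S \<psi> x r = \<infinity>})"

definition limit_disk ::
    "real \<Rightarrow> (C2 \<Rightarrow> C2) \<Rightarrow> C2 set \<Rightarrow> (C2 \<Rightarrow> complex \<Rightarrow> C2) \<Rightarrow> C2 \<Rightarrow> complex set" where
  "limit_disk d f S \<psi> x = {z. ereal (norm z) < limit_radius d f S \<psi> x}"

text \<open>The extended real value \<open>\<infinity>\<close> can occur, in which case its inverse is \<open>0\<close>.\<close>

definition lambda_hat :: "C2 set \<Rightarrow> (C2 \<Rightarrow> complex) \<Rightarrow> C2 \<Rightarrow> ereal" where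
  "lambda_hat S lam x = Liminf (tends_within x S) (\<lambda>y. ereal (norm (lam y)))"

text \<open>The argument \<open>n\<close> below is the number of backward iterates.\<close>

definition lambda_hat_back ::
    "(C2 \<Rightarrow> C2) \<Rightarrow> C2 set \<Rightarrow> (C2 \<Rightarrow> complex) \<Rightarrow> C2 \<Rightarrow> nat \<Rightarrow> ereal" where
  "lambda_hat_back f S lam x n = (\<Prod>i=1..n. inverse (lambda_hat S lam ((inv f ^^ i) x)))"

definition backward_contraction ::
    "(C2 \<Rightarrow> C2) \<Rightarrow> C2 set \<Rightarrow> (C2 \<Rightarrow> complex) \<Rightarrow> C2 \<Rightarrow> bool" where
  "backward_contraction f S lam x \<longleftrightarrow> (\<lambda>n. lambda_hat_back f S lam x n) \<longlonglongrightarrow> 0"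

text \<open>Members of \<open>limit_maps\<close> are maps on \<open>limit_disk\<close>, encoded as total functions with
  arbitrary values outside the disk; nothing below depends on those values.\<close>

definition limit_maps ::
    "real \<Rightarrow> (C2 \<Rightarrow> C2) \<Rightarrow> C2 set \<Rightarrow> (C2 \<Rightarrow> complex \<Rightarrow> C2) \<Rightarrow> C2 \<Rightarrow> (complex \<Rightarrow> C2) set" where
  "limit_maps d f S \<psi> x =
     {\<phi>. holomorphic_curve_on \<phi> (limit_disk d f S \<psi> x) \<and>
        (\<exists>y :: nat \<Rightarrow> C2. (\<forall>n. y n \<in> S) \<and> y \<longlonglongrightarrow> x \<and>
          (\<forall>z\<in>limit_disk d f S \<psi> x. \<exists>e>0. cball z e \<subseteq> limit_disk d f S \<psi> x \<and>
             uniform_limit (cball z e) (\<lambda>n. \<psi> (y n)) \<phi> sequentially))}"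

text \<open>An infimum over the empty set is \<open>\<infinity>\<close>; this is the case of a constant map.\<close>

definition curve_order :: "(complex \<Rightarrow> C2) \<Rightarrow> enat" where
  "curve_order \<phi> = Inf (enat ` {n. 1 \<le> n \<and> curve_deriv n \<phi> 0 \<noteq> 0})"

definition max_order ::
    "real \<Rightarrow> (C2 \<Rightarrow> C2) \<Rightarrow> C2 set \<Rightarrow> (C2 \<Rightarrow> complex \<Rightarrow> C2) \<Rightarrow> C2 \<Rightarrow> enat" where
  "max_order d f S \<psi> x = (SUP \<phi>\<in>limit_maps d f S \<psi> x. curve_order \<phi>)"

text \<open>The germ \<open>V\<^sub>x\<close>, encoded as the collection of all its representatives: sets that coincide
  near \<open>x\<close> with the image of a small disk under a non-constant limit map.\<close>

definition variety_germ ::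
    "real \<Rightarrow> (C2 \<Rightarrow> C2) \<Rightarrow> C2 set \<Rightarrow> (C2 \<Rightarrow> complex \<Rightarrow> C2) \<Rightarrow> C2 \<Rightarrow> C2 set set" where
  "variety_germ d f S \<psi> x =
     {V. \<exists>\<phi>\<in>limit_maps d f S \<psi> x. \<not> \<phi> constant_on limit_disk d f S \<psi> x \<and>
        (\<forall>\<^sub>F e in at_right 0. \<forall>\<^sub>F p in nhds x. p \<in> V \<longleftrightarrow> p \<in> \<phi> ` ball 0 e)}"


subsection \<open>Order of contact\<close>

definition holomorphic_map_on :: "(C2 \<Rightarrow> C2) \<Rightarrow> C2 set \<Rightarrow> bool" where
  "holomorphic_map_on F U \<longleftrightarrow>
     (\<forall>p\<in>U. \<exists>D. (F has_derivative D) (at p) \<and> (\<forall>c v. D (cscale c v) = cscale c (D v)))"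

definition unit_bidisk :: "C2 set" where
  "unit_bidisk = ball 0 1 \<times> ball 0 1"

text \<open>The coordinates are \<open>(z, w) = F p\<close>; their domain is cut down to the preimage of the
  unit bidisk.\<close>

definition holomorphic_coordinates :: "C2 \<Rightarrow> C2 set \<Rightarrow> (C2 \<Rightarrow> C2) \<Rightarrow> bool" where
  "holomorphic_coordinates x U F \<longleftrightarrow>
     open U \<and> x \<in> U \<and> F x = 0 \<and> bij_betw F U unit_bidisk \<and>
     holomorphic_map_on F U \<and> holomorphic_map_on (inv_into U F) unit_bidisk"

text \<open>The two germs are given by their collections of representatives. For coinciding germs
  there is no largest exponent; the supremum then is \<open>\<infinity>\<close>.\<close>

definition contact_order :: "C2 \<Rightarrow> C2 set set \<Rightarrow> C2 set set \<Rightarrow> ereal" where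
  "contact_order x \<V> \<W> =
     Sup (ereal ` {t. 0 < t \<and>
       (\<exists>U F. \<exists>V\<in>\<V>. \<exists>W\<in>\<W>. holomorphic_coordinates x U F \<and>
          (\<forall>p\<in>U \<inter> (V \<union> W). norm (fst (F p)) \<le> norm (snd (F p)) powr t))})"

definition greatest_integer :: "ereal \<Rightarrow> enat" where
  "greatest_integer t = (if t = \<infinity> then \<infinity> else enat (nat \<lfloor>real_of_ereal t\<rfloor>))"


subsection \<open>The strata\<close>

definition stratum ::
    "real \<Rightarrow> (C2 \<Rightarrow> C2) \<Rightarrow> C2 set \<Rightarrow> (C2 \<Rightarrow> complex \<Rightarrow> C2) \<Rightarrow>
     C2 set \<Rightarrow> (C2 \<Rightarrow> complex \<Rightarrow> C2) \<Rightarrow> nat \<Rightarrow> nat \<Rightarrow> C2 set" where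
  "stratum d f Ss \<psi>s Su \<psi>u j k =
     {x \<in> Jstar f. max_order d (inv f) Ss \<psi>s x = enat j \<and> max_order d f Su \<psi>u x = enat k}"

definition stratum' ::
    "real \<Rightarrow> (C2 \<Rightarrow> C2) \<Rightarrow> C2 set \<Rightarrow> (C2 \<Rightarrow> complex \<Rightarrow> C2) \<Rightarrow>
     C2 set \<Rightarrow> (C2 \<Rightarrow> complex \<Rightarrow> C2) \<Rightarrow> nat \<Rightarrow> nat \<Rightarrow> C2 set" where
  "stratum' d f Ss \<psi>s Su \<psi>u j k =
     {x \<in> stratum d f Ss \<psi>s Su \<psi>u j k.
        alpha_limit f x \<inter> stratum d f Ss \<psi>s Su \<psi>u j k \<noteq> {}}"

end

theory Submission
  imports Defs "HOL-Computational_Algebra.Fundamental_Theorem_Algebra"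
begin

text \<open>
  The inverse iterates of \<open>f\<close> flatten the unstable germ at \<open>x\<close>, the contact of the two germs carries
  this over to the stable germ, and in the limit stable curves of high order appear.

  On an unstable curve, \<open>inv f ^^ n\<close> multiplies the parameter by the inverse of a product of \<open>n\<close>
  multipliers, and all unstable curves are bounded by one constant on the unit disk. Backward
  contraction therefore makes every Taylor coefficient of positive order of \<open>(inv f ^^ n) \<circ> \<phi>u\<close> tend to
  0, for an unstable limit map \<open>\<phi>u\<close> at \<open>x\<close> (\<open>unstable_jets_vanish\<close>). Let \<open>\<phi>s\<close> be a stable limit map
  of order \<open>j\<close> at \<open>x\<close>, and suppose that both germs lie in \<open>\<bar>z\<bar> \<le> \<bar>w\<bar> ^ t\<close> in suitable coordinates
  \<open>(z, w)\<close>. Along a curve in this region on which \<open>w\<close> vanishes to order \<open>i\<close>, a function has the same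
  Taylor coefficients of order below \<open>i * t\<close> as its restriction to the axis \<open>z = 0\<close>. So the unstable curve
  shows that the coefficients of positive order below \<open>t\<close> of \<open>inv f ^^ n\<close> on this axis tend to 0, and then
  the coefficients of positive order below \<open>j * t\<close> of \<open>(inv f ^^ n) \<circ> \<phi>s\<close> tend to 0 as well (\<open>jet_transfer\<close>). On stable
  curves \<open>inv f\<close> multiplies the parameter by numbers of modulus at least 1; the coefficients of the stable
  curve based at \<open>(inv f ^^ n) y\<close> are thus at most those of \<open>(inv f ^^ n) \<circ> \<psi>s y\<close>. A diagonal choice of
  base points near \<open>x\<close> and Montel's theorem give a stable limit map at any \<open>xh \<in> alpha_limit f x\<close> whose
  coefficients of order \<open>m\<close> with \<open>1 \<le> m < j * t\<close> vanish (\<open>vanishing_jet_in_limit\<close>). Its order is at least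
  \<open>j * t\<close>, and the supremum over \<open>t\<close> gives the claim.

  Three general facts enter. (1) The Green function of \<open>f\<close> is multiplied by \<open>d\<close> under \<open>f\<close> and has
  bounded sublevel sets on \<open>J\<^sup>-\<close>, and likewise for the inverse (\<open>green_structure\<close>). By Jung's theorem
  (\<open>jung\<close>) and cyclic reduction in an amalgamated product, \<open>f\<close> is conjugate to an alternating composition of
  affine and triangular maps, whose behaviour at infinity is controlled in two complementary sectors.
  (2) Two injective holomorphic parametrizations of one leaf differ by an affine map
  (\<open>same_range_affine\<close>); this provides the stable multipliers, which have modulus at least 1 by
  (1). (3) All nonconstant limit maps at a point have the same germ (\<open>limit_maps_same_germ\<close>); this is
  Hurwitz's principle for intersections of leaves that are disjoint or equal, carried out with a resultant
  (\<open>limit_germ_scalar\<close>).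
\<close>

section \<open>Polynomials in two variables and weighted top forms\<close>

lemma poly2_0 [simp]: "poly2 0 q = 0" by (simp add: poly2_def)
lemma poly2_diff: "poly2 (A - B) q = poly2 A q - poly2 B q" by (simp add: poly2_def)
lemma poly2_mult: "poly2 (A * B) q = poly2 A q * poly2 B q" by (simp add: poly2_def)
lemma poly2_power: "poly2 (A ^ n) q = poly2 A q ^ n" by (simp add: poly2_def poly_power)
lemma poly2_smult: "poly2 (smult [:c:] A) q = c * poly2 A q" by (simp add: poly2_def)
lemma poly2_sum: "poly2 (\<Sum>i\<in>I. A i) q = (\<Sum>i\<in>I. poly2 (A i) q)"
  by (simp add: poly2_def poly_sum)
lemma poly2_monom: "poly2 (monom (monom a i) j) (x,y) = a * x ^ i * y ^ j"
  by (simp add: poly2_def poly_monom)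
lemma poly2_const [simp]: "poly2 [:p:] (x,y) = poly p x" by (simp add: poly2_def)

lemma poly2_eval: "poly2 P (x,y) = (\<Sum>j\<le>degree P. poly (coeff P j) x * y ^ j)"
proof -
  have "poly P [:y:] = (\<Sum>j\<le>degree P. coeff P j * [:y:] ^ j)" by (rule poly_altdef)
  then show ?thesis by (simp add: poly2_def poly_sum poly_power)
qed

lemma poly_as_sum:
  fixes p :: "complex poly"
  assumes "degree p \<le> N" shows "poly p x = (\<Sum>k\<le>N. coeff p k * x ^ k)"
proof -
  have "(\<Sum>k\<le>N. coeff p k * x ^ k) = (\<Sum>k\<le>degree p. coeff p k * x ^ k)"
    by (rule sum.mono_neutral_right) (use assms in \<open>auto simp: coeff_eq_0\<close>)
  then show ?thesis by (simp add: poly_altdef)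
qed

lemma degree_map_poly_poly_le: "degree (map_poly (\<lambda>c. poly c x) P) \<le> degree P" for x :: complex
  by (rule degree_le) (simp add: coeff_map_poly coeff_eq_0)

text \<open>The polynomial \<open>y \<mapsto> P(x, y)\<close> for fixed \<open>x\<close>.\<close>
definition fibre_poly :: "complex poly poly \<Rightarrow> complex \<Rightarrow> complex poly" where
  "fibre_poly P x = map_poly (\<lambda>c. poly c x) P"

lemma poly_fibre_poly: "poly (fibre_poly P x) y = poly2 P (x,y)"
proof -
  have d: "degree (fibre_poly P x) \<le> degree P"
    by (simp add: fibre_poly_def degree_map_poly_poly_le)
  have "poly (fibre_poly P x) y = (\<Sum>j\<le>degree P. coeff (fibre_poly P x) j * y ^ j)"
    by (rule poly_as_sum [OF d])
  then show ?thesis by (simp add: poly2_eval fibre_poly_def coeff_map_poly)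
qed

lemma coeff_fibre_poly: "coeff (fibre_poly P x) j = poly (coeff P j) x"
  by (simp add: fibre_poly_def coeff_map_poly)

lemma degree_fibre_poly: "degree (fibre_poly P x) \<le> degree P"
  by (simp add: fibre_poly_def degree_map_poly_poly_le)

lemma poly2_eq_0_imp:
  assumes "\<And>x y. poly2 P (x,y) = 0" shows "P = 0"
proof (rule poly_eqI)
  fix j
  have "poly (coeff P j) x = 0" for x
  proof -
    have "fibre_poly P x = 0"
      using assms by (intro poly_all_0_iff_0[THEN iffD1] allI) (simp add: poly_fibre_poly)
    then show ?thesis by (metis coeff_0 coeff_fibre_poly)
  qed
  then show "coeff P j = coeff 0 j" using poly_all_0_iff_0[of "coeff P j"] by simp
qed

text \<open>The exponents \<open>(i, j)\<close> of the monomials \<open>x ^ i * y ^ j\<close> that occur in \<open>P\<close>.\<close>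
definition support2 :: "complex poly poly \<Rightarrow> (nat \<times> nat) set" where
  "support2 P = {(i,j). coeff (coeff P j) i \<noteq> 0}"

lemma finite_support2: "finite (support2 P)"
proof -
  have "support2 P \<subseteq> (\<lambda>(j,i). (i,j)) ` (SIGMA j:{..degree P}. {..degree (coeff P j)})"
  proof
    fix z assume z: "z \<in> support2 P"
    obtain i j where ij: "z = (i,j)" by force
    then have "coeff (coeff P j) i \<noteq> 0" using z by (simp add: support2_def)
    then have "i \<le> degree (coeff P j)" "j \<le> degree P"
      using le_degree by (blast, metis coeff_0 le_degree)
    then show "z \<in> (\<lambda>(j,i). (i,j)) ` (SIGMA j:{..degree P}. {..degree (coeff P j)})"
      using ij by force
  qed
  then show ?thesis by (rule finite_subset) auto
qed

lemma poly2_support: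
  "poly2 P (x,y) = (\<Sum>(i,j)\<in>support2 P. coeff (coeff P j) i * x ^ i * y ^ j)"
proof -
  have inj: "inj_on (\<lambda>(j,i). (i,j)) A" for A :: "(nat \<times> nat) set" by (auto simp: inj_on_def)
  let ?S = "SIGMA j:{..degree P}. {..degree (coeff P j)}"
  have "poly2 P (x,y) = (\<Sum>j\<le>degree P. \<Sum>i\<le>degree (coeff P j). coeff (coeff P j) i * x ^ i * y ^ j)"
    by (simp add: poly2_eval poly_altdef[of "coeff P _"] sum_distrib_right)
  also have "\<dots> = (\<Sum>(j,i)\<in>?S. coeff (coeff P j) i * x ^ i * y ^ j)"
    by (subst sum.Sigma) auto
  also have "\<dots> = (\<Sum>(i,j)\<in>(\<lambda>(j,i). (i,j)) ` ?S. coeff (coeff P j) i * x ^ i * y ^ j)"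
    by (subst sum.reindex[OF inj]) (auto simp: case_prod_unfold)
  also have "\<dots> = (\<Sum>(i,j)\<in>support2 P. coeff (coeff P j) i * x ^ i * y ^ j)"
  proof (rule sum.mono_neutral_right)
    show "support2 P \<subseteq> (\<lambda>(j,i). (i,j)) ` ?S"
    proof
      fix z assume z: "z \<in> support2 P"
      obtain i j where ij: "z = (i,j)" by force
      then have "coeff (coeff P j) i \<noteq> 0" using z by (simp add: support2_def)
      then have "i \<le> degree (coeff P j)" "j \<le> degree P"
        using le_degree by (blast, metis coeff_0 le_degree)
      then show "z \<in> (\<lambda>(j,i). (i,j)) ` ?S" using ij by force
    qed
  qed (auto simp: support2_def)
  finally show ?thesis .
qed

text \<open>The degree of \<open>P\<close> when \<open>x\<close> has weight \<open>p\<close> and \<open>y\<close> has weight \<open>q\<close>; meaningful only for \<open>P \<noteq> 0\<close>.\<close>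
definition weight :: "nat \<Rightarrow> nat \<Rightarrow> complex poly poly \<Rightarrow> nat" where
  "weight p q P = Max ((\<lambda>(i,j). p * i + q * j) ` support2 P)"

text \<open>The part of \<open>P\<close> of highest weight, as a function.\<close>
definition top_form :: "nat \<Rightarrow> nat \<Rightarrow> complex poly poly \<Rightarrow> complex \<Rightarrow> complex \<Rightarrow> complex" where
  "top_form p q P x y =
     (\<Sum>(i,j)\<in>{z\<in>support2 P. p * fst z + q * snd z = weight p q P}. coeff (coeff P j) i * x ^ i * y ^ j)"

lemma weight_le: "coeff (coeff P j) i \<noteq> 0 \<Longrightarrow> p * i + q * j \<le> weight p q P"
  unfolding weight_def
  by (rule Max_ge[OF finite_imageI[OF finite_support2]]) (auto simp: support2_def image_iff)

lemma top_form_scale: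
  "top_form p q P (s ^ p * x) (s ^ q * y) = s ^ weight p q P * top_form p q P x y"
  unfolding top_form_def sum_distrib_left
proof (intro sum.cong refl, clarify)
  fix i j assume "p * fst (i,j) + q * snd (i,j) = weight p q P"
  then have "s ^ weight p q P = (s ^ p) ^ i * (s ^ q) ^ j"
    by (simp add: power_mult [symmetric] power_add [symmetric])
  then show "coeff (coeff P j) i * (s ^ p * x) ^ i * (s ^ q * y) ^ j =
       s ^ weight p q P * (coeff (coeff P j) i * x ^ i * y ^ j)"
    by (simp add: power_mult_distrib mult_ac)
qed

lemma top_form_nonzero:
  assumes "P \<noteq> 0" shows "\<exists>x y. top_form p q P x y \<noteq> 0"
proof (rule ccontr)
  assume "\<not> ?thesis"
  then have z: "top_form p q P x y = 0" for x y by blast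
  let ?T = "{z\<in>support2 P. p * fst z + q * snd z = weight p q P}"
  define A where "A = (\<Sum>(i,j)\<in>?T. monom (monom (coeff (coeff P j) i) i) j)"
  have fin: "finite ?T" using finite_support2 by simp
  have "poly2 A (x,y) = top_form p q P x y" for x y
    by (simp add: A_def poly2_sum top_form_def case_prod_unfold poly2_monom)
  then have A0: "A = 0" using z poly2_eq_0_imp by simp
  have "support2 P \<noteq> {}"
  proof
    assume "support2 P = {}"
    then have "poly2 P (x,y) = 0" for x y by (simp add: poly2_support)
    then show False using assms poly2_eq_0_imp by blast
  qed
  then have "weight p q P \<in> (\<lambda>(i,j). p * i + q * j) ` support2 P"
    unfolding weight_def by (intro Max_in) (auto simp: finite_support2)
  then obtain i0 j0 where ij: "(i0,j0) \<in> ?T" by (auto simp: image_iff)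
  have "coeff (coeff A j0) i0 = (\<Sum>(i,j)\<in>?T. if (i,j) = (i0,j0) then coeff (coeff P j) i else 0)"
    unfolding A_def coeff_sum
    by (intro sum.cong refl) (auto simp: coeff_monom)
  also have "\<dots> = (\<Sum>z\<in>?T. if z = (i0,j0) then coeff (coeff P j0) i0 else 0)"
    by (intro sum.cong refl) (auto split: if_splits)
  also have "\<dots> = coeff (coeff P j0) i0"
    using ij fin by (subst sum.delta) auto
  finally show False using ij A0 by (auto simp: support2_def)
qed

lemma top_form_limit:
  fixes s X Y :: "nat \<Rightarrow> complex"
  assumes s: "filterlim s at_infinity sequentially"
    and X: "X \<longlonglongrightarrow> x" and Y: "Y \<longlonglongrightarrow> y"
  shows "(\<lambda>n. poly2 P (s n ^ p * X n, s n ^ q * Y n) / s n ^ weight p q P) \<longlonglongrightarrow> top_form p q P x y"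
proof -
  let ?W = "weight p q P"
  have s0: "eventually (\<lambda>n. s n \<noteq> 0) sequentially"
    using s filterlim_at_infinity_imp_eventually_ne by blast
  have lim: "(\<lambda>n. coeff (coeff P j) i * (s n ^ p * X n) ^ i * (s n ^ q * Y n) ^ j / s n ^ ?W)
      \<longlonglongrightarrow> (if p * i + q * j = ?W then coeff (coeff P j) i * x ^ i * y ^ j else 0)"
    if ij: "(i,j) \<in> support2 P" for i j
  proof -
    have le: "p * i + q * j \<le> ?W" using ij weight_le by (simp add: support2_def)
    define m where "m = ?W - (p * i + q * j)"
    have W: "?W = p * i + q * j + m" using le by (simp add: m_def)
    have ev: "eventually (\<lambda>n. coeff (coeff P j) i * X n ^ i * Y n ^ j * inverse (s n) ^ m =
       coeff (coeff P j) i * (s n ^ p * X n) ^ i * (s n ^ q * Y n) ^ j / s n ^ ?W) sequentially"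
      using s0
    proof eventually_elim
      case (elim n)
      have "s n ^ ?W = (s n ^ p) ^ i * (s n ^ q) ^ j * s n ^ m"
        by (simp add: W power_add power_mult)
      then show ?case using elim by (simp add: power_mult_distrib field_simps)
    qed
    have "(\<lambda>n. inverse (s n) ^ m) \<longlonglongrightarrow> (if m = 0 then 1 else 0)"
    proof (cases "m = 0")
      case False
      have "(\<lambda>n. inverse (s n)) \<longlonglongrightarrow> 0"
        using s by (rule filterlim_compose[OF tendsto_inverse_0])
      from tendsto_power[OF this, of m] False show ?thesis by (simp add: power_0_left)
    qed simp
    then have "(\<lambda>n. coeff (coeff P j) i * X n ^ i * Y n ^ j * inverse (s n) ^ m)
      \<longlonglongrightarrow> coeff (coeff P j) i * x ^ i * y ^ j * (if m = 0 then 1 else 0)"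
      by (intro tendsto_intros X Y)
    moreover have "coeff (coeff P j) i * x ^ i * y ^ j * (if m = 0 then 1 else 0) =
       (if p * i + q * j = ?W then coeff (coeff P j) i * x ^ i * y ^ j else 0)"
      using W by auto
    ultimately show ?thesis
      using Lim_transform_eventually ev by force
  qed
  have "(\<lambda>n. \<Sum>(i,j)\<in>support2 P. coeff (coeff P j) i * (s n ^ p * X n) ^ i * (s n ^ q * Y n) ^ j / s n ^ ?W)
     \<longlonglongrightarrow> (\<Sum>(i,j)\<in>support2 P. if p * i + q * j = ?W then coeff (coeff P j) i * x ^ i * y ^ j else 0)"
    by (rule tendsto_sum) (use lim in auto)
  also have "(\<Sum>(i,j)\<in>support2 P. if p * i + q * j = ?W then coeff (coeff P j) i * x ^ i * y ^ j else 0)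
     = top_form p q P x y"
    unfolding top_form_def using finite_support2
    by (subst sum.inter_filter) (auto intro!: sum.cong)
  finally have lim': "(\<lambda>n. \<Sum>(i,j)\<in>support2 P. coeff (coeff P j) i * (s n ^ p * X n) ^ i * (s n ^ q * Y n) ^ j / s n ^ ?W)
     \<longlonglongrightarrow> top_form p q P x y" .
  have eq: "poly2 P (s n ^ p * X n, s n ^ q * Y n) / s n ^ ?W =
     (\<Sum>(i,j)\<in>support2 P. coeff (coeff P j) i * (s n ^ p * X n) ^ i * (s n ^ q * Y n) ^ j / s n ^ ?W)" for n
    unfolding poly2_support sum_divide_distrib by (rule sum.cong[OF refl]) (simp only: split_beta)
  from lim' show ?thesis by (simp only: eq)
qed

lemma bounded_family_subseq:
  fixes c :: "nat \<Rightarrow> nat \<Rightarrow> 'a::heine_borel"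
  assumes "\<And>k. bounded (range (\<lambda>n. c n k))"
  shows "\<exists>r l. strict_mono r \<and> (\<forall>k\<le>N. (\<lambda>n. c (r n) k) \<longlonglongrightarrow> l k)"
proof (induction N)
  case 0
  obtain l r where "strict_mono (r::nat\<Rightarrow>nat)" "((\<lambda>n. c n 0) \<circ> r) \<longlonglongrightarrow> l"
    using bounded_imp_convergent_subsequence[OF assms[of 0]] by (elim exE conjE)
  then show ?case by (intro exI[of _ r] exI[of _ "\<lambda>_. l"]) (auto simp: o_def)
next
  case (Suc N)
  then obtain r l where r: "strict_mono r" "\<And>k. k \<le> N \<Longrightarrow> (\<lambda>n. c (r n) k) \<longlonglongrightarrow> l k" by blast
  have bdr: "bounded (range (\<lambda>n. c (r n) (Suc N)))"
    using assms[of "Suc N"] by (rule bounded_subset) auto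
  then obtain l' r' where r': "strict_mono (r'::nat\<Rightarrow>nat)" "((\<lambda>n. c (r n) (Suc N)) \<circ> r') \<longlonglongrightarrow> l'"
    using bounded_imp_convergent_subsequence[OF bdr] by (elim exE conjE)
  have "(\<lambda>n. c (r (r' n)) k) \<longlonglongrightarrow> (if k = Suc N then l' else l k)" if "k \<le> Suc N" for k
  proof (cases "k = Suc N")
    case True then show ?thesis using r'(2) by (simp add: o_def)
  next
    case False
    then have "(\<lambda>n. c (r n) k) \<longlonglongrightarrow> l k" using that r(2) by simp
    then show ?thesis using False LIMSEQ_subseq_LIMSEQ[of "\<lambda>n. c (r n) k" "l k" r'] r'(1) by (simp add: o_def)
  qed
  then show ?case
    using strict_mono_o[OF r(1) r'(1)]
    by (intro exI[of _ "r \<circ> r'"] exI[of _ "\<lambda>k. if k = Suc N then l' else l k"]) (auto simp: o_def)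
qed

text \<open>Here \<open>\<rho>\<close> is the scale for a change of parameter \<open>t \<mapsto> \<rho> t\<close> after which the largest
  coefficient of positive degree has norm 1.\<close>
lemma normalise_coefficients:
  fixes c :: "nat \<Rightarrow> 'a::real_normed_vector"
  assumes "\<exists>k\<in>{1..N}. c k \<noteq> 0"
  shows "\<exists>\<rho>>0. (\<forall>k\<in>{1..N}. norm (c k) * \<rho> ^ k \<le> 1) \<and> (\<exists>k\<in>{1..N}. norm (c k) * \<rho> ^ k = 1)"
proof -
  define S where "S = (\<lambda>k. root k (1 / norm (c k))) ` {k\<in>{1..N}. c k \<noteq> 0}"
  define \<rho> where "\<rho> = Min S"
  have S: "finite S" "S \<noteq> {}" using assms by (auto simp: S_def)
  then have "\<rho> \<in> S" by (simp add: \<rho>_def)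
  then obtain k0 where k0: "k0 \<in> {1..N}" "c k0 \<noteq> 0" "\<rho> = root k0 (1 / norm (c k0))"
    by (auto simp: S_def)
  have pos: "\<rho> > 0" using k0 by simp
  have "norm (c k0) * \<rho> ^ k0 = 1" using k0 by (simp add: real_root_pow_pos2)
  moreover have "norm (c k) * \<rho> ^ k \<le> 1" if k: "k \<in> {1..N}" for k
  proof (cases "c k = 0")
    case False
    then have "\<rho> \<le> root k (1 / norm (c k))"
      unfolding \<rho>_def using S k by (intro Min_le) (auto simp: S_def)
    then have "\<rho> ^ k \<le> root k (1 / norm (c k)) ^ k" using pos by (intro power_mono) auto
    also have "\<dots> = 1 / norm (c k)" using k by (simp add: real_root_pow_pos2)
    finally show ?thesis using False by (simp add: field_simps)
  qed simp
  ultimately show ?thesis using pos k0(1) by blast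
qed

text \<open>After rescaling the parameter, nonconstant polynomial curves of bounded degree through a fixed
  point subconverge to a polynomial curve that is still not constant.\<close>
lemma limit_polynomial_curve:
  fixes A B :: "nat \<Rightarrow> complex poly"
  assumes dA: "\<And>n. degree (A n) \<le> N" and dB: "\<And>n. degree (B n) \<le> N"
    and A0: "\<And>n. poly (A n) 0 = a" and B0: "\<And>n. poly (B n) 0 = b"
    and nc: "\<And>n. degree (A n) \<noteq> 0 \<or> degree (B n) \<noteq> 0"
  shows "\<exists>\<rho> r X Y. strict_mono (r :: nat \<Rightarrow> nat) \<and> (degree X \<noteq> 0 \<or> degree Y \<noteq> 0) \<and>
      (\<forall>t. (\<lambda>n. poly (A (r n)) (complex_of_real (\<rho> n) * t)) \<longlonglongrightarrow> poly X t) \<and>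
      (\<forall>t. (\<lambda>n. poly (B (r n)) (complex_of_real (\<rho> n) * t)) \<longlonglongrightarrow> poly Y t)"
proof -
  define c where "c n k = (coeff (A n) k, coeff (B n) k)" for n k
  have ex: "\<exists>\<rho>>0. (\<forall>k\<in>{1..N}. norm (c n k) * \<rho> ^ k \<le> 1) \<and> (\<exists>k\<in>{1..N}. norm (c n k) * \<rho> ^ k = 1)" for n
  proof (rule normalise_coefficients)
    from nc[of n] show "\<exists>k\<in>{1..N}. c n k \<noteq> 0"
    proof
      assume h: "degree (A n) \<noteq> 0"
      then have "c n (degree (A n)) \<noteq> 0" by (auto simp: c_def zero_prod_def)
      then show ?thesis using dA[of n] h by (intro bexI[of _ "degree (A n)"]) auto
    next
      assume h: "degree (B n) \<noteq> 0"
      then have "c n (degree (B n)) \<noteq> 0" by (auto simp: c_def zero_prod_def)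
      then show ?thesis using dB[of n] h by (intro bexI[of _ "degree (B n)"]) auto
    qed
  qed
  define \<rho> where "\<rho> n = (SOME \<rho>. \<rho> > 0 \<and> (\<forall>k\<in>{1..N}. norm (c n k) * \<rho> ^ k \<le> 1) \<and> (\<exists>k\<in>{1..N}. norm (c n k) * \<rho> ^ k = 1))" for n
  have r0: " \<rho> n > 0 \<and> (\<forall>k\<in>{1..N}. norm (c n k) * \<rho> n ^ k \<le> 1) \<and> (\<exists>k\<in>{1..N}. norm (c n k) * \<rho> n ^ k = 1)" for n
    unfolding \<rho>_def by (rule someI_ex[OF ex])
  have \<rho>: "\<And>n. \<rho> n > 0" "\<And>n k. k \<in> {1..N} \<Longrightarrow> norm (c n k) * \<rho> n ^ k \<le> 1"
      "\<And>n. \<exists>k\<in>{1..N}. norm (c n k) * \<rho> n ^ k = 1"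
    using r0 by simp_all
  \<comment> \<open>The rescaled coefficients are bounded, and for every n one of positive degree has norm 1.\<close>
  define e where "e n k = (if k \<in> {1..N} then \<rho> n ^ k *\<^sub>R c n k else if k = 0 then (a,b) else 0)" for n k
  have bd: "bounded (range (\<lambda>n. e n k))" for k
  proof (rule boundedI[of _ "1 + norm (a,b)"])
    fix z assume "z \<in> range (\<lambda>n. e n k)"
    then obtain n where z: "z = e n k" by blast
    have n0: "0 \<le> norm (a,b)" by (rule norm_ge_zero)
    consider "k \<in> {1..N}" | "k = 0" | "k \<notin> {1..N}" "k \<noteq> 0" by blast
    then have "norm (e n k) \<le> 1 + norm (a,b)"
    proof cases
      case 1
      then have "norm (e n k) = norm (c n k) * \<rho> n ^ k"
        using \<rho>(1)[of n] by (simp add: e_def)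
      then show ?thesis using \<rho>(2)[OF 1, of n] n0 by linarith
    next
      case 2 then have "e n k = (a,b)" by (simp add: e_def)
      then show ?thesis by simp
    next
      case 3 then have "e n k = 0" by (auto simp: e_def)
      then show ?thesis using n0 by simp
    qed
    then show "norm z \<le> 1 + norm (a,b)" by (simp add: z)
  qed
  from bounded_family_subseq[of e N, OF bd] obtain r l
    where r: "strict_mono r" and l0: "\<forall>k\<le>N. (\<lambda>n. e (r n) k) \<longlonglongrightarrow> l k"
    by (elim exE conjE)
  have l: "(\<lambda>n. e (r n) k) \<longlonglongrightarrow> l k" if "k \<le> N" for k using l0 that by simp
  define X where "X = (\<Sum>k\<le>N. monom (fst (l k)) k)"
  define Y where "Y = (\<Sum>k\<le>N. monom (snd (l k)) k)"
  have pX: "poly X t = (\<Sum>k\<le>N. fst (l k) * t ^ k)" for t by (simp add: X_def poly_sum poly_monom)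
  have pY: "poly Y t = (\<Sum>k\<le>N. snd (l k) * t ^ k)" for t by (simp add: Y_def poly_sum poly_monom)
  have cX: "coeff X k = fst (l k)" if "k \<le> N" for k using that by (simp add: X_def coeff_sum coeff_monom)
  have cY: "coeff Y k = snd (l k)" if "k \<le> N" for k using that by (simp add: Y_def coeff_sum coeff_monom)
  have eA: "poly (A n) (of_real (\<rho> n) * t) = (\<Sum>k\<le>N. fst (e n k) * t ^ k)" for n t
  proof -
    have "poly (A n) (of_real (\<rho> n) * t) = (\<Sum>k\<le>N. coeff (A n) k * (of_real (\<rho> n) * t) ^ k)"
      by (rule poly_as_sum[OF dA])
    also have "\<dots> = (\<Sum>k\<le>N. fst (e n k) * t ^ k)"
    proof (rule sum.cong[OF refl])
      fix k assume k: "k \<in> {..N}"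
      show "coeff (A n) k * (of_real (\<rho> n) * t) ^ k = fst (e n k) * t ^ k"
      proof (cases "k = 0")
        case True then show ?thesis using A0[of n] by (simp add: e_def poly_0_coeff_0)
      next
        case False then show ?thesis using k
          by (simp add: e_def c_def power_mult_distrib scaleR_conv_of_real)
      qed
    qed
    finally show ?thesis .
  qed
  have eB: "poly (B n) (of_real (\<rho> n) * t) = (\<Sum>k\<le>N. snd (e n k) * t ^ k)" for n t
  proof -
    have "poly (B n) (of_real (\<rho> n) * t) = (\<Sum>k\<le>N. coeff (B n) k * (of_real (\<rho> n) * t) ^ k)"
      by (rule poly_as_sum[OF dB])
    also have "\<dots> = (\<Sum>k\<le>N. snd (e n k) * t ^ k)"
    proof (rule sum.cong[OF refl])
      fix k assume k: "k \<in> {..N}"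
      show "coeff (B n) k * (of_real (\<rho> n) * t) ^ k = snd (e n k) * t ^ k"
      proof (cases "k = 0")
        case True then show ?thesis using B0[of n] by (simp add: e_def poly_0_coeff_0)
      next
        case False then show ?thesis using k
          by (simp add: e_def c_def power_mult_distrib scaleR_conv_of_real)
      qed
    qed
    finally show ?thesis .
  qed
  have limA: "(\<lambda>n. poly (A (r n)) (of_real (\<rho> (r n)) * t)) \<longlonglongrightarrow> poly X t" for t
    unfolding eA pX by (intro tendsto_sum tendsto_mult tendsto_const tendsto_fst l) auto
  have limB: "(\<lambda>n. poly (B (r n)) (of_real (\<rho> (r n)) * t)) \<longlonglongrightarrow> poly Y t" for t
    unfolding eB pY by (intro tendsto_sum tendsto_mult tendsto_const tendsto_snd l) auto
  have "degree X \<noteq> 0 \<or> degree Y \<noteq> 0"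
  proof (rule ccontr)
    assume "\<not> ?thesis"
    then have d0: "degree X = 0" "degree Y = 0" by auto
    have l0: "l k = 0" if "k \<in> {1..N}" for k
    proof -
      have "coeff X k = 0" "coeff Y k = 0" using d0 that by (auto intro: coeff_eq_0)
      then show ?thesis using cX[of k] cY[of k] that by (auto simp: prod_eq_iff)
    qed
    have "eventually (\<lambda>n. \<forall>k\<in>{1..N}. norm (e (r n) k) < 1) sequentially"
    proof (rule eventually_ball_finite)
      show "\<forall>k\<in>{1..N}. eventually (\<lambda>n. norm (e (r n) k) < 1) sequentially"
      proof
        fix k assume k: "k \<in> {1..N}"
        then have "(\<lambda>n. e (r n) k) \<longlonglongrightarrow> 0" using l[of k] l0[of k] by simp
        then have "(\<lambda>n. norm (e (r n) k)) \<longlonglongrightarrow> 0" by (rule tendsto_norm_zero)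
        then show "eventually (\<lambda>n. norm (e (r n) k) < 1) sequentially"
          by (rule order_tendstoD) simp
      qed
    qed simp
    then have "\<exists>n. \<forall>k\<in>{1..N}. norm (e (r n) k) < 1"
      by (rule eventually_happens'[OF sequentially_bot])
    then obtain n where n: "\<forall>k\<in>{1..N}. norm (e (r n) k) < 1" by (elim exE)
    obtain k where k: "k \<in> {1..N}" "norm (c (r n) k) * \<rho> (r n) ^ k = 1"
      using \<rho>(3)[of "r n"] by (elim bexE)
    then have "norm (e (r n) k) = 1" using \<rho>(1)[of "r n"] by (simp add: e_def mult.commute)
    then show False using n k(1) by force
  qed
  then show ?thesis using r limA limB
    by (intro exI[of _ "\<lambda>n. \<rho> (r n)"] exI[of _ r] exI[of _ X] exI[of _ Y] conjI allI)
qed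

section \<open>Weighted orbits and differences of powers\<close>

lemma root_exists_complex: "0 < n \<Longrightarrow> \<exists>w. w ^ n = (z::complex)"
proof (cases "z = 0")
  case False
  assume "0 < n"
  then have "exp (Ln z / of_nat n) ^ n = z" using False by (subst exp_divide_power_eq) auto
  then show ?thesis by blast
qed (auto intro: exI[of _ 0] simp: power_0_left)

text \<open>The points of \<open>y ^ p' = c * x ^ q'\<close> other than those on the axes lie on one orbit of the weighted
  scaling.\<close>
lemma weighted_orbit:
  fixes a b x y :: complex
  assumes pq: "p > 0" "q > 0" and g: "p = g * p'" "q = g * q'" and co: "coprime p' q'"
    and ab: "a \<noteq> 0" "b \<noteq> 0" "x \<noteq> 0" and eq: "y ^ p' = b ^ p' / a ^ q' * x ^ q'"
  shows "\<exists>\<sigma>. x = \<sigma> ^ p * a \<and> y = \<sigma> ^ q * b"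
proof -
  have pos: "g > 0" "p' > 0" "q' > 0" using pq g by auto
  obtain s0 where s0: "s0 ^ p = x / a" using root_exists_complex[OF pq(1)] by blast
  then have s0n: "s0 \<noteq> 0" using ab pq by (auto simp: power_0_left)
  \<comment> \<open>The choice s0 works up to the root of unity w, which a root h of a power of w corrects.\<close>
  define w where "w = y / (b * s0 ^ q)"
  have "y ^ p' = b ^ p' * (x / a) ^ q'" using eq by (simp add: power_divide)
  also have "\<dots> = b ^ p' * (s0 ^ q) ^ p'"
    by (simp add: s0 [symmetric] power_mult [symmetric] g mult_ac)
  finally have "y ^ p' = (b * s0 ^ q) ^ p'" by (simp add: power_mult_distrib)
  then have w: "w ^ p' = 1" using ab s0n by (simp add: w_def power_divide)
  obtain m l where m: "q' * m = p' * l + 1"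
    using bezout_nat[of q' p'] co pos by (auto simp: coprime_iff_gcd_eq_1 gcd.commute)
  obtain h where h: "h ^ g = w ^ m" using root_exists_complex[OF pos(1)] by blast
  have "h ^ p = 1"
  proof -
    have "h ^ p = (w ^ p') ^ m" by (simp add: g power_mult h) (simp add: power_mult [symmetric] mult.commute)
    then show ?thesis by (simp add: w)
  qed
  moreover have "h ^ q = w"
  proof -
    have "h ^ q = w ^ (q' * m)" by (simp add: g power_mult h) (simp add: power_mult [symmetric] mult.commute)
    also have "\<dots> = (w ^ p') ^ l * w" by (simp add: m power_add power_mult)
    finally show ?thesis by (simp add: w)
  qed
  ultimately have "x = (h * s0) ^ p * a \<and> y = (h * s0) ^ q * b"
    using ab s0n s0 by (simp add: power_mult_distrib w_def)
  then show ?thesis by blast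
qed

lemma no_root_constant:
  fixes p :: "complex poly"
  assumes "\<And>z. poly p z \<noteq> 0" shows "\<exists>k. k \<noteq> 0 \<and> p = [:k:]"
proof -
  have "degree p = 0" using assms Fundamental_Theorem_Algebra.fundamental_theorem_of_algebra[of p] constant_degree[of p] by blast
  then obtain k where "p = [:k:]" using degree_eq_zeroE by blast
  then show ?thesis using assms[of 0] by auto
qed

text \<open>Differentiation shows that \<open>X ^ (n - 1)\<close> divides \<open>Y'\<close> and that \<open>Y ^ (m - 1)\<close> divides \<open>X'\<close>;
  for nonconstant \<open>X\<close> and \<open>Y\<close> the degrees contradict each other.\<close>
lemma power_difference_constant:
  fixes X Y :: "complex poly"
  assumes eq: "Y ^ m - smult c (X ^ n) = [:k:]" and k: "k \<noteq> 0" and c: "c \<noteq> 0"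
    and m: "m \<ge> 2" and n: "n \<ge> 2"
  shows "degree X = 0 \<and> degree Y = 0"
proof (rule ccontr)
  assume neg: "\<not> ?thesis"
  have YX: "Y ^ m = [:k:] + smult c (X ^ n)" using eq by (simp add: algebra_simps)
  have dd: "degree Y * m = degree X * n"
  proof -
    have "degree (smult c (X ^ n)) = degree X * n" using c by (simp add: degree_power_eq mult.commute degree_power_eq) (metis degree_power_eq mult.commute degree_0 power_eq_0_iff mult_0 not_gr0 n not_numeral_le_zero)
    moreover have "degree (Y ^ m) = degree Y * m"
      by (metis degree_power_eq mult.commute degree_0 power_eq_0_iff mult_0 not_gr0 m not_numeral_le_zero)
    moreover have "degree ([:k:] + smult c (X ^ n)) = degree (smult c (X ^ n))"
    proof (cases "degree (smult c (X ^ n)) = 0")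
      case True then show ?thesis
        by (metis degree_add_le degree_pCons_0 le_zero_eq le_refl)
    next
      case False then show ?thesis by (intro degree_add_eq_right) simp
    qed
    ultimately show ?thesis using YX by simp
  qed
  have pos: "degree X > 0" "degree Y > 0" using neg dd m n by (cases "degree X"; cases "degree Y"; auto)+
  have "pderiv (Y ^ m) = pderiv (smult c (X ^ n))" using YX by (simp add: pderiv_add pderiv_pCons)
  then have der: "smult (of_nat m) (Y ^ (m - 1)) * pderiv Y = smult c (smult (of_nat n) (X ^ (n - 1)) * pderiv X)"
    using m n by (simp add: pderiv_power pderiv_smult)
  have "X ^ (n - 1) dvd smult (of_nat m) (Y ^ (m - 1)) * pderiv Y" unfolding der by (intro dvd_smult) (simp add: dvd_smult)
  then have "X ^ (n - 1) dvd Y ^ (m - 1) * pderiv Y" using m by (simp add: dvd_smult_iff)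
  then have "X ^ (n - 1) dvd Y * (Y ^ (m - 1) * pderiv Y)" by (rule dvd_mult)
  also have "Y * (Y ^ (m - 1) * pderiv Y) = Y ^ m * pderiv Y" using m by (cases m) auto
  also have "\<dots> = smult k (pderiv Y) + X ^ (n - 1) * (smult c X * pderiv Y)"
    using n by (subst YX, cases n) (auto simp: algebra_simps mult_ac)
  finally have "X ^ (n - 1) dvd smult k (pderiv Y)"
    by (simp only: dvd_add_left_iff dvd_triv_left)
  then have d1: "X ^ (n - 1) dvd pderiv Y" using k by (simp add: dvd_smult_iff)
  have "Y ^ (m - 1) dvd smult c (smult (of_nat n) (X ^ (n - 1)) * pderiv X)" unfolding der [symmetric] by (simp add: dvd_smult)
  then have "Y ^ (m - 1) dvd X ^ (n - 1) * pderiv X" using n c by (simp add: dvd_smult_iff)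
  then have "Y ^ (m - 1) dvd smult c X * (X ^ (n - 1) * pderiv X)" by (rule dvd_mult)
  also have "smult c X * (X ^ (n - 1) * pderiv X) = smult c (X ^ n) * pderiv X"
    using n by (cases n) (auto simp: mult_ac)
  also have "\<dots> = Y ^ (m - 1) * (Y * pderiv X) + smult (- k) (pderiv X)"
  proof -
    have "smult c (X ^ n) = Y ^ m - [:k:]" using YX by simp
    then show ?thesis using m by (simp only:) (cases m, auto simp: algebra_simps)
  qed
  finally have "Y ^ (m - 1) dvd smult (- k) (pderiv X)" by (subst (asm) dvd_add_right_iff) auto
  then have d2: "Y ^ (m - 1) dvd pderiv X" using k by (simp add: dvd_smult_iff del: smult_minus_left)
  have nz: "pderiv Y \<noteq> 0" "pderiv X \<noteq> 0" using pos by (auto simp: pderiv_eq_0_iff)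
  have "degree (X ^ (n - 1)) \<le> degree Y - 1"
    using dvd_imp_degree_le[OF d1 nz(1)] by (simp add: degree_pderiv)
  moreover have "degree (Y ^ (m - 1)) \<le> degree X - 1"
    using dvd_imp_degree_le[OF d2 nz(2)] by (simp add: degree_pderiv)
  moreover have "degree (X ^ (n - 1)) \<ge> degree X"
    using pos(1) n by (subst degree_power_eq) auto
  moreover have "degree (Y ^ (m - 1)) \<ge> degree Y"
    using pos(2) m by (subst degree_power_eq) auto
  ultimately show False using pos by linarith
qed

section \<open>Lowering the degree of a polynomial automorphism\<close>

lemma lead_coeff_limit:
  fixes p :: "complex poly"
  assumes "degree p \<le> m"
  shows "(\<lambda>n. poly p (of_nat (Suc n)) / of_nat (Suc n) ^ m) \<longlonglongrightarrow> coeff p m"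
proof -
  have inv0: "(\<lambda>n. inverse (of_nat (Suc n) :: complex)) \<longlonglongrightarrow> 0"
    using LIMSEQ_Suc[OF lim_inverse_n] by simp
  have "(\<lambda>n. \<Sum>k\<le>m. coeff p k * inverse (of_nat (Suc n)) ^ (m - k)) \<longlonglongrightarrow> (\<Sum>k\<le>m. coeff p k * 0 ^ (m - k))"
    by (intro tendsto_intros inv0)
  moreover have "(\<Sum>k\<le>m. coeff p k * 0 ^ (m - k)) = coeff p m"
  proof -
    have "(\<Sum>k\<le>m. coeff p k * 0 ^ (m - k)) = (\<Sum>k\<le>m. if k = m then coeff p m else 0)"
      by (rule sum.cong) (auto simp: power_0_left)
    then show ?thesis by simp
  qed
  moreover have "(\<Sum>k\<le>m. coeff p k * inverse (of_nat (Suc n)) ^ (m - k)) = poly p (of_nat (Suc n)) / of_nat (Suc n) ^ m" for n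
  proof -
    have nz: "of_nat (Suc n) \<noteq> (0::complex)" by (rule of_nat_neq_0)
    have "coeff p k * inverse (of_nat (Suc n)) ^ (m - k) = coeff p k * of_nat (Suc n) ^ k / of_nat (Suc n) ^ m"
      if "k \<le> m" for k
    proof -
      have "(of_nat (Suc n) :: complex) ^ m = of_nat (Suc n) ^ k * of_nat (Suc n) ^ (m - k)"
        using that by (simp only: power_add [symmetric]) simp
      then show ?thesis using nz by (simp add: field_simps del: of_nat_Suc)
    qed
    then show ?thesis unfolding poly_as_sum[OF assms] sum_divide_distrib by (intro sum.cong) auto
  qed
  ultimately show ?thesis by simp
qed

lemma filterlim_of_nat_Suc: "filterlim (\<lambda>n. of_nat (Suc n) :: complex) at_infinity sequentially"
proof -
  have "filterlim (\<lambda>n. of_nat n :: complex) at_infinity sequentially"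
    by (rule tendsto_of_nat)
  then show ?thesis by (rule filterlim_compose) (rule filterlim_Suc)
qed

text \<open>The map \<open>(P, Q)\<close> is the inverse of \<open>(U, V)\<close>, and degrees are degrees in \<open>y\<close>. The line \<open>x = c\<close> is
  mapped into the level \<open>P = c\<close>. For \<open>c = P(s\<^sup>p x0, s\<^sup>q y0)\<close>, the components of its image are divided
  by \<open>s\<^sup>p\<close> and \<open>s\<^sup>q\<close>; a limit for \<open>s \<longrightarrow> \<infinity>\<close> is a curve on which the top form is constant, with the nonzero
  value that it has at \<open>(x0, y0)\<close>.\<close>
lemma level_curve_of_top_form:
  assumes UV: "\<And>x y. poly2 P (poly2 U (x,y), poly2 V (x,y)) = x"
    and sec: "\<And>z. poly2 U (poly2 P z, poly2 Q z) = fst z" "\<And>z. poly2 V (poly2 P z, poly2 Q z) = snd z"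
    and UVQ: "\<And>x y. poly2 Q (poly2 U (x,y), poly2 V (x,y)) = y"
  shows "\<exists>X Y k. (degree X \<noteq> 0 \<or> degree Y \<noteq> 0) \<and> k \<noteq> 0 \<and>
     (\<forall>t. top_form (degree U) (degree V) P (poly X t) (poly Y t) = k)"
proof -
  let ?p = "degree U" and ?q = "degree V"
  let ?T = "top_form ?p ?q P" and ?W = "weight ?p ?q P"
  have P0: "P \<noteq> 0" using UV[of 1 0] by auto
  obtain x0 y0 where k: "?T x0 y0 \<noteq> 0" using top_form_nonzero[OF P0] by blast
  define s where "s n = (of_nat (Suc n) :: complex)" for n
  have s0: "s n \<noteq> 0" for n unfolding s_def by (rule of_nat_neq_0)
  have sinf: "filterlim s at_infinity sequentially" unfolding s_def by (rule filterlim_of_nat_Suc)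
  define c where "c n = poly2 P (s n ^ ?p * x0, s n ^ ?q * y0)" for n
  define t where "t n = poly2 Q (s n ^ ?p * x0, s n ^ ?q * y0)" for n
  \<comment> \<open>The image of the vertical line through the preimage (c n, t n), in weighted coordinates.\<close>
  define A where "A n = smult (inverse (s n ^ ?p)) (pcompose (fibre_poly U (c n)) [:t n, 1:])" for n
  define B where "B n = smult (inverse (s n ^ ?q)) (pcompose (fibre_poly V (c n)) [:t n, 1:])" for n
  have pA: "poly (A n) z = poly2 U (c n, t n + z) / s n ^ ?p" for n z
    by (simp add: A_def poly_pcompose poly_fibre_poly field_simps)
  have pB: "poly (B n) z = poly2 V (c n, t n + z) / s n ^ ?q" for n z
    by (simp add: B_def poly_pcompose poly_fibre_poly field_simps)
  have dA: "degree (A n) \<le> ?p + ?q" for n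
  proof -
    have "degree (A n) \<le> degree (fibre_poly U (c n))" using s0[of n] by (simp add: A_def degree_pcompose)
    then show ?thesis using degree_fibre_poly[of U "c n"] by linarith
  qed
  have dB: "degree (B n) \<le> ?p + ?q" for n
  proof -
    have "degree (B n) \<le> degree (fibre_poly V (c n))" using s0[of n] by (simp add: B_def degree_pcompose)
    then show ?thesis using degree_fibre_poly[of V "c n"] by linarith
  qed
  have A0: "poly (A n) 0 = x0" and B0: "poly (B n) 0 = y0" for n
    using sec[of "(s n ^ ?p * x0, s n ^ ?q * y0)"] s0[of n]
    by (simp_all add: pA pB c_def[symmetric] t_def[symmetric])
  have nc: "degree (A n) \<noteq> 0 \<or> degree (B n) \<noteq> 0" for n
  proof (rule ccontr)
    assume "\<not> ?thesis"
    then obtain a b where ab: "A n = [:a:]" "B n = [:b:]" using degree_eq_zeroE by metis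
    then have "poly (A n) 0 = poly (A n) 1" "poly (B n) 0 = poly (B n) 1" by simp_all
    then have "poly2 U (c n, t n) = poly2 U (c n, t n + 1)" "poly2 V (c n, t n) = poly2 V (c n, t n + 1)"
      using s0[of n] by (simp_all add: pA pB)
    then show False using UVQ[of "c n" "t n"] UVQ[of "c n" "t n + 1"] by simp
  qed
  from limit_polynomial_curve[of A "?p + ?q" B x0 y0, OF dA dB A0 B0 nc]
  obtain \<rho> r X Y where r: "strict_mono (r :: nat \<Rightarrow> nat)" and XY: "degree X \<noteq> 0 \<or> degree Y \<noteq> 0"
    and lX: "\<forall>z. (\<lambda>n. poly (A (r n)) (complex_of_real (\<rho> n) * z)) \<longlonglongrightarrow> poly X z"
    and lY: "\<forall>z. (\<lambda>n. poly (B (r n)) (complex_of_real (\<rho> n) * z)) \<longlonglongrightarrow> poly Y z"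
    by (elim exE conjE)
  have rinf: "filterlim (\<lambda>n. s (r n)) at_infinity sequentially"
    by (rule filterlim_compose[OF sinf filterlim_subseq[OF r]])
  have lim0: "(\<lambda>n. c (r n) / s (r n) ^ ?W) \<longlonglongrightarrow> ?T x0 y0"
    unfolding c_def by (rule top_form_limit[OF rinf tendsto_const tendsto_const])
  have "?T (poly X z) (poly Y z) = ?T x0 y0" for z
  proof -
    have "(\<lambda>n. poly2 P (s (r n) ^ ?p * poly (A (r n)) (of_real (\<rho> n) * z),
                s (r n) ^ ?q * poly (B (r n)) (of_real (\<rho> n) * z)) / s (r n) ^ ?W)
       \<longlonglongrightarrow> ?T (poly X z) (poly Y z)"
      by (rule top_form_limit[OF rinf]) (use lX lY in simp_all)
    moreover have "poly2 P (s (r n) ^ ?p * poly (A (r n)) (of_real (\<rho> n) * z),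
                s (r n) ^ ?q * poly (B (r n)) (of_real (\<rho> n) * z)) = c (r n)" for n
      using s0[of "r n"] by (simp add: pA pB UV)
    ultimately show ?thesis using lim0 LIMSEQ_unique by fastforce
  qed
  then show ?thesis using XY k by (intro exI[of _ X] exI[of _ Y] exI[of _ "?T x0 y0"]) auto
qed

text \<open>On a vertical line, \<open>P(U, V) = x\<close> is constant, while \<open>U\<close> and \<open>V\<close> grow like their leading
  coefficients times \<open>y ^ p\<close> and \<open>y ^ q\<close>.\<close>
lemma top_form_lead_coeffs:
  assumes UV: "\<And>x y. poly2 P (poly2 U (x,y), poly2 V (x,y)) = x"
    and W: "weight (degree U) (degree V) P > 0"
  shows "top_form (degree U) (degree V) P (poly (lead_coeff U) x) (poly (lead_coeff V) x) = 0"
proof -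
  let ?p = "degree U" and ?q = "degree V"
  define s where "s n = (of_nat (Suc n) :: complex)" for n
  have s0: "s n \<noteq> 0" for n unfolding s_def by (rule of_nat_neq_0)
  have sinf: "filterlim s at_infinity sequentially" unfolding s_def by (rule filterlim_of_nat_Suc)
  have lU: "(\<lambda>n. poly2 U (x, s n) / s n ^ ?p) \<longlonglongrightarrow> poly (lead_coeff U) x"
    using lead_coeff_limit[OF degree_fibre_poly[of U x]]
    by (simp add: poly_fibre_poly coeff_fibre_poly s_def del: of_nat_Suc)
  have lV: "(\<lambda>n. poly2 V (x, s n) / s n ^ ?q) \<longlonglongrightarrow> poly (lead_coeff V) x"
    using lead_coeff_limit[OF degree_fibre_poly[of V x]]
    by (simp add: poly_fibre_poly coeff_fibre_poly s_def del: of_nat_Suc)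
  have "(\<lambda>n. poly2 P (s n ^ ?p * (poly2 U (x, s n) / s n ^ ?p), s n ^ ?q * (poly2 V (x, s n) / s n ^ ?q))
      / s n ^ weight ?p ?q P) \<longlonglongrightarrow> top_form ?p ?q P (poly (lead_coeff U) x) (poly (lead_coeff V) x)"
    by (rule top_form_limit[OF sinf lU lV])
  then have "(\<lambda>n. x / s n ^ weight ?p ?q P) \<longlonglongrightarrow> top_form ?p ?q P (poly (lead_coeff U) x) (poly (lead_coeff V) x)"
    using s0 by (simp add: UV)
  moreover have "(\<lambda>n. x / s n ^ weight ?p ?q P) \<longlonglongrightarrow> 0"
  proof -
    have "(\<lambda>n. inverse (s n)) \<longlonglongrightarrow> 0"
      using sinf by (rule filterlim_compose[OF tendsto_inverse_0])
    from tendsto_mult_left[OF tendsto_power[OF this, of "weight ?p ?q P"], of x]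
    show ?thesis using W by (simp add: power_0_left divide_inverse power_inverse)
  qed
  ultimately show ?thesis using LIMSEQ_unique by blast
qed

text \<open>Let \<open>p = g p'\<close> and \<open>q = g q'\<close> be the degrees of \<open>U\<close> and \<open>V\<close> in \<open>y\<close>, with coprime \<open>p'\<close> and \<open>q'\<close>, let \<open>u\<close> and
  \<open>v\<close> be the leading coefficients and \<open>(X, Y)\<close> the curve of \<open>level_curve_of_top_form\<close>. The
  polynomial \<open>Y ^ p' - c * X ^ q'\<close> with \<open>c = v ^ p' / u ^ q'\<close> has no zero, so it is a nonzero constant; this makes
  \<open>c\<close> independent of \<open>x\<close> and forces \<open>p' = 1\<close> or \<open>q' = 1\<close>. Then subtracting a multiple of a power of
  one component cancels the leading coefficient of the other.\<close>
lemma jung_reduction: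
  assumes UV: "\<And>x y. poly2 P (poly2 U (x,y), poly2 V (x,y)) = x"
    and UVQ: "\<And>x y. poly2 Q (poly2 U (x,y), poly2 V (x,y)) = y"
    and sec: "\<And>z. poly2 U (poly2 P z, poly2 Q z) = fst z" "\<And>z. poly2 V (poly2 P z, poly2 Q z) = snd z"
    and p: "degree U > 0" and q: "degree V > 0"
  shows "(\<exists>c m. degree (V - smult [:c:] (U ^ m)) < degree V) \<or>
         (\<exists>c m. degree (U - smult [:c:] (V ^ m)) < degree U)"
proof -
  let ?p = "degree U" and ?q = "degree V"
  let ?T = "top_form ?p ?q P" and ?W = "weight ?p ?q P"
  let ?u = "lead_coeff U" and ?v = "lead_coeff V"
  have UV0: "U \<noteq> 0" "V \<noteq> 0" using p q by auto
  have uv0: "?u \<noteq> 0" "?v \<noteq> 0" using UV0 by auto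
  obtain X Y k where XY: "degree X \<noteq> 0 \<or> degree Y \<noteq> 0" and k: "k \<noteq> 0"
    and TXY: "\<forall>t. ?T (poly X t) (poly Y t) = k"
    using level_curve_of_top_form[of P U V Q, OF UV sec UVQ] by (elim exE conjE)
  have W: "?W > 0"
  proof (rule ccontr)
    assume "\<not> ?W > 0"
    then have sup: "support2 P \<subseteq> {(0,0)}"
      using weight_le[of P _ _ ?p ?q] p q by (force simp: support2_def)
    have "poly2 P (x,y) = poly2 P (0,0)" for x y
      unfolding poly2_support by (rule sum.cong) (use sup in auto)
    then show False using UV[of 0 0] UV[of 1 0] by (metis zero_neq_one)
  qed
  define g where "g = gcd ?p ?q"
  obtain p' q' where pq: "?p = g * p'" "?q = g * q'" and co: "coprime p' q'"
    using gcd_coprime_exists[of ?p ?q] p unfolding g_def by (metis gcd_eq_0_iff mult.commute not_gr0)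
  have pos: "p' > 0" "q' > 0" "g > 0" using p q pq by auto
  \<comment> \<open>At a zero, (X, Y) would lie on the weighted orbit of (u, v), where the top form vanishes.\<close>
  have key: "\<exists>\<kappa>. \<kappa> \<noteq> 0 \<and> Y ^ p' - smult (poly ?v x ^ p' / poly ?u x ^ q') (X ^ q') = [:\<kappa>:]"
    if nz: "poly ?u x \<noteq> 0" "poly ?v x \<noteq> 0" for x
  proof (rule no_root_constant)
    fix t
    let ?c = "poly ?v x ^ p' / poly ?u x ^ q'"
    show "poly (Y ^ p' - smult ?c (X ^ q')) t \<noteq> 0"
    proof
      assume "poly (Y ^ p' - smult ?c (X ^ q')) t = 0"
      then have eq: "poly Y t ^ p' = ?c * poly X t ^ q'" by simp
      have "?T (poly X t) (poly Y t) = 0"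
      proof (cases "poly X t = 0")
        case True
        then have "poly Y t = 0" using eq pos by (simp add: power_0_left)
        then have "?T (poly X t) (poly Y t) = ?T (0 ^ ?p * 0) (0 ^ ?q * 0)" using True by simp
        also have "\<dots> = 0" using W by (subst top_form_scale) (simp add: power_0_left)
        finally show ?thesis .
      next
        case False
        then obtain \<sigma> where "poly X t = \<sigma> ^ ?p * poly ?u x \<and> poly Y t = \<sigma> ^ ?q * poly ?v x"
          using weighted_orbit[OF p q pq co nz False eq] by blast
        then show ?thesis using top_form_lead_coeffs[OF UV W, of x] by (simp add: top_form_scale)
      qed
      then show False using TXY k by simp
    qed
  qed
  have "\<exists>x. poly (?u * ?v) x \<noteq> 0" using uv0 poly_all_0_iff_0[of "?u * ?v"] by (metis mult_eq_0_iff)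
  then obtain x1 where x1: "poly ?u x1 \<noteq> 0" "poly ?v x1 \<noteq> 0" by auto
  define c where "c = poly ?v x1 ^ p' / poly ?u x1 ^ q'"
  have c0: "c \<noteq> 0" using x1 by (simp add: c_def)
  obtain \<kappa> where \<kappa>: "\<kappa> \<noteq> 0" "Y ^ p' - smult c (X ^ q') = [:\<kappa>:]"
    using key[OF x1] by (auto simp: c_def)
  have dX: "degree X > 0"
  proof (rule ccontr)
    assume "\<not> degree X > 0"
    then obtain a where a: "X = [:a:]" by (metis degree_eq_zeroE not_gr0)
    have "Y ^ p' = [:\<kappa> + c * a ^ q':]" using \<kappa>(2) by (simp add: a poly_const_pow algebra_simps)
    then have "degree (Y ^ p') = 0" by simp
    then have "degree Y = 0" using pos(1) by (cases "Y = 0") (auto simp: degree_power_eq)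
    then show False using XY a by simp
  qed
  \<comment> \<open>As X is not constant, two such differences can both be constant only for equal c.\<close>
  have cuniq: "poly ?v x ^ p' = c * poly ?u x ^ q'" if nz: "poly ?u x \<noteq> 0" "poly ?v x \<noteq> 0" for x
  proof -
    let ?c = "poly ?v x ^ p' / poly ?u x ^ q'"
    obtain \<kappa>' where \<kappa>': "Y ^ p' - smult ?c (X ^ q') = [:\<kappa>':]" using key[OF nz] by blast
    have "smult (?c - c) (X ^ q') = [:\<kappa> - \<kappa>':]"
    proof -
      have "smult (?c - c) (X ^ q') = (Y ^ p' - smult c (X ^ q')) - (Y ^ p' - smult ?c (X ^ q'))"
        by (simp add: smult_diff_left)
      then show ?thesis by (simp add: \<kappa>(2) \<kappa>')
    qed
    then have "degree (smult (?c - c) (X ^ q')) = 0" by simp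
    moreover have "degree (X ^ q') > 0" using dX pos by (subst degree_power_eq) auto
    ultimately have "?c = c" by (auto split: if_splits)
    then show ?thesis using nz by (simp add: field_simps)
  qed
  have vu: "?v ^ p' = smult c (?u ^ q')"
  proof -
    have "?u * ?v * (?v ^ p' - smult c (?u ^ q')) = 0"
    proof (rule poly_all_0_iff_0[THEN iffD1], rule allI)
      fix x show "poly (?u * ?v * (?v ^ p' - smult c (?u ^ q'))) x = 0"
        using cuniq[of x] by auto
    qed
    then show ?thesis using uv0 by simp
  qed
  have "p' < 2 \<or> q' < 2"
    using power_difference_constant[OF \<kappa>(2) \<kappa>(1) c0] dX by force
  then consider "p' = 1" | "q' = 1" using pos by linarith
  then show ?thesis
  proof cases
    case 1
    let ?D = "V - smult [:c:] (U ^ q')"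
    have dU: "degree (U ^ q') = ?q" using pq 1 UV0 by (simp add: degree_power_eq mult.commute)
    have "degree ?D \<le> ?q" by (rule degree_diff_le) (use dU in \<open>auto intro: order.trans[OF degree_smult_le]\<close>)
    moreover have "coeff ?D ?q = 0"
    proof -
      have "coeff (U ^ q') ?q = ?u ^ q'" using dU lead_coeff_power[of U q'] by simp
      then show ?thesis using vu 1 by simp
    qed
    ultimately have "degree ?D < ?q"
      using q by (metis coeff_eq_0 degree_0 le_neq_implies_less leading_coeff_0_iff)
    then show ?thesis by blast
  next
    case 2
    let ?D = "U - smult [:inverse c:] (V ^ p')"
    have dU: "degree (V ^ p') = ?p" using pq 2 UV0 by (simp add: degree_power_eq mult.commute)
    have "degree ?D \<le> ?p" by (rule degree_diff_le) (use dU in \<open>auto intro: order.trans[OF degree_smult_le]\<close>)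
    moreover have "coeff ?D ?p = 0"
    proof -
      have "coeff (V ^ p') ?p = ?v ^ p'" using dU lead_coeff_power[of V p'] by simp
      then show ?thesis using vu 2 c0 by simp
    qed
    ultimately have "degree ?D < ?p"
      using p by (metis coeff_eq_0 degree_0 le_neq_implies_less leading_coeff_0_iff)
    then show ?thesis by blast
  qed
qed

section \<open>Jung's theorem\<close>

text \<open>The affine automorphisms of the plane.\<close>
definition affine_maps :: "(C2 \<Rightarrow> C2) set" where
  "affine_maps = {F. \<exists>a b c d e h. a * d - b * c \<noteq> 0 \<and>
     F = (\<lambda>q. (a * fst q + b * snd q + e, c * fst q + d * snd q + h))}"

text \<open>The polynomial automorphisms that permute the lines \<open>y = const\<close>.\<close>
definition triangular_maps :: "(C2 \<Rightarrow> C2) set" where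
  "triangular_maps = {F. \<exists>a b h p. a \<noteq> 0 \<and> b \<noteq> 0 \<and>
     F = (\<lambda>q. (a * fst q + poly p (snd q), b * snd q + h))}"

lemma affine_maps_inverse:
  assumes "F \<in> affine_maps"
  shows "bij F" "inv F \<in> affine_maps"
proof -
  obtain a b c d e h where D: "a * d - b * c \<noteq> 0"
    and F: "F = (\<lambda>q. (a * fst q + b * snd q + e, c * fst q + d * snd q + h))"
    using assms by (auto simp: affine_maps_def)
  define D where "D = a * d - b * c"
  have D0: "D \<noteq> 0" using D by (simp add: D_def)
  define G where "G = (\<lambda>q::C2. ((d/D) * fst q + (-b/D) * snd q + ((b * h - d * e)/D),
                       (-c/D) * fst q + (a/D) * snd q + ((c * e - a * h)/D)))"
  have FG: "F \<circ> G = id"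
  proof
    fix q :: C2
    have "a * ((d/D) * fst q + (-b/D) * snd q + ((b * h - d * e)/D)) +
          b * ((-c/D) * fst q + (a/D) * snd q + ((c * e - a * h)/D)) + e = fst q"
      using D0 by (simp add: field_simps) (simp add: D_def algebra_simps)
    moreover have "c * ((d/D) * fst q + (-b/D) * snd q + ((b * h - d * e)/D)) +
          d * ((-c/D) * fst q + (a/D) * snd q + ((c * e - a * h)/D)) + h = snd q"
      using D0 by (simp add: field_simps) (simp add: D_def algebra_simps)
    ultimately show "(F \<circ> G) q = id q" by (simp add: F G_def)
  qed
  have GF: "G \<circ> F = id"
  proof
    fix q :: C2
    have "(d/D) * (a * fst q + b * snd q + e) + (-b/D) * (c * fst q + d * snd q + h) + ((b * h - d * e)/D) = fst q"
      using D0 by (simp add: field_simps) (simp add: D_def algebra_simps)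
    moreover have "(-c/D) * (a * fst q + b * snd q + e) + (a/D) * (c * fst q + d * snd q + h) + ((c * e - a * h)/D) = snd q"
      using D0 by (simp add: field_simps) (simp add: D_def algebra_simps)
    ultimately show "(G \<circ> F) q = id q" by (simp add: F G_def)
  qed
  show "bij F" by (rule o_bij[OF GF FG])
  have "inv F = G" by (rule inv_unique_comp[OF FG GF])
  moreover have "G \<in> affine_maps"
  proof -
    have "(d/D) * (a/D) - (-b/D) * (-c/D) = 1 / D"
      using D0 by (simp add: field_simps) (simp add: D_def algebra_simps)
    then have "(d/D) * (a/D) - (-b/D) * (-c/D) \<noteq> 0" using D0 by simp
    then show ?thesis unfolding affine_maps_def G_def mem_Collect_eq by (intro exI conjI) (assumption, rule refl)
  qed
  ultimately show "inv F \<in> affine_maps" by simp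
qed

lemma affine_maps_comp:
  assumes "F \<in> affine_maps" "G \<in> affine_maps" shows "F \<circ> G \<in> affine_maps"
proof -
  obtain a b c d e h where D: "a * d - b * c \<noteq> 0"
    and F: "F = (\<lambda>q. (a * fst q + b * snd q + e, c * fst q + d * snd q + h))"
    using assms(1) by (auto simp: affine_maps_def)
  obtain a' b' c' d' e' h' where D': "a' * d' - b' * c' \<noteq> 0"
    and G: "G = (\<lambda>q. (a' * fst q + b' * snd q + e', c' * fst q + d' * snd q + h'))"
    using assms(2) by (auto simp: affine_maps_def)
  have "(a*a' + b*c') * (c*b' + d*d') - (a*b' + b*d') * (c*a' + d*c') = (a * d - b * c) * (a' * d' - b' * c')"
    by (simp add: algebra_simps)
  then have nz: "(a*a' + b*c') * (c*b' + d*d') - (a*b' + b*d') * (c*a' + d*c') \<noteq> 0" using D D' by simp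
  have FG: "F \<circ> G = (\<lambda>q. ((a*a' + b*c') * fst q + (a*b' + b*d') * snd q + (a*e' + b*h' + e),
      (c*a' + d*c') * fst q + (c*b' + d*d') * snd q + (c*e' + d*h' + h)))"
    by (auto simp: F G fun_eq_iff algebra_simps)
  show ?thesis unfolding FG affine_maps_def mem_Collect_eq
    by (intro exI conjI) (rule nz, rule refl)
qed

lemma triangular_maps_inverse:
  assumes "F \<in> triangular_maps"
  shows "bij F" "inv F \<in> triangular_maps"
proof -
  obtain a b h p where ab: "a \<noteq> 0" "b \<noteq> 0"
    and F: "F = (\<lambda>q. (a * fst q + poly p (snd q), b * snd q + h))"
    using assms by (auto simp: triangular_maps_def)
  define r where "r = smult (- inverse a) (pcompose p [:- h / b, inverse b:])"
  define G where "G = (\<lambda>q::C2. (inverse a * fst q + poly r (snd q), inverse b * snd q + (- h / b)))"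
  have FG: "F \<circ> G = id" and GF: "G \<circ> F = id"
    using ab by (auto simp: F G_def r_def fun_eq_iff poly_pcompose field_simps)
  show "bij F" by (rule o_bij[OF GF FG])
  have "inv F = G" by (rule inv_unique_comp[OF FG GF])
  moreover have "G \<in> triangular_maps"
    unfolding triangular_maps_def G_def mem_Collect_eq
    by (rule exI[of _ "inverse a"], rule exI[of _ "inverse b"], rule exI[of _ "- h / b"], rule exI[of _ r])
      (use ab in simp)
  ultimately show "inv F \<in> triangular_maps" by simp
qed

lemma triangular_maps_comp:
  assumes "F \<in> triangular_maps" "G \<in> triangular_maps" shows "F \<circ> G \<in> triangular_maps"
proof -
  obtain a b h p where ab: "a \<noteq> 0" "b \<noteq> 0"
    and F: "F = (\<lambda>q. (a * fst q + poly p (snd q), b * snd q + h))"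
    using assms by (auto simp: triangular_maps_def)
  obtain a' b' h' p' where ab': "a' \<noteq> 0" "b' \<noteq> 0"
    and G: "G = (\<lambda>q. (a' * fst q + poly p' (snd q), b' * snd q + h'))"
    using assms(2) by (auto simp: triangular_maps_def)
  have FG: "F \<circ> G = (\<lambda>q. ((a*a') * fst q + poly (smult a p' + pcompose p [:h', b':]) (snd q),
      (b*b') * snd q + (b*h' + h)))"
    by (auto simp: F G fun_eq_iff poly_pcompose algebra_simps)
  have nz: "a * a' \<noteq> 0" "b * b' \<noteq> 0" using ab ab' by auto
  show ?thesis unfolding FG triangular_maps_def mem_Collect_eq
    by (intro exI conjI) (rule nz, rule nz, rule refl)
qed

lemma id_affine: "id \<in> affine_maps"
  unfolding affine_maps_def mem_Collect_eq
  by (rule exI[of _ 1], rule exI[of _ 0], rule exI[of _ 0], rule exI[of _ 1], rule exI[of _ 0], rule exI[of _ 0]) auto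

text \<open>Composition of the members of a list; the last member is applied first.\<close>
definition compose_list :: "(C2 \<Rightarrow> C2) list \<Rightarrow> C2 \<Rightarrow> C2" where
  "compose_list ls = foldr (\<circ>) ls id"

lemma compose_list_simps [simp]:
  "compose_list [] = id" "compose_list (l # ls) = l \<circ> compose_list ls"
  by (simp_all add: compose_list_def)

lemma compose_list_append: "compose_list (ls @ ms) = compose_list ls \<circ> compose_list ms"
  by (induction ls) (auto simp: comp_assoc)

text \<open>Compositions of affine and triangular maps.\<close>
definition tame :: "(C2 \<Rightarrow> C2) \<Rightarrow> bool" where
  "tame F \<longleftrightarrow> (\<exists>ls. set ls \<subseteq> affine_maps \<union> triangular_maps \<and> F = compose_list ls)"

lemma tame_letter: "l \<in> affine_maps \<union> triangular_maps \<Longrightarrow> tame l"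
  unfolding tame_def by (rule exI[of _ "[l]"]) simp

lemma tame_comp: "tame F \<Longrightarrow> tame G \<Longrightarrow> tame (F \<circ> G)"
  unfolding tame_def
proof (elim exE conjE)
  fix ls ms assume "set ls \<subseteq> affine_maps \<union> triangular_maps" "F = compose_list ls"
    "set ms \<subseteq> affine_maps \<union> triangular_maps" "G = compose_list ms"
  then show "\<exists>ls. set ls \<subseteq> affine_maps \<union> triangular_maps \<and> F \<circ> G = compose_list ls"
    by (intro exI[of _ "ls @ ms"]) (auto simp: compose_list_append)
qed

text \<open>The exchange of the coordinates, which conjugates triangular maps to maps that permute the lines
  \<open>x = const\<close>.\<close>
definition swap_map :: "C2 \<Rightarrow> C2" where "swap_map q = (snd q, fst q)"

lemma swap_affine: "swap_map \<in> affine_maps"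
  unfolding affine_maps_def mem_Collect_eq
  by (rule exI[of _ 0], rule exI[of _ 1], rule exI[of _ 1], rule exI[of _ 0], rule exI[of _ 0], rule exI[of _ 0])
    (auto simp: swap_map_def fun_eq_iff)

lemma swap_swap [simp]: "swap_map (swap_map q) = q" by (simp add: swap_map_def)

lemma tame_lower:
  assumes "a \<noteq> 0" "b \<noteq> 0"
  shows "tame (\<lambda>q. (b * fst q + h, a * snd q + poly p (fst q)))"
proof -
  have "(\<lambda>q. (a * fst q + poly p (snd q), b * snd q + h)) \<in> triangular_maps"
    unfolding triangular_maps_def mem_Collect_eq
    by (intro exI conjI) (rule assms, rule assms, rule refl)
  then have "tame (swap_map \<circ> ((\<lambda>q. (a * fst q + poly p (snd q), b * snd q + h)) \<circ> swap_map))"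
    using swap_affine by (intro tame_comp tame_letter) auto
  then show ?thesis by (simp add: swap_map_def o_def)
qed

lemma poly2_subst: "\<exists>C. \<forall>q. poly2 C q = poly2 P (poly2 A q, poly2 B q)"
proof (intro exI allI)
  fix q
  show "poly2 (\<Sum>(i,j)\<in>support2 P. smult [:coeff (coeff P j) i:] (A ^ i * B ^ j)) q = poly2 P (poly2 A q, poly2 B q)"
    unfolding poly2_support[of P] poly2_sum
    by (rule sum.cong) (auto simp: poly2_smult poly2_mult poly2_power)
qed

lemma polynomial_map_comp:
  assumes "polynomial_map F" "polynomial_map G" shows "polynomial_map (F \<circ> G)"
proof -
  obtain P Q where F: "\<And>q. F q = (poly2 P q, poly2 Q q)" using assms(1) by (auto simp: polynomial_map_def)
  obtain A B where G: "\<And>q. G q = (poly2 A q, poly2 B q)" using assms(2) by (auto simp: polynomial_map_def)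
  obtain C where C: "\<forall>q. poly2 C q = poly2 P (poly2 A q, poly2 B q)" using poly2_subst by blast
  obtain D where D: "\<forall>q. poly2 D q = poly2 Q (poly2 A q, poly2 B q)" using poly2_subst by blast
  show ?thesis unfolding polynomial_map_def
    by (rule exI[of _ C], rule exI[of _ D]) (simp add: F G C D)
qed

lemma inj_poly_degree:
  fixes p :: "complex poly"
  assumes "inj (poly p)" shows "degree p = 1"
proof -
  have "poly (pderiv p) z \<noteq> 0" for z
  proof -
    have "deriv (poly p) z \<noteq> 0"
      by (rule holomorphic_injective_imp_regular[of "poly p" UNIV z]) (use assms in \<open>auto intro!: holomorphic_intros\<close>)
    then show ?thesis using DERIV_imp_deriv[OF poly_DERIV] by metis
  qed
  then obtain k where "k \<noteq> 0" "pderiv p = [:k:]" using no_root_constant by blast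
  then have "degree p - 1 = 0" "degree p \<noteq> 0"
    using degree_pderiv[of p] by (auto simp: pderiv_eq_0_iff[symmetric])
  then show ?thesis by simp
qed

text \<open>The case in which the first component does not depend on \<open>y\<close>. Injectivity on each vertical line
  makes \<open>V\<close> linear in \<open>y\<close>, with a coefficient that has no zero and hence is constant.\<close>
lemma jung_base:
  assumes bij: "bij F" and F: "\<And>q. F q = (poly2 [:u:] q, poly2 V q)"
  shows "tame F"
proof -
  have Fxy: "F (x,y) = (poly u x, poly2 V (x,y))" for x y by (simp add: F)
  have d1: "degree (fibre_poly V x) = 1" for x
  proof (rule inj_poly_degree, rule injI)
    fix y y' assume "poly (fibre_poly V x) y = poly (fibre_poly V x) y'"
    then have "F (x,y) = F (x,y')" by (simp add: Fxy poly_fibre_poly)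
    then show "y = y'" using bij by (auto dest!: bij_is_inj injD)
  qed
  have "poly (coeff V 1) x \<noteq> 0" for x
    using d1[of x] by (metis coeff_fibre_poly degree_0 leading_coeff_0_iff zero_neq_one)
  then obtain a where a: "a \<noteq> 0" "coeff V 1 = [:a:]" using no_root_constant by blast
  have V: "poly2 V (x,y) = a * y + poly (coeff V 0) x" for x y
  proof -
    have "poly (fibre_poly V x) y = coeff (fibre_poly V x) 0 + coeff (fibre_poly V x) 1 * y"
      using d1[of x] by (simp add: poly_as_sum[of _ 1])
    then show ?thesis using a by (simp add: poly_fibre_poly coeff_fibre_poly)
  qed
  have "degree u = 1"
  proof (rule inj_poly_degree, rule injI)
    fix x x' assume eq: "poly u x = poly u x'"
    define y' where "y' = (poly2 V (x,0) - poly (coeff V 0) x') / a"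
    have "F (x,0) = F (x',y')" using a eq by (simp add: Fxy V y'_def)
    then show "x = x'" using bij by (auto dest!: bij_is_inj injD)
  qed
  then obtain h b where u: "u = [:h, b:]" "b \<noteq> 0"
    by (cases u) (auto split: if_splits elim: degree_eq_zeroE)
  have "F = (\<lambda>q. (b * fst q + h, a * snd q + poly (coeff V 0) (fst q)))"
    by (rule ext) (auto simp: Fxy V u algebra_simps)
  then show ?thesis using tame_lower[OF a(1) u(2)] by simp
qed

text \<open>Polynomial automorphisms of the plane are tame: induction on the sum of the degrees of the two
  components in \<open>y\<close>.\<close>
theorem jung:
  assumes "polynomial_diffeomorphism F" shows "tame F"
proof -
  have "tame F" if "bij F" "polynomial_map (inv F)" "\<And>q. F q = (poly2 U q, poly2 V q)"
    "degree U + degree V = n" for n U V F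
    using that
  proof (induction n arbitrary: U V F rule: less_induct)
    case (less n)
    note bij = less.prems(1) and F = less.prems(3)
    have Fxy: "F (x,y) = (poly2 U (x,y), poly2 V (x,y))" for x y by (simp add: F)
    obtain P Q where PQ: "\<And>q. inv F q = (poly2 P q, poly2 Q q)"
      using less.prems(2) by (auto simp: polynomial_map_def)
    have inv1: "inv F (F q) = q" for q using bij by (simp add: bij_is_inj)
    have inv2: "F (inv F q) = q" for q using bij by (simp add: bij_is_surj surj_f_inv_f)
    consider "degree U = 0" | "degree V = 0" | "degree U > 0" "degree V > 0" by blast
    then show ?case
    proof cases
      case 1
      then obtain u where "U = [:u:]" using degree_eq_zeroE by blast
      then show ?thesis using jung_base[OF bij] F by blast
    next
      case 2
      then obtain v where v: "V = [:v:]" using degree_eq_zeroE by blast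
      have sb: "bij (swap_map \<circ> F)" by (rule bij_comp[OF bij affine_maps_inverse(1)[OF swap_affine]])
      have "tame (swap_map \<circ> F)"
        by (rule jung_base[OF sb, of v U]) (simp add: swap_map_def F v)
      then have "tame (swap_map \<circ> (swap_map \<circ> F))"
        by (rule tame_comp[OF tame_letter[OF UnI1[OF swap_affine]]])
      moreover have "swap_map \<circ> (swap_map \<circ> F) = F" by (auto simp: fun_eq_iff)
      ultimately show ?thesis by simp
    next
      case 3
      have r: "(\<exists>c m. degree (V - smult [:c:] (U ^ m)) < degree V) \<or>
         (\<exists>c m. degree (U - smult [:c:] (V ^ m)) < degree U)"
      proof (rule jung_reduction[of P U V Q, OF _ _ _ _ 3])
        fix x y show "poly2 P (poly2 U (x,y), poly2 V (x,y)) = x" "poly2 Q (poly2 U (x,y), poly2 V (x,y)) = y"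
          using inv1[of "(x,y)"] unfolding PQ Fxy by simp_all
      next
        fix z show "poly2 U (poly2 P z, poly2 Q z) = fst z" "poly2 V (poly2 P z, poly2 Q z) = snd z"
          using inv2[of z] unfolding PQ F by (simp_all add: prod_eq_iff)
      qed
      have step: "tame F" if E: "\<And>q. E q = (e1 q, e2 q)" and E': "polynomial_map E'"
          and EE: "E \<circ> E' = id" "E' \<circ> E = id" and t: "tame E'"
          and red: "\<And>q. E (F q) = (poly2 U' q, poly2 V' q)" "degree U' + degree V' < n"
        for E E' e1 e2 U' V'
      proof -
        have bE: "bij E" by (rule o_bij[OF EE(2,1)])
        have iE: "inv E = E'" by (rule inv_unique_comp[OF EE])
        have "tame (E \<circ> F)"
        proof (rule less.IH[OF red(2)])
          show "bij (E \<circ> F)" by (rule bij_comp[OF bij bE])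
          show "polynomial_map (inv (E \<circ> F))"
            using o_inv_distrib[OF bE bij] less.prems(2) E' by (simp add: iE polynomial_map_comp)
          show "(E \<circ> F) q = (poly2 U' q, poly2 V' q)" for q using red by simp
        qed simp
        then have "tame (E' \<circ> (E \<circ> F))" using t by (rule tame_comp[rotated])
        then show ?thesis using EE(2) by (simp add: comp_assoc [symmetric])
      qed
      from r show ?thesis
      proof
        assume "\<exists>c m. degree (V - smult [:c:] (U ^ m)) < degree V"
        then obtain c m where cm: "degree (V - smult [:c:] (U ^ m)) < degree V" by blast
        let ?E = "\<lambda>q::C2. (fst q, snd q - c * fst q ^ m)"
        let ?E' = "\<lambda>q::C2. (fst q, snd q + c * fst q ^ m)"
        show ?thesis
        proof (rule step[of ?E "\<lambda>q. fst q" "\<lambda>q. snd q - c * fst q ^ m" ?E'])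
          show "polynomial_map ?E'" unfolding polynomial_map_def
            by (rule exI[of _ "[:[:0,1:]:]"], rule exI[of _ "[:0,1:] + [:monom c m:]"])
              (auto simp: poly2_def poly_monom)
          show "tame ?E'"
            using tame_lower[of 1 1 0 "monom c m"] by (simp add: poly_monom)
          show "?E (F q) = (poly2 U q, poly2 (V - smult [:c:] (U ^ m)) q)" for q
            by (simp add: F poly2_diff poly2_smult poly2_power)
          show "degree U + degree (V - smult [:c:] (U ^ m)) < n" using cm less.prems(4) by simp
        qed (auto simp: fun_eq_iff)
      next
        assume "\<exists>c m. degree (U - smult [:c:] (V ^ m)) < degree U"
        then obtain c m where cm: "degree (U - smult [:c:] (V ^ m)) < degree U" by blast
        let ?E = "\<lambda>q::C2. (fst q - c * snd q ^ m, snd q)"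
        let ?E' = "\<lambda>q::C2. (fst q + c * snd q ^ m, snd q)"
        show ?thesis
        proof (rule step[of ?E "\<lambda>q. fst q - c * snd q ^ m" "\<lambda>q. snd q" ?E'])
          show "polynomial_map ?E'" unfolding polynomial_map_def
            by (rule exI[of _ "[:[:0,1:]:] + monom [:c:] m"], rule exI[of _ "[:0,1:]"])
              (auto simp: poly2_def poly_monom poly_power)
          have "?E' \<in> triangular_maps" unfolding triangular_maps_def mem_Collect_eq
            by (rule exI[of _ 1], rule exI[of _ 1], rule exI[of _ 0], rule exI[of _ "monom c m"])
              (auto simp: poly_monom)
          then show "tame ?E'" by (intro tame_letter) simp
          show "?E (F q) = (poly2 (U - smult [:c:] (V ^ m)) q, poly2 V q)" for q
            by (simp add: F poly2_diff poly2_smult poly2_power)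
          show "degree (U - smult [:c:] (V ^ m)) + degree V < n" using cm less.prems(4) by simp
        qed (auto simp: fun_eq_iff)
      qed
    qed
  qed
  moreover obtain U V where "\<And>q. F q = (poly2 U q, poly2 V q)"
    using assms by (auto simp: polynomial_diffeomorphism_def polynomial_map_def)
  ultimately show ?thesis using assms by (auto simp: polynomial_diffeomorphism_def)
qed

section \<open>Reduced words and cyclic reduction\<close>

text \<open>The two groups that generate the tame maps; the index is true for triangular maps.\<close>
definition grp :: "bool \<Rightarrow> (C2 \<Rightarrow> C2) set" where
  "grp b = (if b then triangular_maps else affine_maps)"

text \<open>The members of one of the two groups that are not in the other.\<close>
definition letters :: "bool \<Rightarrow> (C2 \<Rightarrow> C2) set" where
  "letters b = grp b - grp (\<not> b)"

lemma grp_comp: "F \<in> grp b \<Longrightarrow> G \<in> grp b \<Longrightarrow> F \<circ> G \<in> grp b"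
  by (auto simp: grp_def affine_maps_comp triangular_maps_comp split: if_splits)

lemma grp_inv: "F \<in> grp b \<Longrightarrow> inv F \<in> grp b"
  by (auto simp: grp_def affine_maps_inverse triangular_maps_inverse split: if_splits)

lemma grp_bij: "F \<in> grp b \<Longrightarrow> bij F"
  by (auto simp: grp_def affine_maps_inverse triangular_maps_inverse split: if_splits)

lemma grp_tame: "F \<in> grp b \<Longrightarrow> tame F"
  by (rule tame_letter) (auto simp: grp_def split: if_splits)

lemma in_grp_iff: "F \<in> affine_maps \<union> triangular_maps \<longleftrightarrow> (\<exists>b. F \<in> grp b)"
proof
  assume "F \<in> affine_maps \<union> triangular_maps"
  then have "F \<in> grp False \<or> F \<in> grp True" by (auto simp: grp_def)
  then show "\<exists>b. F \<in> grp b" by blast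
qed (auto simp: grp_def split: if_splits)

lemma comp_inv_cancel:
  assumes "bij u" shows "inv u \<circ> (u \<circ> l) = l" "(l \<circ> u) \<circ> inv u = l"
  using assms by (auto simp: fun_eq_iff bij_is_inj bij_is_surj surj_f_inv_f)

text \<open>A factor that lies in both groups does not change the kind of a letter.\<close>
lemma letters_absorb:
  assumes u: "u \<in> grp b" "u \<in> grp (\<not> b)" and l: "l \<in> letters c"
  shows "u \<circ> l \<in> letters c"
proof -
  have uu: "u \<in> grp c'" for c' using u by (cases c'; cases b) auto
  have "u \<circ> l \<notin> grp (\<not> c)"
  proof
    assume "u \<circ> l \<in> grp (\<not> c)"
    then have "inv u \<circ> (u \<circ> l) \<in> grp (\<not> c)" by (rule grp_comp[OF grp_inv[OF uu]])
    then show False using l by (simp add: comp_inv_cancel(1)[OF grp_bij[OF u(1)]] letters_def)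
  qed
  then show ?thesis using grp_comp[OF uu] l by (auto simp: letters_def)
qed

text \<open>A nonempty word whose letters alternate between the two kinds, with first letter of kind \<open>b\<close> and
  last letter of kind \<open>b'\<close>.\<close>
inductive reduced_word :: "bool \<Rightarrow> bool \<Rightarrow> (C2 \<Rightarrow> C2) list \<Rightarrow> bool" where
  single: "l \<in> letters b \<Longrightarrow> reduced_word b b [l]"
| cons: "l \<in> letters b \<Longrightarrow> reduced_word (\<not> b) b' ls \<Longrightarrow> reduced_word b b' (l # ls)"

lemma reduced_ends: "reduced_word b b' ls \<Longrightarrow> ls \<noteq> [] \<and> hd ls \<in> letters b \<and> last ls \<in> letters b'"
  by (induction rule: reduced_word.induct) auto

lemma reduced_append:
  "reduced_word b c r \<Longrightarrow> reduced_word (\<not> c) b' gs \<Longrightarrow> reduced_word b b' (r @ gs)"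
  by (induction rule: reduced_word.induct) (auto intro: reduced_word.cons)

lemma reduced_append_Cons:
  assumes "reduced_word b c r" "reduced_word (\<not> c) b' gs"
  shows "\<exists>l rest. r @ gs = l # rest \<and> l \<in> letters b \<and> reduced_word (\<not> b) b' rest"
  using assms(1)
proof cases
  case (single l) then show ?thesis using assms(2) by auto
next
  case (cons l ls) then show ?thesis using reduced_append[OF cons(3) assms(2)] by auto
qed

lemma reduced_bij: "reduced_word b b' ls \<Longrightarrow> bij (compose_list ls)"
proof (induction rule: reduced_word.induct)
  case (single l b) then show ?case by (auto simp: letters_def intro: grp_bij)
next
  case (cons l b b' ls)
  then have "bij l" by (auto simp: letters_def intro: grp_bij)
  then show ?case using bij_comp[OF cons.IH] by (simp only: compose_list_simps)
qed

lemma reduced_absorb: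
  assumes u: "u \<in> grp d" "u \<in> grp (\<not> d)" and r: "reduced_word b c r"
  shows "\<exists>r'. reduced_word b c r' \<and> compose_list r' = u \<circ> compose_list r"
  using r
proof cases
  case (single l)
  then show ?thesis using letters_absorb[OF u] by (intro exI[of _ "[u \<circ> l]"]) (auto intro: reduced_word.single)
next
  case (cons l ls)
  then show ?thesis using letters_absorb[OF u]
    by (intro exI[of _ "(u \<circ> l) # ls"]) (auto intro: reduced_word.cons simp: comp_assoc)
qed

text \<open>The word \<open>gs\<close> is cyclically reduced: its first and last letters are of different kinds. A factor
  prefixed to a reduced word affects only the first letters of that word, and one further copy of
  \<open>gs\<close> ensures that something remains. In particular the last letter keeps its kind.\<close>
lemma tame_times_power_reduced:
  assumes gs: "reduced_word (\<not> b) b gs" and w: "tame w"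
  shows "\<exists>k b1 r. reduced_word b1 b r \<and> compose_list r = w \<circ> (compose_list gs ^^ k)"
proof -
  let ?g = "compose_list gs"
  have "\<exists>k b1 r. reduced_word b1 b r \<and> compose_list r = compose_list ws \<circ> (?g ^^ k)"
    if "set ws \<subseteq> affine_maps \<union> triangular_maps" for ws
    using that
  proof (induction ws)
    case Nil
    show ?case using gs by (intro exI[of _ 1] exI[of _ "\<not> b"] exI[of _ gs]) simp
  next
    case (Cons c ws)
    have "set ws \<subseteq> affine_maps \<union> triangular_maps" using Cons.prems by simp
    from Cons.IH[OF this] obtain k b1 r where r: "reduced_word b1 b r" "compose_list r = compose_list ws \<circ> (?g ^^ k)"
      by (elim exE conjE)
    obtain l rest where lr: "r @ gs = l # rest" "l \<in> letters b1" "reduced_word (\<not> b1) b rest"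
      using reduced_append_Cons[OF r(1) gs] by blast
    have prod: "compose_list (r @ gs) = compose_list ws \<circ> (?g ^^ Suc k)"
      using r(2) by (simp add: compose_list_append comp_assoc funpow_Suc_right del: funpow.simps)
    have goal: "compose_list (c # ws) \<circ> (?g ^^ Suc k) = c \<circ> (l \<circ> compose_list rest)"
      using prod lr(1) by (simp add: comp_assoc del: funpow.simps)
    have "\<exists>b1 r'. reduced_word b1 b r' \<and> compose_list r' = c \<circ> (l \<circ> compose_list rest)"
    proof (cases "c \<in> grp b1")
      case True
      define u where "u = c \<circ> l"
      have u: "u \<in> grp b1" using True lr(2) by (auto simp: u_def letters_def intro: grp_comp)
      have eq: "c \<circ> (l \<circ> compose_list rest) = u \<circ> compose_list rest" by (simp add: u_def comp_assoc)
      show ?thesis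
      proof (cases "u \<in> grp (\<not> b1)")
        case True
        show ?thesis unfolding eq using reduced_absorb[OF u True lr(3)] by blast
      next
        case False
        then have "reduced_word b1 b (u # rest)" using u lr(3) by (intro reduced_word.cons) (auto simp: letters_def)
        then show ?thesis unfolding eq by (intro exI[of _ b1] exI[of _ "u # rest"]) simp
      qed
    next
      case False
      moreover have "\<exists>b. c \<in> grp b" using Cons.prems by (simp add: in_grp_iff [symmetric])
      ultimately have "c \<in> letters (\<not> b1)" by (cases b1) (auto simp: letters_def grp_def split: if_splits)
      then have "reduced_word (\<not> b1) b (c # l # rest)" using lr by (auto intro!: reduced_word.cons)
      then show ?thesis by (intro exI[of _ "\<not> b1"] exI[of _ "c # l # rest"]) simp
    qed
    then show ?case using goal by (metis (no_types))
  qed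
  then show ?thesis using w by (auto simp: tame_def)
qed

text \<open>Two factors of a word that can be merged into one.\<close>
definition share :: "(C2 \<Rightarrow> C2) \<Rightarrow> (C2 \<Rightarrow> C2) \<Rightarrow> bool" where
  "share l m \<longleftrightarrow> (\<exists>b. l \<in> grp b \<and> m \<in> grp b)"

lemma not_share_letters:
  assumes "\<not> share l m" "l \<in> grp c" "m \<in> grp b"
  shows "l \<in> letters (\<not> b)" "m \<in> letters b"
proof -
  have l: "l \<notin> grp b" using assms by (auto simp: share_def)
  then have c: "c = (\<not> b)" using assms(2) by (cases b; cases c) auto
  show "l \<in> letters (\<not> b)" using l assms c by (auto simp: letters_def)
  show "m \<in> letters b" using assms c by (auto simp: letters_def share_def)
qed

lemma not_share_reduced:
  assumes "length ls \<ge> 2" "set ls \<subseteq> {l. \<exists>b. l \<in> grp b}"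
    and "\<And>xs l m ys. ls = xs @ l # m # ys \<Longrightarrow> \<not> share l m"
  shows "\<exists>b b'. reduced_word b b' ls"
  using assms
proof (induction ls rule: induct_list012)
  case (3 l m rest)
  have ns: "\<not> share l m" using 3(5)[of "[]" l m rest] by simp
  obtain c where l: "l \<in> grp c" using 3(4) by auto
  obtain b where m: "m \<in> grp b" using 3(4) by auto
  show ?case
  proof (cases rest)
    case Nil
    have "reduced_word (\<not> b) b [l, m]"
      using not_share_letters[OF ns l m] by (simp add: reduced_word.cons reduced_word.single)
    then show ?thesis using Nil by blast
  next
    case (Cons a list)
    have "\<exists>b b'. reduced_word b b' (m # rest)"
    proof (rule 3(2))
      show "\<not> share l' m'" if "m # rest = xs @ l' # m' # ys" for xs l' m' ys
        using 3(5)[of "l # xs" l' m' ys] that by simp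
    qed (use Cons 3(4) in auto)
    then obtain d d' where r: "reduced_word d d' (m # rest)" by blast
    then have "m \<in> grp d" using reduced_ends by (force simp: letters_def)
    then have "l \<in> letters (\<not> d)" using not_share_letters[OF ns l] by blast
    then have "reduced_word (\<not> d) d' (l # m # rest)"
      using reduced_word.cons[of l "\<not> d" d' "m # rest"] r by simp
    then show ?thesis by blast
  qed
qed auto

text \<open>Conjugate by a tame map to a member of one of the two groups or to a cyclically reduced word.\<close>
definition conjugate_normal :: "(C2 \<Rightarrow> C2) \<Rightarrow> bool" where
  "conjugate_normal f \<longleftrightarrow> (\<exists>w g. tame w \<and> bij w \<and> tame (inv w) \<and> f = w \<circ> g \<circ> inv w \<and>
     ((\<exists>b. g \<in> grp b) \<or> (\<exists>b gs. g = compose_list gs \<and> reduced_word (\<not> b) b gs)))"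

lemma conjugate_normal_conj:
  assumes "conjugate_normal (u \<circ> f \<circ> inv u)" "u \<in> grp b" shows "conjugate_normal f"
proof -
  obtain w g where wg: "tame w" "bij w" "tame (inv w)" "u \<circ> f \<circ> inv u = w \<circ> g \<circ> inv w"
     "((\<exists>b. g \<in> grp b) \<or> (\<exists>b gs. g = compose_list gs \<and> reduced_word (\<not> b) b gs))"
    using assms(1) unfolding conjugate_normal_def by (elim exE conjE)
  have bu: "bij u" using grp_bij assms(2) by blast
  have "f = inv u \<circ> (u \<circ> f \<circ> inv u) \<circ> u"
    using bu by (auto simp: fun_eq_iff bij_is_inj)
  also have "\<dots> = (inv u \<circ> w) \<circ> g \<circ> (inv w \<circ> u)" by (simp only: wg(4)) (simp only: comp_assoc)
  also have "inv w \<circ> u = inv (inv u \<circ> w)"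
    using o_inv_distrib[of "inv u" w] bu wg(2) by (simp add: bij_imp_bij_inv inv_inv_eq)
  finally have "f = (inv u \<circ> w) \<circ> g \<circ> inv (inv u \<circ> w)" .
  moreover have "tame (inv u \<circ> w)" using assms(2) wg(1) by (intro tame_comp grp_tame[OF grp_inv])
  moreover have "bij (inv u \<circ> w)" using wg(2) bu by (simp add: bij_comp bij_imp_bij_inv)
  moreover have "tame (inv (inv u \<circ> w))"
    using o_inv_distrib[of "inv u" w] bu wg(2,3) assms(2)
    by (simp add: bij_imp_bij_inv inv_inv_eq tame_comp grp_tame)
  ultimately show ?thesis using wg(5) unfolding conjugate_normal_def
    by (intro exI[of _ "inv u \<circ> w"] exI[of _ g]) simp
qed

text \<open>Induction on the length of the word: adjacent factors of one group are merged, and when the first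
  and the last factor lie in one group, conjugation makes them adjacent.\<close>
lemma cyclic_reduction:
  assumes "tame f" shows "conjugate_normal f"
proof -
  have tid: "tame id" by (rule tame_letter) (simp add: id_affine)
  have triv: "conjugate_normal g" if "(\<exists>b. g \<in> grp b) \<or> (\<exists>b gs. g = compose_list gs \<and> reduced_word (\<not> b) b gs)" for g
    unfolding conjugate_normal_def using that tid by (intro exI[of _ id] exI[of _ g]) simp
  have "conjugate_normal (compose_list ls)" if "set ls \<subseteq> {l. \<exists>b. l \<in> grp b}" for ls
    using that
  proof (induction "length ls" arbitrary: ls rule: less_induct)
    case less
    consider "ls = []" | l where "ls = [l]" | "length ls \<ge> 2" by (cases ls; cases "tl ls") auto
    then show ?case
    proof cases
      case 1
      have "id \<in> grp False" by (simp add: grp_def id_affine)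
      then show ?thesis using 1 by (intro triv) auto
    next
      case 2 then show ?thesis using less.prems by (intro triv) auto
    next
      case 3
      show ?thesis
      proof (cases "\<exists>xs l m ys. ls = xs @ l # m # ys \<and> share l m")
        case True
        then obtain xs l m ys b where ls: "ls = xs @ l # m # ys" and b: "l \<in> grp b" "m \<in> grp b"
          by (auto simp: share_def)
        have "conjugate_normal (compose_list (xs @ (l \<circ> m) # ys))"
          by (rule less.hyps) (use less.prems ls grp_comp[OF b] in auto)
        then show ?thesis by (simp add: ls compose_list_append comp_assoc)
      next
        case ns: False
        then obtain b b' where r: "reduced_word b b' ls"
          using not_share_reduced[OF 3 less.prems] by blast
        show ?thesis
        proof (cases "b' = b")
          case False
          then have "reduced_word (\<not> b') b' ls" using r by (cases b; cases b') auto
          then show ?thesis by (intro triv disjI2 exI[of _ b'] exI[of _ ls]) simp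
        next
          case True
          obtain l ms m where ls: "ls = l # ms @ [m]"
          proof (cases ls)
            case (Cons a list)
            then show ?thesis using 3 that[of a "butlast list" "last list"] by (cases list) auto
          qed (use 3 in simp)
          have b: "l \<in> grp b" "m \<in> grp b" using reduced_ends[OF r] True ls by (auto simp: letters_def)
          have bm: "bij m" using grp_bij b by blast
          have "conjugate_normal (compose_list ((m \<circ> l) # ms))"
            by (rule less.hyps) (use less.prems ls grp_comp[OF b(2,1)] in auto)
          also have "compose_list ((m \<circ> l) # ms) = m \<circ> compose_list ls \<circ> inv m"
            using bm by (auto simp: ls compose_list_append fun_eq_iff bij_is_surj surj_f_inv_f)
          finally show ?thesis by (rule conjugate_normal_conj[OF _ b(2)])
        qed
      qed
    qed
  qed
  then show ?thesis using assms by (auto simp: tame_def in_grp_iff [symmetric] subset_eq)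
qed

section \<open>Growth in sectors at infinity\<close>

text \<open>The two sectors \<open>c \<bar>x\<bar> \<le> \<bar>y\<bar>\<close> (for \<open>b\<close> true) and \<open>\<bar>y\<bar> \<le> c \<bar>x\<bar>\<close>, which cover the plane.\<close>
definition sector :: "real \<Rightarrow> bool \<Rightarrow> C2 set" where
  "sector c b = {q. if b then c * norm (fst q) \<le> norm (snd q) else norm (snd q) \<le> c * norm (fst q)}"

lemma sector_or: "q \<in> sector c b \<or> q \<in> sector c (\<not> b)"
  by (auto simp: sector_def)

text \<open>Far from the origin, \<open>F\<close> maps the sector \<open>b\<close> into the sector \<open>b'\<close>, and \<open>norm (F q)\<close> is there comparable
  to \<open>norm q ^ s\<close>.\<close>
definition goes :: "real \<Rightarrow> bool \<Rightarrow> bool \<Rightarrow> (C2 \<Rightarrow> C2) \<Rightarrow> nat \<Rightarrow> bool" where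
  "goes c b b' F s \<longleftrightarrow> (\<exists>R K. \<forall>q\<in>sector c b. R \<le> norm q \<longrightarrow>
     F q \<in> sector c b' \<and> \<bar>ln (norm (F q)) - real s * ln (norm q)\<bar> \<le> K)"

text \<open>Growth at most of order \<open>m\<close> on the whole plane.\<close>
definition grows :: "(C2 \<Rightarrow> C2) \<Rightarrow> nat \<Rightarrow> bool" where
  "grows F m \<longleftrightarrow> (\<exists>C>0. \<forall>q. norm (F q) \<le> C * (1 + norm q) ^ m)"

lemma goesD:
  assumes "goes c b b' F s"
  obtains R K where "R \<ge> 1" "K \<ge> 0" "\<And>q. q \<in> sector c b \<Longrightarrow> R \<le> norm q \<Longrightarrow> F q \<in> sector c b'"
    "\<And>q. q \<in> sector c b \<Longrightarrow> R \<le> norm q \<Longrightarrow> \<bar>ln (norm (F q)) - real s * ln (norm q)\<bar> \<le> K"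
proof -
  obtain R K where RK: "\<And>q. q \<in> sector c b \<Longrightarrow> R \<le> norm q \<Longrightarrow>
     F q \<in> sector c b' \<and> \<bar>ln (norm (F q)) - real s * ln (norm q)\<bar> \<le> K"
    using assms by (auto simp: goes_def)
  show thesis by (rule that[of "max 1 R" "max 0 K"]) (use RK in \<open>auto intro: order_trans[OF _ max.cobounded2]\<close>)
qed

lemma goesI:
  assumes A: "A > 0" and B: "B > 0"
    and h: "\<And>q. q \<in> sector c b \<Longrightarrow> R \<le> norm q \<Longrightarrow>
      F q \<in> sector c b' \<and> A * norm q ^ s \<le> norm (F q) \<and> norm (F q) \<le> B * norm q ^ s"
  shows "goes c b b' F s"
  unfolding goes_def
proof (intro exI ballI impI)
  fix q assume q: "q \<in> sector c b" "max R 1 \<le> norm q"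
  then have n: "norm q > 0" by linarith
  have F: "F q \<in> sector c b'" "A * norm q ^ s \<le> norm (F q)" "norm (F q) \<le> B * norm q ^ s"
    using h[OF q(1)] q(2) by auto
  have pos: "0 < A * norm q ^ s" using A n by simp
  then have Fp: "0 < norm (F q)" using F(2) by linarith
  have "ln (A * norm q ^ s) \<le> ln (norm (F q))" using pos F(2) Fp by (subst ln_le_cancel_iff) auto
  moreover have "ln (norm (F q)) \<le> ln (B * norm q ^ s)" using F(3) Fp B n by (subst ln_le_cancel_iff) auto
  moreover have "ln (A * norm q ^ s) = ln A + real s * ln (norm q)"
    using A n by (simp add: ln_mult ln_realpow)
  moreover have "ln (B * norm q ^ s) = ln B + real s * ln (norm q)"
    using B n by (simp add: ln_mult ln_realpow)
  ultimately show "F q \<in> sector c b' \<and> \<bar>ln (norm (F q)) - real s * ln (norm q)\<bar> \<le> \<bar>ln A\<bar> + \<bar>ln B\<bar>"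
    using F(1) by linarith
qed

lemma goes_comp:
  assumes F: "goes c b b' F s" and G: "goes c b' b'' G t" and s: "s \<ge> 1"
  shows "goes c b b'' (G \<circ> F) (t * s)"
proof -
  obtain R K where R: "R \<ge> 1" "K \<ge> 0" "\<And>q. q \<in> sector c b \<Longrightarrow> R \<le> norm q \<Longrightarrow> F q \<in> sector c b'"
    "\<And>q. q \<in> sector c b \<Longrightarrow> R \<le> norm q \<Longrightarrow> \<bar>ln (norm (F q)) - real s * ln (norm q)\<bar> \<le> K"
    using goesD[OF F] by blast
  obtain R' K' where R': "R' \<ge> 1" "K' \<ge> 0" "\<And>q. q \<in> sector c b' \<Longrightarrow> R' \<le> norm q \<Longrightarrow> G q \<in> sector c b''"
    "\<And>q. q \<in> sector c b' \<Longrightarrow> R' \<le> norm q \<Longrightarrow> \<bar>ln (norm (G q)) - real t * ln (norm q)\<bar> \<le> K'"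
    using goesD[OF G] by blast
  show ?thesis unfolding goes_def
  proof (intro exI ballI impI)
    fix q assume q: "q \<in> sector c b" "max R (R' * exp (K + 1)) \<le> norm q"
    have R1: "R \<le> norm q" using q(2) by simp
    have n: "norm q \<ge> 1" using R1 R(1) by linarith
    have e: "\<bar>ln (norm (F q)) - real s * ln (norm q)\<bar> \<le> K" by (rule R(4)[OF q(1) R1])
    have "R' * exp (K + 1) > 0" "R' * exp (K + 1) \<le> norm q" using q(2) R'(1) by auto
    then have "ln (R' * exp (K + 1)) \<le> ln (norm q)" using n by (subst ln_le_cancel_iff) auto
    then have "ln R' + (K + 1) \<le> ln (norm q)" using R'(1) by (simp add: ln_mult)
    moreover have "1 * ln (norm q) \<le> real s * ln (norm q)"
      using s n by (intro mult_right_mono) auto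
    ultimately have lnF: "ln R' + (K + 1) \<le> real s * ln (norm q)" by linarith
    have R2: "R' \<le> norm (F q)"
    proof (cases "norm (F q) > 0")
      case True
      have "ln R' \<le> ln (norm (F q))" using lnF e by linarith
      then show ?thesis using R'(1) True by (subst (asm) ln_le_cancel_iff) auto
    next
      case False
      then have "ln (norm (F q)) = 0" by simp
      moreover have "ln R' \<ge> 0" using R'(1) by simp
      ultimately show ?thesis using lnF e by linarith
    qed
    have Fc: "F q \<in> sector c b'" by (rule R(3)[OF q(1) R1])
    have "\<bar>ln (norm (G (F q))) - real t * ln (norm (F q))\<bar> \<le> K'" by (rule R'(4)[OF Fc R2])
    moreover have "\<bar>real t * ln (norm (F q)) - real t * (real s * ln (norm q))\<bar> \<le> real t * K"
      using e by (simp add: right_diff_distrib [symmetric] abs_mult mult_left_mono)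
    ultimately have "\<bar>ln (norm (G (F q))) - real (t * s) * ln (norm q)\<bar> \<le> K' + real t * K"
      by (simp add: mult.assoc)
    then show "(G \<circ> F) q \<in> sector c b'' \<and> \<bar>ln (norm ((G \<circ> F) q)) - real (t * s) * ln (norm q)\<bar> \<le> K' + real t * K"
      using R'(3)[OF Fc R2] by simp
  qed
qed

lemma grows_comp:
  assumes "grows F s" "grows G t" shows "grows (G \<circ> F) (t * s)"
proof -
  obtain C where C: "C > 0" "\<And>q. norm (F q) \<le> C * (1 + norm q) ^ s" using assms(1) by (auto simp: grows_def)
  obtain D where D: "D > 0" "\<And>q. norm (G q) \<le> D * (1 + norm q) ^ t" using assms(2) by (auto simp: grows_def)
  have "norm ((G \<circ> F) q) \<le> (D * (1 + C) ^ t) * (1 + norm q) ^ (t * s)" for q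
  proof -
    have one: "1 \<le> (1 + norm q) ^ s" by (rule one_le_power) simp
    have "1 + norm (F q) \<le> (1 + C) * (1 + norm q) ^ s"
      using C(2)[of q] one unfolding distrib_right by linarith
    then have "(1 + norm (F q)) ^ t \<le> ((1 + C) * (1 + norm q) ^ s) ^ t" by (rule power_mono) simp
    then have "D * (1 + norm (F q)) ^ t \<le> D * ((1 + C) * (1 + norm q) ^ s) ^ t" using D(1) by simp
    moreover have "((1 + norm q) ^ s) ^ t = (1 + norm q) ^ (t * s)" by (simp add: power_mult [symmetric] mult.commute)
    ultimately show ?thesis using D(2)[of "F q"] by (simp add: power_mult_distrib mult.assoc)
  qed
  moreover have "D * (1 + C) ^ t > 0" using C D by simp
  ultimately show ?thesis unfolding grows_def by blast
qed

lemma poly_growth_bound: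
  fixes p :: "complex poly"
  assumes "degree p \<le> N"
  shows "\<exists>C\<ge>0. \<forall>y. norm (poly p y) \<le> C * (1 + norm y) ^ N"
proof (intro exI conjI allI)
  show "0 \<le> (\<Sum>k\<le>N. norm (coeff p k))" by (rule sum_nonneg) simp
  fix y
  have "norm (poly p y) \<le> (\<Sum>k\<le>N. norm (coeff p k) * norm y ^ k)"
    unfolding poly_as_sum[OF assms] by (rule order_trans[OF norm_sum]) (simp add: norm_mult norm_power)
  also have "\<dots> \<le> (\<Sum>k\<le>N. norm (coeff p k) * (1 + norm y) ^ N)"
  proof (rule sum_mono)
    fix k assume k: "k \<in> {..N}"
    have "norm y ^ k \<le> (1 + norm y) ^ k" by (rule power_mono) auto
    also have "\<dots> \<le> (1 + norm y) ^ N" by (rule power_increasing) (use k in auto)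
    finally show "norm (coeff p k) * norm y ^ k \<le> norm (coeff p k) * (1 + norm y) ^ N"
      by (rule mult_left_mono) simp
  qed
  finally show "norm (poly p y) \<le> (\<Sum>k\<le>N. norm (coeff p k)) * (1 + norm y) ^ N"
    by (simp add: sum_distrib_right)
qed

lemma norm_pair_bounds:
  fixes q :: C2
  shows "norm (fst q) \<le> norm q" "norm (snd q) \<le> norm q" "norm q \<le> norm (fst q) + norm (snd q)"
  using norm_Pair_le[of "fst q" "snd q"] norm_fst_le[of "fst q" "snd q"] norm_snd_le[of "snd q" "fst q"] by simp_all

text \<open>Where \<open>y\<close> is not small compared with \<open>x\<close>, the term of degree \<open>s\<close> in \<open>y\<close> dominates.\<close>
lemma goes_triangular:
  assumes F: "F = (\<lambda>q. (a * fst q + poly p (snd q), b * snd q + h))" and b: "b \<noteq> 0"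
    and s: "degree p = s" "s \<ge> 2"
  shows "c > 0 \<Longrightarrow> goes c True False F s" "grows F s"
proof -
  define L where "L = lead_coeff p"
  have L: "norm L > 0" using s by (auto simp: L_def)
  let ?r = "p - monom L s"
  have "degree ?r \<le> s - 1"
  proof (rule degree_le, intro allI impI)
    fix i assume "s - 1 < i"
    then show "coeff ?r i = 0" using s by (cases "i = s") (auto simp: L_def coeff_monom coeff_eq_0)
  qed
  then obtain C where C: "C \<ge> 0" "\<And>y. norm (poly ?r y) \<le> C * (1 + norm y) ^ (s - 1)"
    using poly_growth_bound by blast
  obtain C' where C': "C' \<ge> 0" "\<And>y. norm (poly p y) \<le> C' * (1 + norm y) ^ s"
    using poly_growth_bound[of p s] s by auto
  have pm: "u \<le> u ^ k" if "1 \<le> u" "1 \<le> k" for u :: real and k :: nat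
    using self_le_power[of u k] that by simp
  show "grows F s" unfolding grows_def
  proof (intro exI conjI allI)
    show "norm a + C' + norm b + norm h + 1 > 0" using C'(1) by (smt (verit) norm_ge_zero)
    fix q :: C2
    let ?N = "(1 + norm q) ^ s"
    have N1: "1 + norm q \<le> ?N" using s by (intro pm) auto
    have "norm (F q) \<le> norm (a * fst q + poly p (snd q)) + norm (b * snd q + h)"
      unfolding F by (rule norm_Pair_le)
    also have "\<dots> \<le> norm a * norm (fst q) + norm (poly p (snd q)) + (norm b * norm (snd q) + norm h)"
      by (intro add_mono order_trans[OF norm_triangle_ineq]) (auto simp: norm_mult)
    also have "\<dots> \<le> norm a * ?N + C' * ?N + (norm b * ?N + norm h * ?N)"
    proof (intro add_mono)
      show "norm a * norm (fst q) \<le> norm a * ?N"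
        using N1 norm_pair_bounds(1)[of q] by (intro mult_left_mono) auto
      show "norm b * norm (snd q) \<le> norm b * ?N"
        using N1 norm_pair_bounds(2)[of q] by (intro mult_left_mono) auto
      have "1 \<le> ?N" using N1 norm_ge_zero[of q] by linarith
      from mult_left_mono[OF this norm_ge_zero[of h]] show "norm h \<le> norm h * ?N" by simp
      have "(1 + norm (snd q)) ^ s \<le> ?N" using norm_pair_bounds(2)[of q] by (intro power_mono) auto
      then show "norm (poly p (snd q)) \<le> C' * ?N"
        using C'(2)[of "snd q"] C'(1) by (meson mult_left_mono order_trans)
    qed
    also have "\<dots> \<le> (norm a + C' + norm b + norm h + 1) * ?N"
      using N1 norm_ge_zero[of q] by (simp add: distrib_right)
    finally show "norm (F q) \<le> (norm a + C' + norm b + norm h + 1) * ?N" .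
  qed
  assume c: "c > 0"
  define C1 where "C1 = norm a / c + C * 2 ^ (s - 1)"
  define C2 where "C2 = norm b + norm h"
  define l where "l = 1 + 1 / c"
  have l: "l \<ge> 1" using c by (simp add: l_def)
  have C1: "C1 \<ge> 0" using c C by (simp add: C1_def)
  have C2: "C2 > 0" using b by (simp add: C2_def add_pos_nonneg)
  define R where "R = l * (1 + 2 * C1 / norm L + 2 * C2 / (c * norm L))"
  show "goes c True False F s"
  proof (rule goesI[of "norm L / (2 * l ^ s)" "norm L + C1 + C2" c True R])
    show "0 < norm L / (2 * l ^ s)" using L l by simp
    show "0 < norm L + C1 + C2" using L C1 C2 by linarith
    fix q :: C2 assume q: "q \<in> sector c True" "R \<le> norm q"
    define x y where "x = fst q" and "y = snd q"
    have xy: "norm x \<le> norm y / c" using q(1) c by (simp add: sector_def x_def y_def field_simps)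
    have nl: "norm q \<le> l * norm y"
      using norm_pair_bounds(3)[of q] xy by (simp add: x_def y_def l_def distrib_right)
    then have "l * (1 + 2 * C1 / norm L + 2 * C2 / (c * norm L)) \<le> l * norm y" using q(2) by (simp add: R_def)
    then have ybig: "1 + 2 * C1 / norm L + 2 * C2 / (c * norm L) \<le> norm y" using l by simp
    have nn: "0 \<le> 2 * C1 / norm L" "0 \<le> 2 * C2 / (c * norm L)" using C1 C2 c L by auto
    have y1: "1 \<le> norm y" using ybig nn by linarith
    have yC1: "2 * C1 \<le> norm L * norm y"
    proof -
      have "2 * C1 / norm L \<le> norm y" using ybig nn by linarith
      then show ?thesis using L by (simp add: field_simps)
    qed
    have yC2: "2 * C2 \<le> c * norm L * norm y"
    proof -
      have "2 * C2 / (c * norm L) \<le> norm y" using ybig nn by linarith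
      then show ?thesis using L c by (simp add: field_simps)
    qed
    define Y where "Y = norm y ^ (s - 1)"
    have Y: "norm y \<le> Y" "1 \<le> Y" "norm y ^ s = norm y * Y"
    proof -
      show "norm y \<le> Y" unfolding Y_def using s by (intro pm y1) auto
      then show "1 \<le> Y" using y1 by linarith
      have "norm y ^ s = norm y ^ Suc (s - 1)" using s by simp
      then show "norm y ^ s = norm y * Y" by (simp add: Y_def)
    qed
    have yq: "norm y \<le> norm q" unfolding y_def by (rule norm_pair_bounds)
    have dev: "norm (a * x + poly p y - L * y ^ s) \<le> C1 * Y"
    proof -
      have eq: "a * x + poly p y - L * y ^ s = a * x + poly ?r y" by (simp add: poly_monom)
      have "norm (a * x + poly p y - L * y ^ s) \<le> norm (a * x) + norm (poly ?r y)"
        unfolding eq by (rule norm_triangle_ineq)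
      moreover have "norm (a * x) \<le> norm a / c * Y"
      proof -
        have "norm (a * x) \<le> norm a * (norm y / c)" unfolding norm_mult using xy by (intro mult_left_mono) auto
        also have "\<dots> \<le> norm a * (Y / c)" using Y(1) c by (intro mult_left_mono divide_right_mono) auto
        finally show ?thesis by simp
      qed
      moreover have "norm (poly ?r y) \<le> C * 2 ^ (s - 1) * Y"
      proof -
        have "(1 + norm y) ^ (s - 1) \<le> (2 * norm y) ^ (s - 1)" using y1 by (intro power_mono) auto
        then have "C * (1 + norm y) ^ (s - 1) \<le> C * (2 ^ (s - 1) * Y)"
          unfolding Y_def power_mult_distrib [symmetric] using C(1) by (rule mult_left_mono)
        then show ?thesis using C(2)[of y] by (simp add: mult.assoc)
      qed
      ultimately show ?thesis by (simp add: C1_def distrib_right)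
    qed
    have nL: "norm (L * y ^ s) = norm L * norm y * Y" by (simp add: norm_mult norm_power Y(3))
    have half: "2 * (C1 * Y) \<le> norm L * norm y * Y"
      using mult_right_mono[OF yC1, of Y] Y(2) by simp
    have lower: "norm L * norm y * Y / 2 \<le> norm (a * x + poly p y)"
      using norm_triangle_ineq2[of "L * y ^ s" "L * y ^ s - (a * x + poly p y)"] dev half nL
      by (simp add: norm_minus_commute)
    have upper: "norm (a * x + poly p y) \<le> norm L * norm y * Y + C1 * Y"
      using norm_triangle_ineq[of "L * y ^ s" "a * x + poly p y - L * y ^ s"] dev nL by simp
    have snd_up: "norm (b * y + h) \<le> C2 * norm y"
    proof -
      have "norm (b * y + h) \<le> norm b * norm y + norm h"
        by (rule order_trans[OF norm_triangle_ineq]) (simp add: norm_mult)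
      also have "norm h \<le> norm h * norm y" using mult_left_mono[OF y1 norm_ge_zero[of h]] by simp
      finally show ?thesis by (simp add: C2_def distrib_right)
    qed
    have Fq: "F q = (a * x + poly p y, b * y + h)" by (simp add: F x_def y_def)
    have "C2 * norm y \<le> C2 * Y" using Y(1) C2 by simp
    moreover have "2 * (C2 * Y) \<le> c * (norm L * norm y * Y)"
      using mult_right_mono[OF yC2, of Y] Y(2) by (simp add: mult_ac)
    ultimately have "norm (b * y + h) \<le> c * (norm L * norm y * Y / 2)" using snd_up by simp
    also have "\<dots> \<le> c * norm (a * x + poly p y)" using lower c by (intro mult_left_mono) auto
    finally have sector: "F q \<in> sector c False" by (simp add: sector_def Fq)
    have "norm L / (2 * l ^ s) * norm q ^ s \<le> norm L / (2 * l ^ s) * (l * norm y) ^ s"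
      using nl l L by (intro mult_left_mono power_mono) auto
    also have "\<dots> = norm L * norm y * Y / 2" using l by (simp add: power_mult_distrib Y(3))
    also have "\<dots> \<le> norm (F q)"
      using lower norm_pair_bounds(1)[of "F q"] by (simp add: Fq)
    finally have lo: "norm L / (2 * l ^ s) * norm q ^ s \<le> norm (F q)" .
    have "norm (F q) \<le> norm (a * x + poly p y) + norm (b * y + h)"
      unfolding Fq by (rule norm_Pair_le)
    also have "\<dots> \<le> norm L * norm y * Y + C1 * Y + C2 * norm y" using upper snd_up by linarith
    also have "\<dots> \<le> norm L * (norm y * Y) + C1 * (norm y * Y) + C2 * (norm y * Y)"
    proof (intro add_mono)
      show "C1 * Y \<le> C1 * (norm y * Y)" using C1 y1 Y(2) by (intro mult_left_mono) auto
      have "norm y \<le> norm y * Y" using mult_left_mono[OF Y(2), of "norm y"] by simp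
      then show "C2 * norm y \<le> C2 * (norm y * Y)" using C2 by (intro mult_left_mono) auto
    qed simp
    also have "\<dots> = (norm L + C1 + C2) * norm y ^ s" by (simp add: Y(3) distrib_right)
    also have "\<dots> \<le> (norm L + C1 + C2) * norm q ^ s"
      using yq C1 C2 L by (intro mult_left_mono power_mono) auto
    finally show "F q \<in> sector c False \<and> norm L / (2 * l ^ s) * norm q ^ s \<le> norm (F q) \<and>
        norm (F q) \<le> (norm L + C1 + C2) * norm q ^ s" using sector lo by simp
  qed
qed

section \<open>Growth of reduced words\<close>

text \<open>An affine map that is not triangular moves the point at infinity of the first axis; for small \<open>c\<close>
  it therefore moves the whole sector around that axis into the complementary sector.\<close>
lemma goes_affine:
  assumes F: "F = (\<lambda>q. (a * fst q + b * snd q + e, g * fst q + d * snd q + h))" and g: "g \<noteq> 0"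
  shows "\<exists>c0>0. \<forall>c. 0 < c \<longrightarrow> c \<le> c0 \<longrightarrow> goes c False True F 1"
proof -
  define M where "M = norm a + norm b + norm e + norm d + norm h + norm g + 1"
  have M: "M \<ge> 1" "norm a + norm b + norm e \<le> M" "norm d \<le> M" "norm h \<le> M" "norm g + norm d + norm h \<le> M"
    by (simp_all add: M_def add_nonneg_nonneg)
  define c0 where "c0 = min 1 (norm g / (4 * M))"
  have c0: "c0 > 0" using g M(1) by (simp add: c0_def)
  have "goes c False True F 1" if c: "0 < c" "c \<le> c0" for c
  proof (rule goesI[of "norm g / 8" "2 * M" c False "max 2 (8 * M / norm g)"])
    show "0 < norm g / 8" "0 < 2 * M" using g M(1) by auto
    fix q :: C2 assume q: "q \<in> sector c False" "max 2 (8 * M / norm g) \<le> norm q"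
    define x y where "x = fst q" and "y = snd q"
    have c1: "c \<le> 1" "c * M \<le> norm g / 4"
      using c M(1) by (auto simp: c0_def field_simps)
    have xy: "norm y \<le> c * norm x" using q(1) by (simp add: sector_def x_def y_def)
    have xy1: "norm y \<le> norm x" using xy c1 c(1) mult_right_mono[OF c1(1), of "norm x"] by simp
    have nl: "norm q \<le> 2 * norm x" using norm_pair_bounds(3)[of q] xy1 by (simp add: x_def y_def)
    have xq: "norm x \<le> norm q" unfolding x_def by (rule norm_pair_bounds)
    have x1: "1 \<le> norm x" using q(2) nl by simp
    have xM: "4 * M \<le> norm g * norm x"
    proof -
      have "8 * M / norm g \<le> 2 * norm x" using q(2) nl by simp
      then show ?thesis using g by (simp add: field_simps)
    qed
    have Fq: "F q = (a * x + b * y + e, g * x + d * y + h)" by (simp add: F x_def y_def)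
    have ex: "norm e \<le> norm e * norm x" "norm h \<le> norm h * norm x"
      using mult_left_mono[OF x1, of "norm e"] mult_left_mono[OF x1, of "norm h"] by auto
    have by': "norm b * norm y \<le> norm b * norm x" "norm d * norm y \<le> norm d * norm x"
      using xy1 by (auto intro: mult_left_mono)
    have f1: "norm (a * x + b * y + e) \<le> M * norm x"
    proof -
      have "norm (a * x + b * y + e) \<le> norm a * norm x + norm b * norm y + norm e"
        by (intro order_trans[OF norm_triangle_ineq] add_mono) (auto simp: norm_mult norm_triangle_ineq intro: order_trans[OF norm_triangle_ineq])
      also have "\<dots> \<le> (norm a + norm b + norm e) * norm x" using ex(1) by'(1) unfolding distrib_right by linarith
      also have "\<dots> \<le> M * norm x" using M(2) by (intro mult_right_mono) auto
      finally show ?thesis .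
    qed
    have f2: "norm (g * x + d * y + h) \<le> M * norm x"
    proof -
      have "norm (g * x + d * y + h) \<le> norm g * norm x + norm d * norm y + norm h"
        by (intro order_trans[OF norm_triangle_ineq] add_mono) (auto simp: norm_mult norm_triangle_ineq intro: order_trans[OF norm_triangle_ineq])
      also have "\<dots> \<le> (norm g + norm d + norm h) * norm x" using ex(2) by'(2) unfolding distrib_right by linarith
      also have "\<dots> \<le> M * norm x" using M(5) by (intro mult_right_mono) auto
      finally show ?thesis .
    qed
    have f3: "norm g * norm x / 4 \<le> norm (g * x + d * y + h)"
    proof -
      have "norm (g * x) \<le> norm (g * x + d * y + h) + norm (d * y + h)"
        using norm_triangle_ineq4[of "g * x + d * y + h" "d * y + h"] by simp
      moreover have "norm (d * y + h) \<le> norm d * norm y + norm h"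
        by (rule order_trans[OF norm_triangle_ineq]) (simp add: norm_mult)
      moreover have "norm d * norm y \<le> norm g * norm x / 4"
      proof -
        have "norm d * norm y \<le> M * (c * norm x)" using M(1,3) xy by (intro mult_mono) auto
        also have "\<dots> = (c * M) * norm x" by simp
        also have "\<dots> \<le> norm g / 4 * norm x" using c1(2) by (intro mult_right_mono) auto
        finally show ?thesis by simp
      qed
      moreover have "norm h \<le> norm g * norm x / 4" using M(4) xM by simp
      moreover have "norm (g * x) = norm g * norm x" by (rule norm_mult)
      moreover have "0 \<le> norm g * norm x" by simp
      ultimately show ?thesis by linarith
    qed
    have "c * norm (a * x + b * y + e) \<le> c * (M * norm x)" using f1 c(1) by (intro mult_left_mono) auto
    also have "\<dots> = (c * M) * norm x" by simp
    also have "\<dots> \<le> norm g / 4 * norm x" using c1(2) by (intro mult_right_mono) auto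
    finally have sector: "F q \<in> sector c True" using f3 by (simp add: sector_def Fq)
    have "norm g / 8 * norm q \<le> norm g * norm x / 4" using mult_left_mono[OF nl, of "norm g / 8"] by simp
    also have "\<dots> \<le> norm (F q)" using f3 norm_pair_bounds(2)[of "F q"] by (simp add: Fq)
    finally have lo: "norm g / 8 * norm q \<le> norm (F q)" .
    have "norm (F q) \<le> norm (a * x + b * y + e) + norm (g * x + d * y + h)"
      unfolding Fq by (rule norm_Pair_le)
    also have "\<dots> \<le> 2 * M * norm x" using f1 f2 by simp
    also have "\<dots> \<le> 2 * M * norm q" using xq M(1) by (intro mult_left_mono) auto
    finally show "F q \<in> sector c True \<and> norm g / 8 * norm q ^ 1 \<le> norm (F q) \<and> norm (F q) \<le> 2 * M * norm q ^ 1"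
      using sector lo by simp
  qed
  then show ?thesis using c0 by blast
qed

lemma grows_affine:
  assumes F: "F = (\<lambda>q. (a * fst q + b * snd q + e, g * fst q + d * snd q + h))"
  shows "grows F 1"
  unfolding grows_def
proof (intro exI conjI allI)
  let ?C = "norm a + norm b + norm e + (norm g + norm d + norm h) + 1"
  show "?C > 0" by (smt (verit) norm_ge_zero)
  fix q :: C2
  have t: "norm (u * fst q + v * snd q + w) \<le> (norm u + norm v + norm w) * (1 + norm q)" for u v w
  proof -
    have "norm (u * fst q + v * snd q + w) \<le> norm u * norm (fst q) + norm v * norm (snd q) + norm w"
      by (intro order_trans[OF norm_triangle_ineq] add_mono) (auto simp: norm_mult norm_triangle_ineq intro: order_trans[OF norm_triangle_ineq])
    also have "\<dots> \<le> norm u * (1 + norm q) + norm v * (1 + norm q) + norm w * (1 + norm q)"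
    proof (intro add_mono mult_left_mono)
      show "norm w \<le> norm w * (1 + norm q)" by (simp add: distrib_left)
    qed (use norm_pair_bounds[of q] in \<open>auto intro: order_trans\<close>)
    finally show ?thesis by (simp add: distrib_right)
  qed
  have "norm (F q) \<le> norm (a * fst q + b * snd q + e) + norm (g * fst q + d * snd q + h)"
    unfolding F by (rule norm_Pair_le)
  also have "\<dots> \<le> (norm a + norm b + norm e) * (1 + norm q) + (norm g + norm d + norm h) * (1 + norm q)"
    by (rule add_mono[OF t t])
  also have "\<dots> \<le> ?C * (1 + norm q) ^ 1" unfolding distrib_right by simp
  finally show "norm (F q) \<le> ?C * (1 + norm q) ^ 1" .
qed

text \<open>The iterates of a triangular map have bounded degree.\<close>
lemma grows_triangular:
  assumes "F \<in> triangular_maps"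
  shows "\<exists>m\<ge>1. \<forall>n. grows (F ^^ n) m"
proof -
  obtain a b h p where ab: "a \<noteq> 0" "b \<noteq> 0" and F: "F = (\<lambda>q. (a * fst q + poly p (snd q), b * snd q + h))"
    using assms by (auto simp: triangular_maps_def)
  define m where "m = max 2 (degree p)"
  have g: "grows (\<lambda>q. (a * fst q + poly p (snd q), b * snd q + h)) m"
    if ab: "b \<noteq> 0" and d: "degree p \<le> m" for a b h :: complex and p
  proof -
    \<comment> \<open>Adding the monomial of degree m when it is missing makes the case of exact degree applicable.\<close>
    define p' where "p' = p + (if degree p = m then 0 else monom 1 m)"
    have d': "degree p' = m"
    proof (cases "degree p = m")
      case False
      then have "degree p < m" using d by simp
      then show ?thesis using False by (simp add: p'_def degree_add_eq_right degree_monom_eq)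
    qed (simp add: p'_def)
    have "grows (\<lambda>q. (a * fst q + poly p' (snd q), b * snd q + h)) m"
      by (rule goes_triangular(2)[OF refl ab d']) (simp add: m_def)
    then obtain C where C: "C > 0" "\<And>q. norm (a * fst q + poly p' (snd q), b * snd q + h) \<le> C * (1 + norm q) ^ m"
      by (auto simp: grows_def)
    have "norm (a * fst q + poly p (snd q), b * snd q + h) \<le> (C + 1) * (1 + norm q) ^ m" for q
    proof -
      have eq: "(a * fst q + poly p (snd q), b * snd q + h) =
          (a * fst q + poly p' (snd q), b * snd q + h) - (if degree p = m then 0 else snd q ^ m, 0)"
        by (simp add: p'_def poly_monom)
      have "norm (if degree p = m then 0 else snd q ^ m, 0::complex) \<le> (1 + norm q) ^ m"
      proof (cases "degree p = m")
        case False
        have "norm (snd q) ^ m \<le> (1 + norm q) ^ m"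
          using norm_pair_bounds(2)[of q] by (intro power_mono) auto
        then show ?thesis using False by (simp add: norm_power)
      qed (simp add: norm_Pair)
      then show ?thesis unfolding eq distrib_right
        using norm_triangle_ineq4[of "(a * fst q + poly p' (snd q), b * snd q + h)" "(if degree p = m then 0 else snd q ^ m, 0)"] C(2)[of q]
        by linarith
    qed
    moreover have "C + 1 > 0" using C by simp
    ultimately show ?thesis unfolding grows_def by blast
  qed
  have shape: "\<exists>a b h p. b \<noteq> 0 \<and> degree p \<le> m \<and> F ^^ n = (\<lambda>q. (a * fst q + poly p (snd q), b * snd q + h))" for n
  proof (induction n)
    case 0
    show ?case by (rule exI[of _ 1], rule exI[of _ 1], rule exI[of _ 0], rule exI[of _ 0]) (auto simp: fun_eq_iff)
  next
    case (Suc n)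
    then obtain a' b' h' p' where b': "b' \<noteq> 0" "degree p' \<le> m"
      and Fn: "F ^^ n = (\<lambda>q. (a' * fst q + poly p' (snd q), b' * snd q + h'))" by (elim exE conjE)
    have "degree (smult a p' + pcompose p [:h', b':]) \<le> m"
    proof (rule degree_add_le)
      show "degree (smult a p') \<le> m" using b'(2) by (rule order_trans[OF degree_smult_le])
      show "degree (pcompose p [:h', b':]) \<le> m" using b'(1) by (simp add: degree_pcompose m_def)
    qed
    moreover have "F ^^ Suc n = (\<lambda>q. ((a * a') * fst q + poly (smult a p' + pcompose p [:h', b':]) (snd q),
        (b * b') * snd q + (b * h' + h)))"
      by (simp add: Fn fun_eq_iff poly_pcompose algebra_simps) (simp add: F poly_pcompose algebra_simps)
    moreover have "b * b' \<noteq> 0" using ab b' by simp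
    ultimately show ?case by (intro exI conjI) assumption+
  qed
  have "grows (F ^^ n) m" for n
    using shape[of n] g by (elim exE conjE) simp
  moreover have "m \<ge> 1" by (simp add: m_def)
  ultimately show ?thesis by blast
qed

text \<open>The behaviour of a word with first letter of kind \<open>b\<close> and last letter of kind \<open>b'\<close>: a triangular letter
  maps the sector \<open>True\<close> to the sector \<open>False\<close>, and an affine letter maps \<open>False\<close> to \<open>True\<close>. The last letter acts
  first, so the word starts in the sector \<open>b'\<close> and ends in the sector \<open>\<not> b\<close>, and its inverse is controlled
  from \<open>b\<close> to \<open>\<not> b'\<close>. The number \<open>s\<close> is the exponent of growth of both maps.\<close>
definition letter_data :: "bool \<Rightarrow> bool \<Rightarrow> (C2 \<Rightarrow> C2) \<Rightarrow> nat \<Rightarrow> bool" where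
  "letter_data b b' F s \<longleftrightarrow> s \<ge> 1 \<and> grows F s \<and> grows (inv F) s \<and>
     (\<exists>c0>0. \<forall>c. 0 < c \<longrightarrow> c \<le> c0 \<longrightarrow> goes c b' (\<not> b) F s \<and> goes c b (\<not> b') (inv F) s)"

lemma letter_data_letter:
  assumes l: "l \<in> letters b"
  shows "\<exists>s. letter_data b b l s \<and> (b \<longrightarrow> s \<ge> 2)"
proof (cases b)
  case True
  then have lt: "l \<in> triangular_maps" "l \<notin> affine_maps" using l by (auto simp: letters_def grp_def)
  obtain a b' h p where ab: "a \<noteq> 0" "b' \<noteq> 0" and F: "l = (\<lambda>q. (a * fst q + poly p (snd q), b' * snd q + h))"
    using lt(1) by (auto simp: triangular_maps_def)
  have d: "degree p \<ge> 2"
  proof (rule ccontr)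
    assume "\<not> ?thesis"
    then have "degree p \<le> 1" by simp
    then have "poly p y = coeff p 0 + coeff p 1 * y" for y by (simp add: poly_as_sum[of p 1])
    then have "l = (\<lambda>q. (a * fst q + coeff p 1 * snd q + coeff p 0, 0 * fst q + b' * snd q + h))"
      by (auto simp: F fun_eq_iff)
    moreover have "a * b' - coeff p 1 * 0 \<noteq> 0" using ab by simp
    ultimately have "l \<in> affine_maps" unfolding affine_maps_def mem_Collect_eq by (intro exI conjI) assumption+
    then show False using lt by simp
  qed
  define r where "r = smult (- inverse a) (pcompose p [:- h / b', inverse b':])"
  define G where "G = (\<lambda>q::C2. (inverse a * fst q + poly r (snd q), inverse b' * snd q + (- h / b')))"
  have FG: "l \<circ> G = id" and GF: "G \<circ> l = id"
    using ab by (auto simp: F G_def r_def fun_eq_iff poly_pcompose field_simps)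
  have iG: "inv l = G" by (rule inv_unique_comp[OF FG GF])
  have dr: "degree r = degree p" using ab by (simp add: r_def degree_pcompose)
  have ib: "inverse b' \<noteq> 0" using ab by simp
  have "letter_data True True l (degree p)"
    unfolding letter_data_def iG
    using goes_triangular[OF F ab(2) refl d] goes_triangular[OF G_def ib dr d] d
    by (auto intro!: exI[of _ "1::real"])
  then show ?thesis using True d by auto
next
  case False
  then have lt: "l \<in> affine_maps" "l \<notin> triangular_maps" using l by (auto simp: letters_def grp_def)
  have shape: "\<exists>a b e g d h. g \<noteq> 0 \<and> F = (\<lambda>q. (a * fst q + b * snd q + e, g * fst q + d * snd q + h))"
    if FA: "F \<in> affine_maps" "F \<notin> triangular_maps" for F
  proof -
    obtain a b g d e h where D: "a * d - b * g \<noteq> 0"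
      and F: "F = (\<lambda>q. (a * fst q + b * snd q + e, g * fst q + d * snd q + h))"
      using FA(1) unfolding affine_maps_def mem_Collect_eq by (elim exE conjE)
    have "g \<noteq> 0"
    proof
      assume g: "g = 0"
      have "F = (\<lambda>q. (a * fst q + poly [:e, b:] (snd q), d * snd q + h))" by (auto simp: F g fun_eq_iff)
      moreover have "a \<noteq> 0" "d \<noteq> 0" using D g by auto
      ultimately have "F \<in> triangular_maps" unfolding triangular_maps_def mem_Collect_eq by (intro exI conjI) assumption+
      then show False using FA by simp
    qed
    then show ?thesis using F by (intro exI conjI) assumption+
  qed
  have il: "inv l \<in> affine_maps" "inv l \<notin> triangular_maps"
  proof -
    show "inv l \<in> affine_maps" using affine_maps_inverse[OF lt(1)] by simp
    show "inv l \<notin> triangular_maps"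
    proof
      assume "inv l \<in> triangular_maps"
      then have "inv (inv l) \<in> triangular_maps" by (rule triangular_maps_inverse)
      then show False using lt affine_maps_inverse(1)[OF lt(1)] by (simp add: inv_inv_eq)
    qed
  qed
  have 1: "grows l 1 \<and> (\<exists>c0>0. \<forall>c. 0 < c \<longrightarrow> c \<le> c0 \<longrightarrow> goes c False True l 1)"
    using shape[OF lt] goes_affine grows_affine by (elim exE conjE) simp
  have 2: "grows (inv l) 1 \<and> (\<exists>c0>0. \<forall>c. 0 < c \<longrightarrow> c \<le> c0 \<longrightarrow> goes c False True (inv l) 1)"
    using shape[OF il] goes_affine grows_affine by (elim exE conjE) simp
  obtain c0 c1 where c: "c0 > 0" "\<And>c. 0 < c \<Longrightarrow> c \<le> c0 \<Longrightarrow> goes c False True l 1"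
     "c1 > 0" "\<And>c. 0 < c \<Longrightarrow> c \<le> c1 \<Longrightarrow> goes c False True (inv l) 1" using 1 2 by auto
  have "letter_data False False l 1"
    unfolding letter_data_def using 1 2 c by (auto intro!: exI[of _ "min c0 c1"])
  then show ?thesis using False by auto
qed

lemma letter_data_comp:
  assumes l: "letter_data b b l s" and G: "letter_data (\<not> b) b' G t" and bij: "bij l" "bij G"
  shows "letter_data b b' (l \<circ> G) (s * t)"
proof -
  obtain c0 where c0: "c0 > 0" "\<And>c. 0 < c \<Longrightarrow> c \<le> c0 \<Longrightarrow> goes c b (\<not> b) l s"
     "\<And>c. 0 < c \<Longrightarrow> c \<le> c0 \<Longrightarrow> goes c b (\<not> b) (inv l) s" using l by (auto simp: letter_data_def)
  obtain c1 where c1: "c1 > 0" "\<And>c. 0 < c \<Longrightarrow> c \<le> c1 \<Longrightarrow> goes c b' b G t"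
     "\<And>c. 0 < c \<Longrightarrow> c \<le> c1 \<Longrightarrow> goes c (\<not> b) (\<not> b') (inv G) t" using G by (auto simp: letter_data_def)
  have st: "s \<ge> 1" "t \<ge> 1" and gr: "grows l s" "grows (inv l) s" "grows G t" "grows (inv G) t"
    using l G by (auto simp: letter_data_def)
  have i: "inv (l \<circ> G) = inv G \<circ> inv l" by (rule o_inv_distrib[OF bij])
  have "goes c b' (\<not> b) (l \<circ> G) (s * t) \<and> goes c b (\<not> b') (inv (l \<circ> G)) (s * t)"
    if "0 < c" "c \<le> min c0 c1" for c
    using goes_comp[OF c1(2) c0(2) st(2), of c] goes_comp[OF c0(3) c1(3) st(1), of c] that
    by (simp add: i mult.commute)
  moreover have "grows (l \<circ> G) (s * t)" "grows (inv (l \<circ> G)) (s * t)"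
    using grows_comp[OF gr(3,1)] grows_comp[OF gr(2,4)] by (simp_all add: i mult.commute)
  moreover have "min c0 c1 > 0" using c0 c1 by simp
  moreover have "s * t \<ge> 1" using st by simp
  ultimately show ?thesis unfolding letter_data_def by blast
qed

lemma letter_data_reduced:
  assumes "reduced_word b b' ls"
  shows "\<exists>s. letter_data b b' (compose_list ls) s \<and> (b \<or> b' \<longrightarrow> s \<ge> 2)"
  using assms
proof (induction rule: reduced_word.induct)
  case (single l b)
  then show ?case using letter_data_letter[OF single] by auto
next
  case (cons l b b' ls)
  obtain s where s: "letter_data b b l s" "b \<longrightarrow> s \<ge> 2" using letter_data_letter[OF cons(1)] by blast
  obtain t where t: "letter_data (\<not> b) b' (compose_list ls) t" "\<not> b \<or> b' \<longrightarrow> t \<ge> 2" using cons.IH by blast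
  have "bij l" using cons(1) by (auto simp: letters_def intro: grp_bij)
  then have "letter_data b b' (compose_list (l # ls)) (s * t)"
    using letter_data_comp[OF s(1) t(1) _ reduced_bij[OF cons(2)]] by simp
  moreover have "s * t \<ge> 2" 
  proof -
    have "s \<ge> 1" "t \<ge> 1" using s t by (auto simp: letter_data_def)
    then show ?thesis using s(2) t(2) mult_le_mono[of 2 s 1 t] mult_le_mono[of 1 s 2 t] by (cases b) auto
  qed
  ultimately show ?case by blast
qed

section \<open>Escape to infinity and the Green function\<close>

text \<open>The map \<open>f\<close> is conjugate by \<open>w\<close> to a map \<open>g\<close> of degree \<open>D\<close> that sends a sector at infinity to itself, while
  the inverse of \<open>g\<close> does this with the complementary sector. The last condition controls the
  conjugation on the sector, after finitely many iterates have removed all cancellations.\<close>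
definition normal_form :: "(C2 \<Rightarrow> C2) \<Rightarrow> (C2 \<Rightarrow> C2) \<Rightarrow> (C2 \<Rightarrow> C2) \<Rightarrow> bool \<Rightarrow> real \<Rightarrow> nat \<Rightarrow> bool" where
  "normal_form f w g b c D \<longleftrightarrow> bij w \<and> bij g \<and> continuous_on UNIV w \<and> continuous_on UNIV (inv w) \<and>
     continuous_on UNIV g \<and> continuous_on UNIV (inv g) \<and> f = w \<circ> g \<circ> inv w \<and> D \<ge> 2 \<and>
     goes c b b g D \<and> goes c (\<not> b) (\<not> b) (inv g) D \<and>
     (\<exists>k N b'. N \<ge> 1 \<and> goes c b b' (w \<circ> (g ^^ k)) N)"

text \<open>Orbits that start far out in the invariant sector go to infinity, and the quantities that define
  the Green function converge along them.\<close>
lemma escape_sector: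
  assumes g: "goes c b b g D" and D: "D \<ge> 2"
  obtains R K where "R \<ge> 1" "K \<ge> 0"
    "\<And>q n. q \<in> sector c b \<Longrightarrow> R \<le> norm q \<Longrightarrow>
       (g ^^ n) q \<in> sector c b \<and> ln (norm q) + real n \<le> ln (norm ((g ^^ n) q)) \<and> norm q \<le> norm ((g ^^ n) q)"
    "\<And>q. q \<in> sector c b \<Longrightarrow> R \<le> norm q \<Longrightarrow>
       \<exists>L. (\<lambda>n. ln (norm ((g ^^ n) q)) / real D ^ n) \<longlonglongrightarrow> L \<and> ln (norm q) - K \<le> L"
proof -
  obtain R0 K where R0: "R0 \<ge> 1" "K \<ge> 0" "\<And>q. q \<in> sector c b \<Longrightarrow> R0 \<le> norm q \<Longrightarrow> g q \<in> sector c b"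
    "\<And>q. q \<in> sector c b \<Longrightarrow> R0 \<le> norm q \<Longrightarrow> \<bar>ln (norm (g q)) - real D * ln (norm q)\<bar> \<le> K"
    by (rule goesD[OF g]) (rule that)
  define R where "R = max R0 (exp (K + 1))"
  have R1: "R \<ge> 1" "R0 \<le> R" "exp (K + 1) \<le> R" using R0 by (auto simp: R_def)
  have step: "g q \<in> sector c b \<and> ln (norm q) + 1 \<le> ln (norm (g q)) \<and> norm q \<le> norm (g q)"
    if q: "q \<in> sector c b" "R \<le> norm q" for q
  proof -
    have n: "norm q > 0" using q R1 by linarith
    have "K + 1 \<le> ln (norm q)"
      using q(2) R1(3) n by (subst ln_ge_iff) auto
    moreover have "2 * ln (norm q) \<le> real D * ln (norm q)"
      using D q(2) R1(1) by (intro mult_right_mono) auto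
    moreover have "\<bar>ln (norm (g q)) - real D * ln (norm q)\<bar> \<le> K"
      using R0(4)[OF q(1)] q(2) R1 by linarith
    ultimately have l: "ln (norm q) + 1 \<le> ln (norm (g q))" by linarith
    have "norm (g q) > 0"
    proof (rule ccontr)
      assume "\<not> ?thesis"
      then have "ln (norm (g q)) = 0" by simp
      then show False using l q(2) R1(1) \<open>K + 1 \<le> ln (norm q)\<close> R0(2) by linarith
    qed
    moreover have "ln (norm q) \<le> ln (norm (g q))" using l by linarith
    ultimately have "norm q \<le> norm (g q)" using n by (subst (asm) ln_le_cancel_iff) auto
    moreover have "g q \<in> sector c b" using R0(3)[OF q(1)] q(2) R1 by linarith
    ultimately show ?thesis using l by simp
  qed
  have iter: "(g ^^ n) q \<in> sector c b \<and> ln (norm q) + real n \<le> ln (norm ((g ^^ n) q)) \<and> norm q \<le> norm ((g ^^ n) q)"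
    if q: "q \<in> sector c b" "R \<le> norm q" for q n
  proof (induction n)
    case (Suc n)
    then have "R \<le> norm ((g ^^ n) q)" using q by linarith
    then show ?case using step[of "(g ^^ n) q"] Suc by auto
  qed (use q in auto)
  have lim: "\<exists>L. (\<lambda>n. ln (norm ((g ^^ n) q)) / real D ^ n) \<longlonglongrightarrow> L \<and> ln (norm q) - K \<le> L"
    if q: "q \<in> sector c b" "R \<le> norm q" for q
  proof -
    define a where "a n = ln (norm ((g ^^ n) q)) / real D ^ n" for n
    define e where "e n = a (Suc n) - a n" for n
    \<comment> \<open>Successive terms differ by at most K / D ^ (n + 1), so the limit is within K of the first term.\<close>
    have eb: "\<bar>e n\<bar> \<le> K * (1 / 2) ^ Suc n" for n
    proof -
      have z: "(g ^^ n) q \<in> sector c b" "R0 \<le> norm ((g ^^ n) q)" using iter[OF q, of n] q(2) R1 by auto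
      have Dp: "real D ^ Suc n > 0" using D by simp
      have "e n = (ln (norm (g ((g ^^ n) q))) - real D * ln (norm ((g ^^ n) q))) / real D ^ Suc n"
        using D by (simp add: e_def a_def field_simps)
      then have "\<bar>e n\<bar> \<le> K / real D ^ Suc n"
        using R0(4)[OF z] Dp by (simp add: divide_right_mono)
      also have "\<dots> \<le> K / 2 ^ Suc n"
        using R0(2) D by (intro divide_left_mono power_mono) auto
      finally show ?thesis by (simp add: power_divide)
    qed
    have geo: "(\<lambda>n. K * (1 / 2) ^ Suc n) sums K"
      using sums_mult[OF power_half_series, of K] by simp
    have se: "summable (\<lambda>n. \<bar>e n\<bar>)"
      by (rule summable_comparison_test[OF _ sums_summable[OF geo]]) (use eb in auto)
    have "(\<Sum>i<n. e i) = a n - a 0" for n unfolding e_def by (rule sum_lessThan_telescope)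
    then have an: "a n = a 0 + (\<Sum>i<n. e i)" for n by simp
    have sm: "summable e" using se by (rule summable_rabs_cancel)
    have "(\<lambda>n. a 0 + (\<Sum>i<n. e i)) \<longlonglongrightarrow> a 0 + suminf e"
      by (intro tendsto_add tendsto_const summable_LIMSEQ sm)
    then have "a \<longlonglongrightarrow> a 0 + suminf e" by (simp only: an [symmetric])
    moreover have "\<bar>suminf e\<bar> \<le> K"
    proof -
      have "\<bar>suminf e\<bar> \<le> (\<Sum>n. \<bar>e n\<bar>)" by (rule summable_rabs[OF se])
      also have "\<dots> \<le> (\<Sum>n. K * (1 / 2) ^ Suc n)"
        by (rule suminf_le[OF _ se sums_summable[OF geo]]) (rule eb)
      also have "\<dots> = K" using geo by (rule sums_unique [symmetric])
      finally show ?thesis .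
    qed
    moreover have "a 0 = ln (norm q)" by (simp add: a_def)
    ultimately show ?thesis unfolding a_def by (intro exI[of _ "a 0 + suminf e"]) (simp add: a_def)
  qed
  show thesis by (rule that[OF R1(1) R0(2) iter lim])
qed

lemma conj_funpow:
  fixes w g :: "'a \<Rightarrow> 'a"
  assumes "bij w" shows "(w \<circ> g \<circ> inv w) ^^ n = w \<circ> (g ^^ n) \<circ> inv w"
proof (induction n)
  case 0 show ?case using assms by (auto simp: fun_eq_iff bij_is_surj surj_f_inv_f)
next
  case (Suc n)
  show ?case using Suc assms by (auto simp: fun_eq_iff bij_is_inj)
qed

lemma funpow_inv_cancel:
  fixes g :: "'a \<Rightarrow> 'a"
  assumes "bij g" shows "(g ^^ n) ((inv g ^^ n) q) = q"
proof (induction n arbitrary: q)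
  case (Suc n)
  have "(g ^^ Suc n) ((inv g ^^ Suc n) q) = g ((g ^^ n) ((inv g ^^ n) (inv g q)))"
    by (simp add: funpow_swap1)
  then show ?case using Suc assms by (simp add: bij_is_surj surj_f_inv_f)
qed simp

lemma continuous_image_bounded:
  fixes w :: "C2 \<Rightarrow> C2"
  assumes "continuous_on UNIV w" "bounded A" shows "bounded (w ` A)"
proof -
  have "compact (w ` closure A)"
    by (rule compact_continuous_image) (use assms in \<open>auto intro: continuous_on_subset\<close>)
  then show ?thesis by (rule bounded_subset[OF compact_imp_bounded]) (use closure_subset in blast)
qed

text \<open>A point with bounded backward orbit can be far out only in the sector that \<open>g\<close> maps into itself, so
  its forward orbit is bounded or governed by \<open>escape_sector\<close>. Moreover the set of these points is
  closed, so that it contains its frontier \<open>Jplus (inv f)\<close>.\<close>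
theorem green_facts:
  assumes nf: "normal_form f w g b c D"
  shows "Jplus (inv f) \<subseteq> Kplus (inv f)"
    and "p \<in> Kplus (inv f) \<Longrightarrow> convergent (\<lambda>n. max 0 (ln (norm ((f ^^ n) p))) / real D ^ n)"
    and "bounded {p \<in> Kplus (inv f). green (real D) f p \<le> C}"
proof -
  have bw: "bij w" and bg: "bij g" and cw: "continuous_on UNIV w" and ciw: "continuous_on UNIV (inv w)"
    and cig: "continuous_on UNIV (inv g)" and f: "f = w \<circ> g \<circ> inv w" and D: "D \<ge> 2"
    and gg: "goes c b b g D" and gi: "goes c (\<not> b) (\<not> b) (inv g) D"
    using nf by (simp_all add: normal_form_def)
  obtain k N b' where N: "N \<ge> 1" and gr: "goes c b b' (w \<circ> (g ^^ k)) N"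
    using nf by (auto simp: normal_form_def)
  obtain R1 K1 where R1: "R1 \<ge> 1" "K1 \<ge> 0"
    "\<And>q n. q \<in> sector c b \<Longrightarrow> R1 \<le> norm q \<Longrightarrow>
       (g ^^ n) q \<in> sector c b \<and> ln (norm q) + real n \<le> ln (norm ((g ^^ n) q)) \<and> norm q \<le> norm ((g ^^ n) q)"
    "\<And>q. q \<in> sector c b \<Longrightarrow> R1 \<le> norm q \<Longrightarrow>
       \<exists>L. (\<lambda>n. ln (norm ((g ^^ n) q)) / real D ^ n) \<longlonglongrightarrow> L \<and> ln (norm q) - K1 \<le> L"
    by (rule escape_sector[OF gg D]) (rule that)
  obtain R2 K2 where R2: "R2 \<ge> 1" "K2 \<ge> 0"
    "\<And>q n. q \<in> sector c (\<not> b) \<Longrightarrow> R2 \<le> norm q \<Longrightarrow>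
       (inv g ^^ n) q \<in> sector c (\<not> b) \<and> ln (norm q) + real n \<le> ln (norm ((inv g ^^ n) q)) \<and> norm q \<le> norm ((inv g ^^ n) q)"
    "\<And>q. q \<in> sector c (\<not> b) \<Longrightarrow> R2 \<le> norm q \<Longrightarrow>
       \<exists>L. (\<lambda>n. ln (norm ((inv g ^^ n) q)) / real D ^ n) \<longlonglongrightarrow> L \<and> ln (norm q) - K2 \<le> L"
    by (rule escape_sector[OF gi D]) (rule that)
  obtain R3 K3 where R3: "R3 \<ge> 1" "K3 \<ge> 0"
    "\<And>q. q \<in> sector c b \<Longrightarrow> R3 \<le> norm q \<Longrightarrow> (w \<circ> (g ^^ k)) q \<in> sector c b'"
    "\<And>q. q \<in> sector c b \<Longrightarrow> R3 \<le> norm q \<Longrightarrow> \<bar>ln (norm ((w \<circ> (g ^^ k)) q)) - real N * ln (norm q)\<bar> \<le> K3"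
    by (rule goesD[OF gr]) (rule that)
  define R where "R = max R1 R2"
  have R: "R1 \<le> R" "R2 \<le> R" by (auto simp: R_def)
  \<comment> \<open>A backward orbit is unbounded as soon as it moves further out than max R (norm q), an open condition.\<close>
  define E where "E = {q. \<exists>n. max R (norm q) < norm ((inv g ^^ n) q)}"
  have if': "inv f = w \<circ> inv g \<circ> inv w"
    using bw bg by (simp add: f o_inv_distrib bij_comp bij_imp_bij_inv inv_inv_eq comp_assoc)
  have ifn: "(inv f ^^ n) p = w ((inv g ^^ n) (inv w p))" for n p
    by (simp add: if' conj_funpow[OF bw])
  have fn: "(f ^^ n) p = w ((g ^^ n) (inv w p))" for n p
    by (simp add: f conj_funpow[OF bw])
  have bdd: "bounded (range (\<lambda>n. (inv f ^^ n) p)) \<longleftrightarrow> bounded (range (\<lambda>n. (inv g ^^ n) (inv w p)))" for p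
  proof
    assume "bounded (range (\<lambda>n. (inv f ^^ n) p))"
    then have "bounded (inv w ` range (\<lambda>n. (inv f ^^ n) p))" by (rule continuous_image_bounded[OF ciw])
    then show "bounded (range (\<lambda>n. (inv g ^^ n) (inv w p)))"
      using bw by (simp add: image_image ifn bij_is_inj)
  next
    assume "bounded (range (\<lambda>n. (inv g ^^ n) (inv w p)))"
    then have "bounded (w ` range (\<lambda>n. (inv g ^^ n) (inv w p)))" by (rule continuous_image_bounded[OF cw])
    then show "bounded (range (\<lambda>n. (inv f ^^ n) p))" by (simp add: image_image ifn)
  qed
  have unb: "\<not> bounded (range (\<lambda>n. (inv g ^^ n) q))"
    if z: "(inv g ^^ m) q \<in> sector c (\<not> b)" "R2 \<le> norm ((inv g ^^ m) q)" for m q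
  proof
    assume "bounded (range (\<lambda>n. (inv g ^^ n) q))"
    then obtain B where B: "\<And>n. norm ((inv g ^^ n) q) \<le> B" by (auto simp: bounded_iff)
    obtain n where n: "ln (max 1 B) < real n" using reals_Archimedean2 by blast
    have "(inv g ^^ n) ((inv g ^^ m) q) = (inv g ^^ (n + m)) q" by (simp add: funpow_add)
    then have "ln (norm ((inv g ^^ m) q)) + real n \<le> ln (norm ((inv g ^^ (n + m)) q))"
      "norm ((inv g ^^ m) q) \<le> norm ((inv g ^^ (n + m)) q)"
      using R2(3)[OF z, of n] by auto
    moreover have "0 \<le> ln (norm ((inv g ^^ m) q))" using z(2) R2(1) by simp
    moreover have "ln (norm ((inv g ^^ (n + m)) q)) \<le> ln (max 1 B)"
      using B[of "n + m"] calculation(2) z(2) R2(1) by (subst ln_le_cancel_iff) auto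
    ultimately show False using n by linarith
  qed
  \<comment> \<open>At such a moment the orbit is in the sector of inv g: in the sector of g, applying g ^^ n would not decrease the norm.\<close>
  have KE: "Kplus (inv f) = - (inv w -` E)"
  proof -
    have "\<not> bounded (range (\<lambda>n. (inv g ^^ n) q)) \<longleftrightarrow> q \<in> E" for q
    proof
      assume "\<not> bounded (range (\<lambda>n. (inv g ^^ n) q))"
      then have "\<not> (\<forall>n. norm ((inv g ^^ n) q) \<le> max R (norm q))" by (auto simp: bounded_iff)
      then show "q \<in> E" by (auto simp: E_def not_le)
    next
      assume "q \<in> E"
      then obtain n where n: "max R (norm q) < norm ((inv g ^^ n) q)" by (auto simp: E_def)
      have "(inv g ^^ n) q \<notin> sector c b"
      proof
        assume "(inv g ^^ n) q \<in> sector c b"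
        then have "norm ((inv g ^^ n) q) \<le> norm ((g ^^ n) ((inv g ^^ n) q))"
          using R1(3)[of "(inv g ^^ n) q" n] n R by auto
        then show False using n by (simp add: funpow_inv_cancel[OF bg])
      qed
      then have "(inv g ^^ n) q \<in> sector c (\<not> b)" using sector_or by blast
      then show "\<not> bounded (range (\<lambda>n. (inv g ^^ n) q))" using n R by (intro unb) auto
    qed
    then have "p \<in> Kplus (inv f) \<longleftrightarrow> p \<in> - (inv w -` E)" for p
      unfolding Kplus_def mem_Collect_eq bdd Compl_iff vimage_eq by blast
    then show ?thesis by blast
  qed
  have cign: "continuous_on UNIV (inv g ^^ n)" for n
  proof (induction n)
    case 0 show ?case by (simp add: id_def)
  next
    case (Suc n)
    have "continuous_on UNIV (inv g \<circ> (inv g ^^ n))"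
      by (rule continuous_on_compose[OF Suc]) (rule continuous_on_subset[OF cig], simp)
    then show ?case by (simp add: o_def)
  qed
  have "open E"
  proof -
    have "E = (\<Union>n. {q. max R (norm q) < norm ((inv g ^^ n) q)})" by (auto simp: E_def)
    moreover have "open {q. max R (norm q) < norm ((inv g ^^ n) q)}" for n
      by (intro open_Collect_less continuous_intros cign)
    ultimately show ?thesis by auto
  qed
  then have "open (inv w -` E)" using ciw by (simp add: continuous_on_open_vimage)
  then have "closed (Kplus (inv f))" by (simp add: KE closed_Compl)
  then show "Jplus (inv f) \<subseteq> Kplus (inv f)"
    unfolding Jplus_def by (simp add: frontier_subset_closed)
  have Kg: "(g ^^ n) q \<in> sector c b \<or> norm ((g ^^ n) q) < R2"
    if "w q \<in> Kplus (inv f)" for q n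
  proof (rule ccontr)
    assume neg: "\<not> ?thesis"
    let ?z = "(g ^^ n) q"
    have bz: "bounded (range (\<lambda>n. (inv g ^^ n) q))"
      using that bw by (simp add: Kplus_def bdd bij_is_inj)
    have "?z \<in> sector c (\<not> b)" "R2 \<le> norm ?z" using neg sector_or[of ?z c b] by auto
    then have "\<not> bounded (range (\<lambda>m. (inv g ^^ m) ?z))" using unb[of 0 ?z] by simp
    moreover have "bounded (range (\<lambda>m. (inv g ^^ m) ?z))"
    proof (rule bounded_subset)
      have "inj g" using bg by (rule bij_is_inj)
      have canc: "(inv g ^^ i) ((g ^^ i) y) = y" for i y
      proof (induction i arbitrary: y)
        case (Suc i)
        have "(inv g ^^ Suc i) ((g ^^ Suc i) y) = inv g ((inv g ^^ i) ((g ^^ i) (g y)))"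
          by (simp add: funpow_swap1)
        then show ?case using Suc \<open>inj g\<close> by simp
      qed simp
      show "bounded (range (\<lambda>m. (inv g ^^ m) q) \<union> (\<lambda>m. (inv g ^^ m) ?z) ` {..n})"
        using bz by (simp add: bounded_Un finite_imp_bounded)
      show "range (\<lambda>m. (inv g ^^ m) ?z) \<subseteq> range (\<lambda>m. (inv g ^^ m) q) \<union> (\<lambda>m. (inv g ^^ m) ?z) ` {..n}"
      proof
        fix y assume "y \<in> range (\<lambda>m. (inv g ^^ m) ?z)"
        then obtain m where y: "y = (inv g ^^ m) ?z" by blast
        show "y \<in> range (\<lambda>m. (inv g ^^ m) q) \<union> (\<lambda>m. (inv g ^^ m) ?z) ` {..n}"
        proof (cases "m \<le> n")
          case False
          then have "(inv g ^^ m) ?z = (inv g ^^ (m - n)) ((inv g ^^ n) ?z)"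
            using fun_cong[OF funpow_add[of "m - n" n "inv g"], of ?z] by simp
          then show ?thesis by (simp add: y canc)
        qed (auto simp: y)
      qed
    qed
    ultimately show False by simp
  qed
  \<comment> \<open>Once g ^^ n0 has entered the sector, w \<circ> (g ^^ k) distorts logarithms of norms by a factor N up to a bounded error.\<close>
  have lim: "\<exists>L. (\<lambda>n. max 0 (ln (norm ((f ^^ n) p))) / real D ^ n) \<longlonglongrightarrow> L \<and>
      real N / real D ^ (k + n0) * (ln (norm ((g ^^ n0) (inv w p))) - K1) \<le> L"
    if z: "(g ^^ n0) (inv w p) \<in> sector c b" "R1 \<le> norm ((g ^^ n0) (inv w p))" for p n0
  proof -
    let ?z = "(g ^^ n0) (inv w p)"
    obtain L where L: "(\<lambda>n. ln (norm ((g ^^ n) ?z)) / real D ^ n) \<longlonglongrightarrow> L" "ln (norm ?z) - K1 \<le> L"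
      using R1(4)[OF z] by blast
    have Dp: "real D > 0" using D by simp
    have fm: "(f ^^ (m + (k + n0))) p = (w \<circ> (g ^^ k)) ((g ^^ m) ?z)" for m
    proof -
      have "(g ^^ (m + (k + n0))) (inv w p) = (g ^^ k) ((g ^^ m) ?z)"
      proof -
        have "m + (k + n0) = k + (m + n0)" by simp
        then show ?thesis by (simp only: funpow_add o_apply)
      qed
      then show ?thesis by (simp add: fn)
    qed
    have ev: "eventually (\<lambda>m. norm (ln (norm ((f ^^ (m + (k + n0))) p)) / real D ^ m
                 - real N * (ln (norm ((g ^^ m) ?z)) / real D ^ m)) \<le> K3 * (inverse (real D)) ^ m) sequentially"
    proof -
      have "eventually (\<lambda>m. ln R3 \<le> real m) sequentially"
        using eventually_ge_at_top[of "nat \<lceil>ln R3\<rceil>"] by eventually_elim linarith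
      then show ?thesis
      proof eventually_elim
        case (elim m)
        have a: "(g ^^ m) ?z \<in> sector c b" "ln (norm ?z) + real m \<le> ln (norm ((g ^^ m) ?z))"
          "norm ?z \<le> norm ((g ^^ m) ?z)" using R1(3)[OF z, of m] by auto
        have "0 \<le> ln (norm ?z)" using z(2) R1(1) by simp
        then have "ln R3 \<le> ln (norm ((g ^^ m) ?z))" using a(2) elim by linarith
        moreover have "norm ((g ^^ m) ?z) > 0" using a(3) z(2) R1(1) by linarith
        ultimately have "R3 \<le> norm ((g ^^ m) ?z)" using R3(1) by (subst (asm) ln_le_cancel_iff) auto
        from R3(4)[OF a(1) this]
        have "\<bar>ln (norm ((f ^^ (m + (k + n0))) p)) - real N * ln (norm ((g ^^ m) ?z))\<bar> \<le> K3"
          by (simp only: fm)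
        then have "\<bar>ln (norm ((f ^^ (m + (k + n0))) p)) - real N * ln (norm ((g ^^ m) ?z))\<bar> / real D ^ m \<le> K3 / real D ^ m"
          using Dp by (intro divide_right_mono) auto
        moreover have "ln (norm ((f ^^ (m + (k + n0))) p)) / real D ^ m - real N * (ln (norm ((g ^^ m) ?z)) / real D ^ m)
           = (ln (norm ((f ^^ (m + (k + n0))) p)) - real N * ln (norm ((g ^^ m) ?z))) / real D ^ m"
          by (simp add: diff_divide_distrib)
        moreover have "K3 * inverse (real D) ^ m = K3 / real D ^ m"
          by (simp add: power_inverse divide_inverse)
        moreover have "\<bar>X / real D ^ m\<bar> = \<bar>X\<bar> / real D ^ m" for X
          using Dp by (simp add: abs_divide)
        ultimately show ?case by (simp only: real_norm_def)
      qed
    qed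
    have "(\<lambda>m. K3 * (inverse (real D)) ^ m) \<longlonglongrightarrow> K3 * 0"
      using D by (intro tendsto_mult tendsto_const LIMSEQ_power_zero) (auto simp: field_simps)
    then have diff: "(\<lambda>m. ln (norm ((f ^^ (m + (k + n0))) p)) / real D ^ m
                 - real N * (ln (norm ((g ^^ m) ?z)) / real D ^ m)) \<longlonglongrightarrow> 0"
      using Lim_null_comparison[OF ev] by simp
    from tendsto_add[OF diff tendsto_mult_left[OF L(1), of "real N"]]
    have "(\<lambda>m. ln (norm ((f ^^ (m + (k + n0))) p)) / real D ^ m) \<longlonglongrightarrow> real N * L" by simp
    from tendsto_max[OF tendsto_const[of 0] tendsto_divide[OF this tendsto_const[of "real D ^ (k + n0)"]]]
    have "(\<lambda>m. max 0 (ln (norm ((f ^^ (m + (k + n0))) p)) / real D ^ m / real D ^ (k + n0))) \<longlonglongrightarrow> max 0 (real N * L / real D ^ (k + n0))"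
      using Dp by simp
    moreover have "max 0 (ln (norm ((f ^^ (m + (k + n0))) p)) / real D ^ m / real D ^ (k + n0)) =
        max 0 (ln (norm ((f ^^ (m + (k + n0))) p))) / real D ^ (m + (k + n0))" for m
    proof -
      have md: "max 0 (u / c) = max 0 u / c" if "c > 0" for u c :: real
        using that by (auto simp: max_def zero_le_divide_iff)
      have "real D ^ (m + (k + n0)) > 0" using Dp by simp
      from md[OF this] show ?thesis by (simp only: power_add divide_divide_eq_left mult.assoc)
    qed
    ultimately have "(\<lambda>m. max 0 (ln (norm ((f ^^ (m + (k + n0))) p))) / real D ^ (m + (k + n0))) \<longlonglongrightarrow> max 0 (real N * L / real D ^ (k + n0))"
      by simp
    then have l: "(\<lambda>n. max 0 (ln (norm ((f ^^ n) p))) / real D ^ n) \<longlonglongrightarrow> max 0 (real N * L / real D ^ (k + n0))"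
      by (rule LIMSEQ_offset)
    have "real N / real D ^ (k + n0) * (ln (norm ?z) - K1) \<le> real N / real D ^ (k + n0) * L"
      using L(2) by (intro mult_left_mono) auto
    also have "\<dots> \<le> max 0 (real N * L / real D ^ (k + n0))" by simp
    finally show ?thesis using l by blast
  qed
  show "convergent (\<lambda>n. max 0 (ln (norm ((f ^^ n) p))) / real D ^ n)" if p: "p \<in> Kplus (inv f)"
  proof (cases "\<exists>n0. R \<le> norm ((g ^^ n0) (inv w p))")
    case True
    then obtain n0 where n0: "R \<le> norm ((g ^^ n0) (inv w p))" by blast
    have "w (inv w p) \<in> Kplus (inv f)" using p bw by (simp add: bij_is_surj surj_f_inv_f)
    from Kg[OF this, of n0] n0 R have "(g ^^ n0) (inv w p) \<in> sector c b" by auto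
    then show ?thesis using lim[of n0 p] n0 R by (auto intro: convergentI)
  next
    case False
    then have "bounded (range (\<lambda>n. (g ^^ n) (inv w p)))"
      by (intro boundedI[of _ R]) (auto simp: not_le intro: less_imp_le)
    then have "bounded (w ` range (\<lambda>n. (g ^^ n) (inv w p)))" by (rule continuous_image_bounded[OF cw])
    then have "bounded (range (\<lambda>n. (f ^^ n) p))" by (simp add: image_image fn)
    then obtain B where B: "\<And>n. norm ((f ^^ n) p) \<le> B" by (auto simp: bounded_iff)
    have est: "norm (max 0 (ln (norm ((f ^^ n) p))) / real D ^ n) \<le> ln (max 1 B) * (inverse (real D)) ^ n" for n
    proof -
      have "max 0 (ln (norm ((f ^^ n) p))) \<le> ln (max 1 B)"
      proof (cases "norm ((f ^^ n) p) > 0")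
        case True
        then have "ln (norm ((f ^^ n) p)) \<le> ln (max 1 B)" using B[of n] by (subst ln_le_cancel_iff) auto
        then show ?thesis by simp
      qed simp
      then have "max 0 (ln (norm ((f ^^ n) p))) / real D ^ n \<le> ln (max 1 B) / real D ^ n"
        using D by (intro divide_right_mono) auto
      then show ?thesis using D by (simp add: power_inverse divide_inverse)
    qed
    have "(\<lambda>n. ln (max 1 B) * (inverse (real D)) ^ n) \<longlonglongrightarrow> ln (max 1 B) * 0"
      using D by (intro tendsto_mult tendsto_const LIMSEQ_power_zero) (auto simp: field_simps)
    then have null: "(\<lambda>n. ln (max 1 B) * (inverse (real D)) ^ n) \<longlonglongrightarrow> 0" by (simp only: mult_zero_right)
    have "(\<lambda>n. max 0 (ln (norm ((f ^^ n) p))) / real D ^ n) \<longlonglongrightarrow> 0"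
      by (rule Lim_null_comparison[OF always_eventually[OF allI[OF est]] null])
    then show ?thesis by (rule convergentI)
  qed
  show "bounded {p \<in> Kplus (inv f). green (real D) f p \<le> C}"
  proof -
    define B where "B = max R (exp (C * real D ^ k / real N + K1))"
    have "norm (inv w p) \<le> B" if p: "p \<in> Kplus (inv f)" "green (real D) f p \<le> C" for p
    proof (cases "R \<le> norm (inv w p)")
      case True
      have "w (inv w p) \<in> Kplus (inv f)" using p bw by (simp add: bij_is_surj surj_f_inv_f)
      from Kg[OF this, of 0] True R have co: "(g ^^ 0) (inv w p) \<in> sector c b" by auto
      obtain L where L: "(\<lambda>n. max 0 (ln (norm ((f ^^ n) p))) / real D ^ n) \<longlonglongrightarrow> L"
          "real N / real D ^ (k + 0) * (ln (norm ((g ^^ 0) (inv w p))) - K1) \<le> L"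
        using lim[OF co] True R by auto
      have "green (real D) f p = L" unfolding green_def using L(1) by (rule limI)
      then have "real N / real D ^ k * (ln (norm (inv w p)) - K1) \<le> C" using L(2) p(2) by simp
      then have "ln (norm (inv w p)) \<le> C * real D ^ k / real N + K1"
        using N D by (simp add: field_simps)
      then have "exp (ln (norm (inv w p))) \<le> exp (C * real D ^ k / real N + K1)"
        by (simp only: exp_le_cancel_iff)
      moreover have "norm (inv w p) > 0" using True R R1(1) by linarith
      ultimately show ?thesis by (simp only: B_def exp_ln le_max_iff_disj simp_thms)
    qed (simp add: B_def)
    then have "{p \<in> Kplus (inv f). green (real D) f p \<le> C} \<subseteq> w ` cball 0 B"
    proof -
      assume h: "\<And>p. p \<in> Kplus (inv f) \<Longrightarrow> green (real D) f p \<le> C \<Longrightarrow> norm (inv w p) \<le> B"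
      show ?thesis
      proof
        fix p assume "p \<in> {p \<in> Kplus (inv f). green (real D) f p \<le> C}"
        then have "inv w p \<in> cball 0 B" using h by simp
        then have "w (inv w p) \<in> w ` cball 0 B" by blast
        then show "p \<in> w ` cball 0 B" using bw by (simp add: bij_is_surj surj_f_inv_f)
      qed
    qed
    then show ?thesis by (rule bounded_subset[OF continuous_image_bounded[OF cw bounded_cball]])
  qed
qed

lemma green_mult:
  assumes "convergent (\<lambda>n. max 0 (ln (norm ((f ^^ n) p))) / d ^ n)" "d > 0"
  shows "green d f (f p) = d * green d f p"
proof -
  let ?u = "\<lambda>n. max 0 (ln (norm ((f ^^ n) p))) / d ^ n"
  have "?u \<longlonglongrightarrow> green d f p" using assms(1) by (simp add: green_def convergent_LIMSEQ_iff)
  then have "(\<lambda>n. d * ?u (Suc n)) \<longlonglongrightarrow> d * green d f p" by (intro tendsto_mult_left LIMSEQ_Suc)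
  moreover have "d * ?u (Suc n) = max 0 (ln (norm ((f ^^ n) (f p)))) / d ^ n" for n
    using assms(2) by (simp add: funpow_swap1)
  ultimately show ?thesis unfolding green_def by (simp add: limI)
qed

section \<open>Degree growth and the normal form\<close>

lemma letter_continuous:
  assumes "F \<in> affine_maps \<union> triangular_maps" shows "continuous_on UNIV F"
  using assms
proof
  assume "F \<in> affine_maps"
  then show ?thesis unfolding affine_maps_def mem_Collect_eq by (elim exE conjE) (simp, intro continuous_intros)
next
  assume "F \<in> triangular_maps"
  then show ?thesis unfolding triangular_maps_def mem_Collect_eq by (elim exE conjE) (simp, intro continuous_intros)
qed

lemma grows_id: "grows id 1" unfolding grows_def by (rule exI[of _ 1]) simp

lemma tame_facts:
  assumes "tame w" shows "continuous_on UNIV w" "\<exists>m\<ge>1. grows w m"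
proof -
  have "continuous_on UNIV (compose_list ls) \<and> (\<exists>m\<ge>1. grows (compose_list ls) m)"
    if "set ls \<subseteq> affine_maps \<union> triangular_maps" for ls
    using that
  proof (induction ls)
    case Nil
    then show ?case using grows_id by (auto simp: id_def)
  next
    case (Cons l ls)
    have l: "l \<in> affine_maps \<union> triangular_maps" using Cons.prems by simp
    have IH: "continuous_on UNIV (compose_list ls)" "\<exists>m\<ge>1. grows (compose_list ls) m" using Cons by auto
    have "\<exists>m\<ge>1. grows l m"
    proof (cases "l \<in> triangular_maps")
      case True
      then obtain m where "m \<ge> 1" "\<forall>n. grows (l ^^ n) m" using grows_triangular by blast
      then have "grows (l ^^ 1) m" by blast
      then show ?thesis using \<open>m \<ge> 1\<close> by auto
    next
      case False
      then have "l \<in> affine_maps" using l by simp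
      then show ?thesis unfolding affine_maps_def mem_Collect_eq using grows_affine by blast
    qed
    then obtain m where m: "m \<ge> 1" "grows l m" by blast
    obtain m' where m': "m' \<ge> 1" "grows (compose_list ls) m'" using IH by blast
    have "grows (l \<circ> compose_list ls) (m * m')" by (rule grows_comp[OF m'(2) m(2)])
    moreover have "m * m' \<ge> 1" using m m' by simp
    moreover have "continuous_on UNIV (l \<circ> compose_list ls)"
      by (rule continuous_on_compose[OF IH(1)]) (rule continuous_on_subset[OF letter_continuous[OF l]], simp)
    ultimately show ?case unfolding compose_list_simps by blast
  qed
  then show "continuous_on UNIV w" "\<exists>m\<ge>1. grows w m" using assms by (auto simp: tame_def)
qed

lemma reduced_inverse:
  "reduced_word b b' ls \<Longrightarrow> reduced_word b' b (rev (map inv ls)) \<and> compose_list (rev (map inv ls)) = inv (compose_list ls)"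
proof (induction rule: reduced_word.induct)
  have li: "inv l \<in> letters b" if "l \<in> letters b" for l b
  proof -
    have l: "l \<in> grp b" "l \<notin> grp (\<not> b)" using that by (auto simp: letters_def)
    have "inv l \<notin> grp (\<not> b)"
      using grp_inv[of "inv l" "\<not> b"] l grp_bij[OF l(1)] by (auto simp: inv_inv_eq)
    then show ?thesis using grp_inv[OF l(1)] by (simp add: letters_def)
  qed
  {
    case (single l b)
    then show ?case using li by (auto intro: reduced_word.single)
  next
    case (cons l b b' ls)
    have "reduced_word b' b (rev (map inv ls) @ [inv l])"
      by (rule reduced_append[of _ "\<not> b"]) (use cons li in \<open>auto intro: reduced_word.single\<close>)
    moreover have "bij l" using cons(1) by (auto simp: letters_def intro: grp_bij)
    moreover have "compose_list (rev (map inv (l # ls))) = inv (compose_list ls) \<circ> inv l"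
      using cons.IH by (simp add: compose_list_append)
    ultimately show ?case
      by (simp only: compose_list_simps o_inv_distrib[OF \<open>bij l\<close> reduced_bij[OF cons(2)]]) simp
  }
qed

lemma grp_union: "grp b \<subseteq> affine_maps \<union> triangular_maps" by (auto simp: grp_def)

lemma reduced_tame: "reduced_word b b' ls \<Longrightarrow> tame (compose_list ls)"
proof (induction rule: reduced_word.induct)
  case (single l b)
  then show ?case using grp_tame by (auto simp: letters_def)
next
  case (cons l b b' ls)
  then have "tame l" using grp_tame by (auto simp: letters_def)
  from tame_comp[OF this cons.IH] show ?case by (simp only: compose_list_simps)
qed

lemma top_form_scale_limit:
  assumes "P \<noteq> 0"
  shows "\<exists>x y. (\<lambda>n. poly2 P (of_nat (Suc n) * x, of_nat (Suc n) * y) / of_nat (Suc n) ^ weight 1 1 P) \<longlonglongrightarrow> top_form 1 1 P x y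
     \<and> top_form 1 1 P x y \<noteq> 0"
proof -
  obtain x y where xy: "top_form 1 1 P x y \<noteq> 0" using top_form_nonzero[OF assms] by blast
  have "(\<lambda>n. poly2 P (of_nat (Suc n) ^ 1 * x, of_nat (Suc n) ^ 1 * y) / of_nat (Suc n) ^ weight 1 1 P) \<longlonglongrightarrow> top_form 1 1 P x y"
    by (rule top_form_limit[OF filterlim_of_nat_Suc tendsto_const tendsto_const])
  then have "(\<lambda>n. poly2 P (of_nat (Suc n) * x, of_nat (Suc n) * y) / of_nat (Suc n) ^ weight 1 1 P) \<longlonglongrightarrow> top_form 1 1 P x y"
    unfolding power_one_right .
  then show ?thesis using xy by (intro exI conjI)
qed

text \<open>Evaluation along the multiples of a vector at which the homogeneous top form does not vanish shows
  that growth of order \<open>m\<close> bounds the total degree by \<open>m\<close>.\<close>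
lemma growth_total_degree:
  assumes C: "\<And>q. norm (poly2 P q) \<le> C * (1 + norm q) ^ m"
  shows "total_degree_le P m"
  unfolding total_degree_le_def
proof (intro allI impI)
  fix i k assume nz: "coeff (coeff P i) k \<noteq> 0"
  then have P: "P \<noteq> 0" by auto
  let ?W = "weight 1 1 P"
  have iW: "i + k \<le> ?W" using weight_le[OF nz, of 1 1] by simp
  obtain x y where lim: "(\<lambda>n. poly2 P (of_nat (Suc n) * x, of_nat (Suc n) * y) / of_nat (Suc n) ^ ?W) \<longlonglongrightarrow> top_form 1 1 P x y"
     and t: "top_form 1 1 P x y \<noteq> 0"
    using top_form_scale_limit[OF P] by (elim exE conjE)
  show "i + k \<le> m"
  proof (rule ccontr)
    assume "\<not> i + k \<le> m"
    then have mW: "m < ?W" using iW by simp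
    define B where "B = \<bar>C\<bar> * (1 + norm (x,y)) ^ m"
    have "norm (poly2 P (of_nat (Suc n) * x, of_nat (Suc n) * y) / of_nat (Suc n) ^ ?W) \<le> B * inverse (real (Suc n))" for n
    proof -
      let ?s = "real (Suc n)"
      have s1: "?s \<ge> 1" by simp
      have "norm (of_nat (Suc n) * x, of_nat (Suc n) * y) = ?s * norm (x,y)"
      proof -
        have "(of_nat (Suc n) * x, of_nat (Suc n) * y) = ?s *\<^sub>R (x,y)"
          by (simp add: scaleR_conv_of_real)
        then show ?thesis by (simp only: norm_scaleR abs_of_nat)
      qed
      then have "norm (poly2 P (of_nat (Suc n) * x, of_nat (Suc n) * y)) \<le> C * (1 + ?s * norm (x,y)) ^ m"
        using C[of "(of_nat (Suc n) * x, of_nat (Suc n) * y)"] by simp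
      also have "\<dots> \<le> \<bar>C\<bar> * (?s * (1 + norm (x,y))) ^ m"
      proof (rule mult_mono)
        show "(1 + ?s * norm (x,y)) ^ m \<le> (?s * (1 + norm (x,y))) ^ m"
          using s1 by (intro power_mono) (auto simp: distrib_left)
      qed auto
      also have "\<dots> = B * ?s ^ m" by (simp add: B_def power_mult_distrib)
      finally have n1: "norm (poly2 P (of_nat (Suc n) * x, of_nat (Suc n) * y)) \<le> B * ?s ^ m" .
      have B0: "B \<ge> 0" by (simp add: B_def)
      have "?s ^ m * ?s \<le> ?s ^ ?W"
      proof -
        have "?s ^ m * ?s = ?s ^ Suc m" by simp
        also have "\<dots> \<le> ?s ^ ?W" using mW s1 by (intro power_increasing) auto
        finally show ?thesis .
      qed
      then have "?s ^ m / ?s ^ ?W \<le> inverse ?s" by (simp add: field_simps)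
      then have "B * (?s ^ m / ?s ^ ?W) \<le> B * inverse ?s" using B0 by (rule mult_left_mono)
      moreover have "norm (poly2 P (of_nat (Suc n) * x, of_nat (Suc n) * y) / of_nat (Suc n) ^ ?W) \<le> B * ?s ^ m / ?s ^ ?W"
        using n1 unfolding norm_divide norm_power norm_of_nat by (rule divide_right_mono) simp
      ultimately show ?thesis by simp
    qed
    then have "eventually (\<lambda>n. norm (poly2 P (of_nat (Suc n) * x, of_nat (Suc n) * y) / of_nat (Suc n) ^ ?W) \<le> B * inverse (real (Suc n))) sequentially"
      by (rule always_eventually[OF allI])
    moreover have "(\<lambda>n. B * inverse (real (Suc n))) \<longlonglongrightarrow> 0"
      using tendsto_mult_left[OF LIMSEQ_inverse_real_of_nat, of B] by (simp only: mult_zero_right)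
    ultimately have "(\<lambda>n. poly2 P (of_nat (Suc n) * x, of_nat (Suc n) * y) / of_nat (Suc n) ^ ?W) \<longlonglongrightarrow> 0"
      by (rule Lim_null_comparison)
    then show False using LIMSEQ_unique[OF lim] t by blast
  qed
qed

lemma total_degree_growth:
  assumes "total_degree_le P m"
  shows "\<exists>C\<ge>0. \<forall>q. norm (poly2 P q) \<le> C * (1 + norm q) ^ m"
proof (intro exI conjI allI)
  show "0 \<le> (\<Sum>(i,j)\<in>support2 P. norm (coeff (coeff P j) i))" by (rule sum_nonneg) auto
  fix q :: C2
  obtain x y where q: "q = (x,y)" by force
  have "norm (poly2 P q) \<le> (\<Sum>(i,j)\<in>support2 P. norm (coeff (coeff P j) i) * norm x ^ i * norm y ^ j)"
    unfolding q poly2_support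
    by (rule order_trans[OF norm_sum]) (simp add: norm_mult norm_power split_beta)
  also have "\<dots> \<le> (\<Sum>(i,j)\<in>support2 P. norm (coeff (coeff P j) i) * (1 + norm q) ^ m)"
  proof (rule sum_mono, clarify)
    fix i j assume ij: "(i,j) \<in> support2 P"
    then have "j + i \<le> m" using assms by (auto simp: support2_def total_degree_le_def)
    then have "i + j \<le> m" by simp
    have "norm x ^ i * norm y ^ j \<le> (1 + norm q) ^ i * (1 + norm q) ^ j"
      using norm_pair_bounds[of q] by (intro mult_mono power_mono) (auto simp: q)
    also have "\<dots> \<le> (1 + norm q) ^ m"
      unfolding power_add [symmetric] using \<open>i + j \<le> m\<close> by (intro power_increasing) auto
    finally show "norm (coeff (coeff P j) i) * norm x ^ i * norm y ^ j \<le> norm (coeff (coeff P j) i) * (1 + norm q) ^ m"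
      by (simp add: mult.assoc mult_left_mono)
  qed
  also have "\<dots> = (\<Sum>(i,j)\<in>support2 P. norm (coeff (coeff P j) i)) * (1 + norm q) ^ m"
    by (simp add: sum_distrib_right split_beta)
  finally show "norm (poly2 P q) \<le> (\<Sum>(i,j)\<in>support2 P. norm (coeff (coeff P j) i)) * (1 + norm q) ^ m" .
qed

lemma total_degree_ex: "\<exists>m. total_degree_le P m"
proof -
  have "total_degree_le P (weight 1 1 P)"
    unfolding total_degree_le_def using weight_le[of P _ _ 1 1] by (force simp: add.commute)
  then show ?thesis by blast
qed

lemma total_degree_mono: "total_degree_le P m \<Longrightarrow> m \<le> n \<Longrightarrow> total_degree_le P n"
  by (force simp: total_degree_le_def)

lemma polynomial_map_degree_le:
  assumes "polynomial_map F" "grows F m" shows "polynomial_map_degree F \<le> m"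
proof -
  obtain P Q where F: "\<forall>q. F q = (poly2 P q, poly2 Q q)" using assms(1) unfolding polynomial_map_def by (elim exE)
  obtain C where C: "\<And>q. norm (F q) \<le> C * (1 + norm q) ^ m" using assms(2) by (auto simp: grows_def)
  have "total_degree_le P m"
  proof (rule growth_total_degree[of P C])
    fix q
    have "norm (poly2 P q) \<le> norm (F q)" using norm_pair_bounds(1)[of "F q"] by (simp only: F fst_conv snd_conv)
    then show "norm (poly2 P q) \<le> C * (1 + norm q) ^ m" using C[of q] by linarith
  qed
  moreover have "total_degree_le Q m"
  proof (rule growth_total_degree[of Q C])
    fix q
    have "norm (poly2 Q q) \<le> norm (F q)" using norm_pair_bounds(2)[of "F q"] by (simp only: F fst_conv snd_conv)
    then show "norm (poly2 Q q) \<le> C * (1 + norm q) ^ m" using C[of q] by linarith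
  qed
  ultimately show ?thesis unfolding polynomial_map_degree_def using F by (intro Least_le) blast
qed

lemma polynomial_map_degree_grows:
  assumes "polynomial_map F" shows "grows F (polynomial_map_degree F)"
proof -
  obtain P Q where F: "\<forall>q. F q = (poly2 P q, poly2 Q q)" using assms unfolding polynomial_map_def by (elim exE)
  obtain m1 m2 where "total_degree_le P m1" "total_degree_le Q m2" using total_degree_ex by metis
  then have "total_degree_le P (max m1 m2)" "total_degree_le Q (max m1 m2)"
    by (auto elim: total_degree_mono)
  then have "\<exists>m. \<exists>P Q. (\<forall>p. F p = (poly2 P p, poly2 Q p)) \<and> total_degree_le P m \<and> total_degree_le Q m"
    using F by blast
  from LeastI_ex[OF this] obtain P Q where F: "\<forall>p. F p = (poly2 P p, poly2 Q p)"
     and t: "total_degree_le P (polynomial_map_degree F)" "total_degree_le Q (polynomial_map_degree F)"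
    unfolding polynomial_map_degree_def by (elim exE conjE)
  obtain C where C: "C \<ge> 0" "\<And>q. norm (poly2 P q) \<le> C * (1 + norm q) ^ polynomial_map_degree F"
    using total_degree_growth[OF t(1)] by blast
  obtain C' where C': "C' \<ge> 0" "\<And>q. norm (poly2 Q q) \<le> C' * (1 + norm q) ^ polynomial_map_degree F"
    using total_degree_growth[OF t(2)] by blast
  have "norm (F q) \<le> (C + C' + 1) * (1 + norm q) ^ polynomial_map_degree F" for q
  proof -
    have "norm (F q) \<le> norm (poly2 P q) + norm (poly2 Q q)" using norm_Pair_le[of "poly2 P q" "poly2 Q q"] by (simp only: F)
    moreover have "0 \<le> (1 + norm q) ^ polynomial_map_degree F" by simp
    ultimately show ?thesis using C(2)[of q] C'(2)[of q] unfolding distrib_right by linarith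
  qed
  moreover have "C + C' + 1 > 0" using C C' by linarith
  ultimately show ?thesis unfolding grows_def by blast
qed

text \<open>Comparison of the two estimates far out on a coordinate axis, which lies in the sector.\<close>
lemma goes_grows_le:
  assumes g: "goes c b b' F s" and m: "grows F m" and c: "c > 0"
  shows "s \<le> m"
proof (rule ccontr)
  assume "\<not> s \<le> m"
  then have sm: "real m + 1 \<le> real s" by simp
  obtain R K where R: "R \<ge> 1" "K \<ge> 0" "\<And>q. q \<in> sector c b \<Longrightarrow> R \<le> norm q \<Longrightarrow> F q \<in> sector c b'"
    "\<And>q. q \<in> sector c b \<Longrightarrow> R \<le> norm q \<Longrightarrow> \<bar>ln (norm (F q)) - real s * ln (norm q)\<bar> \<le> K"
    by (rule goesD[OF g]) (rule that)
  obtain C where C: "C > 0" "\<And>q. norm (F q) \<le> C * (1 + norm q) ^ m" using m by (auto simp: grows_def)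
  define T where "T = max R (exp (K + \<bar>ln C\<bar> + real m * ln 2 + 1))"
  define q :: C2 where "q = (if b then (0, of_real T) else (of_real T, 0))"
  have T: "T \<ge> 1" "T \<ge> R" "K + \<bar>ln C\<bar> + real m * ln 2 + 1 \<le> ln T"
    using R by (auto simp: T_def ln_ge_iff)
  have nq: "norm q = T" using T by (simp add: q_def norm_Pair)
  have qs: "q \<in> sector c b" using T c by (simp add: q_def sector_def)
  have "\<bar>ln (norm (F q)) - real s * ln T\<bar> \<le> K" using R(4)[OF qs] T nq by simp
  then have l: "real s * ln T - K \<le> ln (norm (F q))" by linarith
  have lT: "ln T \<ge> 0" using T by simp
  have sT: "(real m + 1) * ln T \<le> real s * ln T" using sm lT by (rule mult_right_mono)
  have m2: "0 \<le> real m * ln 2" by simp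
  have mT: "0 \<le> real m * ln T" using lT by simp
  have Fp: "norm (F q) > 0"
  proof (rule ccontr)
    assume "\<not> ?thesis"
    then have "ln (norm (F q)) = 0" by simp
    then show False using l sT T(3) m2 mT unfolding distrib_right by linarith
  qed
  have "norm (F q) \<le> C * (2 * T) ^ m"
  proof -
    have "(1 + T) ^ m \<le> (2 * T) ^ m" using T by (intro power_mono) auto
    then have "C * (1 + T) ^ m \<le> C * (2 * T) ^ m" using C(1) by simp
    then show ?thesis using C(2)[of q] unfolding nq by linarith
  qed
  then have "ln (norm (F q)) \<le> ln (C * (2 * T) ^ m)" using Fp C T by (subst ln_le_cancel_iff) auto
  also have "\<dots> = ln C + real m * (ln 2 + ln T)" using C T by (simp add: ln_mult ln_realpow distrib_left)
  finally have "ln (norm (F q)) \<le> ln C + real m * ln 2 + real m * ln T" by (simp add: distrib_left)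
  then show False using l sT T(3) unfolding distrib_right by linarith
qed

lemma polynomial_map_funpow:
  assumes "polynomial_map f" shows "polynomial_map (f ^^ n)"
proof (induction n)
  case 0
  show ?case unfolding polynomial_map_def
    by (rule exI[of _ "[:[:0,1:]:]"], rule exI[of _ "[:0,1:]"]) (auto simp: poly2_def)
next
  case (Suc n)
  then show ?case unfolding funpow.simps by (rule polynomial_map_comp[OF assms])
qed

lemma grows_funpow:
  assumes "grows g D" shows "grows (g ^^ n) (D ^ n)"
proof (induction n)
  case 0 show ?case using grows_id by (simp add: id_def)
next
  case (Suc n)
  show ?case unfolding funpow.simps power_Suc by (rule grows_comp[OF Suc assms])
qed

lemma goes_funpow:
  assumes "goes c b b g D" "D \<ge> 1" shows "goes c b b (g ^^ n) (D ^ n)"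
proof (induction n)
  case 0 show ?case unfolding goes_def by (intro exI[of _ 0]) simp
next
  case (Suc n)
  have "D ^ n \<ge> 1" using assms(2) by simp
  then show ?case unfolding funpow.simps power_Suc by (rule goes_comp[OF Suc assms(1)])
qed

text \<open>The number \<open>D\<close> is the dynamical degree because the degree of \<open>f ^^ n\<close> lies between two positive
  multiples of \<open>D ^ n\<close>.\<close>
theorem polynomial_diffeomorphism_normal_form:
  assumes f: "polynomial_diffeomorphism f" and d: "has_dynamical_degree f d" "d > 1"
  shows "\<exists>w g b c D. real D = d \<and> normal_form f w g b c D \<and> normal_form (inv f) w (inv g) (\<not> b) c D"
proof -
  have pf: "polynomial_map f" using f by (simp add: polynomial_diffeomorphism_def)
  obtain w g where w: "tame w" "bij w" "tame (inv w)" and fw: "f = w \<circ> g \<circ> inv w"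
    and g: "(\<exists>b. g \<in> grp b) \<or> (\<exists>b gs. g = compose_list gs \<and> reduced_word (\<not> b) b gs)"
    using cyclic_reduction[OF jung[OF f]] unfolding conjugate_normal_def by (elim exE conjE)
  have fn: "f ^^ n = w \<circ> (g ^^ n) \<circ> inv w" for n by (simp only: fw conj_funpow[OF w(2)])
  obtain m1 where m1: "m1 \<ge> 1" "grows w m1" using tame_facts[OF w(1)] by blast
  obtain m2 where m2: "m2 \<ge> 1" "grows (inv w) m2" using tame_facts[OF w(3)] by blast
  let ?deg = "\<lambda>n. real (polynomial_map_degree (f ^^ n))"
  have lim: "(\<lambda>n. root n (?deg n)) \<longlonglongrightarrow> d" using d(1) by (simp add: has_dynamical_degree_def)
  have upper: "polynomial_map_degree (f ^^ n) \<le> m1 * (e * m2)" if "grows (g ^^ n) e" for n e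
  proof -
    have "grows (f ^^ n) (m1 * (e * m2))"
      unfolding fn comp_assoc by (intro grows_comp[OF _ m1(2)] grows_comp[OF m2(2) that])
    then show ?thesis by (rule polynomial_map_degree_le[OF polynomial_map_funpow[OF pf]])
  qed
  have root_const: "(\<lambda>n. root n (A * D ^ n)) \<longlonglongrightarrow> D" if "A > 0" "D > 0" for A D :: real
  proof -
    have "(\<lambda>n. root n A * D) \<longlonglongrightarrow> 1 * D" by (intro tendsto_mult LIMSEQ_root_const that tendsto_const)
    moreover have "eventually (\<lambda>n. root n A * D = root n (A * D ^ n)) sequentially"
      using eventually_gt_at_top[of 0] by eventually_elim (use that in \<open>simp add: real_root_mult real_root_power_cancel\<close>)
    ultimately show ?thesis using Lim_transform_eventually by fastforce
  qed
  obtain b gs where gs: "g = compose_list gs" "reduced_word (\<not> b) b gs"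
  proof -
    \<comment> \<open>The iterates of a map in one of the two groups have bounded degree, which would give d at most 1.\<close>
    have "\<not> (\<exists>b. g \<in> grp b)"
    proof
      assume "\<exists>b. g \<in> grp b"
      then obtain b where gb: "g \<in> grp b" by blast
      have "\<exists>m\<ge>1. \<forall>n. grows (g ^^ n) m"
      proof (cases "g \<in> triangular_maps")
        case True then show ?thesis by (rule grows_triangular)
      next
        case False
        then have "g \<in> affine_maps" using gb grp_union by blast
        then have "grows g 1" unfolding affine_maps_def mem_Collect_eq using grows_affine by blast
        then have "grows (g ^^ n) 1" for n using grows_funpow[of g 1 n] by simp
        then show ?thesis by blast
      qed
      then obtain m where m: "m \<ge> 1" "\<And>n. grows (g ^^ n) m" by blast
      define M where "M = real (m1 * (m * m2))"
      have M: "M > 0" using m1 m2 m by (simp add: M_def)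
      have "d \<le> 1"
      proof (rule LIMSEQ_le[OF lim])
        show "(\<lambda>n. root n (M * 1 ^ n)) \<longlonglongrightarrow> 1" by (rule root_const) (use M in auto)
        show "\<exists>N. \<forall>n\<ge>N. root n (?deg n) \<le> root n (M * 1 ^ n)"
        proof (intro exI[of _ 1] allI impI)
          fix n :: nat assume n: "1 \<le> n"
          have "?deg n \<le> M" using upper[OF m(2)[of n]] unfolding M_def of_nat_le_iff .
          then show "root n (?deg n) \<le> root n (M * 1 ^ n)" using n by (intro real_root_le_mono) auto
        qed
      qed
      then show False using d(2) by simp
    qed
    then show thesis using g that by blast
  qed
  obtain D where D: "letter_data (\<not> b) b g D" "D \<ge> 2"
    using letter_data_reduced[OF gs(2)] gs(1) by auto
  have bg: "bij g" using reduced_bij[OF gs(2)] gs(1) by simp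
  obtain c0 where c0: "c0 > 0" "\<And>c. 0 < c \<Longrightarrow> c \<le> c0 \<Longrightarrow> goes c b b g D \<and> goes c (\<not> b) (\<not> b) (inv g) D"
    using D(1) unfolding letter_data_def not_not by blast
  have gD: "grows g D" using D(1) by (simp add: letter_data_def)
  obtain k b1 r where r: "reduced_word b1 b r" "compose_list r = w \<circ> (compose_list gs ^^ k)"
    using tame_times_power_reduced[OF gs(2) w(1)] by (elim exE conjE)
  obtain N where N: "letter_data b1 b (compose_list r) N" using letter_data_reduced[OF r(1)] by blast
  obtain c1 where c1: "c1 > 0" "\<And>c. 0 < c \<Longrightarrow> c \<le> c1 \<Longrightarrow> goes c b (\<not> b1) (w \<circ> (g ^^ k)) N"
    using N unfolding letter_data_def r(2) gs(1) by blast
  have N1: "N \<ge> 1" using N by (simp add: letter_data_def)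
  \<comment> \<open>The inverse is treated in the same way, with the reversed word of inverses.\<close>
  let ?hs = "rev (map inv gs)"
  have hs: "reduced_word b (\<not> b) ?hs" "compose_list ?hs = inv g"
    using reduced_inverse[OF gs(2)] gs(1) by auto
  have hs': "reduced_word (\<not> (\<not> b)) (\<not> b) ?hs" using hs(1) by simp
  obtain k' b2 r' where r': "reduced_word b2 (\<not> b) r'" "compose_list r' = w \<circ> (compose_list ?hs ^^ k')"
    using tame_times_power_reduced[OF hs' w(1)] by (elim exE conjE)
  obtain N' where N': "letter_data b2 (\<not> b) (compose_list r') N'" using letter_data_reduced[OF r'(1)] by blast
  obtain c2 where c2: "c2 > 0" "\<And>c. 0 < c \<Longrightarrow> c \<le> c2 \<Longrightarrow> goes c (\<not> b) (\<not> b2) (w \<circ> (inv g ^^ k')) N'"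
    using N' unfolding letter_data_def r'(2) hs(2) by blast
  have N1': "N' \<ge> 1" using N' by (simp add: letter_data_def)
  define c where "c = min c0 (min c1 c2)"
  have c: "c > 0" "c \<le> c0" "c \<le> c1" "c \<le> c2" using c0 c1 c2 by (auto simp: c_def)
  have tg: "tame g" using reduced_tame[OF gs(2)] gs(1) by simp
  have tig: "tame (inv g)" using reduced_tame[OF hs(1)] hs(2) by simp
  have nf: "normal_form f w g b c D"
    unfolding normal_form_def
    using w bg tame_facts(1) tg tig fw D(2) c0(2)[OF c(1,2)] c1(2)[OF c(1,3)] N1 by blast
  have "inv f = w \<circ> inv g \<circ> inv w"
    using w(2) bg by (simp add: fw o_inv_distrib bij_comp bij_imp_bij_inv inv_inv_eq comp_assoc)
  then have nf': "normal_form (inv f) w (inv g) (\<not> b) c D"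
    unfolding normal_form_def
    using w bg tame_facts(1) tg tig D(2) c0(2)[OF c(1,2)] c2(2)[OF c(1,4)] N1'
    by (simp add: bij_imp_bij_inv inv_inv_eq) blast
  have low: "N * D ^ n \<le> polynomial_map_degree (f ^^ (n + k)) * m1" for n
  proof -
    have "D ^ n \<ge> 1" using D(2) by simp
    then have "goes c b (\<not> b1) ((w \<circ> (g ^^ k)) \<circ> (g ^^ n)) (N * D ^ n)"
      using goes_comp[OF goes_funpow[of c b g D n] c1(2)[OF c(1,3)]] c0(2)[OF c(1,2)] D(2) by simp
    moreover have "(w \<circ> (g ^^ k)) \<circ> (g ^^ n) = (f ^^ (n + k)) \<circ> w"
    proof -
      have "(f ^^ (n + k)) \<circ> w = w \<circ> (g ^^ (n + k))"
        using w(2) by (auto simp: fn fun_eq_iff bij_is_inj)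
      also have "g ^^ (n + k) = (g ^^ k) \<circ> (g ^^ n)" by (simp only: add.commute[of n k] funpow_add)
      finally show ?thesis by (simp only: comp_assoc)
    qed
    moreover have "grows ((f ^^ (n + k)) \<circ> w) (polynomial_map_degree (f ^^ (n + k)) * m1)"
      by (rule grows_comp[OF m1(2) polynomial_map_degree_grows[OF polynomial_map_funpow[OF pf]]])
    ultimately show ?thesis using goes_grows_le c(1) by metis
  qed
  define A where "A = real N / (real m1 * real D ^ k)"
  define B where "B = real (m1 * m2)"
  have A: "A > 0" "B > 0" using N1 m1 m2 D(2) by (auto simp: A_def B_def)
  have b1: "root n (A * real D ^ n) \<le> root n (?deg n)" if n: "n \<ge> max 1 k" for n
  proof -
    obtain i where i: "n = i + k" using n by (metis le_iff_add add.commute max.bounded_iff)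
    have "real (N * D ^ i) \<le> real (polynomial_map_degree (f ^^ n) * m1)" using low[of i] unfolding i of_nat_le_iff .
    then have "A * real D ^ n \<le> ?deg n"
      using m1 D(2) by (simp add: A_def i power_add field_simps)
    then show ?thesis using n by (intro real_root_le_mono) auto
  qed
  have b2: "root n (?deg n) \<le> root n (B * real D ^ n)" if n: "n \<ge> 1" for n
  proof -
    have "real (polynomial_map_degree (f ^^ n)) \<le> real (m1 * (D ^ n * m2))"
      using upper[OF grows_funpow[OF gD]] unfolding of_nat_le_iff .
    then have "?deg n \<le> B * real D ^ n" by (simp add: B_def mult_ac)
    then show ?thesis using n by (intro real_root_le_mono) auto
  qed
  have "(\<lambda>n. root n (?deg n)) \<longlonglongrightarrow> real D"
  proof (rule tendsto_sandwich)
    show "(\<lambda>n. root n (A * real D ^ n)) \<longlonglongrightarrow> real D" "(\<lambda>n. root n (B * real D ^ n)) \<longlonglongrightarrow> real D"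
      using A D(2) by (auto intro!: root_const)
    show "eventually (\<lambda>n. root n (A * real D ^ n) \<le> root n (?deg n)) sequentially"
      using eventually_ge_at_top[of "max 1 k"] by eventually_elim (rule b1)
    show "eventually (\<lambda>n. root n (?deg n) \<le> root n (B * real D ^ n)) sequentially"
      using eventually_ge_at_top[of 1] by eventually_elim (rule b2)
  qed
  then have "real D = d" using LIMSEQ_unique lim by blast
  then show ?thesis using nf nf' by blast
qed

text \<open>The two properties of the Green functions that the argument needs, for \<open>f\<close> and for its inverse:
  the functional equation, and boundedness of the sublevel sets, on \<open>J\<^sup>-\<close> and on \<open>J\<^sup>+\<close>.\<close>
theorem green_structure:
  assumes "polynomial_diffeomorphism f" "has_dynamical_degree f d" "d > 1"
  shows "p \<in> Jplus (inv f) \<Longrightarrow> green d f (f p) = d * green d f p"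
    and "bounded {p \<in> Jplus (inv f). green d f p \<le> C}"
    and "p \<in> Jplus f \<Longrightarrow> green d (inv f) (inv f p) = d * green d (inv f) p"
    and "bounded {p \<in> Jplus f. green d (inv f) p \<le> C}"
proof -
  obtain w g b c D where D: "real D = d" and nf: "normal_form f w g b c D"
    and nf': "normal_form (inv f) w (inv g) (\<not> b) c D"
    using polynomial_diffeomorphism_normal_form[OF assms] by (elim exE conjE)
  have iif: "inv (inv f) = f" using assms(1) by (simp add: polynomial_diffeomorphism_def inv_inv_eq)
  note F = green_facts[OF nf] and G = green_facts[OF nf', unfolded iif]
  show "green d f (f p) = d * green d f p" if "p \<in> Jplus (inv f)"
    by (rule green_mult[OF F(2)[OF subsetD[OF F(1) that], unfolded D]]) (use assms(3) in simp)
  show "green d (inv f) (inv f p) = d * green d (inv f) p" if "p \<in> Jplus f"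
    by (rule green_mult[OF G(2)[OF subsetD[OF G(1) that], unfolded D]]) (use assms(3) in simp)
  show "bounded {p \<in> Jplus (inv f). green d f p \<le> C}"
    by (rule bounded_subset[OF F(3)[of C]]) (use F(1) D in auto)
  show "bounded {p \<in> Jplus f. green d (inv f) p \<le> C}"
    by (rule bounded_subset[OF G(3)[of C]]) (use G(1) D in auto)
qed

section \<open>Parametrizations of a leaf\<close>

text \<open>The values near \<open>h 0\<close> are taken near \<open>0\<close> only, so infinity is not an essential singularity, and \<open>h\<close> is a
  polynomial whose derivative has no zero.\<close>
lemma entire_injective_affine:
  assumes hol: "h holomorphic_on UNIV" and inj: "inj h"
  obtains \<alpha> \<beta> where "\<alpha> \<noteq> 0" "\<And>z. h z = \<alpha> * z + \<beta>"
proof -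
  let ?f = "\<lambda>z. h z - h 0"
  have holf: "?f holomorphic_on UNIV" by (intro holomorphic_intros hol)
  have op: "open (?f ` ball 0 1)"
    by (rule open_mapping_thm3[OF holomorphic_on_subset[OF holf]]) (use inj in \<open>auto simp: inj_on_def inj_def\<close>)
  have "0 \<in> ?f ` ball 0 1" by (rule image_eqI[of _ _ 0]) auto
  then obtain \<delta> where \<delta>: "\<delta> > 0" "ball 0 \<delta> \<subseteq> ?f ` ball 0 1" using op openE by blast
  have big: "\<delta> \<le> norm (?f z)" if z1: "norm z \<ge> 1" for z
  proof (rule ccontr)
    assume "\<not> ?thesis"
    then have "?f z \<in> ball 0 \<delta>" by simp
    then obtain y where "y \<in> ball 0 1" "?f z = ?f y" using \<delta>(2) by blast
    then have "z = y" using inj by (auto dest: injD)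
    then show False using z1 \<open>y \<in> ball 0 1\<close> by simp
  qed
  have nz: "?f z \<noteq> 0" if "z \<noteq> 0" for z using inj that by (auto dest: injD)
  define F where "F = (\<lambda>z. inverse (?f (inverse z)))"
  have holF: "F holomorphic_on (ball 0 1 - {0})"
  proof -
    have "?f \<circ> inverse holomorphic_on (ball 0 1 - {0})"
      by (rule holomorphic_on_compose_gen[OF _ holf]) (auto intro!: holomorphic_intros)
    then have "(\<lambda>z. inverse ((?f \<circ> inverse) z)) holomorphic_on (ball 0 1 - {0})"
      by (rule holomorphic_on_inverse) (use nz in auto)
    then show ?thesis by (simp add: F_def o_def)
  qed
  have "\<exists>B. eventually (\<lambda>z. norm (F z) \<le> B) (at 0)"
  proof (intro exI)
    have ball: "norm (F z) \<le> inverse \<delta>" if z: "dist z 0 < 1" "z \<noteq> 0" for z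
    proof -
      have "norm (inverse z) \<ge> 1" using z by (simp add: norm_inverse one_le_inverse)
      from big[OF this] show ?thesis using \<delta>(1) by (simp add: F_def norm_inverse le_imp_inverse_le)
    qed
    show "eventually (\<lambda>z. norm (F z) \<le> inverse \<delta>) (at 0)"
      unfolding eventually_at by (rule exI[of _ 1]) (use ball in auto)
  qed
  then obtain G where G: "G holomorphic_on ball 0 1" "\<And>z. z \<in> ball 0 1 - {0} \<Longrightarrow> G z = F z"
    using holomorphic_on_extend_bounded[OF holF] by auto
  have "isCont G 0"
    using G(1) holomorphic_on_imp_continuous_on continuous_on_eq_continuous_at[of "ball 0 1" G] by auto
  then have "(G \<longlongrightarrow> G 0) (at 0)" by (simp add: isCont_def)
  then have "(F \<longlongrightarrow> G 0) (at 0)"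
  proof (rule Lim_transform_eventually)
    show "eventually (\<lambda>z. G z = F z) (at 0)"
      unfolding eventually_at by (rule exI[of _ 1]) (use G(2) in auto)
  qed
  then have "((inverse \<circ> ?f) \<longlongrightarrow> G 0) at_infinity"
    by (simp add: lim_at_infinity_0 F_def o_def)
  from pole_at_infinity[OF holf this] obtain a n where a: "\<And>z. h z - h 0 = (\<Sum>i\<le>n. a i * z ^ i)" by blast
  define p where "p = (\<Sum>i\<le>n. monom (a i) i)"
  have pf: "poly p z = h z - h 0" for z by (simp add: p_def poly_sum poly_monom a)
  have "poly (pderiv p) z \<noteq> 0" for z
  proof -
    have "deriv ?f z \<noteq> 0"
      by (rule holomorphic_injective_imp_regular[OF holf]) (use inj in \<open>auto simp: inj_on_def inj_def\<close>)
    moreover have "?f = poly p" by (simp add: pf fun_eq_iff)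
    ultimately show ?thesis using DERIV_imp_deriv[OF poly_DERIV[of p z]] by simp
  qed
  then have "constant (poly (pderiv p))"
    using Fundamental_Theorem_Algebra.fundamental_theorem_of_algebra by blast
  then have "degree (pderiv p) = 0" by (simp add: constant_degree)
  then have "degree p \<le> 1" by (simp add: degree_pderiv)
  then have "p = [:coeff p 0, coeff p 1:]"
    by (intro poly_eqI) (auto simp: coeff_pCons coeff_eq_0 split: nat.splits)
  then have "poly p z = poly [:coeff p 0, coeff p 1:] z" for z by (rule arg_cong)
  then have pz: "poly p z = coeff p 0 + z * coeff p 1" for z by simp
  have eq: "h z = coeff p 1 * z + (coeff p 0 + h 0)" for z
    using pf[of z] pz[of z] by (simp add: algebra_simps)
  have "coeff p 1 \<noteq> 0"
  proof
    assume "coeff p 1 = 0"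
    moreover have "coeff p 0 = 0" using pf[of 0] by (simp add: poly_0_coeff_0)
    ultimately have "h 1 - h 0 = 0" using pf[of 1] pz[of 1] by simp
    then have "h 1 = h 0" by simp
    then have "(1::complex) = 0" by (rule injD[OF inj])
    then show False by simp
  qed
  then show thesis using eq by (rule that)
qed

text \<open>At an intersection of two curves, the second of which is immersed, the first one is locally a
  reparametrization of the second or the intersection is isolated.\<close>
lemma curve_intersection_scalar:
  fixes u1 v1 u2 v2 :: "complex \<Rightarrow> complex"
  assumes hol: "u1 holomorphic_on UNIV" "v1 holomorphic_on UNIV" "u2 holomorphic_on UNIV" "v2 holomorphic_on UNIV"
    and d: "deriv u2 b \<noteq> 0" and eq: "u1 a = u2 b" "v1 a = v2 b"
  shows "(\<exists>r>0. \<exists>k. k holomorphic_on ball a r \<and> (\<forall>z\<in>ball a r. u1 z = u2 (k z) \<and> v1 z = v2 (k z))) \<or>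
     (\<exists>e>0. \<forall>a'\<in>ball a e. \<forall>b'\<in>ball b e. u1 a' = u2 b' \<and> v1 a' = v2 b' \<longrightarrow> a' = a)"
proof -
  obtain r where r: "r > 0" "inj_on u2 (ball b r)"
    using has_complex_derivative_locally_injective[OF hol(3) _ _ d] by auto
  have hb: "u2 holomorphic_on ball b r" using hol(3) by (rule holomorphic_on_subset) simp
  have op: "open (u2 ` ball b r)" by (rule open_mapping_thm3[OF hb _ r(2)]) simp
  obtain g where g: "g holomorphic_on (u2 ` ball b r)" "\<And>z. z \<in> ball b r \<Longrightarrow> g (u2 z) = z"
    by (rule holomorphic_has_inverse[OF hb open_ball r(2)]) (rule that)
  have cu1: "continuous_on UNIV u1" using hol(1) by (rule holomorphic_on_imp_continuous_on)
  have "open (u1 -` (u2 ` ball b r))" using cu1 op by (rule open_vimage[rotated])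
  moreover have "a \<in> u1 -` (u2 ` ball b r)" using eq(1) r(1) by auto
  ultimately obtain r1 where r1: "r1 > 0" "ball a r1 \<subseteq> u1 -` (u2 ` ball b r)" using openE by blast
  define k where "k = (\<lambda>z. g (u1 z))"
  have "(g \<circ> u1) holomorphic_on ball a r1"
    by (rule holomorphic_on_compose_gen[OF _ g(1)]) (use r1 hol(1) in \<open>auto intro: holomorphic_on_subset\<close>)
  then have holk: "k holomorphic_on ball a r1" by (simp add: k_def o_def)
  have uk: "u2 (k z) = u1 z" if z: "z \<in> ball a r1" for z
  proof -
    obtain y where "y \<in> ball b r" "u1 z = u2 y" using r1(2) z by blast
    then show ?thesis using g(2) by (simp add: k_def)
  qed
  define \<delta> where "\<delta> = (\<lambda>z. v1 z - v2 (k z))"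
  have "(v2 \<circ> k) holomorphic_on ball a r1"
    by (rule holomorphic_on_compose_gen[OF holk hol(4)]) simp
  then have hold: "\<delta> holomorphic_on ball a r1"
    unfolding \<delta>_def by (intro holomorphic_on_diff) (auto simp: o_def intro: holomorphic_on_subset[OF hol(2)])
  have ka: "k a = b" using g(2)[of b] r(1) eq(1) by (simp add: k_def)
  have d0: "\<delta> a = 0" using eq(2) ka by (simp add: \<delta>_def)
  show ?thesis
  proof (cases "\<forall>z\<in>ball a r1. \<delta> z = 0")
    case True
    then have "\<forall>z\<in>ball a r1. u1 z = u2 (k z) \<and> v1 z = v2 (k z)" using uk by (simp add: \<delta>_def)
    then show ?thesis using r1(1) holk by blast
  next
    case False
    then obtain \<beta> where \<beta>: "\<beta> \<in> ball a r1" "\<delta> \<beta> \<noteq> 0" by blast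
    obtain r2 where r2: "0 < r2" "ball a r2 \<subseteq> ball a r1" "\<And>z. z \<in> ball a r2 - {a} \<Longrightarrow> \<delta> z \<noteq> 0"
      using isolated_zeros[OF hold open_ball connected_ball _ d0 \<beta>] r1(1) by auto
    have "a' = a" if a': "a' \<in> ball a (min r r2)" and b': "b' \<in> ball b (min r r2)"
       and e: "u1 a' = u2 b'" "v1 a' = v2 b'" for a' b'
    proof -
      have "k a' = b'" using g(2)[of b'] b' e(1) by (simp add: k_def)
      then have "\<delta> a' = 0" using e(2) by (simp add: \<delta>_def)
      then show ?thesis using r2(3)[of a'] a' by auto
    qed
    then show ?thesis using r(1) r2(1) by (intro disjI2 exI[of _ "min r r2"]) auto
  qed
qed

lemma curve_intersection:
  assumes hol: "holomorphic_curve_on \<phi> UNIV" "holomorphic_curve_on \<psi> UNIV"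
    and d: "curve_deriv 1 \<psi> b \<noteq> 0" and eq: "\<phi> a = \<psi> b"
  shows "(\<exists>r>0. \<exists>k. k holomorphic_on ball a r \<and> (\<forall>z\<in>ball a r. \<phi> z = \<psi> (k z))) \<or>
     (\<exists>e>0. \<forall>a'\<in>ball a e. \<forall>b'\<in>ball b e. \<phi> a' = \<psi> b' \<longrightarrow> a' = a)"
proof (cases "deriv (\<lambda>t. fst (\<psi> t)) b \<noteq> 0")
  case True
  show ?thesis
    using curve_intersection_scalar[of "\<lambda>t. fst (\<phi> t)" "\<lambda>t. snd (\<phi> t)" "\<lambda>t. fst (\<psi> t)" "\<lambda>t. snd (\<psi> t)" b a]
      hol True eq by (simp add: holomorphic_curve_on_def prod_eq_iff)
next
  case False
  then have "deriv (\<lambda>t. snd (\<psi> t)) b \<noteq> 0" using d by (simp add: curve_deriv_def zero_prod_def)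
  then show ?thesis
    using curve_intersection_scalar[of "\<lambda>t. snd (\<phi> t)" "\<lambda>t. fst (\<phi> t)" "\<lambda>t. snd (\<psi> t)" "\<lambda>t. fst (\<psi> t)" b a]
      hol eq by (simp add: holomorphic_curve_on_def prod_eq_iff conj_commute)
qed

text \<open>The points over which the graph of \<open>h\<close> has isolated points are countable in number, as the plane is second
  countable.\<close>
lemma countable_isolated_graph:
  fixes h :: "complex \<Rightarrow> complex"
  assumes iso: "\<And>a. a \<in> F \<Longrightarrow> \<exists>e>0. \<forall>a'\<in>ball a e. h a' \<in> ball (h a) e \<longrightarrow> a' = a"
  shows "countable F"
proof -
  obtain B :: "(complex \<times> complex) set set" where B: "countable B" "topological_basis B"
    using ex_countable_basis by blast
  have "\<exists>V\<in>B. (a, h a) \<in> V \<and> (\<forall>a'. (a', h a') \<in> V \<longrightarrow> a' = a)" if a: "a \<in> F" for a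
  proof -
    obtain e where e: "e > 0" "\<forall>a'\<in>ball a e. h a' \<in> ball (h a) e \<longrightarrow> a' = a" using iso[OF a] by blast
    have "open (ball a e \<times> ball (h a) e)" "(a, h a) \<in> ball a e \<times> ball (h a) e" using e(1) by (auto intro: open_Times)
    then obtain V where "V \<in> B" "(a, h a) \<in> V" "V \<subseteq> ball a e \<times> ball (h a) e"
      by (rule topological_basisE[OF B(2)])
    then show ?thesis using e(2) by blast
  qed
  then obtain V where V: "\<And>a. a \<in> F \<Longrightarrow> V a \<in> B \<and> (a, h a) \<in> V a \<and> (\<forall>a'. (a', h a') \<in> V a \<longrightarrow> a' = a)"
    by metis
  have "inj_on V F" using V by (metis inj_onI)
  moreover have "countable (V ` F)" by (rule countable_subset[OF _ B(1)]) (use V in blast)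
  ultimately show ?thesis by (rule countable_image_inj_on[rotated])
qed

lemma countable_closed_isolated_point:
  fixes F :: "complex set"
  assumes "closed F" "countable F" "F \<noteq> {}"
  shows "\<exists>a\<in>F. \<exists>s>0. ball a s \<inter> F = {a}"
proof (rule ccontr)
  assume neg: "\<not> ?thesis"
  have dense: "F \<subseteq> closure (F - {a})" if aF: "a \<in> F" for a
  proof -
    have "a islimpt F"
      unfolding islimpt_approachable
    proof (intro allI impI)
      fix e :: real assume "e > 0"
      then have "ball a e \<inter> F \<noteq> {a}" using neg aF by blast
      moreover have "a \<in> ball a e \<inter> F" using aF \<open>e > 0\<close> by simp
      ultimately obtain x where "x \<in> ball a e \<inter> F" "x \<noteq> a" by blast
      then show "\<exists>x'\<in>F. x' \<noteq> a \<and> dist x' a < e" by (auto simp: dist_commute)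
    qed
    then have "a islimpt (F - {a})" by (simp only: islimpt_punctured [symmetric])
    then have "a \<in> closure (F - {a})" by (simp add: closure_def)
    then show ?thesis using closure_subset[of "F - {a}"] by blast
  qed
  have "F \<subseteq> closure (\<Inter> ((\<lambda>a. F - {a}) ` F))"
  proof (rule Baire[OF assms(1)])
    show "countable ((\<lambda>a. F - {a}) ` F)" using assms(2) by simp
    fix T assume "T \<in> (\<lambda>a. F - {a}) ` F"
    then obtain a where a: "a \<in> F" "T = F - {a}" by blast
    have "openin (top_of_set F) (F \<inter> (- {a}))" by (rule openin_open_Int) (simp add: open_Compl)
    then show "openin (top_of_set F) T \<and> F \<subseteq> closure T" using a dense by (simp add: Diff_eq)
  qed
  moreover have "\<Inter> ((\<lambda>a. F - {a}) ` F) = {}" using assms(3) by blast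
  ultimately show False using assms(3) by simp
qed

text \<open>Let \<open>h\<close> be the change of parameters from \<open>\<phi>\<close> to \<open>\<psi>\<close>. Where the two curves do not coincide locally, the graph of
  \<open>h\<close> has an isolated point, so the set \<open>F\<close> of points without a neighbourhood on which \<open>h\<close> is holomorphic is
  closed and countable; if it is not empty, it has an isolated point by Baire's theorem. There \<open>h\<close> omits a
  disk of values, by injectivity, so it has a removable singularity or a pole. Both are impossible;
  hence \<open>h\<close> is entire and injective.\<close>
theorem same_range_affine:
  assumes phi: "inj \<phi>" "holomorphic_curve_on \<phi> UNIV" and im: "injective_holomorphic_immersion \<psi>"
    and ran: "range \<phi> = range \<psi>"
  shows "\<exists>\<alpha> \<beta>. \<alpha> \<noteq> 0 \<and> (\<forall>z. \<phi> z = \<psi> (\<alpha> * z + \<beta>))"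
proof -
  have inj: "inj \<phi>" "inj \<psi>" and hol: "holomorphic_curve_on \<phi> UNIV" "holomorphic_curve_on \<psi> UNIV"
    and im2: "\<And>z. curve_deriv 1 \<psi> z \<noteq> 0" using phi im by (auto simp: injective_holomorphic_immersion_def)
  have cont: "continuous_on UNIV \<phi>" "continuous_on UNIV \<psi>"
  proof -
    have c: "continuous_on UNIV \<gamma>" if "holomorphic_curve_on \<gamma> UNIV" for \<gamma>
    proof -
      have "continuous_on UNIV (\<lambda>z. (fst (\<gamma> z), snd (\<gamma> z)))"
        using that by (intro continuous_on_Pair holomorphic_on_imp_continuous_on) (auto simp: holomorphic_curve_on_def)
      then show ?thesis by simp
    qed
    show "continuous_on UNIV \<phi>" "continuous_on UNIV \<psi>" using hol c by auto
  qed
  define h where "h = inv \<psi> \<circ> \<phi>"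
  have \<psi>h: "\<psi> (h a) = \<phi> a" for a
  proof -
    have "\<phi> a \<in> range \<psi>" using ran by blast
    then show ?thesis by (simp add: h_def f_inv_into_f)
  qed
  have hinj: "inj h" by (metis \<psi>h inj(1) injI injD)
  have hk: "h a = b" if "\<psi> b = \<phi> a" for a b using that \<psi>h inj(2) by (metis injD)
  define G where "G = {a. \<exists>r>0. h holomorphic_on ball a r}"
  define F where "F = - G"
  have "open G"
    unfolding open_contains_ball
  proof
    fix a assume "a \<in> G"
    then obtain r where r: "r > 0" "h holomorphic_on ball a r" by (auto simp: G_def)
    have "ball a r \<subseteq> G"
    proof
      fix z assume "z \<in> ball a r"
      then obtain e where "e > 0" "ball z e \<subseteq> ball a r" using open_ball openE by blast
      then show "z \<in> G" using r(2) by (auto simp: G_def intro: holomorphic_on_subset)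
    qed
    then show "\<exists>e>0. ball a e \<subseteq> G" using r(1) by blast
  qed
  then have clF: "closed F" by (simp add: F_def closed_Compl)
  have holG: "h holomorphic_on G"
    unfolding holomorphic_on_def
  proof
    fix a assume "a \<in> G"
    then obtain r where "r > 0" "h holomorphic_on ball a r" by (auto simp: G_def)
    then have "h field_differentiable at a" by (simp add: holomorphic_on_imp_differentiable_at)
    then show "h field_differentiable at a within G" by (rule field_differentiable_at_within)
  qed
  have isoF: "\<exists>e>0. \<forall>a'\<in>ball a e. h a' \<in> ball (h a) e \<longrightarrow> a' = a" if a: "a \<in> F" for a
  proof -
    have "\<not> (\<exists>r>0. \<exists>k. k holomorphic_on ball a r \<and> (\<forall>z\<in>ball a r. \<phi> z = \<psi> (k z)))"
    proof
      assume "\<exists>r>0. \<exists>k. k holomorphic_on ball a r \<and> (\<forall>z\<in>ball a r. \<phi> z = \<psi> (k z))"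
      then obtain r k where k: "r > 0" "k holomorphic_on ball a r" "\<forall>z\<in>ball a r. \<phi> z = \<psi> (k z)" by blast
      have "h holomorphic_on ball a r"
        by (rule holomorphic_transform[OF k(2)]) (use k(3) hk in force)
      then show False using a k(1) by (auto simp: F_def G_def)
    qed
    then obtain e where e: "e > 0" "\<forall>a'\<in>ball a e. \<forall>b'\<in>ball (h a) e. \<phi> a' = \<psi> b' \<longrightarrow> a' = a"
      using curve_intersection[OF hol im2 \<psi>h[of a, symmetric]] by blast
    then have "a' = a" if "a' \<in> ball a e" "h a' \<in> ball (h a) e" for a'
      using that \<psi>h[of a', symmetric] by blast
    then show ?thesis using e(1) by blast
  qed
  have "F = {}"
  proof (rule ccontr)
    assume "F \<noteq> {}"
    then obtain a0 s where a0: "a0 \<in> F" "s > 0" "ball a0 s \<inter> F = {a0}"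
      using countable_closed_isolated_point[OF clF countable_isolated_graph[OF isoF]] by blast
    have hp: "h holomorphic_on ball a0 s - {a0}"
      by (rule holomorphic_on_subset[OF holG]) (use a0 in \<open>auto simp: F_def\<close>)
    define c where "c = a0 + of_real (s / 2)"
    have cin: "c \<in> ball a0 s" "c \<noteq> a0" using a0(2) by (auto simp: c_def dist_norm)
    have "open (ball a0 s - {a0})" by (simp add: open_Diff)
    then obtain t0 where t0: "t0 > 0" "ball c t0 \<subseteq> ball a0 s - {a0}" using cin openE by blast
    define t where "t = min t0 (s / 4)"
    have t: "t > 0" "ball c t \<subseteq> ball a0 s - {a0}" "t \<le> s / 4" using t0 a0(2) by (auto simp: t_def)
    have "open (h ` ball c t)"
      by (rule open_mapping_thm3) (use t hinj in \<open>auto intro: holomorphic_on_subset[OF hp] inj_on_subset\<close>)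
    moreover have "h c \<in> h ` ball c t" using t(1) by simp
    ultimately obtain \<delta> where \<delta>: "\<delta> > 0" "ball (h c) \<delta> \<subseteq> h ` ball c t" using openE by blast
    define s' where "s' = s / 4"
    have s': "s' > 0" "s' \<le> s" using a0(2) by (auto simp: s'_def)
    have disj: "z \<notin> ball c t" if "z \<in> ball a0 s'" for z
    proof
      assume "z \<in> ball c t"
      then have "dist a0 c < s / 4 + s / 4" using that t(3) dist_triangle[of a0 c z]
        by (simp add: s'_def dist_commute)
      then show False using a0(2) by (simp add: c_def dist_norm)
    qed
    \<comment> \<open>The values near h c are already taken in the disk around c.\<close>
    have far: "\<delta> \<le> norm (h z - h c)" if "z \<in> ball a0 s'" for z
    proof (rule ccontr)
      assume "\<not> ?thesis"
      then have "h z \<in> ball (h c) \<delta>" by (simp add: dist_norm norm_minus_commute)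
      then obtain y where "y \<in> ball c t" "h z = h y" using \<delta>(2) by blast
      then show False using disj[OF that] hinj by (auto dest: injD)
    qed
    have hcnz: "h z - h c \<noteq> 0" if "z \<in> ball a0 s'" for z
      using far[OF that] \<delta>(1) by auto
    define q where "q = (\<lambda>z. inverse (h z - h c))"
    have holq: "q holomorphic_on ball a0 s' - {a0}"
      unfolding q_def by (intro holomorphic_intros holomorphic_on_subset[OF hp]) (use s' hcnz in auto)
    have "\<exists>B. eventually (\<lambda>z. norm (q z) \<le> B) (at a0)"
    proof (rule exI[of _ "inverse \<delta>"])
      have "norm (q z) \<le> inverse \<delta>" if "dist z a0 < s'" for z
        using far[of z] that \<delta>(1) by (simp add: q_def norm_inverse dist_commute le_imp_inverse_le)
      then show "eventually (\<lambda>z. norm (q z) \<le> inverse \<delta>) (at a0)"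
        unfolding eventually_at using s'(1) by blast
    qed
    then obtain g where g: "g holomorphic_on ball a0 s'" "\<And>z. z \<in> ball a0 s' - {a0} \<Longrightarrow> g z = q z"
      using holomorphic_on_extend_bounded[OF holq] s'(1) by auto
    have gc: "isCont g a0"
      using g(1) holomorphic_on_imp_continuous_on continuous_on_eq_continuous_at[of "ball a0 s'" g] s'(1) by auto
    have phic: "isCont \<phi> a0" using cont(1) by (simp add: continuous_on_eq_continuous_at)
    show False
    proof (cases "g a0 = 0")
      case False
      obtain e where e: "e > 0" "\<And>z. dist z a0 < e \<Longrightarrow> g z \<noteq> 0"
        using continuous_at_avoid[OF gc False] by (auto simp: dist_commute)
      define e' where "e' = min e s'"
      have e': "e' > 0" "e' \<le> e" "e' \<le> s'" using e s' by (auto simp: e'_def)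
      define k where "k = (\<lambda>z. h c + inverse (g z))"
      have holk: "k holomorphic_on ball a0 e'"
        unfolding k_def using e(2) e' by (intro holomorphic_intros holomorphic_on_subset[OF g(1)]) (auto simp: dist_commute)
      have kh: "k z = h z" if "z \<in> ball a0 e' - {a0}" for z
        using g(2)[of z] that e' by (simp add: k_def q_def)
      have kc: "isCont k a0"
        using holk holomorphic_on_imp_continuous_on continuous_on_eq_continuous_at[of "ball a0 e'" k] e'(1) by auto
      \<comment> \<open>A removable singularity: continuity of the two curves identifies the value at a0.\<close>
      have "isCont \<psi> (k a0)" using cont(2) by (simp add: continuous_on_eq_continuous_at)
      then have "((\<lambda>z. \<psi> (k z)) \<longlongrightarrow> \<psi> (k a0)) (at a0)"
        using kc isCont_o2 isCont_def by blast
      then have "(\<phi> \<longlongrightarrow> \<psi> (k a0)) (at a0)"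
      proof (rule Lim_transform_eventually)
        have "\<psi> (k z) = \<phi> z" if "z \<noteq> a0" "dist z a0 < e'" for z
          using kh[of z] that \<psi>h by (simp add: dist_commute)
        then show "eventually (\<lambda>z. \<psi> (k z) = \<phi> z) (at a0)"
          unfolding eventually_at using e'(1) by blast
      qed
      moreover have "(\<phi> \<longlongrightarrow> \<phi> a0) (at a0)" using phic by (simp add: isCont_def)
      ultimately have "\<psi> (k a0) = \<phi> a0" by (rule tendsto_unique[OF at_neq_bot])
      then have "k a0 = h a0" using hk[of "k a0" a0] by simp
      then have "h z = k z" if "z \<in> ball a0 e'" for z using kh[of z] that by (cases "z = a0") auto
      then have "h holomorphic_on ball a0 e'" by (intro holomorphic_transform[OF holk]) simp
      then show False using a0(1) e'(1) by (auto simp: F_def G_def)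
    next
      case True
      have "\<not> g constant_on ball a0 s'"
      proof
        assume "g constant_on ball a0 s'"
        then have "g (a0 + of_real (s' / 2)) = g a0"
          using s'(1) unfolding constant_on_def by (auto simp: dist_norm)
        moreover have "g (a0 + of_real (s' / 2)) = q (a0 + of_real (s' / 2))"
          using g(2) s'(1) by (simp add: dist_norm)
        moreover have "q (a0 + of_real (s' / 2)) \<noteq> 0"
          using hcnz[of "a0 + of_real (s' / 2)"] s'(1) by (simp add: q_def dist_norm)
        ultimately show False using True by simp
      qed
      moreover define e where "e = s' / 2"
      moreover have e: "e > 0" "ball a0 e \<subseteq> ball a0 s'" using s'(1) by (auto simp: e_def)
      ultimately have "open (g ` ball a0 e)"
        using open_mapping_thm[OF g(1) open_ball connected_ball open_ball] by blast
      moreover have "0 \<in> g ` ball a0 e" using True e(1) by (intro image_eqI[of _ _ a0]) auto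
      ultimately obtain \<eta> where \<eta>: "\<eta> > 0" "ball 0 \<eta> \<subseteq> g ` ball a0 e" using openE by blast
      \<comment> \<open>At a pole, h would take all large values near a0, so the image of \<psi> would be bounded, against Liouville's theorem.\<close>
      have cov: "\<psi> w \<in> \<phi> ` cball a0 e" if "norm (w - h c) > 1 / \<eta>" for w
      proof -
        have wn: "w - h c \<noteq> 0" using that \<eta>(1) by auto
        have "norm (inverse (w - h c)) < \<eta>"
        proof -
          have "1 < \<eta> * norm (w - h c)" using that \<eta>(1) by (simp add: field_simps)
          then show ?thesis using wn by (simp add: norm_inverse norm_divide divide_simps mult.commute)
        qed
        then obtain z where z: "z \<in> ball a0 e" "g z = inverse (w - h c)" using \<eta>(2) by force
        have "z \<noteq> a0" using z(2) True wn by auto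
        then have "inverse (h z - h c) = inverse (w - h c)" using g(2)[of z] z e(2) by (auto simp: q_def)
        then have "h z = w" by simp
        then have "\<psi> w = \<phi> z" using \<psi>h by metis
        then show ?thesis using z(1) by auto
      qed
      have bnd: "bounded (range \<psi>)"
      proof (rule bounded_subset)
        have "compact (\<phi> ` cball a0 e)" "compact (\<psi> ` cball (h c) (1 / \<eta>))"
          by (auto intro!: compact_continuous_image continuous_on_subset[OF cont(1)] continuous_on_subset[OF cont(2)])
        then show "bounded (\<phi> ` cball a0 e \<union> \<psi> ` cball (h c) (1 / \<eta>))"
          by (simp add: compact_imp_bounded)
        show "range \<psi> \<subseteq> \<phi> ` cball a0 e \<union> \<psi> ` cball (h c) (1 / \<eta>)"
        proof
          fix y assume "y \<in> range \<psi>"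
          then obtain w where w: "y = \<psi> w" by blast
          show "y \<in> \<phi> ` cball a0 e \<union> \<psi> ` cball (h c) (1 / \<eta>)"
          proof (cases "norm (w - h c) > 1 / \<eta>")
            case True then show ?thesis using cov w by blast
          next
            case False
            then have "w \<in> cball (h c) (1 / \<eta>)" by (simp add: dist_norm norm_minus_commute)
            then show ?thesis using w by blast
          qed
        qed
      qed
      then obtain M where M: "\<And>z. norm (\<psi> z) \<le> M" by (auto simp: bounded_iff)
      have "norm (fst (\<psi> z)) \<le> M" "norm (snd (\<psi> z)) \<le> M" for z
        using M[of z] norm_fst_le[of "fst (\<psi> z)" "snd (\<psi> z)"] norm_snd_le[of "snd (\<psi> z)" "fst (\<psi> z)"] by auto
      then have "bounded (range (\<lambda>z. fst (\<psi> z)))" "bounded (range (\<lambda>z. snd (\<psi> z)))"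
        by (auto intro!: boundedI[of _ M])
      then have "(\<lambda>z. fst (\<psi> z)) constant_on UNIV" "(\<lambda>z. snd (\<psi> z)) constant_on UNIV"
        using hol(2) by (auto simp: holomorphic_curve_on_def intro: Liouville_theorem)
      then have "\<psi> 0 = \<psi> 1" by (auto simp: constant_on_def prod_eq_iff)
      then show False using inj(2) by (auto dest: injD)
    qed
  qed
  then have "G = UNIV" by (auto simp: F_def)
  then have "h holomorphic_on UNIV" using holG by simp
  then obtain \<alpha> \<beta> where "\<alpha> \<noteq> 0" "\<And>z. h z = \<alpha> * z + \<beta>"
    using hinj by (rule entire_injective_affine) (rule that)
  then show ?thesis using \<psi>h by (intro exI[of _ \<alpha>] exI[of _ \<beta>]) simp
qed

section \<open>Resultants of holomorphic functions of one variable\<close>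

lemma minimum_modulus_zero:
  assumes hol: "f holomorphic_on S" and S: "open S" "cball c r \<subseteq> S" and r: "r > 0"
    and sph: "\<And>z. z \<in> sphere c r \<Longrightarrow> \<delta> \<le> norm (f z)" and small: "norm (f c) < \<delta>"
  shows "\<exists>z\<in>ball c r. f z = 0"
proof (rule ccontr)
  assume neg: "\<not> ?thesis"
  have d: "\<delta> > 0" using small norm_ge_zero[of "f c"] by linarith
  have nz: "f z \<noteq> 0" if "z \<in> cball c r" for z
  proof (cases "z \<in> ball c r")
    case False
    then have "z \<in> sphere c r" using that by auto
    then show ?thesis using sph[of z] d by auto
  qed (use neg in blast)
  have holi: "(\<lambda>z. inverse (f z)) holomorphic_on cball c r"
    by (intro holomorphic_on_inverse holomorphic_on_subset[OF hol S(2)]) (use nz in blast)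
  have "norm (inverse (f c)) \<le> inverse \<delta>"
  proof (rule maximum_modulus_frontier[of "\<lambda>z. inverse (f z)" "cball c r" "inverse \<delta>" c])
    show "(\<lambda>z. inverse (f z)) holomorphic_on interior (cball c r)"
      using holi by (rule holomorphic_on_subset) (rule interior_subset)
    show "continuous_on (closure (cball c r)) (\<lambda>z. inverse (f z))"
      using holomorphic_on_imp_continuous_on[OF holi] by simp
    show "norm (inverse (f z)) \<le> inverse \<delta>" if "z \<in> frontier (cball c r)" for z
      using sph[of z] that d r by (simp add: norm_inverse le_imp_inverse_le)
  qed (use r in auto)
  moreover have "f c \<noteq> 0" using nz[of c] r by simp
  ultimately have "\<delta> \<le> norm (f c)" using d by (simp add: norm_inverse)
  then show False using small by simp
qed

subsection \<open>Newton's identities\<close>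

text \<open>The coefficients of a product of such factors are the elementary symmetric functions of the \<open>v\<close>.\<close>
definition root_gen :: "complex \<Rightarrow> complex fps" where
  "root_gen v = 1 + fps_const v * fps_X"

lemma root_gen_deriv:
  "fps_deriv (root_gen v ^ n) = root_gen v ^ n * (of_nat n * Abs_fps (\<lambda>i. (-1) ^ i * v ^ Suc i))"
proof -
  let ?G = "Abs_fps (\<lambda>i. (-1) ^ i * v ^ Suc i)"
  have G: "root_gen v * ?G = fps_const v"
  proof (rule fps_ext)
    fix i
    show "(root_gen v * ?G) $ i = fps_const v $ i"
      by (cases i) (simp_all add: root_gen_def distrib_right mult.assoc)
  qed
  have d: "fps_deriv (root_gen v) = fps_const v" by (simp add: root_gen_def)
  show ?thesis
  proof (induction n)
    case (Suc n)
    have "fps_deriv (root_gen v ^ Suc n) = fps_const v * root_gen v ^ n + root_gen v * (root_gen v ^ n * (of_nat n * ?G))"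
      unfolding power_Suc fps_deriv_mult d Suc by (rule add.commute)
    also have "\<dots> = (root_gen v * ?G) * root_gen v ^ n + root_gen v * (root_gen v ^ n * (of_nat n * ?G))"
      by (simp only: G)
    also have "\<dots> = root_gen v ^ Suc n * (of_nat (Suc n) * ?G)"
      by (simp only: power_Suc of_nat_Suc) (simp only: distrib_left distrib_right mult_1_left mult_ac)
    finally show ?case .
  qed simp
qed

text \<open>Newton's identities for the elementary symmetric functions and the power sums, with multiplicities.\<close>
lemma newton_identity:
  assumes "finite Z"
  shows "of_nat (Suc k) * (\<Prod>b\<in>Z. root_gen (v b) ^ n b) $ Suc k =
     (\<Sum>i=0..k. (\<Prod>b\<in>Z. root_gen (v b) ^ n b) $ i * ((-1) ^ (k - i) * (\<Sum>b\<in>Z. of_nat (n b) * v b ^ Suc (k - i))))"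
proof -
  let ?E = "\<lambda>Z. \<Prod>b\<in>Z. root_gen (v b) ^ n b"
  let ?L = "\<lambda>Z. \<Sum>b\<in>Z. of_nat (n b) * Abs_fps (\<lambda>i. (-1) ^ i * v b ^ Suc i)"
  have d: "fps_deriv (?E Z) = ?E Z * ?L Z"
    using assms
  proof (induction Z)
    case (insert x Z)
    have "fps_deriv (?E (insert x Z)) = fps_deriv (root_gen (v x) ^ n x) * ?E Z + root_gen (v x) ^ n x * fps_deriv (?E Z)"
      using insert.hyps by (simp add: mult_ac)
    also have "\<dots> = ?E (insert x Z) * ?L (insert x Z)"
      unfolding insert.IH root_gen_deriv using insert.hyps by (simp add: algebra_simps)
    finally show ?case .
  qed simp
  have L: "?L Z $ i = (-1) ^ i * (\<Sum>b\<in>Z. of_nat (n b) * v b ^ Suc i)" for i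
    by (simp add: fps_sum_nth fps_of_nat [symmetric] sum_distrib_left mult_ac)
  have "of_nat (Suc k) * ?E Z $ Suc k = fps_deriv (?E Z) $ k" by (simp add: mult.commute)
  also have "\<dots> = (\<Sum>i=0..k. ?E Z $ i * ?L Z $ (k - i))" unfolding d by (rule fps_mult_nth)
  finally show ?thesis by (simp only: L)
qed

lemma fps_top_mult:
  fixes A B :: "complex fps"
  assumes "\<And>i. i > m \<Longrightarrow> A $ i = 0" "\<And>i. i > n \<Longrightarrow> B $ i = 0"
  shows "(A * B) $ (m + n) = A $ m * B $ n" "i > m + n \<Longrightarrow> (A * B) $ i = 0"
proof -
  have "(A * B) $ (m + n) = (\<Sum>i=0..m + n. if i = m then A $ m * B $ n else 0)"
    unfolding fps_mult_nth
  proof (intro sum.cong refl)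
    fix i assume "i \<in> {0..m + n}"
    then show "A $ i * B $ (m + n - i) = (if i = m then A $ m * B $ n else 0)"
      using assms(1)[of i] assms(2)[of "m + n - i"] by (cases i m rule: linorder_cases) auto
  qed
  then show "(A * B) $ (m + n) = A $ m * B $ n" by simp
  show "(A * B) $ i = 0" if i: "i > m + n"
    unfolding fps_mult_nth
  proof (intro sum.neutral ballI)
    fix j assume "j \<in> {0..i}"
    then show "A $ j * B $ (i - j) = 0" using assms(1)[of j] assms(2)[of "i - j"] i by (cases "j > m") auto
  qed
qed

lemma root_gen_top:
  assumes "finite Z"
  shows "(\<Prod>b\<in>Z. root_gen (v b) ^ n b) $ (\<Sum>b\<in>Z. n b) = (\<Prod>b\<in>Z. v b ^ n b) \<and>
     (\<forall>i > (\<Sum>b\<in>Z. n b). (\<Prod>b\<in>Z. root_gen (v b) ^ n b) $ i = 0)"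
  using assms
proof (induction Z)
  case (insert x Z)
  have one: "root_gen u ^ k $ k = u ^ k \<and> (\<forall>i>k. root_gen u ^ k $ i = 0)" for u k
  proof (induction k)
    case (Suc k)
    have r: "root_gen u $ i = (if i = 0 then 1 else if i = 1 then u else 0)" for i
      by (cases i) (auto simp: root_gen_def)
    have b1: "root_gen u $ i = 0" if "i > 1" for i using that by (simp add: r)
    have b2: "root_gen u ^ k $ i = 0" if "i > k" for i using Suc that by blast
    show ?case using fps_top_mult[of 1 "root_gen u" k "root_gen u ^ k"] b1 b2 Suc by (simp add: r)
  qed (auto simp: fps_one_nth)
  have b1: "root_gen (v x) ^ n x $ i = 0" if "i > n x" for i using one that by blast
  have b2: "(\<Prod>b\<in>Z. root_gen (v b) ^ n b) $ i = 0" if "i > (\<Sum>b\<in>Z. n b)" for i using insert.IH that by blast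
  show ?case
    using fps_top_mult[of "n x" "root_gen (v x) ^ n x" "\<Sum>b\<in>Z. n b" "\<Prod>b\<in>Z. root_gen (v b) ^ n b"] b1 b2 insert one
    by simp
qed (simp add: fps_one_nth)

text \<open>By Newton's identities, the product of values with multiplicities is holomorphic if their
  power sums are and their total number is constant.\<close>
lemma product_holomorphic_from_power_sums:
  assumes fin: "\<And>a. a \<in> T \<Longrightarrow> finite (Z a)"
    and m: "\<And>a. a \<in> T \<Longrightarrow> (\<Sum>b\<in>Z a. n a b) = m"
    and p: "\<And>j. (\<lambda>a. \<Sum>b\<in>Z a. of_nat (n a b) * v a b ^ Suc j) holomorphic_on T"
  shows "(\<lambda>a. \<Prod>b\<in>Z a. (v a b :: complex) ^ n a b) holomorphic_on T"
proof -
  let ?E = "\<lambda>a. \<Prod>b\<in>Z a. root_gen (v a b) ^ n a b"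
  have e: "(\<lambda>a. ?E a $ k) holomorphic_on T" for k
  proof (induction k rule: less_induct)
    case (less k)
    show ?case
    proof (cases k)
      case 0
      have "?E a $ k = 1" if "a \<in> T" for a
        using fin[OF that] unfolding 0
        by (induction rule: finite_induct) (simp_all add: fps_power_zeroth root_gen_def)
      then show ?thesis by (intro holomorphic_transform[OF holomorphic_on_const[of 1]]) auto
    next
      case (Suc l)
      have "(\<lambda>a. (\<Sum>i=0..l. ?E a $ i * ((-1) ^ (l - i) * (\<Sum>b\<in>Z a. of_nat (n a b) * v a b ^ Suc (l - i)))) / of_nat (Suc l)) holomorphic_on T"
        by (intro holomorphic_intros less p) (auto simp: Suc simp del: of_nat_Suc)
      then show ?thesis
      proof (rule holomorphic_transform)
        fix a assume a: "a \<in> T"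
        have h: "of_nat (Suc l) * ?E a $ Suc l =
          (\<Sum>i=0..l. ?E a $ i * ((-1) ^ (l - i) * (\<Sum>b\<in>Z a. of_nat (n a b) * v a b ^ Suc (l - i))))"
          by (rule newton_identity[OF fin[OF a]])
        have nz: "(of_nat (Suc l) :: complex) \<noteq> 0" by (rule of_nat_neq_0)
        show "(\<Sum>i=0..l. ?E a $ i * ((-1) ^ (l - i) * (\<Sum>b\<in>Z a. of_nat (n a b) * v a b ^ Suc (l - i)))) / of_nat (Suc l) = ?E a $ k"
          unfolding Suc by (subst h [symmetric]) (rule nonzero_mult_div_cancel_left[OF nz])
      qed
    qed
  qed
  show ?thesis
  proof (rule holomorphic_transform[OF e[of m]])
    fix a assume a: "a \<in> T"
    show "?E a $ m = (\<Prod>b\<in>Z a. v a b ^ n a b)"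
      using root_gen_top[OF fin[OF a], of "v a" "n a"] m[OF a] by simp
  qed
qed

subsection \<open>Sums over the roots of an equation\<close>

lemma param_integral_holomorphic:
  assumes r: "\<rho> > 0" and F: "continuous_on (sphere 0 \<rho>) F" and u: "continuous_on (sphere 0 \<rho>) u"
    and far: "\<And>b. b \<in> sphere 0 \<rho> \<Longrightarrow> u b \<notin> ball u0 \<eta>"
  shows "(\<lambda>\<zeta>. contour_integral (circlepath 0 \<rho>) (\<lambda>b. F b / (u b - \<zeta>))) holomorphic_on ball u0 \<eta>"
proof -
  let ?g = "circlepath 0 \<rho> :: real \<Rightarrow> complex"
  let ?g' = "\<lambda>t. 2 * of_real pi * \<i> * of_real \<rho> * exp (2 * of_real pi * \<i> * of_real t)"
  have gs: "?g t \<in> sphere 0 \<rho>" for t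
    using r by (simp add: circlepath_def part_circlepath_def norm_mult)
  have contg: "continuous_on A ?g" for A
    unfolding circlepath_def part_circlepath_def linepath_def by (intro continuous_intros)
  have cF: "continuous_on A (\<lambda>t. F (?g t))" for A
    by (rule continuous_on_compose2[OF F contg]) (use gs in auto)
  have cu: "continuous_on A (\<lambda>t. u (?g t))" for A
    by (rule continuous_on_compose2[OF u contg]) (use gs in auto)
  have nz: "u (?g t) - \<zeta> \<noteq> 0" if "\<zeta> \<in> ball u0 \<eta>" for t \<zeta>
    using far[OF gs[of t]] that by auto
  have "(\<lambda>\<zeta>. integral (cbox 0 1) (\<lambda>t. F (?g t) / (u (?g t) - \<zeta>) * ?g' t)) holomorphic_on ball u0 \<eta>"
  proof (rule leibniz_rule_holomorphic)
    show "((\<lambda>\<zeta>. F (?g t) / (u (?g t) - \<zeta>) * ?g' t) has_field_derivative F (?g t) / (u (?g t) - \<zeta>)\<^sup>2 * ?g' t) (at \<zeta> within ball u0 \<eta>)"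
      if "\<zeta> \<in> ball u0 \<eta>" for \<zeta> t
      using nz[OF that, of t]
      by (auto intro!: derivative_eq_intros simp: power2_eq_square field_simps)
    show "(\<lambda>t. F (?g t) / (u (?g t) - \<zeta>) * ?g' t) integrable_on cbox 0 1" if "\<zeta> \<in> ball u0 \<eta>" for \<zeta>
      by (intro integrable_continuous continuous_intros cF cu) (use nz[OF that] in auto)
    show "continuous_on (ball u0 \<eta> \<times> cbox 0 1) (\<lambda>(\<zeta>, t). F (?g t) / (u (?g t) - \<zeta>)\<^sup>2 * ?g' t)"
    proof -
      have c1: "continuous_on (ball u0 \<eta> \<times> cbox 0 1) (\<lambda>x. F (?g (snd x)))"
        by (rule continuous_on_compose2[OF cF[of UNIV]]) (auto intro: continuous_intros)
      have c2: "continuous_on (ball u0 \<eta> \<times> cbox 0 1) (\<lambda>x. u (?g (snd x)))"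
        by (rule continuous_on_compose2[OF cu[of UNIV]]) (auto intro: continuous_intros)
      show ?thesis unfolding split_beta
        by (intro continuous_intros c1 c2) (use nz in auto)
    qed
  qed simp
  then show ?thesis
    by (simp add: contour_integral_integral vector_derivative_circlepath cbox_interval mult_ac)
qed

text \<open>The solutions of \<open>u b = \<zeta>\<close> in the disk of radius \<open>\<rho>\<close>.\<close>
definition roots_in :: "(complex \<Rightarrow> complex) \<Rightarrow> real \<Rightarrow> complex \<Rightarrow> complex set" where
  "roots_in u \<rho> \<zeta> = {b\<in>ball 0 \<rho>. u b = \<zeta>}"

text \<open>The multiplicity of such a solution.\<close>
definition root_mult :: "(complex \<Rightarrow> complex) \<Rightarrow> complex \<Rightarrow> complex \<Rightarrow> nat" where
  "root_mult u \<zeta> b = nat (zorder (\<lambda>b. u b - \<zeta>) b)"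

text \<open>Sums over the solutions, counted with multiplicity, depend holomorphically on the right hand side, by
  the argument principle.\<close>
lemma root_sums:
  assumes hol: "u holomorphic_on ball 0 r1" and r: "0 < \<rho>" "\<rho> < r1"
    and far: "\<And>b. b \<in> sphere 0 \<rho> \<Longrightarrow> u b \<notin> ball u0 \<eta>"
  shows "\<zeta> \<in> ball u0 \<eta> \<Longrightarrow> finite (roots_in u \<rho> \<zeta>)"
    and "\<zeta> \<in> ball u0 \<eta> \<Longrightarrow> b \<in> roots_in u \<rho> \<zeta> \<Longrightarrow> root_mult u \<zeta> b \<ge> 1"
    and "h holomorphic_on ball 0 r1 \<Longrightarrow>
      (\<lambda>\<zeta>. \<Sum>b\<in>roots_in u \<rho> \<zeta>. of_nat (root_mult u \<zeta> b) * h b) holomorphic_on ball u0 \<eta>"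
proof -
  define r2 where "r2 = (\<rho> + r1) / 2"
  have r2: "\<rho> < r2" "r2 < r1" using r by (auto simp: r2_def)
  have sub: "cball 0 r2 \<subseteq> ball (0::complex) r1" using r2 by auto
  have hu: "(\<lambda>b. u b - \<zeta>) holomorphic_on ball 0 r1" for \<zeta> by (intro holomorphic_intros hol)
  have nc: "\<not> (\<lambda>b. u b - \<zeta>) constant_on ball 0 r1 \<or> (\<forall>b\<in>ball 0 r1. u b \<noteq> \<zeta>)" if "\<zeta> \<in> ball u0 \<eta>" for \<zeta>
  proof (rule disjCI)
    assume "\<not> (\<forall>b\<in>ball 0 r1. u b \<noteq> \<zeta>)"
    then obtain b where b: "b \<in> ball 0 r1" "u b = \<zeta>" by blast
    have "(of_real \<rho> :: complex) \<in> sphere 0 \<rho>" "(of_real \<rho> :: complex) \<in> ball 0 r1" using r by auto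
    then have "u (of_real \<rho>) - \<zeta> \<noteq> 0" using far[of "of_real \<rho>"] that by auto
    then show "\<not> (\<lambda>b. u b - \<zeta>) constant_on ball 0 r1"
      using b \<open>of_real \<rho> \<in> ball 0 r1\<close> unfolding constant_on_def by (metis eq_iff_diff_eq_0)
  qed
  have finz: "finite {b\<in>cball 0 r2. u b - \<zeta> = 0}" if z: "\<zeta> \<in> ball u0 \<eta>" for \<zeta>
    using nc[OF z]
  proof
    assume "\<not> (\<lambda>b. u b - \<zeta>) constant_on ball 0 r1"
    then show ?thesis by (intro holomorphic_compact_finite_zeros[OF hu]) (use sub in auto)
  next
    assume "\<forall>b\<in>ball 0 r1. u b \<noteq> \<zeta>"
    then have "{b\<in>cball 0 r2. u b - \<zeta> = 0} = {}" using sub by auto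
    then show ?thesis by (simp only: finite.emptyI)
  qed
  show fin: "finite (roots_in u \<rho> \<zeta>)" if "\<zeta> \<in> ball u0 \<eta>" for \<zeta>
    by (rule finite_subset[OF _ finz[OF that]]) (use r2 in \<open>auto simp: roots_in_def\<close>)
  have zp: "zorder (\<lambda>b. u b - \<zeta>) b > 0" if z: "\<zeta> \<in> ball u0 \<eta>" and b: "b \<in> ball 0 r1" "u b = \<zeta>" for \<zeta> b
  proof -
    have "(of_real \<rho> :: complex) \<in> ball 0 r1" using r by auto
    moreover have "u (of_real \<rho>) - \<zeta> \<noteq> 0" using far[of "of_real \<rho>"] z r by auto
    ultimately have "\<exists>w\<in>ball 0 r1. u w - \<zeta> \<noteq> 0" by blast
    from zorder_exist_zero[OF hu open_ball connected_ball b(1) this] show ?thesis using b(2) by simp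
  qed
  show "root_mult u \<zeta> b \<ge> 1" if "\<zeta> \<in> ball u0 \<eta>" "b \<in> roots_in u \<rho> \<zeta>"
  proof -
    have "zorder (\<lambda>b. u b - \<zeta>) b > 0" using zp[OF that(1), of b] that(2) r by (simp add: roots_in_def)
    then show ?thesis by (simp add: root_mult_def)
  qed
  show "(\<lambda>\<zeta>. \<Sum>b\<in>roots_in u \<rho> \<zeta>. of_nat (root_mult u \<zeta> b) * h b) holomorphic_on ball u0 \<eta>"
    if h: "h holomorphic_on ball 0 r1"
  proof -
    have ss: "sphere 0 \<rho> \<subseteq> ball (0::complex) r1" using r by auto
    have du: "deriv u holomorphic_on ball 0 r1" by (intro holomorphic_deriv hol) simp
    have "(\<lambda>\<zeta>. contour_integral (circlepath 0 \<rho>) (\<lambda>b. deriv u b * h b / (u b - \<zeta>))) holomorphic_on ball u0 \<eta>"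
      by (rule param_integral_holomorphic[OF r(1) _ _ far])
        (auto intro!: holomorphic_on_imp_continuous_on holomorphic_on_mult holomorphic_on_subset[OF du ss]
          holomorphic_on_subset[OF h ss] holomorphic_on_subset[OF hol ss])
    then have "(\<lambda>\<zeta>. contour_integral (circlepath 0 \<rho>) (\<lambda>b. deriv u b * h b / (u b - \<zeta>)) / (of_real (2 * pi) * \<i>)) holomorphic_on ball u0 \<eta>"
      by (intro holomorphic_intros) auto
    then show ?thesis
    proof (rule holomorphic_transform)
      fix \<zeta> assume z: "\<zeta> \<in> ball u0 \<eta>"
      let ?f = "\<lambda>b. u b - \<zeta>" and ?S = "ball (0::complex) r2"
      let ?Z = "{w \<in> ?S. ?f w = 0 \<or> w \<in> {}}"
      have sS: "?S \<subseteq> ball 0 r1" using sub by auto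
      have finZ: "finite ?Z" by (rule finite_subset[OF _ finz[OF z]]) auto
      have pim: "path_image (circlepath 0 \<rho>) = sphere 0 \<rho>" using r by simp
      have sz: "w \<notin> sphere 0 \<rho>" if "?f w = 0" for w using far[of w] that z by auto
      have "contour_integral (circlepath 0 \<rho>) (\<lambda>x. deriv ?f x * h x / ?f x) =
         of_real (2 * pi) * \<i> * (\<Sum>p\<in>?Z. winding_number (circlepath 0 \<rho>) p * h p * of_int (zorder ?f p))"
      proof (rule argument_principle)
        show "?f holomorphic_on ?S - {}" using holomorphic_on_subset[OF hu sS] by simp
        show "h holomorphic_on ?S" by (rule holomorphic_on_subset[OF h sS])
        show "path_image (circlepath 0 \<rho>) \<subseteq> ?S - ?Z"
          unfolding pim using sz r2 by auto
        show "\<forall>p. p \<notin> ?S \<longrightarrow> winding_number (circlepath 0 \<rho>) p = 0"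
        proof (intro allI impI)
          fix p assume "p \<notin> ?S"
          then show "winding_number (circlepath 0 \<rho>) p = 0"
            using r2 r(1) by (intro winding_number_zero_outside[of _ "cball 0 \<rho>"]) (auto simp: pim)
        qed
        show "finite ?Z" by (rule finZ)
      qed auto
      also have "(\<Sum>p\<in>?Z. winding_number (circlepath 0 \<rho>) p * h p * of_int (zorder ?f p)) =
          (\<Sum>p\<in>roots_in u \<rho> \<zeta>. winding_number (circlepath 0 \<rho>) p * h p * of_int (zorder ?f p))"
      proof (rule sum.mono_neutral_right[OF finZ])
        show "roots_in u \<rho> \<zeta> \<subseteq> ?Z" using r2 by (auto simp: roots_in_def)
        show "\<forall>i\<in>?Z - roots_in u \<rho> \<zeta>. winding_number (circlepath 0 \<rho>) i * h i * of_int (zorder ?f i) = 0"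
        proof
          fix i assume i: "i \<in> ?Z - roots_in u \<rho> \<zeta>"
          then have "i \<notin> cball 0 \<rho>" using sz[of i] by (auto simp: roots_in_def)
          then have "winding_number (circlepath 0 \<rho>) i = 0"
            by (intro winding_number_zero_outside[of _ "cball 0 \<rho>"]) (use r in \<open>auto simp: pim\<close>)
          then show "winding_number (circlepath 0 \<rho>) i * h i * of_int (zorder ?f i) = 0" by simp
        qed
      qed
      also have "\<dots> = (\<Sum>b\<in>roots_in u \<rho> \<zeta>. of_nat (root_mult u \<zeta> b) * h b)"
      proof (rule sum.cong[OF refl])
        fix b assume b: "b \<in> roots_in u \<rho> \<zeta>"
        have "winding_number (circlepath 0 \<rho>) b = 1"
          using b by (intro winding_number_circlepath) (auto simp: roots_in_def)
        moreover have "of_nat (root_mult u \<zeta> b) = (of_int (zorder ?f b) :: complex)"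
          using zp[OF z, of b] b r by (simp add: root_mult_def roots_in_def)
        ultimately show "winding_number (circlepath 0 \<rho>) b * h b * of_int (zorder ?f b) = of_nat (root_mult u \<zeta> b) * h b"
          by simp
      qed
      finally have ap: "contour_integral (circlepath 0 \<rho>) (\<lambda>x. deriv ?f x * h x / ?f x) =
         of_real (2 * pi) * \<i> * (\<Sum>b\<in>roots_in u \<rho> \<zeta>. of_nat (root_mult u \<zeta> b) * h b)" .
      have "contour_integral (circlepath 0 \<rho>) (\<lambda>b. deriv u b * h b / (u b - \<zeta>)) =
          contour_integral (circlepath 0 \<rho>) (\<lambda>x. deriv ?f x * h x / ?f x)"
      proof (rule contour_integral_cong[OF refl])
        fix x assume "x \<in> path_image (circlepath 0 \<rho>)"
        then have "x \<in> ball 0 r1" using r by (auto simp: pim)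
        then have "u field_differentiable at x" using hol by (simp add: holomorphic_on_imp_differentiable_at)
        then have "deriv ?f x = deriv u x" by simp
        then show "deriv u x * h x / (u x - \<zeta>) = deriv ?f x * h x / ?f x" by simp
      qed
      then show "contour_integral (circlepath 0 \<rho>) (\<lambda>b. deriv u b * h b / (u b - \<zeta>)) / (of_real (2 * pi) * \<i>) =
         (\<Sum>b\<in>roots_in u \<rho> \<zeta>. of_nat (root_mult u \<zeta> b) * h b)"
        unfolding ap by simp
    qed
  qed
qed

text \<open>The resultant of the equations \<open>u b = z a\<close> and \<open>g b = w a\<close> for \<open>b\<close>, as a function of \<open>a\<close>. It vanishes
  exactly where they have a common solution in the disk.\<close>
lemma root_resultant_holomorphic:
  assumes hol: "u holomorphic_on ball 0 r1" "g holomorphic_on ball 0 r1" and r: "0 < \<rho>" "\<rho> < r1"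
    and far: "\<And>b. b \<in> sphere 0 \<rho> \<Longrightarrow> u b \<notin> ball u0 \<eta>" and eta: "\<eta> > 0"
    and zw: "z holomorphic_on T" "w holomorphic_on T" and zT: "z ` T \<subseteq> ball u0 \<eta>"
  shows "(\<lambda>a. \<Prod>b\<in>roots_in u \<rho> (z a). (w a - g b) ^ root_mult u (z a) b) holomorphic_on T"
    and "\<exists>m. \<forall>a\<in>T. (\<Sum>b\<in>roots_in u \<rho> (z a). root_mult u (z a) b) = m"
proof -
  note rs = root_sums[OF hol(1) r far]
  let ?s = "\<lambda>i \<zeta>. \<Sum>b\<in>roots_in u \<rho> \<zeta>. of_nat (root_mult u \<zeta> b) * g b ^ i"
  have s: "?s i holomorphic_on ball u0 \<eta>" for i
    by (rule rs(3), assumption) (intro holomorphic_intros hol)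
  have sz: "(\<lambda>a. ?s i (z a)) holomorphic_on T" for i
    using holomorphic_on_compose_gen[OF zw(1) s zT] by (simp add: o_def)
  let ?N = "\<lambda>\<zeta>. of_nat (\<Sum>b\<in>roots_in u \<rho> \<zeta>. root_mult u \<zeta> b) :: complex"
  have "?N holomorphic_on ball u0 \<eta>" using s[of 0] by simp
  then have "continuous_on (ball u0 \<eta>) ?N" by (rule holomorphic_on_imp_continuous_on)
  then have "?N constant_on ball u0 \<eta>"
  proof (rule continuous_discrete_range_constant[OF connected_ball])
    fix x assume "x \<in> ball u0 \<eta>"
    show "\<exists>e>0. \<forall>y. y \<in> ball u0 \<eta> \<and> ?N y \<noteq> ?N x \<longrightarrow> e \<le> norm (?N y - ?N x)"
    proof (intro exI[of _ 1] conjI allI impI)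
      fix y assume "y \<in> ball u0 \<eta> \<and> ?N y \<noteq> ?N x"
      then have "?N y \<noteq> ?N x" by blast
      then have ne: "(\<Sum>b\<in>roots_in u \<rho> y. root_mult u y b) \<noteq> (\<Sum>b\<in>roots_in u \<rho> x. root_mult u x b)"
        by (rule contrapos_nn) (simp only:)
      have "1 \<le> norm (of_nat i - of_nat j :: complex)" if "i \<noteq> j" for i j :: nat
      proof -
        have "of_nat i - of_nat j = (of_int (int i - int j) :: complex)" by simp
        then have "norm (of_nat i - of_nat j :: complex) = \<bar>real_of_int (int i - int j)\<bar>"
          by (metis norm_of_int)
        then show ?thesis using that by linarith
      qed
      then show "1 \<le> norm (?N y - ?N x)" using ne by blast
    qed simp
  qed
  then obtain c where c: "\<And>\<zeta>. \<zeta> \<in> ball u0 \<eta> \<Longrightarrow> ?N \<zeta> = c" by (auto simp: constant_on_def)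
  define m where "m = (\<Sum>b\<in>roots_in u \<rho> u0. root_mult u u0 b)"
  have mm: "(\<Sum>b\<in>roots_in u \<rho> (z a). root_mult u (z a) b) = m" if "a \<in> T" for a
  proof -
    have "z a \<in> ball u0 \<eta>" "u0 \<in> ball u0 \<eta>" using zT that eta by auto
    then have "?N (z a) = ?N u0" using c by metis
    then show ?thesis unfolding m_def of_nat_eq_iff .
  qed
  then show "\<exists>m. \<forall>a\<in>T. (\<Sum>b\<in>roots_in u \<rho> (z a). root_mult u (z a) b) = m" by blast
  show "(\<lambda>a. \<Prod>b\<in>roots_in u \<rho> (z a). (w a - g b) ^ root_mult u (z a) b) holomorphic_on T"
  proof (rule product_holomorphic_from_power_sums[where n = "\<lambda>a b. root_mult u (z a) b" and v = "\<lambda>a b. w a - g b"])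
    show "finite (roots_in u \<rho> (z a))" if "a \<in> T" for a using rs(1) zT that by auto
    show "(\<Sum>b\<in>roots_in u \<rho> (z a). root_mult u (z a) b) = m" if "a \<in> T" for a using mm that .
    fix j
    have "(\<lambda>a. \<Sum>i\<le>Suc j. of_nat (Suc j choose i) * w a ^ i * (-1) ^ (Suc j - i) * ?s (Suc j - i) (z a)) holomorphic_on T"
      by (intro holomorphic_intros sz zw)
    then show "(\<lambda>a. \<Sum>b\<in>roots_in u \<rho> (z a). of_nat (root_mult u (z a) b) * (w a - g b) ^ Suc j) holomorphic_on T"
    proof (rule holomorphic_transform)
      fix a assume "a \<in> T"
      have "(\<Sum>b\<in>roots_in u \<rho> (z a). of_nat (root_mult u (z a) b) * (w a - g b) ^ Suc j) =
         (\<Sum>b\<in>roots_in u \<rho> (z a). \<Sum>i\<le>Suc j. of_nat (Suc j choose i) * w a ^ i * (-1) ^ (Suc j - i) * (of_nat (root_mult u (z a) b) * g b ^ (Suc j - i)))"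
      proof (rule sum.cong[OF refl])
        fix b
        have "(w a - g b) ^ Suc j = (w a + (- g b)) ^ Suc j" by simp
        also have "\<dots> = (\<Sum>i\<le>Suc j. of_nat (Suc j choose i) * w a ^ i * (- g b) ^ (Suc j - i))"
          by (rule binomial_ring)
        finally have "of_nat (root_mult u (z a) b) * (w a - g b) ^ Suc j =
            (\<Sum>i\<le>Suc j. of_nat (root_mult u (z a) b) * (of_nat (Suc j choose i) * w a ^ i * (- g b) ^ (Suc j - i)))"
          by (simp only: sum_distrib_left)
        then show "of_nat (root_mult u (z a) b) * (w a - g b) ^ Suc j =
            (\<Sum>i\<le>Suc j. of_nat (Suc j choose i) * w a ^ i * (-1) ^ (Suc j - i) * (of_nat (root_mult u (z a) b) * g b ^ (Suc j - i)))"
          by (simp only: power_minus[of "g b"] mult_ac)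
      qed
      also have "\<dots> = (\<Sum>i\<le>Suc j. of_nat (Suc j choose i) * w a ^ i * (-1) ^ (Suc j - i) * ?s (Suc j - i) (z a))"
        unfolding sum_distrib_left by (rule sum.swap)
      finally show "(\<Sum>i\<le>Suc j. of_nat (Suc j choose i) * w a ^ i * (-1) ^ (Suc j - i) * ?s (Suc j - i) (z a)) =
         (\<Sum>b\<in>roots_in u \<rho> (z a). of_nat (root_mult u (z a) b) * (w a - g b) ^ Suc j)" by simp
    qed
  qed
qed

section \<open>Limits of leaves that are disjoint or equal\<close>

text \<open>The two curves \<open>(u, g)\<close> and \<open>(z, w)\<close> intersect: the resultant is smaller at the centre than on the circle, so
  it has a zero.\<close>
lemma single_pair_common_zero:
  assumes hol: "u holomorphic_on ball 0 r1" "g holomorphic_on ball 0 r1" and r: "0 < \<rho>" "\<rho> < r1"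
    and far: "\<And>b. b \<in> sphere 0 \<rho> \<Longrightarrow> u b \<notin> ball u0 \<eta>" and eta: "\<eta> > 0"
    and zw: "z holomorphic_on ball 0 r2" "w holomorphic_on ball 0 r2" and e: "0 < \<epsilon>" "\<epsilon> < r2"
    and zT: "z ` ball 0 r2 \<subseteq> ball u0 \<eta>" and d: "\<delta> > 0"
    and circ: "\<And>a b. a \<in> sphere 0 \<epsilon> \<Longrightarrow> b \<in> ball 0 \<rho> \<Longrightarrow> u b = z a \<Longrightarrow> \<delta> \<le> norm (w a - g b)"
    and centre: "\<And>b. b \<in> ball 0 \<rho> \<Longrightarrow> u b = z 0 \<Longrightarrow> norm (w 0 - g b) < \<delta>"
    and ex: "\<exists>b\<in>ball 0 \<rho>. u b = z 0"
  shows "\<exists>a\<in>ball 0 \<epsilon>. \<exists>b\<in>ball 0 \<rho>. u b = z a \<and> g b = w a"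
proof -
  let ?P = "\<lambda>a. \<Prod>b\<in>roots_in u \<rho> (z a). (w a - g b) ^ root_mult u (z a) b"
  note rs = root_sums(1,2)[OF hol(1) r far]
  have zb: "z a \<in> ball u0 \<eta>" if "a \<in> ball 0 r2" for a using zT that by blast
  have fin: "finite (roots_in u \<rho> (z a))" if "a \<in> ball 0 r2" for a
    using rs(1)[OF _ zb[OF that]] by simp
  have mult1: "root_mult u (z a) b \<ge> 1" if "a \<in> ball 0 r2" "b \<in> roots_in u \<rho> (z a)" for a b
    using rs(2)[OF _ zb[OF that(1)] that(2)] by simp
  have P: "?P holomorphic_on ball 0 r2"
    by (rule root_resultant_holomorphic(1)[OF hol r _ eta zw zT]) (rule far)
  obtain m where m: "\<forall>a\<in>ball 0 r2. (\<Sum>b\<in>roots_in u \<rho> (z a). root_mult u (z a) b) = m"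
    using root_resultant_holomorphic(2)[OF hol r _ eta zw zT] far by blast
  have nP: "norm (?P a) = (\<Prod>b\<in>roots_in u \<rho> (z a). norm (w a - g b) ^ root_mult u (z a) b)" for a
    by (simp add: prod_norm [symmetric] norm_power)
  have dm: "\<delta> ^ m = (\<Prod>b\<in>roots_in u \<rho> (z a). \<delta> ^ root_mult u (z a) b)" if "a \<in> ball 0 r2" for a
    using m that by (simp add: power_sum [symmetric])
  have "\<exists>a\<in>ball 0 \<epsilon>. ?P a = 0"
  proof (rule minimum_modulus_zero[OF P open_ball _ e(1)])
    show "cball 0 \<epsilon> \<subseteq> ball (0::complex) r2" using e by auto
    show "\<delta> ^ m \<le> norm (?P a)" if a: "a \<in> sphere 0 \<epsilon>" for a
    proof -
      have a2: "a \<in> ball 0 r2" using a e by auto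
      show ?thesis unfolding nP dm[OF a2]
        by (intro prod_mono conjI power_mono) (use d circ[OF a] in \<open>auto simp: roots_in_def\<close>)
    qed
    have z0: "(0::complex) \<in> ball 0 r2" using e by simp
    obtain b0 where b0: "b0 \<in> roots_in u \<rho> (z 0)" using ex by (auto simp: roots_in_def)
    show "norm (?P 0) < \<delta> ^ m"
      unfolding nP dm[OF z0]
    proof (rule prod_mono_strict)
      show "finite (roots_in u \<rho> (z 0))" by (rule fin[OF z0])
      show "norm (w 0 - g b0) ^ root_mult u (z 0) b0 < \<delta> ^ root_mult u (z 0) b0"
        using centre[of b0] b0 mult1[OF z0 b0] by (intro power_strict_mono) (auto simp: roots_in_def)
      show "b0 \<in> roots_in u \<rho> (z 0)" by (rule b0)
      show "0 < \<delta> ^ root_mult u (z 0) b" for b using d by simp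
      fix b assume "b \<in> roots_in u \<rho> (z 0)"
      then show "0 \<le> norm (w 0 - g b) ^ root_mult u (z 0) b \<and> norm (w 0 - g b) ^ root_mult u (z 0) b \<le> \<delta> ^ root_mult u (z 0) b"
        using centre[of b] by (auto simp: roots_in_def intro!: power_mono)
    qed
  qed
  then obtain a where a: "a \<in> ball 0 \<epsilon>" "?P a = 0" by blast
  have "a \<in> ball 0 r2" using a e by auto
  then obtain b where "b \<in> roots_in u \<rho> (z a)" "w a - g b = 0"
    using a(2) fin by (auto simp: prod_zero_iff)
  then show ?thesis using a(1) by (intro bexI[of _ a] bexI[of _ b]) (auto simp: roots_in_def)
qed

text \<open>An affine line through a bidisk meets its boundary.\<close>
lemma line_exits_bidisk:
  assumes a0: "a0 \<in> ball (0::complex) \<epsilon>" and b0: "\<alpha> * a0 + \<beta> \<in> ball (0::complex) \<rho>"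
  shows "\<exists>a. a \<in> cball 0 \<epsilon> \<and> \<alpha> * a + \<beta> \<in> cball 0 \<rho> \<and> (a \<in> sphere 0 \<epsilon> \<or> \<alpha> * a + \<beta> \<in> sphere 0 \<rho>)"
proof -
  define D where "D = {a. a \<in> ball 0 \<epsilon> \<and> \<alpha> * a + \<beta> \<in> ball 0 \<rho>}"
  have De: "D = ball 0 \<epsilon> \<inter> (\<lambda>a. \<alpha> * a + \<beta>) -` ball 0 \<rho>" by (auto simp: D_def)
  have oD: "open D" unfolding De by (intro open_Int open_vimage continuous_intros) auto
  have "D \<noteq> {}" using a0 b0 by (auto simp: D_def)
  moreover have "D \<noteq> UNIV"
  proof
    assume "D = UNIV"
    then have "complex_of_real (\<bar>\<epsilon>\<bar> + 1) \<in> D" by simp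
    then have "norm (complex_of_real (\<bar>\<epsilon>\<bar> + 1)) < \<epsilon>" by (simp add: D_def)
    moreover have "norm (complex_of_real (\<bar>\<epsilon>\<bar> + 1)) = \<bar>\<epsilon>\<bar> + 1" unfolding norm_of_real by simp
    ultimately show False by linarith
  qed
  ultimately have "frontier D \<noteq> {}" by (simp add: frontier_eq_empty)
  then obtain a where a: "a \<in> closure D" "a \<notin> D" using oD by (auto simp: frontier_def interior_open)
  have "closure D \<subseteq> cball 0 \<epsilon> \<inter> (\<lambda>a. \<alpha> * a + \<beta>) -` cball 0 \<rho>"
    by (rule closure_minimal) (auto simp: D_def intro!: closed_Int closed_vimage continuous_intros)
  then have "a \<in> cball 0 \<epsilon>" "\<alpha> * a + \<beta> \<in> cball 0 \<rho>" using a by auto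
  moreover have "a \<notin> ball 0 \<epsilon> \<or> \<alpha> * a + \<beta> \<notin> ball 0 \<rho>" using a by (auto simp: D_def)
  ultimately show ?thesis by (intro exI[of _ a]) auto
qed

text \<open>The curves \<open>(Z n, W n)\<close> and \<open>(U n, G n)\<close> parametrize leaves that are disjoint or equal, and equal leaves
  differ by an affine change of parameter. If the limits \<open>(z, w)\<close> and \<open>(u, g)\<close> agree at \<open>0\<close>, then \<open>(z, w)\<close> maps a
  small disk into the image of \<open>(u, g)\<close>. Otherwise \<open>0\<close> is an isolated zero of the resultant of the limits, so
  that for large \<open>n\<close> the curves of index \<open>n\<close> intersect in a small bidisk of parameters but not on its boundary.
  An intersection, however, extends along an affine line of parameters.\<close>
lemma limit_germ_scalar:
  fixes u g z w :: "complex \<Rightarrow> complex" and U G Z W :: "nat \<Rightarrow> complex \<Rightarrow> complex"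
  assumes R: "R > 0" and hol: "u holomorphic_on ball 0 R" "g holomorphic_on ball 0 R"
      "z holomorphic_on ball 0 R" "w holomorphic_on ball 0 R"
    and holn: "\<And>n. U n holomorphic_on UNIV" "\<And>n. G n holomorphic_on UNIV"
      "\<And>n. Z n holomorphic_on UNIV" "\<And>n. W n holomorphic_on UNIV"
    and lim: "uniform_limit (ball 0 R) U u sequentially" "uniform_limit (ball 0 R) G g sequentially"
      "uniform_limit (ball 0 R) Z z sequentially" "uniform_limit (ball 0 R) W w sequentially"
    and eq0: "z 0 = u 0" "w 0 = g 0"
    and nconst: "\<not> u constant_on ball 0 R"
    and leaf: "\<And>n a b. U n b = Z n a \<Longrightarrow> G n b = W n a \<Longrightarrow>
        \<exists>\<alpha> \<beta>. b = \<alpha> * a + \<beta> \<and> (\<forall>t. U n (\<alpha> * t + \<beta>) = Z n t \<and> G n (\<alpha> * t + \<beta>) = W n t)"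
    and rho0: "\<rho>0 > 0"
  shows "\<exists>\<epsilon>>0. \<forall>a\<in>ball 0 \<epsilon>. \<exists>b\<in>ball 0 \<rho>0. u b = z a \<and> g b = w a"
proof -
  have hu0: "(\<lambda>b. u b - u 0) holomorphic_on ball 0 R" by (intro holomorphic_intros hol)
  have "\<not> (\<forall>b\<in>ball 0 R. u b = u 0)" using nconst unfolding constant_on_def by blast
  then obtain \<beta>0 where "\<beta>0 \<in> ball 0 R" "u \<beta>0 \<noteq> u 0" by blast
  then have b0: "\<beta>0 \<in> ball 0 R" "u \<beta>0 - u 0 \<noteq> 0" by auto
  have z1: "(0::complex) \<in> ball 0 R" and z2: "u 0 - u 0 = 0" using R by auto
  obtain r where r: "0 < r" "ball 0 r \<subseteq> ball (0::complex) R" "\<And>b. b \<in> ball 0 r - {0} \<Longrightarrow> u b - u 0 \<noteq> 0"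
    by (rule isolated_zeros[OF hu0 open_ball connected_ball z1 z2 b0]) (rule that)
  define \<rho> where "\<rho> = min (r / 2) (min (R / 2) (\<rho>0 / 2))"
  have rho: "0 < \<rho>" "\<rho> < r" "\<rho> < R" "\<rho> < \<rho>0" using r R rho0 by (auto simp: \<rho>_def)
  have unz: "u b \<noteq> u 0" if "b \<in> cball 0 \<rho>" "b \<noteq> 0" for b using r(3)[of b] that rho by auto
  have cont: "continuous_on (ball 0 R) u" "continuous_on (ball 0 R) g" "continuous_on (ball 0 R) z" "continuous_on (ball 0 R) w"
    using hol holomorphic_on_imp_continuous_on by auto
  have csub: "cball 0 s \<subseteq> ball (0::complex) R" "sphere 0 s \<subseteq> ball (0::complex) R" if "s < R" for s using that by auto
  have "\<exists>x\<in>sphere 0 \<rho>. \<forall>y\<in>sphere 0 \<rho>. norm (u x - u 0) \<le> norm (u y - u 0)"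
    by (rule continuous_attains_inf) (use rho in \<open>auto intro!: continuous_intros continuous_on_subset[OF cont(1)]\<close>)
  then obtain x where x: "x \<in> sphere 0 \<rho>" "\<And>y. y \<in> sphere 0 \<rho> \<Longrightarrow> norm (u x - u 0) \<le> norm (u y - u 0)" by blast
  define \<eta> where "\<eta> = norm (u x - u 0) / 2"
  have eta: "\<eta> > 0" using unz[of x] x(1) rho by (auto simp: \<eta>_def)
  have far2: "2 * \<eta> \<le> norm (u b - u 0)" if "b \<in> sphere 0 \<rho>" for b using x(2)[OF that] by (simp add: \<eta>_def)
  have far: "u b \<notin> ball (u 0) \<eta>" if "b \<in> sphere 0 \<rho>" for b
    using far2[OF that] eta by (simp add: dist_norm norm_minus_commute)
  have z0: "isCont z 0" using cont(3) R continuous_on_eq_continuous_at[of "ball 0 R" z] by auto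
  obtain s where s: "s > 0" "\<And>a. dist a 0 < s \<Longrightarrow> dist (z a) (z 0) < \<eta> / 2"
    using z0 half_gt_zero[OF eta] unfolding continuous_at_eps_delta by blast
  define \<epsilon>1 where "\<epsilon>1 = min s (R / 2)"
  have e1: "\<epsilon>1 > 0" "\<epsilon>1 \<le> s" "\<epsilon>1 < R" using s R by (auto simp: \<epsilon>1_def)
  have zhalf: "norm (z a - u 0) < \<eta> / 2" if "a \<in> ball 0 \<epsilon>1" for a
    using s(2)[of a] that e1 eq0 by (simp add: dist_norm)
  have zT: "z ` ball 0 \<epsilon>1 \<subseteq> ball (u 0) \<eta>"
  proof
    fix y assume "y \<in> z ` ball 0 \<epsilon>1"
    then obtain a where "a \<in> ball 0 \<epsilon>1" "y = z a" by blast
    then show "y \<in> ball (u 0) \<eta>" using zhalf[of a] eta by (simp add: dist_norm norm_minus_commute)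
  qed
  have e1sub: "ball 0 \<epsilon>1 \<subseteq> ball (0::complex) R" using e1 by auto
  let ?P = "\<lambda>a. \<Prod>b\<in>roots_in u \<rho> (z a). (w a - g b) ^ root_mult u (z a) b"
  have P: "?P holomorphic_on ball 0 \<epsilon>1"
    by (rule root_resultant_holomorphic(1)[OF hol(1,2) rho(1,3) _ eta _ _ zT])
      (rule far, assumption, rule holomorphic_on_subset[OF hol(3) e1sub], rule holomorphic_on_subset[OF hol(4) e1sub])
  have Pzero: "?P a = 0 \<longleftrightarrow> (\<exists>b\<in>ball 0 \<rho>. u b = z a \<and> g b = w a)" if a: "a \<in> ball 0 \<epsilon>1" for a
  proof -
    have za: "z a \<in> ball (u 0) \<eta>" using zT a by blast
    have fin: "finite (roots_in u \<rho> (z a))" by (rule root_sums(1)[OF hol(1) rho(1,3) _ za]) (rule far)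
    have m1: "root_mult u (z a) b \<ge> 1" if "b \<in> roots_in u \<rho> (z a)" for b
      by (rule root_sums(2)[OF hol(1) rho(1,3) _ za that]) (rule far)
    have "?P a = 0 \<longleftrightarrow> (\<exists>b\<in>roots_in u \<rho> (z a). (w a - g b) ^ root_mult u (z a) b = 0)"
      by (rule prod_zero_iff[OF fin])
    also have "\<dots> \<longleftrightarrow> (\<exists>b\<in>roots_in u \<rho> (z a). w a - g b = 0)"
    proof (rule bex_cong[OF refl])
      fix b assume "b \<in> roots_in u \<rho> (z a)"
      then show "((w a - g b) ^ root_mult u (z a) b = 0) = (w a - g b = 0)" using m1[of b] by simp
    qed
    also have "\<dots> \<longleftrightarrow> (\<exists>b\<in>ball 0 \<rho>. u b = z a \<and> g b = w a)" by (auto simp: roots_in_def)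
    finally show ?thesis .
  qed
  show ?thesis
  proof (cases "\<exists>\<beta>\<in>ball 0 \<epsilon>1. ?P \<beta> \<noteq> 0")
    \<comment> \<open>If the resultant vanishes identically, every point of the first curve is on the second one.\<close>
    case False
    then have "\<exists>b\<in>ball 0 \<rho>0. u b = z a \<and> g b = w a" if aa: "a \<in> ball 0 \<epsilon>1" for a
    proof -
      have "?P a = 0" using False aa by blast
      then obtain b where "b \<in> ball 0 \<rho>" "u b = z a \<and> g b = w a" using Pzero[OF aa] by blast
      moreover have "b \<in> ball 0 \<rho>0" using \<open>b \<in> ball 0 \<rho>\<close> rho by auto
      ultimately show ?thesis by blast
    qed
    then show ?thesis using e1(1) by blast
  next
    case True
    then obtain \<beta>1 where \<beta>1: "\<beta>1 \<in> ball 0 \<epsilon>1" "?P \<beta>1 \<noteq> 0" by blast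
    have "(0::complex) \<in> ball 0 \<epsilon>1" "(0::complex) \<in> ball 0 \<rho>" using e1(1) rho(1) by auto
    then have P0: "?P 0 = 0" using Pzero[of 0] eq0 by (metis (no_types))
    have z3: "(0::complex) \<in> ball 0 \<epsilon>1" using e1(1) by simp
    obtain t where t: "0 < t" "ball 0 t \<subseteq> ball (0::complex) \<epsilon>1" "\<And>a. a \<in> ball 0 t - {0} \<Longrightarrow> ?P a \<noteq> 0"
      by (rule isolated_zeros[OF P open_ball connected_ball z3 P0 \<beta>1]) (rule that)
    define \<epsilon> where "\<epsilon> = min (t / 2) (\<epsilon>1 / 2)"
    have e: "0 < \<epsilon>" "\<epsilon> < t" "\<epsilon> < \<epsilon>1" using t e1 by (auto simp: \<epsilon>_def)
    have nocirc: "\<not> (u b = z a \<and> g b = w a)" if a: "a \<in> sphere 0 \<epsilon>" and b: "b \<in> cball 0 \<rho>" for a b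
    proof
      assume h: "u b = z a \<and> g b = w a"
      have a1: "a \<in> ball 0 \<epsilon>1" "a \<in> ball 0 t - {0}" using a e by auto
      have "b \<notin> sphere 0 \<rho>"
      proof
        assume "b \<in> sphere 0 \<rho>"
        then have "2 * \<eta> \<le> norm (z a - u 0)" using far2[of b] h by simp
        then show False using zhalf[OF a1(1)] eta by linarith
      qed
      then have "b \<in> ball 0 \<rho>" using b by auto
      then have "?P a = 0" using Pzero[OF a1(1)] h by blast
      then show False using t(3)[OF a1(2)] by blast
    qed
    let ?K = "sphere (0::complex) \<epsilon> \<times> cball (0::complex) \<rho>"
    let ?f = "\<lambda>x. norm (z (fst x) - u (snd x)) + norm (w (fst x) - g (snd x))"
    have "\<exists>x\<in>?K. \<forall>y\<in>?K. ?f x \<le> ?f y"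
    proof (rule continuous_attains_inf)
      show "compact ?K" by (intro compact_Times) auto
      have "complex_of_real \<epsilon> \<in> sphere 0 \<epsilon>" "(0::complex) \<in> cball 0 \<rho>" using e rho by auto
      then show "?K \<noteq> {}" by blast
      have s1: "fst ` ?K \<subseteq> ball 0 R" using e e1 by force
      have s2: "snd ` ?K \<subseteq> ball 0 R" using rho by force
      show "continuous_on ?K ?f"
        by (intro continuous_intros continuous_on_compose2[OF cont(1) _ s2] continuous_on_compose2[OF cont(2) _ s2]
            continuous_on_compose2[OF cont(3) _ s1] continuous_on_compose2[OF cont(4) _ s1])
    qed
    then obtain x0 where x0: "x0 \<in> ?K" "\<And>y. y \<in> ?K \<Longrightarrow> ?f x0 \<le> ?f y" by blast
    \<comment> \<open>A lower bound for the distance of the limit curves over the part \<open>norm a = \<epsilon>\<close> of the boundary.\<close>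
    define \<delta> where "\<delta> = ?f x0 / 3"
    have "?f x0 > 0"
    proof (rule ccontr)
      assume "\<not> ?f x0 > 0"
      then have "norm (z (fst x0) - u (snd x0)) = 0" "norm (w (fst x0) - g (snd x0)) = 0"
        using norm_ge_zero[of "z (fst x0) - u (snd x0)"] norm_ge_zero[of "w (fst x0) - g (snd x0)"] by linarith+
      then show False using nocirc[of "fst x0" "snd x0"] x0(1) by auto
    qed
    then have del: "\<delta> > 0" by (simp add: \<delta>_def)
    have sep: "3 * \<delta> \<le> norm (z a - u b) + norm (w a - g b)" if "a \<in> sphere 0 \<epsilon>" "b \<in> cball 0 \<rho>" for a b
      using x0(2)[of "(a,b)"] that by (simp add: \<delta>_def)
    have "isCont g 0" using cont(2) R continuous_on_eq_continuous_at[of "ball 0 R" g] by auto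
    then obtain s2 where s2: "s2 > 0" "\<And>b. dist b 0 < s2 \<Longrightarrow> dist (g b) (g 0) < \<delta> / 2"
      using half_gt_zero[OF del] unfolding continuous_at_eps_delta by blast
    define \<rho>2 where "\<rho>2 = min s2 \<rho> / 2"
    have rho2: "0 < \<rho>2" "\<rho>2 < s2" "\<rho>2 < \<rho>" using s2 rho by (auto simp: \<rho>2_def)
    let ?A = "cball 0 \<rho> - ball (0::complex) \<rho>2"
    have "\<exists>x\<in>?A. \<forall>y\<in>?A. norm (u x - u 0) \<le> norm (u y - u 0)"
    proof (rule continuous_attains_inf)
      show "compact ?A" by (intro compact_diff) auto
      have "complex_of_real \<rho> \<in> ?A" using rho rho2 by auto
      then show "?A \<noteq> {}" by blast
      show "continuous_on ?A (\<lambda>x. norm (u x - u 0))"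
        by (intro continuous_intros continuous_on_subset[OF cont(1)]) (use rho in auto)
    qed
    then obtain x2 where x2: "x2 \<in> ?A" "\<And>y. y \<in> ?A \<Longrightarrow> norm (u x2 - u 0) \<le> norm (u y - u 0)" by blast
    define \<mu> where "\<mu> = norm (u x2 - u 0)"
    have "x2 \<noteq> 0" using x2(1) rho2 by auto
    then have mu: "\<mu> > 0" using unz[of x2] x2(1) by (auto simp: \<mu>_def)
    define \<sigma> where "\<sigma> = min (\<delta> / 4) (min (\<mu> / 4) (\<eta> / 4))"
    have sig: "\<sigma> > 0" "4 * \<sigma> \<le> \<delta>" "4 * \<sigma> \<le> \<mu>" "4 * \<sigma> \<le> \<eta>" using del mu eta by (auto simp: \<sigma>_def)
    have "eventually (\<lambda>n. (\<forall>b\<in>ball 0 R. dist (U n b) (u b) < \<sigma>) \<and> (\<forall>b\<in>ball 0 R. dist (G n b) (g b) < \<sigma>) \<and>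
        (\<forall>b\<in>ball 0 R. dist (Z n b) (z b) < \<sigma>) \<and> (\<forall>b\<in>ball 0 R. dist (W n b) (w b) < \<sigma>)) sequentially"
      by (intro eventually_conj uniform_limitD[OF lim(1) sig(1)] uniform_limitD[OF lim(2) sig(1)]
          uniform_limitD[OF lim(3) sig(1)] uniform_limitD[OF lim(4) sig(1)])
    from eventually_happens'[OF sequentially_bot this] obtain n where
      nn: "\<forall>b\<in>ball 0 R. dist (U n b) (u b) < \<sigma>" "\<forall>b\<in>ball 0 R. dist (G n b) (g b) < \<sigma>"
         "\<forall>b\<in>ball 0 R. dist (Z n b) (z b) < \<sigma>" "\<forall>b\<in>ball 0 R. dist (W n b) (w b) < \<sigma>"
      by (elim exE conjE)
    have n: "\<And>b. b \<in> ball 0 R \<Longrightarrow> norm (U n b - u b) < \<sigma>" "\<And>b. b \<in> ball 0 R \<Longrightarrow> norm (G n b - g b) < \<sigma>"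
         "\<And>b. b \<in> ball 0 R \<Longrightarrow> norm (Z n b - z b) < \<sigma>" "\<And>b. b \<in> ball 0 R \<Longrightarrow> norm (W n b - w b) < \<sigma>"
      using nn by (simp_all only: dist_norm)
    have bR: "b \<in> ball 0 R" if "b \<in> cball 0 \<rho>" for b using that rho by auto
    have aR: "a \<in> ball 0 R" if "a \<in> ball 0 \<epsilon>1" for a using that e1 by auto
    have farn: "\<eta> + \<sigma> \<le> norm (U n b - u 0)" if b: "b \<in> sphere 0 \<rho>" for b
    proof -
      have "norm (u b - u 0) \<le> norm (U n b - u 0) + norm (U n b - u b)"
        using norm_triangle_ineq4[of "U n b - u 0" "U n b - u b"] by simp
      then show ?thesis using far2[OF b] n(1)[OF bR, of b] b sig by auto
    qed
    have zn: "norm (Z n a - u 0) < \<eta>" if a: "a \<in> ball 0 \<epsilon>1" for a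
    proof -
      have "norm (Z n a - u 0) \<le> norm (Z n a - z a) + norm (z a - u 0)"
        using norm_triangle_ineq[of "Z n a - z a" "z a - u 0"] by simp
      then show ?thesis using zhalf[OF a] n(3)[OF aR[OF a]] sig eta by linarith
    qed
    have zn0: "norm (Z n 0 - u 0) < \<sigma>" using n(3)[of 0] R eq0 by simp
    have sepn: "\<delta> \<le> norm (W n a - G n b)" if a: "a \<in> sphere 0 \<epsilon>" and b: "b \<in> cball 0 \<rho>" and h: "U n b = Z n a" for a b
    proof -
      have aR': "a \<in> ball 0 R" using a e by (intro aR) auto
      have "norm (z a - u b) \<le> norm (Z n a - z a) + norm (U n b - u b)"
        using norm_triangle_ineq4[of "U n b - u b" "Z n a - z a"] h by (simp add: norm_minus_commute add.commute)
      moreover have "norm (w a - g b) \<le> norm (W n a - G n b) + (norm (W n a - w a) + norm (G n b - g b))"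
      proof -
        have "w a - g b = (W n a - G n b) + ((G n b - g b) - (W n a - w a))" by simp
        then have "norm (w a - g b) \<le> norm (W n a - G n b) + norm ((G n b - g b) - (W n a - w a))"
          using norm_triangle_ineq[of "W n a - G n b" "(G n b - g b) - (W n a - w a)"] by simp
        moreover have "norm ((G n b - g b) - (W n a - w a)) \<le> norm (G n b - g b) + norm (W n a - w a)"
          by (rule norm_triangle_ineq4)
        ultimately show ?thesis by linarith
      qed
      ultimately show ?thesis using sep[OF a b] n(1)[OF bR[OF b]] n(2)[OF bR[OF b]] n(3)[OF aR'] n(4)[OF aR'] sig
        by linarith
    qed
    have "\<exists>a\<in>ball 0 \<epsilon>. \<exists>b\<in>ball 0 \<rho>. U n b = Z n a \<and> G n b = W n a"
    proof (rule single_pair_common_zero[where ?r1.0 = R and ?r2.0 = \<epsilon>1 and ?u0.0 = "u 0" and \<eta> = \<eta> and \<delta> = \<delta>])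
      show "U n b \<notin> ball (u 0) \<eta>" if "b \<in> sphere 0 \<rho>" for b
        using farn[OF that] sig by (auto simp: dist_norm norm_minus_commute)
      show "Z n ` ball 0 \<epsilon>1 \<subseteq> ball (u 0) \<eta>"
      proof
        fix y assume "y \<in> Z n ` ball 0 \<epsilon>1"
        then obtain a where "a \<in> ball 0 \<epsilon>1" "y = Z n a" by blast
        then show "y \<in> ball (u 0) \<eta>" using zn[of a] by (simp add: dist_norm norm_minus_commute)
      qed
      show "\<delta> \<le> norm (W n a - G n b)" if "a \<in> sphere 0 \<epsilon>" "b \<in> ball 0 \<rho>" "U n b = Z n a" for a b
        using sepn that by auto
      show "norm (W n 0 - G n b) < \<delta>" if b: "b \<in> ball 0 \<rho>" and h: "U n b = Z n 0" for b
      proof -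
        have bc: "b \<in> cball 0 \<rho>" using b by auto
        have "b \<in> ball 0 \<rho>2"
        proof (rule ccontr)
          assume "b \<notin> ball 0 \<rho>2"
          then have "\<mu> \<le> norm (u b - u 0)" using x2(2)[of b] bc by (simp add: \<mu>_def)
          moreover have "norm (u b - u 0) \<le> norm (Z n 0 - u 0) + norm (U n b - u b)"
            using norm_triangle_ineq4[of "Z n 0 - u 0" "U n b - u b"] h by simp
          ultimately show False using zn0 n(1)[OF bR[OF bc]] sig by linarith
        qed
        then have "norm (g b - g 0) < \<delta> / 2" using s2(2)[of b] rho2 by (simp add: dist_norm)
        moreover have "norm (W n 0 - G n b) \<le> norm (W n 0 - w 0) + (norm (g b - g 0) + norm (G n b - g b))"
        proof -
          have "W n 0 - G n b = (W n 0 - w 0) - ((g b - g 0) + (G n b - g b))" using eq0 by simp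
          then have "norm (W n 0 - G n b) \<le> norm (W n 0 - w 0) + norm ((g b - g 0) + (G n b - g b))"
            using norm_triangle_ineq4[of "W n 0 - w 0" "(g b - g 0) + (G n b - g b)"] by simp
          moreover have "norm ((g b - g 0) + (G n b - g b)) \<le> norm (g b - g 0) + norm (G n b - g b)"
            by (rule norm_triangle_ineq)
          ultimately show ?thesis by linarith
        qed
        moreover have "norm (W n 0 - w 0) < \<sigma>" using n(4)[of 0] R by simp
        ultimately show ?thesis using n(2)[OF bR[OF bc]] sig by linarith
      qed
      have "\<exists>b\<in>ball 0 \<rho>. U n b - Z n 0 = 0"
      proof (rule minimum_modulus_zero[where S = UNIV and \<delta> = \<eta>])
        show "(\<lambda>b. U n b - Z n 0) holomorphic_on UNIV" by (intro holomorphic_intros holn)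
        show "\<eta> \<le> norm (U n b - Z n 0)" if b: "b \<in> sphere 0 \<rho>" for b
          using farn[OF b] zn0 norm_triangle_ineq4[of "U n b - Z n 0" "u 0 - Z n 0"]
          by (simp add: norm_minus_commute)
        have "norm (U n 0 - Z n 0) \<le> norm (U n 0 - u 0) + norm (Z n 0 - u 0)"
          using norm_triangle_ineq4[of "U n 0 - u 0" "Z n 0 - u 0"] by simp
        then show "norm (U n 0 - Z n 0) < \<eta>" using n(1)[of 0] R zn0 sig eta by auto
      qed (use rho in auto)
      then show "\<exists>b\<in>ball 0 \<rho>. U n b = Z n 0" by auto
    qed (use rho e eta del in \<open>auto intro: holomorphic_on_subset[OF holn(1)]
        holomorphic_on_subset[OF holn(2)] holomorphic_on_subset[OF holn(3)] holomorphic_on_subset[OF holn(4)]\<close>)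
    then obtain a b where ab: "a \<in> ball 0 \<epsilon>" "b \<in> ball 0 \<rho>" "U n b = Z n a" "G n b = W n a" by blast
    \<comment> \<open>The line of intersections must leave the bidisk through its boundary.\<close>
    obtain \<alpha> \<beta> where l: "b = \<alpha> * a + \<beta>" "\<And>t. U n (\<alpha> * t + \<beta>) = Z n t" "\<And>t. G n (\<alpha> * t + \<beta>) = W n t"
      using leaf[OF ab(3,4)] by blast
    obtain c where c: "c \<in> cball 0 \<epsilon>" "\<alpha> * c + \<beta> \<in> cball 0 \<rho>" "c \<in> sphere 0 \<epsilon> \<or> \<alpha> * c + \<beta> \<in> sphere 0 \<rho>"
      using line_exits_bidisk[OF ab(1), of \<alpha> \<beta> \<rho>] ab(2) l(1) by blast
    have c1: "c \<in> ball 0 \<epsilon>1" using c(1) e by auto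
    from c(3) have False
    proof
      assume "c \<in> sphere 0 \<epsilon>"
      then show False using sepn[OF _ c(2) l(2)] l(3)[of c] del by auto
    next
      assume "\<alpha> * c + \<beta> \<in> sphere 0 \<rho>"
      then show False using farn[of "\<alpha> * c + \<beta>"] l(2)[of c] zn[OF c1] sig by auto
    qed
    then show ?thesis ..
  qed
qed

section \<open>Jets of curves in a contact region\<close>

lemma higher_deriv_0_of_bound:
  assumes hol: "f holomorphic_on ball 0 r" and r: "r > 0"
    and b: "\<And>z. z \<in> ball 0 r \<Longrightarrow> norm (f z) \<le> C * norm z powr s" and m: "real m < s"
  shows "(deriv ^^ m) f 0 = (0::complex)"
proof -
  have C: "C \<ge> 0"
  proof -
    have "0 \<le> norm (f (of_real (r/2)))" by simp
    also have "\<dots> \<le> C * norm (of_real (r/2) :: complex) powr s" using r by (intro b) simp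
    finally show ?thesis using r by (simp add: zero_le_mult_iff)
  qed
  have le: "norm ((deriv ^^ m) f 0) \<le> fact m * C * \<rho> powr (s - m)" if rho: "0 < \<rho>" "\<rho> < r" for \<rho>
  proof -
    have "norm ((deriv ^^ m) f 0) \<le> fact m * (C * \<rho> powr s) / \<rho> ^ m"
    proof (rule Cauchy_inequality)
      show "f holomorphic_on ball 0 \<rho>" by (rule holomorphic_on_subset[OF hol]) (use rho in auto)
      show "continuous_on (cball 0 \<rho>) f"
        by (rule continuous_on_subset[OF holomorphic_on_imp_continuous_on[OF hol]]) (use rho in auto)
      show "norm (f x) \<le> C * \<rho> powr s" if "norm (0 - x) = \<rho>" for x
        using b[of x] that rho by simp
    qed (rule rho)
    also have "\<rho> powr (s - m) = \<rho> powr s / \<rho> ^ m" using rho by (simp add: powr_diff powr_realpow)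
    then have "fact m * (C * \<rho> powr s) / \<rho> ^ m = fact m * C * \<rho> powr (s - m)" by simp
    finally show ?thesis .
  qed
  have "((\<lambda>\<rho>. fact m * C * \<rho> powr (s - m)) \<longlongrightarrow> fact m * C * 0) (at_right 0)"
  proof (intro tendsto_mult tendsto_const)
    have "((\<lambda>\<rho>. \<rho> powr (s - real m)) \<longlongrightarrow> 0 powr (s - real m)) (at_right 0)"
      by (rule tendsto_powr2) (use m in \<open>auto intro: tendsto_ident_at simp: eventually_at_right_less\<close>, simp add: eventually_at_filter)
    then show "((\<lambda>\<rho>. \<rho> powr (s - real m)) \<longlongrightarrow> 0) (at_right 0)" by simp
  qed
  moreover have "eventually (\<lambda>\<rho>. norm ((deriv ^^ m) f 0) \<le> fact m * C * \<rho> powr (s - m)) (at_right 0)"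
    using eventually_at_right_real[OF r] by eventually_elim (use le in auto)
  ultimately have "norm ((deriv ^^ m) f 0) \<le> fact m * C * 0"
    by (intro tendsto_le[OF _ _ tendsto_const]) auto
  then show ?thesis by simp
qed

lemma vanishing_derivs_bound:
  assumes hol: "f holomorphic_on ball 0 r" and r: "r > 0"
    and v: "\<And>m. 1 \<le> m \<Longrightarrow> m < j \<Longrightarrow> (deriv ^^ m) f 0 = 0" and j: "j \<ge> 1"
  shows "\<exists>C e. 0 < e \<and> e \<le> r \<and> 0 \<le> C \<and> (\<forall>z\<in>ball 0 e. norm (f z - f 0) \<le> C * norm z ^ j)"
proof (cases "\<exists>n\<ge>1. (deriv ^^ n) f 0 \<noteq> 0")
  case True
  define n where "n = (LEAST n. 1 \<le> n \<and> (deriv ^^ n) f 0 \<noteq> 0)"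
  have n: "1 \<le> n" "(deriv ^^ n) f 0 \<noteq> 0" using LeastI_ex[of "\<lambda>n. 1 \<le> n \<and> (deriv ^^ n) f 0 \<noteq> 0"] True by (auto simp: n_def)
  have nl: "(deriv ^^ i) f 0 = 0" if "0 < i" "i < n" for i
    using not_less_Least[of i "\<lambda>n. 1 \<le> n \<and> (deriv ^^ n) f 0 \<noteq> 0"] that by (auto simp: n_def)
  have jn: "j \<le> n" using v[of n] n by force
  have z0: "(0::complex) \<in> ball 0 r" using r by simp
  have n0: "0 < n" using n by simp
  obtain g s where g: "0 < s" "g holomorphic_on ball 0 s" "\<And>w. w \<in> ball 0 s \<Longrightarrow> f w - f 0 = (w - 0) ^ n * g w"
     "\<And>w. w \<in> ball 0 s \<Longrightarrow> g w \<noteq> 0"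
    by (rule holomorphic_factor_order_of_zero[OF hol open_ball z0 n0 n(2) nl]) (assumption, assumption, rule that)
  define e where "e = min (s / 2) (min r 1)"
  have e: "0 < e" "e < s" "e \<le> r" "e \<le> 1" using g r by (auto simp: e_def)
  have "compact (g ` cball 0 e)"
    by (intro compact_continuous_image continuous_on_subset[OF holomorphic_on_imp_continuous_on[OF g(2)]]) (use e in auto)
  then have "bounded (g ` cball 0 e)" by (rule compact_imp_bounded)
  then obtain C where Cb: "\<forall>y\<in>g ` cball 0 e. norm y \<le> C" unfolding bounded_iff by (elim exE)
  have C: "norm y \<le> C" if "y \<in> g ` cball 0 e" for y using Cb that by (rule bspec)
  have "norm (g 0) \<le> C" using C[of "g 0"] e by auto
  then have C0: "0 \<le> C" using norm_ge_zero[of "g 0"] by linarith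
  have "norm (f z - f 0) \<le> C * norm z ^ j" if z: "z \<in> ball 0 e" for z
  proof -
    have "norm (f z - f 0) = norm z ^ n * norm (g z)" using g(3)[of z] z e by (simp add: norm_mult norm_power)
    also have "\<dots> \<le> norm z ^ j * C"
      using z e jn C[of "g z"] by (intro mult_mono power_decreasing) auto
    finally show ?thesis by (simp add: mult.commute)
  qed
  then show ?thesis using e C0 by blast
next
  case False
  have const: "f z = f 0" if "z \<in> ball 0 r" for z
  proof (rule holomorphic_fun_eq_const_on_connected[OF hol open_ball connected_ball])
    show "(deriv ^^ n) f 0 = 0" if "0 < n" for n
    proof -
      have "1 \<le> n" using that by simp
      then show ?thesis using False by blast
    qed
  qed (use r that in simp_all)
  show ?thesis
  proof (rule exI[of _ 0], rule exI[of _ r], intro conjI ballI)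
    show "norm (f z - f 0) \<le> 0 * norm z ^ j" if "z \<in> ball 0 r" for z
      unfolding const[OF that] by simp
  qed (rule r, rule order_refl, rule order_refl)
qed

lemma fps_low_mult:
  fixes A B :: "complex fps"
  assumes "\<And>i. i < m \<Longrightarrow> A $ i = 0" "\<And>i. i < n \<Longrightarrow> B $ i = 0"
  shows "(A * B) $ (m + n) = A $ m * B $ n" "i < m + n \<Longrightarrow> (A * B) $ i = 0"
proof -
  have "(A * B) $ (m + n) = (\<Sum>i=0..m + n. if i = m then A $ m * B $ n else 0)"
    unfolding fps_mult_nth
  proof (intro sum.cong refl)
    fix i assume "i \<in> {0..m + n}"
    then show "A $ i * B $ (m + n - i) = (if i = m then A $ m * B $ n else 0)"
      using assms(1)[of i] assms(2)[of "m + n - i"] by (cases i m rule: linorder_cases) auto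
  qed
  then show "(A * B) $ (m + n) = A $ m * B $ n" by simp
  show "(A * B) $ i = 0" if i: "i < m + n"
    unfolding fps_mult_nth
  proof (intro sum.neutral ballI)
    fix j assume "j \<in> {0..i}"
    then show "A $ j * B $ (i - j) = 0" using assms(1)[of j] assms(2)[of "i - j"] i by (cases "j < m") auto
  qed
qed

lemma fps_power_low:
  fixes W :: "complex fps"
  assumes "\<And>i. i < k \<Longrightarrow> W $ i = 0"
  shows "W ^ l $ (l * k) = (W $ k) ^ l \<and> (\<forall>i < l * k. W ^ l $ i = 0)"
proof (induction l)
  case (Suc l)
  have b: "W ^ l $ i = 0" if "i < l * k" for i using Suc that by blast
  show ?case using fps_low_mult[of k W "l * k" "W ^ l", OF assms b] Suc by simp
qed (simp add: fps_one_nth)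

lemma higher_deriv_fps:
  fixes f :: "complex \<Rightarrow> complex"
  assumes "f has_fps_expansion F" shows "(deriv ^^ m) f 0 = fact m * F $ m"
  using fps_nth_fps_expansion[OF assms, of m] by simp

lemma composed_coefficients:
  assumes B: "B holomorphic_on ball 0 s" "s > 0" and w: "w holomorphic_on ball 0 r" "r > 0" and w0: "w 0 = 0"
  shows "(deriv ^^ m) (B \<circ> w) 0 = fact m * (\<Sum>i=0..m. ((deriv ^^ i) B 0 / fact i) * (fps_expansion w 0 ^ i $ m))"
proof -
  have eB: "B has_fps_expansion fps_expansion B 0" by (rule has_fps_expansion_fps_expansion[OF open_ball _ B(1)]) (use B in simp)
  have ew: "w has_fps_expansion fps_expansion w 0" by (rule has_fps_expansion_fps_expansion[OF open_ball _ w(1)]) (use w in simp)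
  have "fps_expansion w 0 $ 0 = 0" by (simp add: fps_expansion_def w0)
  then have "(B \<circ> w) has_fps_expansion (fps_expansion B 0 oo fps_expansion w 0)"
    by (rule has_fps_expansion_compose[OF eB ew])
  then have "(deriv ^^ m) (B \<circ> w) 0 = fact m * (fps_expansion B 0 oo fps_expansion w 0) $ m" by (rule higher_deriv_fps)
  then show ?thesis by (simp add: fps_compose_nth fps_expansion_def)
qed

text \<open>If \<open>w\<close> vanishes to order \<open>k\<close>, the coefficient of order \<open>l * k\<close> of \<open>B n \<circ> w\<close> is a nonzero multiple of the
  coefficient of order \<open>l\<close> of \<open>B n\<close>, up to terms with lower coefficients of \<open>B n\<close>.\<close>
lemma coefficients_tend_to_zero:
  fixes B :: "nat \<Rightarrow> complex \<Rightarrow> complex"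
  assumes B: "\<And>n. B n holomorphic_on ball 0 s" "s > 0" and w: "w holomorphic_on ball 0 r" "r > 0" and w0: "w 0 = 0"
    and k: "k \<ge> 1" "(deriv ^^ k) w 0 \<noteq> 0" "\<And>i. i < k \<Longrightarrow> (deriv ^^ i) w 0 = 0"
    and lim: "\<And>m. 1 \<le> m \<Longrightarrow> real m < real k * t \<Longrightarrow> (\<lambda>n. (deriv ^^ m) (B n \<circ> w) 0) \<longlonglongrightarrow> 0"
  shows "1 \<le> l \<Longrightarrow> real l < t \<Longrightarrow> (\<lambda>n. (deriv ^^ l) (B n) 0) \<longlonglongrightarrow> 0"
proof (induction l rule: less_induct)
  case (less l)
  let ?W = "fps_expansion w 0"
  have Wk: "?W $ i = 0" if "i < k" for i using k(3)[OF that] by (simp add: fps_expansion_def)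
  have Wk': "?W $ k \<noteq> 0" using k(2) by (simp add: fps_expansion_def)
  have Wl: "?W ^ l $ (l * k) = (?W $ k) ^ l" using fps_power_low[of k ?W l] Wk by blast
  have W0: "?W ^ i $ (l * k) = 0" if "i > l" for i
    using fps_power_low[of k ?W i] Wk that k(1) by auto
  have lk: "1 \<le> l * k" using less.prems k by simp
  have eq: "(deriv ^^ (l * k)) (B n \<circ> w) 0 / fact (l * k) =
      (\<Sum>i\<in>{1..<l}. ((deriv ^^ i) (B n) 0 / fact i) * (?W ^ i $ (l * k))) + (deriv ^^ l) (B n) 0 / fact l * (?W $ k) ^ l" for n
  proof -
    have "(deriv ^^ (l * k)) (B n \<circ> w) 0 / fact (l * k) = (\<Sum>i=0..l * k. ((deriv ^^ i) (B n) 0 / fact i) * (?W ^ i $ (l * k)))"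
      unfolding composed_coefficients[OF B w w0] by simp
    also have "\<dots> = (\<Sum>i\<in>insert l {1..<l}. ((deriv ^^ i) (B n) 0 / fact i) * (?W ^ i $ (l * k)))"
    proof (rule sum.mono_neutral_right)
      have ll: "l \<le> l * k" using k(1) by simp
      have "i \<le> l * k" if "i \<le> l" for i using that ll by (rule order_trans)
      then show "insert l {1..<l} \<subseteq> {0..l * k}" by auto
      show "\<forall>i\<in>{0..l * k} - insert l {1..<l}. (deriv ^^ i) (B n) 0 / fact i * ?W ^ i $ (l * k) = 0"
      proof
        fix i assume "i \<in> {0..l * k} - insert l {1..<l}"
        then have "i = 0 \<or> i > l" by auto
        then show "(deriv ^^ i) (B n) 0 / fact i * ?W ^ i $ (l * k) = 0"
        proof
          assume "i = 0" then show ?thesis using lk by (simp add: fps_one_nth)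
        next
          assume "i > l" then show ?thesis using W0 by simp
        qed
      qed
    qed simp
    also have "\<dots> = (\<Sum>i\<in>{1..<l}. ((deriv ^^ i) (B n) 0 / fact i) * (?W ^ i $ (l * k))) + (deriv ^^ l) (B n) 0 / fact l * (?W $ k) ^ l"
      using Wl by (subst sum.insert) (auto simp: add.commute)
    finally show ?thesis .
  qed
  have kl: "real (l * k) < real k * t" using less.prems k(1) by (simp add: mult.commute)
  have a: "(\<lambda>n. (deriv ^^ (l * k)) (B n \<circ> w) 0 / fact (l * k)) \<longlonglongrightarrow> 0 / fact (l * k)"
    by (intro tendsto_divide tendsto_const lim lk kl) simp
  have b: "(\<lambda>n. \<Sum>i\<in>{1..<l}. ((deriv ^^ i) (B n) 0 / fact i) * (?W ^ i $ (l * k))) \<longlonglongrightarrow> (\<Sum>i\<in>{1..<l}. (0 / fact i) * (?W ^ i $ (l * k)))"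
    by (intro tendsto_sum tendsto_mult tendsto_divide tendsto_const less.IH) (use less.prems in auto)
  have "(\<lambda>n. (deriv ^^ l) (B n) 0 / fact l * (?W $ k) ^ l) \<longlonglongrightarrow> 0"
    using tendsto_diff[OF a b] unfolding eq by simp
  from tendsto_mult_right[OF this, of "fact l / (?W $ k) ^ l"]
  show ?case using Wk' by simp
qed

text \<open>If \<open>w\<close> vanishes to order \<open>j\<close>, coefficients of \<open>B n\<close> of order \<open>i\<close> contribute to orders at least \<open>i * j\<close> of
  the composition.\<close>
lemma composed_coefficients_tend_to_zero:
  fixes B :: "nat \<Rightarrow> complex \<Rightarrow> complex"
  assumes B: "\<And>n. B n holomorphic_on ball 0 s" "s > 0" and w: "w holomorphic_on ball 0 r" "r > 0" and w0: "w 0 = 0"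
    and v: "\<And>i. i < j \<Longrightarrow> (deriv ^^ i) w 0 = 0" and j: "j \<ge> 1"
    and lim: "\<And>l. 1 \<le> l \<Longrightarrow> real l < t \<Longrightarrow> (\<lambda>n. (deriv ^^ l) (B n) 0) \<longlonglongrightarrow> 0"
    and m: "1 \<le> m" "real m < real j * t"
  shows "(\<lambda>n. (deriv ^^ m) (B n \<circ> w) 0) \<longlonglongrightarrow> 0"
proof -
  let ?W = "fps_expansion w 0"
  have Wj: "?W $ i = 0" if "i < j" for i using v[OF that] by (simp add: fps_expansion_def)
  have "(\<lambda>n. ((deriv ^^ i) (B n) 0 / fact i) * (?W ^ i $ m)) \<longlonglongrightarrow> 0" for i
  proof (cases "i = 0 \<or> m < i * j")
    case True
    then have "?W ^ i $ m = 0"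
    proof
      assume "i = 0" then show ?thesis using m(1) by (simp add: fps_one_nth)
    next
      assume "m < i * j" then show ?thesis using fps_power_low[of j ?W i] Wj by blast
    qed
    then show ?thesis by simp
  next
    case False
    then have "i * j \<le> m" by simp
    then have "real (i * j) \<le> real m" unfolding of_nat_le_iff .
    then have "real j * real i < real j * t" using m(2) by (simp add: mult.commute)
    then have "real i < t" using j by simp
    then have "(\<lambda>n. (deriv ^^ i) (B n) 0) \<longlonglongrightarrow> 0" using lim False by simp
    then have "(\<lambda>n. ((deriv ^^ i) (B n) 0 / fact i) * (?W ^ i $ m)) \<longlonglongrightarrow> (0 / fact i) * (?W ^ i $ m)"
      by (intro tendsto_intros) simp_all
    then show ?thesis by simp
  qed
  then have "(\<lambda>n. fact m * (\<Sum>i=0..m. ((deriv ^^ i) (B n) 0 / fact i) * (?W ^ i $ m))) \<longlonglongrightarrow> fact m * (\<Sum>i=0..m. 0)"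
    by (intro tendsto_mult tendsto_const tendsto_sum)
  then show ?thesis unfolding composed_coefficients[OF B w w0] by simp
qed

subsection \<open>Holomorphic maps of two variables along curves\<close>

lemma holomorphic_map_along_curve:
  assumes G: "holomorphic_map_on G Q" and h: "h1 holomorphic_on S" "h2 holomorphic_on S" "open S"
    and im: "\<And>z. z \<in> S \<Longrightarrow> (h1 z, h2 z) \<in> Q"
  shows "(\<lambda>z. fst (G (h1 z, h2 z))) holomorphic_on S" "(\<lambda>z. snd (G (h1 z, h2 z))) holomorphic_on S"
proof -
  have d: "\<exists>d1 d2. ((\<lambda>z. fst (G (h1 z, h2 z))) has_field_derivative d1) (at z) \<and>
      ((\<lambda>z. snd (G (h1 z, h2 z))) has_field_derivative d2) (at z)" if z: "z \<in> S" for z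
  proof -
    obtain D where D: "(G has_derivative D) (at (h1 z, h2 z))" "\<And>c v. D (cscale c v) = cscale c (D v)"
      using G im[OF z] by (auto simp: holomorphic_map_on_def)
    have "(h1 has_field_derivative deriv h1 z) (at z)" "(h2 has_field_derivative deriv h2 z) (at z)"
      using h z holomorphic_derivI by blast+
    then have "(h1 has_derivative (\<lambda>c. deriv h1 z * c)) (at z)" "(h2 has_derivative (\<lambda>c. deriv h2 z * c)) (at z)"
      by (simp_all add: has_field_derivative_def)
    then have "((\<lambda>z. (h1 z, h2 z)) has_derivative (\<lambda>c. (deriv h1 z * c, deriv h2 z * c))) (at z)"
      by (rule has_derivative_Pair)
    from has_derivative_compose[OF this D(1)]
    have "((\<lambda>z. G (h1 z, h2 z)) has_derivative (\<lambda>c. D (deriv h1 z * c, deriv h2 z * c))) (at z)" .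
    moreover have "D (deriv h1 z * c, deriv h2 z * c) = cscale c (D (deriv h1 z, deriv h2 z))" for c
      using D(2)[of c "(deriv h1 z, deriv h2 z)"] by (simp add: cscale_def mult.commute)
    ultimately have dd: "((\<lambda>z. G (h1 z, h2 z)) has_derivative (\<lambda>c. cscale c (D (deriv h1 z, deriv h2 z)))) (at z)" by simp
    have "((\<lambda>z. fst (G (h1 z, h2 z))) has_derivative (\<lambda>c. fst (D (deriv h1 z, deriv h2 z)) * c)) (at z)"
      using has_derivative_fst[OF dd] by (simp add: cscale_def mult.commute)
    moreover have "((\<lambda>z. snd (G (h1 z, h2 z))) has_derivative (\<lambda>c. snd (D (deriv h1 z, deriv h2 z)) * c)) (at z)"
      using has_derivative_snd[OF dd] by (simp add: cscale_def mult.commute)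
    ultimately show ?thesis unfolding has_field_derivative_def by blast
  qed
  show "(\<lambda>z. fst (G (h1 z, h2 z))) holomorphic_on S" "(\<lambda>z. snd (G (h1 z, h2 z))) holomorphic_on S"
    unfolding holomorphic_on_open[OF h(3)] using d by blast+
qed

lemma poly2_holomorphic:
  assumes "h1 holomorphic_on S" "h2 holomorphic_on S"
  shows "(\<lambda>z. poly2 P (h1 z, h2 z)) holomorphic_on S"
  unfolding poly2_support split_beta by (intro holomorphic_intros assms)

lemma poly2_continuous:
  assumes "continuous_on S h" shows "continuous_on S (\<lambda>z. poly2 P (h z))"
proof -
  have "continuous_on S (\<lambda>z. poly2 P (fst (h z), snd (h z)))"
    unfolding poly2_support split_beta by (intro continuous_intros assms)
  then show ?thesis by simp
qed

lemma lipschitz_in_first: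
  assumes G: "holomorphic_map_on G unit_bidisk"
  shows "\<exists>C\<ge>0. \<forall>z w. norm z \<le> 1/4 \<longrightarrow> norm w \<le> 1/4 \<longrightarrow>
     norm (poly2 P (G (z, w)) - poly2 P (G (0, w))) \<le> C * norm z"
proof -
  let ?a = "\<lambda>z w. poly2 P (G (z, w))"
  have contG: "continuous_on unit_bidisk G"
    unfolding continuous_on_def
  proof
    fix p assume "p \<in> unit_bidisk"
    then obtain D where "(G has_derivative D) (at p)" using G by (auto simp: holomorphic_map_on_def)
    then have "isCont G p" by (rule has_derivative_continuous)
    then show "(G \<longlongrightarrow> G p) (at p within unit_bidisk)" unfolding isCont_def by (rule tendsto_within_subset) simp
  qed
  let ?K = "cball (0::complex) (1/2) \<times> cball (0::complex) (1/2)"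
  have "compact ((\<lambda>p. poly2 P (G p)) ` ?K)"
    by (intro compact_continuous_image poly2_continuous continuous_on_subset[OF contG] compact_Times compact_cball)
      (auto simp: unit_bidisk_def)
  then have "bounded ((\<lambda>p. poly2 P (G p)) ` ?K)" by (rule compact_imp_bounded)
  then obtain M where Mb: "\<forall>y\<in>(\<lambda>p. poly2 P (G p)) ` ?K. norm y \<le> M" unfolding bounded_iff by (elim exE)
  have M: "norm y \<le> M" if "y \<in> (\<lambda>p. poly2 P (G p)) ` ?K" for y using Mb that by (rule bspec)
  have M': "norm (?a z w) \<le> M" if "norm z \<le> 1/2" "norm w \<le> 1/2" for z w using M[of "?a z w"] that by force
  have M0: "M \<ge> 0" using order_trans[OF norm_ge_zero M'[of 0 0]] by simp
  have "norm (?a z w - ?a 0 w) \<le> (4 * M) * norm (z - 0)" if zw: "norm z \<le> 1/4" "norm w \<le> 1/4" for z w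
  proof -
    have hw: "(\<lambda>z. ?a z w) holomorphic_on ball 0 1"
    proof -
      have "(\<lambda>z. fst (G (z, w))) holomorphic_on ball 0 1" "(\<lambda>z. snd (G (z, w))) holomorphic_on ball 0 1"
        by (rule holomorphic_map_along_curve[OF G, of "\<lambda>z. z" _ "\<lambda>_. w"]; use zw in \<open>auto simp: unit_bidisk_def\<close>)+
      from poly2_holomorphic[OF this] show ?thesis by simp
    qed
    show ?thesis
    proof (rule field_differentiable_bound[of "cball 0 (1/4)" "\<lambda>z. ?a z w" "deriv (\<lambda>z. ?a z w)"])
      fix y assume y: "y \<in> cball (0::complex) (1/4)"
      then have y1: "y \<in> ball 0 1" by auto
      show "((\<lambda>z. ?a z w) has_field_derivative deriv (\<lambda>z. ?a z w) y) (at y within cball 0 (1/4))"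
        using holomorphic_derivI[OF hw open_ball y1] by (rule has_field_derivative_at_within)
      have sub: "cball y (1/4) \<subseteq> ball 0 1"
      proof
        fix v assume "v \<in> cball y (1/4)"
        then show "v \<in> ball 0 1" using y norm_triangle_ineq[of y "v - y"] by (simp add: dist_norm norm_minus_commute)
      qed
      have "norm ((deriv ^^ 1) (\<lambda>z. ?a z w) y) \<le> fact 1 * M / (1/4) ^ 1"
      proof (rule Cauchy_inequality)
        show "(\<lambda>z. ?a z w) holomorphic_on ball y (1/4)" by (rule holomorphic_on_subset[OF hw]) (use sub in auto)
        show "continuous_on (cball y (1/4)) (\<lambda>z. ?a z w)"
          by (rule continuous_on_subset[OF holomorphic_on_imp_continuous_on[OF hw] sub])
        show "norm (?a v w) \<le> M" if "norm (y - v) = 1/4" for v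
        proof (rule M')
          show "norm v \<le> 1/2" using y that norm_triangle_ineq4[of y "y - v"] by simp
        qed (use zw in simp)
      qed simp
      then show "norm (deriv (\<lambda>z. ?a z w) y) \<le> 4 * M" by simp
    qed (use zw in auto)
  qed
  then show ?thesis using M0 by (intro exI[of _ "4 * M"]) auto
qed
text \<open>In the given coordinates both curves lie in \<open>\<bar>z\<bar> \<le> \<bar>w\<bar> ^ t\<close>. On a curve in this region whose coordinate
  \<open>w\<close> vanishes to order \<open>i\<close>, a function agrees with its restriction to the axis \<open>z = 0\<close> up to order below
  \<open>i * t\<close>. The hypothesis on the first curve therefore makes the coefficients of positive order below \<open>t\<close> of the
  restriction of \<open>P n\<close> to that axis tend to 0, and these determine the coefficients of positive order below \<open>j * t\<close>
  along the second curve.\<close>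
lemma jet_transfer:
  assumes co: "holomorphic_coordinates x U F" and t: "t > 0" and r: "r > 0"
    and hu: "holomorphic_curve_on \<phi> (ball 0 r)" "\<phi> 0 = x"
    and bu: "\<And>z. z \<in> ball 0 r \<Longrightarrow> \<phi> z \<in> U \<and> norm (fst (F (\<phi> z))) \<le> norm (snd (F (\<phi> z))) powr t"
    and hs: "holomorphic_curve_on \<psi> (ball 0 r)" "\<psi> 0 = x"
    and bs: "\<And>z. z \<in> ball 0 r \<Longrightarrow> \<psi> z \<in> U \<and> norm (fst (F (\<psi> z))) \<le> norm (snd (F (\<psi> z))) powr t"
    and nc: "\<exists>m\<ge>1. curve_deriv m \<phi> 0 \<noteq> 0"
    and j: "j \<ge> 1" and vs: "\<And>m. 1 \<le> m \<Longrightarrow> m < j \<Longrightarrow> curve_deriv m \<psi> 0 = 0"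
    and lim: "\<And>m. 1 \<le> m \<Longrightarrow> (\<lambda>n. (deriv ^^ m) (\<lambda>z. poly2 (P n) (\<phi> z)) 0) \<longlonglongrightarrow> 0"
    and m: "1 \<le> m" "real m < real j * t"
  shows "(\<lambda>n. (deriv ^^ m) (\<lambda>z. poly2 (P n) (\<psi> z)) 0) \<longlonglongrightarrow> 0"
proof -
  have U: "open U" "x \<in> U" "F x = 0" "bij_betw F U unit_bidisk" "holomorphic_map_on F U"
    "holomorphic_map_on (inv_into U F) unit_bidisk" using co by (auto simp: holomorphic_coordinates_def)
  define G where "G = inv_into U F"
  have GF: "G (F p) = p" if "p \<in> U" for p using U(4) that by (simp add: G_def bij_betw_inv_into_left)
  have FU: "F p \<in> unit_bidisk" if "p \<in> U" for p using U(4) that by (auto simp: bij_betw_def)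
  have G: "holomorphic_map_on G unit_bidisk" using U(6) by (simp add: G_def)
  have comps: "(\<lambda>z. fst (F (\<gamma> z))) holomorphic_on ball 0 r \<and> (\<lambda>z. snd (F (\<gamma> z))) holomorphic_on ball 0 r"
    if "holomorphic_curve_on \<gamma> (ball 0 r)" "\<And>z. z \<in> ball 0 r \<Longrightarrow> \<gamma> z \<in> U" for \<gamma>
    using holomorphic_map_along_curve[OF U(5), of "\<lambda>z. fst (\<gamma> z)" "ball 0 r" "\<lambda>z. snd (\<gamma> z)"] that
    by (simp add: holomorphic_curve_on_def)
  define zu wu zs ws where "zu = (\<lambda>z. fst (F (\<phi> z)))" and "wu = (\<lambda>z. snd (F (\<phi> z)))"
    and "zs = (\<lambda>z. fst (F (\<psi> z)))" and "ws = (\<lambda>z. snd (F (\<psi> z)))"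
  have hzu: "zu holomorphic_on ball 0 r" "wu holomorphic_on ball 0 r" using comps[OF hu(1)] bu by (auto simp: zu_def wu_def)
  have hzs: "zs holomorphic_on ball 0 r" "ws holomorphic_on ball 0 r" using comps[OF hs(1)] bs by (auto simp: zs_def ws_def)
  have at0: "zu 0 = 0" "wu 0 = 0" "zs 0 = 0" "ws 0 = 0"
    using U(3) hu(2) hs(2) by (simp_all add: zu_def wu_def zs_def ws_def)
  have \<phi>G: "\<phi> z = G (zu z, wu z)" "norm (zu z) \<le> norm (wu z) powr t" "norm (zu z) < 1" "norm (wu z) < 1"
    if z: "z \<in> ball 0 r" for z
    using bu[OF z] GF[of "\<phi> z"] FU[of "\<phi> z"] by (auto simp: zu_def wu_def unit_bidisk_def mem_Times_iff)
  have \<psi>G: "\<psi> z = G (zs z, ws z)" "norm (zs z) \<le> norm (ws z) powr t" "norm (zs z) < 1" "norm (ws z) < 1"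
    if z: "z \<in> ball 0 r" for z
    using bs[OF z] GF[of "\<psi> z"] FU[of "\<psi> z"] by (auto simp: zs_def ws_def unit_bidisk_def mem_Times_iff)
  define B where "B n w = poly2 (P n) (G (0, w))" for n w
  have hB: "B n holomorphic_on ball 0 1" for n
  proof -
    have "(\<lambda>w. fst (G (0, w))) holomorphic_on ball 0 1" "(\<lambda>w. snd (G (0, w))) holomorphic_on ball 0 1"
      by (rule holomorphic_map_along_curve[OF G, of "\<lambda>_. 0" _ "\<lambda>w. w"]; simp add: unit_bidisk_def)+
    from poly2_holomorphic[OF this, of "P n"] show ?thesis by (simp add: B_def[abs_def])
  qed
  have curve_hol: "(\<lambda>z. poly2 (P n) (\<gamma> z)) holomorphic_on ball 0 r" if "holomorphic_curve_on \<gamma> (ball 0 r)" for \<gamma> n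
    using poly2_holomorphic[of "\<lambda>z. fst (\<gamma> z)" "ball 0 r" "\<lambda>z. snd (\<gamma> z)" "P n"] that by (simp add: holomorphic_curve_on_def)
  \<comment> \<open>Up to order below i * t, a curve inside the contact region has the jets of its projection to the second axis.\<close>
  have compare: "(deriv ^^ m) (\<lambda>z. poly2 (P n) (\<gamma> z)) 0 = (deriv ^^ m) (B n \<circ> w) 0"
    if hg: "holomorphic_curve_on \<gamma> (ball 0 r)" and hz: "z1 holomorphic_on ball 0 r" "w holomorphic_on ball 0 r"
      and w0: "w 0 = 0" and z0: "z1 0 = 0"
      and \<gamma>G: "\<And>z. z \<in> ball 0 r \<Longrightarrow> \<gamma> z = G (z1 z, w z) \<and> norm (z1 z) \<le> norm (w z) powr t \<and> norm (w z) < 1"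
      and i: "i \<ge> 1" and v: "\<And>m. 1 \<le> m \<Longrightarrow> m < i \<Longrightarrow> (deriv ^^ m) w 0 = 0"
      and m: "real m < real i * t" for \<gamma> z1 w i m n
  proof -
    obtain C e where C: "0 < e" "e \<le> r" "0 \<le> C" "\<And>z. z \<in> ball 0 e \<Longrightarrow> norm (w z - w 0) \<le> C * norm z ^ i"
      using vanishing_derivs_bound[OF hz(2) r v i] by blast
    obtain L where L: "L \<ge> 0" "\<And>z w. norm z \<le> 1/4 \<Longrightarrow> norm w \<le> 1/4 \<Longrightarrow>
        norm (poly2 (P n) (G (z, w)) - poly2 (P n) (G (0, w))) \<le> L * norm z"
      using lipschitz_in_first[OF G, of "P n"] by blast
    have small: "\<exists>s>0. \<forall>z. dist z 0 < s \<longrightarrow> dist (h z) (h 0) < 1/4" if "h holomorphic_on ball 0 r" for h :: "complex \<Rightarrow> complex"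
    proof -
      have "isCont h 0"
        using holomorphic_on_imp_continuous_on[OF that] r continuous_on_eq_continuous_at[of "ball 0 r" h] by auto
      then show ?thesis unfolding continuous_at_eps_delta by (rule allE[of _ "1/4"]) simp
    qed
    obtain s1 where s1: "s1 > 0" "\<And>z. dist z 0 < s1 \<Longrightarrow> dist (z1 z) (z1 0) < 1/4" using small[OF hz(1)] by blast
    obtain s2 where s2: "s2 > 0" "\<And>z. dist z 0 < s2 \<Longrightarrow> dist (w z) (w 0) < 1/4" using small[OF hz(2)] by blast
    define e' where "e' = min e (min s1 s2)"
    have e': "e' > 0" "e' \<le> r" "e' \<le> e" "e' \<le> s1" "e' \<le> s2" using C s1 s2 by (auto simp: e'_def)
    let ?d = "\<lambda>z. poly2 (P n) (\<gamma> z) - (B n \<circ> w) z"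
    have hBw: "(B n \<circ> w) holomorphic_on ball 0 r"
      by (rule holomorphic_on_compose_gen[OF hz(2) hB]) (use \<gamma>G in auto)
    have hd: "?d holomorphic_on ball 0 r" by (intro holomorphic_on_diff curve_hol[OF hg] hBw)
    have "(deriv ^^ m) ?d 0 = 0"
    proof (rule higher_deriv_0_of_bound[OF _ e'(1) _ m])
      show "?d holomorphic_on ball 0 e'" by (rule holomorphic_on_subset[OF hd]) (use e' in auto)
      fix z :: complex assume z: "z \<in> ball 0 e'"
      have zr: "z \<in> ball 0 r" "z \<in> ball 0 e" using z e' by auto
      have "norm (z1 z) \<le> 1/4" "norm (w z) \<le> 1/4"
        using s1(2)[of z] s2(2)[of z] z e' w0 z0 by (simp_all add: dist_norm)
      then have "norm (?d z) \<le> L * norm (z1 z)" using L(2) \<gamma>G[OF zr(1)] by (simp add: B_def)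
      also have "\<dots> \<le> L * (norm (w z) powr t)" using \<gamma>G[OF zr(1)] L(1) by (intro mult_left_mono) auto
      also have "\<dots> \<le> L * ((C * norm z ^ i) powr t)"
        using C(4)[OF zr(2)] w0 t L(1) by (intro mult_left_mono powr_mono2) auto
      also have "\<dots> = L * C powr t * norm z powr (real i * t)"
        using C(3) i by (cases "z = 0") (auto simp: powr_mult powr_realpow [symmetric] powr_powr)
      finally show "norm (?d z) \<le> (L * C powr t) * norm z powr (real i * t)" .
    qed
    moreover have "(deriv ^^ m) ?d 0 = (deriv ^^ m) (\<lambda>z. poly2 (P n) (\<gamma> z)) 0 - (deriv ^^ m) (B n \<circ> w) 0"
      by (rule higher_deriv_diff[OF curve_hol[OF hg] hBw open_ball]) (use r in simp)
    ultimately show ?thesis by simp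
  qed
  \<comment> \<open>If wu were constant, so would be zu, by the inequality, and then \<phi>.\<close>
  have "\<exists>k\<ge>1. (deriv ^^ k) wu 0 \<noteq> 0"
  proof (rule ccontr)
    assume neg: "\<not> ?thesis"
    have wu0: "wu z = wu 0" if zr: "z \<in> ball 0 r" for z
    proof (rule holomorphic_fun_eq_const_on_connected[OF hzu(2) open_ball connected_ball])
      show "(deriv ^^ n) wu 0 = 0" if "0 < n" for n
      proof -
        have "1 \<le> n" using that by simp
        then show ?thesis using neg by blast
      qed
    qed (use r zr in simp_all)
    have \<phi>x: "\<phi> z = x" if "z \<in> ball 0 r" for z
    proof -
      have "wu z = 0" using wu0[OF that] at0 by simp
      moreover have "zu z = 0" using \<phi>G(2)[OF that] \<open>wu z = 0\<close> by simp
      ultimately have "\<phi> z = G (F x)" using \<phi>G(1)[OF that] U(3) by (simp add: zero_prod_def)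
      then show ?thesis using GF U(2) by simp
    qed
    have "curve_deriv m \<phi> 0 = 0" if "m \<ge> 1" for m
    proof -
      have z: "(deriv ^^ m) h 0 = 0" if hc: "\<And>z. z \<in> ball 0 r \<Longrightarrow> h z = c" for h :: "complex \<Rightarrow> complex" and c
      proof -
        have "(deriv ^^ m) h 0 = (deriv ^^ m) (\<lambda>_. c) 0"
          by (rule higher_deriv_cong_ev) (use eventually_nhds_in_open[of "ball 0 r" 0] r hc in \<open>auto elim!: eventually_mono\<close>)
        then show ?thesis using \<open>m \<ge> 1\<close> by simp
      qed
      show ?thesis unfolding curve_deriv_def zero_prod_def
        using z[of "\<lambda>t. fst (\<phi> t)" "fst x"] z[of "\<lambda>t. snd (\<phi> t)" "snd x"] \<phi>x by simp
    qed
    then show False using nc by blast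
  qed
  define k where "k = (LEAST k. 1 \<le> k \<and> (deriv ^^ k) wu 0 \<noteq> 0)"
  have k: "1 \<le> k" "(deriv ^^ k) wu 0 \<noteq> 0"
    using LeastI_ex[OF \<open>\<exists>k\<ge>1. (deriv ^^ k) wu 0 \<noteq> 0\<close>] by (simp_all add: k_def)
  have kl: "(deriv ^^ i) wu 0 = 0" if "1 \<le> i" "i < k" for i
    using not_less_Least[of i "\<lambda>k. 1 \<le> k \<and> (deriv ^^ k) wu 0 \<noteq> 0"] that by (auto simp: k_def)
  have kl': "(deriv ^^ i) wu 0 = 0" if "i < k" for i
    using kl[of i] that at0 by (cases i) auto
  have limB: "(\<lambda>n. (deriv ^^ l) (B n) 0) \<longlonglongrightarrow> 0" if "1 \<le> l" "real l < t" for l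
  proof (rule coefficients_tend_to_zero[OF hB zero_less_one hzu(2) r at0(2) k kl' _ that])
    fix m assume mm: "1 \<le> m" "real m < real k * t"
    have "(deriv ^^ m) (\<lambda>z. poly2 (P n) (\<phi> z)) 0 = (deriv ^^ m) (B n \<circ> wu) 0" for n
      by (rule compare[OF hu(1) hzu at0(2,1) _ k(1) kl mm(2)]) (use \<phi>G in auto)
    then show "(\<lambda>n. (deriv ^^ m) (B n \<circ> wu) 0) \<longlonglongrightarrow> 0" using lim[OF mm(1)] by simp
  qed
  \<comment> \<open>The second coordinate of the other curve vanishes to order at least j.\<close>
  have ws0: "(deriv ^^ i) ws 0 = 0" if "i < j" for i
  proof -
    have v1: "(deriv ^^ m) (\<lambda>z. fst (\<psi> z)) 0 = 0" "(deriv ^^ m) (\<lambda>z. snd (\<psi> z)) 0 = 0" if "1 \<le> m" "m < j" for m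
      using vs[OF that] by (simp_all add: curve_deriv_def zero_prod_def)
    obtain C1 e1 where C1: "0 < e1" "e1 \<le> r" "0 \<le> C1" "\<And>z. z \<in> ball 0 e1 \<Longrightarrow> norm (fst (\<psi> z) - fst (\<psi> 0)) \<le> C1 * norm z ^ j"
      using vanishing_derivs_bound[OF _ r v1(1) j] hs(1) by (auto simp: holomorphic_curve_on_def)
    obtain C2 e2 where C2: "0 < e2" "e2 \<le> r" "0 \<le> C2" "\<And>z. z \<in> ball 0 e2 \<Longrightarrow> norm (snd (\<psi> z) - snd (\<psi> 0)) \<le> C2 * norm z ^ j"
      using vanishing_derivs_bound[OF _ r v1(2) j] hs(1) by (auto simp: holomorphic_curve_on_def)
    obtain D where D: "(F has_derivative D) (at x)" using U(2,5) by (auto simp: holomorphic_map_on_def)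
    obtain K where K: "K > 0" "\<And>v. norm (D v) \<le> norm v * K"
      using bounded_linear.pos_bounded[OF has_derivative_bounded_linear[OF D]] by blast
    obtain s where s: "s > 0" "\<And>y. norm (y - x) < s \<Longrightarrow> norm (F y - F x - D (y - x)) \<le> 1 * norm (y - x)"
      using D[unfolded has_derivative_at_alt] zero_less_one by blast
    define C where "C = C1 + C2"
    have nb: "norm (\<psi> z - x) \<le> C * norm z ^ j" if "z \<in> ball 0 (min e1 e2)" for z
    proof -
      have "norm (\<psi> z - x) \<le> norm (fst (\<psi> z - x)) + norm (snd (\<psi> z - x))"
        using norm_Pair_le[of "fst (\<psi> z - x)" "snd (\<psi> z - x)"] by (simp only: prod.collapse)
      then show ?thesis using C1(4)[of z] C2(4)[of z] that hs(2) by (simp add: C_def distrib_right)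
    qed
    have C0: "C \<ge> 0" using C1 C2 by (simp add: C_def)
    have "isCont \<psi> 0"
    proof -
      have "continuous_on (ball 0 r) (\<lambda>z. (fst (\<psi> z), snd (\<psi> z)))"
        using hs(1) by (intro continuous_on_Pair holomorphic_on_imp_continuous_on) (auto simp: holomorphic_curve_on_def)
      then show ?thesis using r continuous_on_eq_continuous_at[of "ball 0 r" \<psi>] by simp
    qed
    then obtain s' where s': "s' > 0" "\<And>z. dist z 0 < s' \<Longrightarrow> dist (\<psi> z) (\<psi> 0) < s"
      using s(1) unfolding continuous_at_eps_delta by blast
    define e where "e = min s' (min e1 e2)"
    have e: "e > 0" "e \<le> r" "e \<le> s'" "e \<le> min e1 e2" using s' C1 C2 by (auto simp: e_def)
    show ?thesis
    proof (rule higher_deriv_0_of_bound[of ws e _ "real j"])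
      show "ws holomorphic_on ball 0 e" by (rule holomorphic_on_subset[OF hzs(2)]) (use e in auto)
      show "real i < real j" using \<open>i < j\<close> by simp
      fix z :: complex assume z: "z \<in> ball 0 e"
      have "norm (\<psi> z - x) < s" using s'(2)[of z] z e hs(2) by (simp add: dist_norm)
      from s(2)[OF this] have "norm (F (\<psi> z) - D (\<psi> z - x)) \<le> norm (\<psi> z - x)" by (simp add: U(3))
      then have "norm (F (\<psi> z)) \<le> norm (\<psi> z - x) + norm (D (\<psi> z - x))"
        using norm_triangle_ineq[of "F (\<psi> z) - D (\<psi> z - x)" "D (\<psi> z - x)"] by simp
      also have "\<dots> \<le> (1 + K) * norm (\<psi> z - x)" using K(2)[of "\<psi> z - x"] by (simp add: distrib_right mult.commute)
      also have "\<dots> \<le> (1 + K) * (C * norm z ^ j)" using nb[of z] z e K(1) by (intro mult_left_mono) auto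
      finally have "norm (F (\<psi> z)) \<le> ((1 + K) * C) * norm z ^ j" by simp
      moreover have "norm (ws z) \<le> norm (F (\<psi> z))"
        unfolding ws_def using norm_snd_le[of "snd (F (\<psi> z))" "fst (F (\<psi> z))"] by simp
      moreover have "norm z ^ j = norm z powr real j" using j by (cases "z = 0") (auto simp: powr_realpow)
      ultimately show "norm (ws z) \<le> ((1 + K) * C) * norm z powr real j" by simp
    qed (rule e(1))
  qed
  have "(deriv ^^ m) (\<lambda>z. poly2 (P n) (\<psi> z)) 0 = (deriv ^^ m) (B n \<circ> ws) 0" for n
    by (rule compare[OF hs(1) hzs at0(4,3) _ j _ m(2)]) (use \<psi>G ws0 in auto)
  moreover have "(\<lambda>n. (deriv ^^ m) (B n \<circ> ws) 0) \<longlonglongrightarrow> 0"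
    by (rule composed_coefficients_tend_to_zero[OF hB zero_less_one hzs(2) r at0(4) ws0 j limB m])
  ultimately show ?thesis by simp
qed

section \<open>Limit maps of a family of leaves\<close>

lemma uniform_limit_continuous_compose:
  fixes G :: "nat \<Rightarrow> complex \<Rightarrow> C2" and H :: "C2 \<Rightarrow> complex"
  assumes G: "uniform_limit A G \<phi> sequentially" and b: "bounded (\<phi> ` A)" and H: "continuous_on UNIV H"
  shows "uniform_limit A (\<lambda>n z. H (G n z)) (\<lambda>z. H (\<phi> z)) sequentially"
proof (rule uniform_limitI)
  fix e :: real assume e: "e > 0"
  obtain B where B: "\<And>z. z \<in> A \<Longrightarrow> norm (\<phi> z) \<le> B" using b unfolding bounded_iff by blast
  have "uniformly_continuous_on (cball 0 (B + 1)) H"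
    by (rule compact_uniformly_continuous) (auto intro: continuous_on_subset[OF H])
  then obtain \<delta> where \<delta>: "\<delta> > 0" "\<And>p q. p \<in> cball 0 (B + 1) \<Longrightarrow> q \<in> cball 0 (B + 1) \<Longrightarrow> dist q p < \<delta> \<Longrightarrow> dist (H q) (H p) < e"
    using e unfolding uniformly_continuous_on_def by blast
  have "eventually (\<lambda>n. \<forall>z\<in>A. dist (G n z) (\<phi> z) < min \<delta> 1) sequentially"
    by (rule uniform_limitD[OF G]) (use \<delta>(1) in simp)
  then show "eventually (\<lambda>n. \<forall>z\<in>A. dist (H (G n z)) (H (\<phi> z)) < e) sequentially"
  proof eventually_elim
    case (elim n)
    show ?case
    proof
      fix z assume z: "z \<in> A"
      have d: "dist (G n z) (\<phi> z) < \<delta>" "dist (G n z) (\<phi> z) < 1" using elim z by auto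
      have "norm (G n z) \<le> norm (\<phi> z) + dist (G n z) (\<phi> z)"
        using norm_triangle_ineq[of "\<phi> z" "G n z - \<phi> z"] by (simp add: dist_norm)
      then have "G n z \<in> cball 0 (B + 1)" "\<phi> z \<in> cball 0 (B + 1)" using B[OF z] d(2) by auto
      then show "dist (H (G n z)) (H (\<phi> z)) < e" using \<delta>(2) d(1) by blast
    qed
  qed
qed

lemma uniform_limit_pair:
  assumes a: "uniform_limit K f1 g1 F" and b: "uniform_limit K f2 g2 F"
  shows "uniform_limit K (\<lambda>n z. (f1 n z, f2 n z)) (\<lambda>z. (g1 z, g2 z)) F"
proof (rule uniform_limitI)
  fix e :: real assume "e > 0"
  then have e: "e / 2 > 0" by simp
  from uniform_limitD[OF a e] uniform_limitD[OF b e]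
  show "eventually (\<lambda>n. \<forall>z\<in>K. dist (f1 n z, f2 n z) (g1 z, g2 z) < e) F"
  proof eventually_elim
    case (elim n)
    show ?case
    proof
      fix z assume z: "z \<in> K"
      have "dist (f1 n z, f2 n z) (g1 z, g2 z) \<le> dist (f1 n z) (g1 z) + dist (f2 n z) (g2 z)"
        unfolding dist_Pair_Pair by (intro sqrt_sum_squares_le_sum zero_le_dist)
      then show "dist (f1 n z, f2 n z) (g1 z, g2 z) < e"
        using bspec[OF elim(1) z] bspec[OF elim(2) z] by linarith
    qed
  qed
qed

lemma higher_deriv_uniform_limit:
  fixes g :: "nat \<Rightarrow> complex \<Rightarrow> complex"
  assumes e: "e > 0" and lim: "uniform_limit (cball 0 e) g h sequentially"
    and g: "\<And>n. g n holomorphic_on UNIV" and h: "h holomorphic_on ball 0 e"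
  shows "(\<lambda>n. (deriv ^^ m) (g n) 0) \<longlonglongrightarrow> (deriv ^^ m) h 0"
proof (rule LIMSEQ_I)
  fix \<epsilon> :: real assume eps: "\<epsilon> > 0"
  define \<rho> where "\<rho> = e / 2"
  have rho: "0 < \<rho>" "\<rho> < e" using e by (auto simp: \<rho>_def)
  define \<delta> where "\<delta> = \<epsilon> * \<rho> ^ m / (2 * fact m)"
  have del: "\<delta> > 0" using eps rho by (simp add: \<delta>_def)
  from uniform_limitD[OF lim del] obtain N where N: "\<And>n z. n \<ge> N \<Longrightarrow> z \<in> cball 0 e \<Longrightarrow> dist (g n z) (h z) < \<delta>"
    unfolding eventually_sequentially by blast
  have "norm ((deriv ^^ m) (g n) 0 - (deriv ^^ m) h 0) < \<epsilon>" if n: "n \<ge> N" for n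
  proof -
    have gb: "g n holomorphic_on ball 0 e" using g by (rule holomorphic_on_subset) simp
    have d: "(\<lambda>z. g n z - h z) holomorphic_on ball 0 e" by (intro holomorphic_on_diff gb h)
    have "(deriv ^^ m) (g n) 0 - (deriv ^^ m) h 0 = (deriv ^^ m) (\<lambda>z. g n z - h z) 0"
      by (rule higher_deriv_diff[symmetric, OF gb h open_ball]) (use e in simp)
    moreover have "norm ((deriv ^^ m) (\<lambda>z. g n z - h z) 0) \<le> fact m * \<delta> / \<rho> ^ m"
    proof (rule Cauchy_inequality)
      show "(\<lambda>z. g n z - h z) holomorphic_on ball 0 \<rho>" by (rule holomorphic_on_subset[OF d]) (use rho in auto)
      show "continuous_on (cball 0 \<rho>) (\<lambda>z. g n z - h z)"
        by (rule continuous_on_subset[OF holomorphic_on_imp_continuous_on[OF d]]) (use rho in auto)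
      show "norm (g n z - h z) \<le> \<delta>" if "norm (0 - z) = \<rho>" for z
        using N[OF n, of z] that rho by (simp add: dist_norm)
    qed (rule rho)
    moreover have "fact m * \<delta> / \<rho> ^ m = \<epsilon> / 2" using rho by (simp add: \<delta>_def)
    ultimately have "norm ((deriv ^^ m) (g n) 0 - (deriv ^^ m) h 0) \<le> \<epsilon> / 2" by (simp only:)
    then show ?thesis using eps by linarith
  qed
  then show "\<exists>N. \<forall>n\<ge>N. norm ((deriv ^^ m) (g n) 0 - (deriv ^^ m) h 0) < \<epsilon>" by blast
qed

text \<open>A relation between consecutive curves of a family extends to iterates, with the product of the
  multipliers along the orbit.\<close>
lemma chain_of_curves:
  fixes \<psi> :: "C2 \<Rightarrow> complex \<Rightarrow> C2"
  assumes T: "\<And>y. y \<in> S \<Longrightarrow> T y \<in> S" and a: "\<And>y z. y \<in> S \<Longrightarrow> T (\<psi> y z) = \<psi> (T y) (a y * z)" and y: "y \<in> S"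
  shows "(T ^^ n) y \<in> S" "(T ^^ n) (\<psi> y z) = \<psi> ((T ^^ n) y) ((\<Prod>i<n. a ((T ^^ i) y)) * z)"
proof -
  have "(T ^^ n) y \<in> S \<and> (T ^^ n) (\<psi> y z) = \<psi> ((T ^^ n) y) ((\<Prod>i<n. a ((T ^^ i) y)) * z)"
  proof (induction n)
    case (Suc n)
    then show ?case using T a by (simp add: mult.assoc mult.left_commute)
  qed (use y in simp)
  then show "(T ^^ n) y \<in> S" "(T ^^ n) (\<psi> y z) = \<psi> ((T ^^ n) y) ((\<Prod>i<n. a ((T ^^ i) y)) * z)" by auto
qed

context
  fixes d :: real and h :: "C2 \<Rightarrow> C2" and S :: "C2 set" and \<psi> :: "C2 \<Rightarrow> complex \<Rightarrow> C2"
  assumes fam: "unstable_family d h S \<psi>"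
begin

lemma family_curve:
  assumes "y \<in> S"
  shows "inj (\<psi> y)" "holomorphic_curve_on (\<psi> y) UNIV" "\<psi> y 0 = y" "injective_holomorphic_immersion (\<psi> y)"
    "\<psi> y z \<in> Jplus (inv h)"
proof -
  have all: "y \<in> S \<longrightarrow> range (\<psi> y) \<subseteq> Jplus (inv h)" "injective_holomorphic_immersion (\<psi> y)" "\<psi> y 0 = y"
    using fam assms unfolding unstable_family_def by blast+
  show "\<psi> y z \<in> Jplus (inv h)" using all(1) assms by blast
  show "inj (\<psi> y)" "holomorphic_curve_on (\<psi> y) UNIV" using all(2) by (simp_all add: injective_holomorphic_immersion_def)
qed (use fam assms in \<open>simp_all add: unstable_family_def\<close>)

lemma family_green_le:
  assumes "y \<in> S" "norm z \<le> r" "green_max d h (\<psi> y) r \<le> ereal C"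
  shows "green d h (\<psi> y z) \<le> C"
proof -
  have "ereal (green d h (\<psi> y z)) \<le> green_max d h (\<psi> y) r"
    unfolding green_max_def by (rule SUP_upper) (use assms in simp)
  then show ?thesis using assms(3) by (metis ereal_less_eq(3) order_trans)
qed

lemma family_green_1:
  assumes "y \<in> S" "norm z \<le> 1" shows "green d h (\<psi> y z) \<le> 1"
proof (rule family_green_le[OF assms])
  show "green_max d h (\<psi> y) 1 \<le> ereal 1" using fam assms(1) by (simp add: unstable_family_def one_ereal_def)
qed

text \<open>For \<open>norm l < 1\<close> the Green function would be at most \<open>1 / d\<close> on the image of the unit disk under \<open>\<psi> y\<close>,
  where its maximum is 1.\<close>
lemma multiplier_norm_ge_1:
  assumes y: "y \<in> S" and l: "\<And>z. h (\<psi> y z) = \<psi> (h y) (l * z)" and d: "d > 1"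
    and green: "\<And>p. p \<in> Jplus (inv h) \<Longrightarrow> green d h (h p) = d * green d h p"
  shows "norm l \<ge> 1"
proof (rule ccontr)
  assume neg: "\<not> ?thesis"
  have hy: "h y \<in> S" using fam y by (auto simp: unstable_family_def)
  have "green_max d h (\<psi> y) 1 \<le> ereal (1 / d)"
    unfolding green_max_def
  proof (rule SUP_least)
    fix z :: complex assume z: "z \<in> cball 0 1"
    have "norm (l * z) \<le> 1" using neg z by (simp add: norm_mult mult_le_one)
    then have "green d h (\<psi> (h y) (l * z)) \<le> 1" by (rule family_green_1[OF hy])
    then have "d * green d h (\<psi> y z) \<le> 1" using green[OF family_curve(5)[OF y, of z]] l[of z] by simp
    then show "ereal (green d h (\<psi> y z)) \<le> ereal (1 / d)" using d by (simp add: field_simps)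
  qed
  moreover have "green_max d h (\<psi> y) 1 = 1" using fam y by (simp add: unstable_family_def)
  ultimately have "ereal 1 \<le> ereal (1 / d)" by (simp add: one_ereal_def)
  then show False using d by simp
qed

text \<open>Both sides parametrize the same leaf.\<close>
lemma multiplier_exists:
  assumes y: "y \<in> S" and bij: "bij h" and pol: "polynomial_map h"
  shows "\<exists>l. l \<noteq> 0 \<and> (\<forall>z. h (\<psi> y z) = \<psi> (h y) (l * z))"
proof -
  have hy: "h y \<in> S" using fam y by (auto simp: unstable_family_def)
  obtain P Q where h: "\<forall>q. h q = (poly2 P q, poly2 Q q)" using pol unfolding polynomial_map_def by (elim exE)
  have hc: "(\<lambda>z. fst (\<psi> y z)) holomorphic_on UNIV" "(\<lambda>z. snd (\<psi> y z)) holomorphic_on UNIV"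
    using family_curve(2)[OF y] by (auto simp: holomorphic_curve_on_def)
  have hol: "holomorphic_curve_on (\<lambda>z. h (\<psi> y z)) UNIV"
    using poly2_holomorphic[OF hc, of P] poly2_holomorphic[OF hc, of Q]
    by (simp add: holomorphic_curve_on_def h[rule_format, of "\<psi> y z" for z])
  have inj: "inj (\<lambda>z. h (\<psi> y z))"
    using inj_compose[OF bij_is_inj[OF bij] family_curve(1)[OF y]] by (simp add: o_def)
  have ran: "range (\<lambda>z. h (\<psi> y z)) = range (\<psi> (h y))"
  proof -
    have "h ` range (\<psi> y) = range (\<psi> (h y))" using fam y by (simp add: unstable_family_def)
    then show ?thesis by (simp add: image_image)
  qed
  obtain \<alpha> \<beta> where ab: "\<alpha> \<noteq> 0" "\<forall>z. h (\<psi> y z) = \<psi> (h y) (\<alpha> * z + \<beta>)"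
    using same_range_affine[OF inj hol family_curve(4)[OF hy] ran] by (elim exE conjE)
  have "\<psi> (h y) \<beta> = \<psi> (h y) 0" using ab(2)[rule_format, of 0] family_curve(3)[OF y] family_curve(3)[OF hy] by simp
  then have "\<beta> = 0" by (rule injD[OF family_curve(1)[OF hy]])
  then show ?thesis using ab by (intro exI[of _ \<alpha>]) simp
qed

lemma family_leaf:
  assumes y: "y \<in> S" "y' \<in> S" and eq: "\<psi> y' b = \<psi> y a"
  shows "\<exists>\<alpha> \<beta>. b = \<alpha> * a + \<beta> \<and> (\<forall>t. \<psi> y' (\<alpha> * t + \<beta>) = \<psi> y t)"
proof -
  have "range (\<psi> y) \<inter> range (\<psi> y') \<noteq> {}" using eq by (metis disjoint_iff rangeI)
  then have ran: "range (\<psi> y) = range (\<psi> y')" using fam y unfolding unstable_family_def by blast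
  obtain \<alpha> \<beta> where ab: "\<forall>z. \<psi> y z = \<psi> y' (\<alpha> * z + \<beta>)"
    using same_range_affine[OF family_curve(1,2)[OF y(1)] family_curve(4)[OF y(2)] ran] by (elim exE conjE)
  have "\<psi> y' b = \<psi> y' (\<alpha> * a + \<beta>)" using eq ab by simp
  then have "b = \<alpha> * a + \<beta>" by (rule injD[OF family_curve(1)[OF y(2)]])
  then show ?thesis using ab by (intro exI[of _ \<alpha>] exI[of _ \<beta>]) simp
qed

lemma limit_radius_pos: "limit_radius d h S \<psi> x > 0"
proof -
  have "1 \<le> limit_radius d h S \<psi> x"
    unfolding limit_radius_def
  proof (rule Inf_greatest)
    fix R assume "R \<in> ereal ` {r. 0 \<le> r \<and> local_green_max d h S \<psi> x r = \<infinity>}"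
    then obtain r where r: "R = ereal r" "local_green_max d h S \<psi> x r = \<infinity>" by blast
    have "1 \<le> r"
    proof (rule ccontr)
      assume "\<not> 1 \<le> r"
      have "local_green_max d h S \<psi> x r \<le> 1"
        unfolding local_green_max_def
      proof (rule Limsup_bounded)
        show "eventually (\<lambda>y. green_max d h (\<psi> y) r \<le> 1) (tends_within x S)"
          unfolding tends_within_def eventually_inf_principal
        proof (rule always_eventually, intro allI impI)
          fix y assume "y \<in> S"
          have "green_max d h (\<psi> y) r \<le> green_max d h (\<psi> y) 1"
            unfolding green_max_def by (rule SUP_subset_mono) (use \<open>\<not> 1 \<le> r\<close> in auto)
          then show "green_max d h (\<psi> y) r \<le> 1" using fam \<open>y \<in> S\<close> by (simp add: unstable_family_def)
        qed
      qed
      then show False using r(2) by simp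
    qed
    then show "1 \<le> R" by (simp add: r(1) one_ereal_def)
  qed
  moreover have "(0::ereal) < 1" by simp
  ultimately show ?thesis by order
qed

lemma open_limit_disk: "open (limit_disk d h S \<psi> x)" and zero_limit_disk: "0 \<in> limit_disk d h S \<psi> x"
proof -
  show "0 \<in> limit_disk d h S \<psi> x" using limit_radius_pos by (simp add: limit_disk_def zero_ereal_def)
  show "open (limit_disk d h S \<psi> x)"
  proof (cases "limit_radius d h S \<psi> x")
    case (real R)
    then have "limit_disk d h S \<psi> x = ball 0 R" by (auto simp: limit_disk_def)
    then show ?thesis by simp
  qed (auto simp: limit_disk_def)
qed

lemma limit_map_near_0:
  assumes "\<phi> \<in> limit_maps d h S \<psi> x"
  obtains y e where "\<And>n. y n \<in> S" "y \<longlonglongrightarrow> x" "e > 0" "uniform_limit (cball 0 e) (\<lambda>n. \<psi> (y n)) \<phi> sequentially"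
    "holomorphic_curve_on \<phi> (cball 0 e)" "\<phi> 0 = x"
proof -
  have hol: "holomorphic_curve_on \<phi> (limit_disk d h S \<psi> x)" using assms by (simp add: limit_maps_def)
  obtain y where y: "\<And>n. y n \<in> S" "y \<longlonglongrightarrow> x"
      "\<forall>z\<in>limit_disk d h S \<psi> x. \<exists>e>0. cball z e \<subseteq> limit_disk d h S \<psi> x \<and> uniform_limit (cball z e) (\<lambda>n. \<psi> (y n)) \<phi> sequentially"
    using assms unfolding limit_maps_def by blast
  obtain e where e: "e > 0" "cball 0 e \<subseteq> limit_disk d h S \<psi> x" "uniform_limit (cball 0 e) (\<lambda>n. \<psi> (y n)) \<phi> sequentially"
    using bspec[OF y(3) zero_limit_disk] by blast
  have "(\<lambda>n. \<psi> (y n) 0) \<longlonglongrightarrow> \<phi> 0" by (rule tendsto_uniform_limitI[OF e(3)]) (use e(1) in simp)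
  moreover have "\<psi> (y n) 0 = y n" for n by (rule family_curve(3)[OF y(1)])
  ultimately have "\<phi> 0 = x" using y(2) LIMSEQ_unique by simp
  moreover have "holomorphic_curve_on \<phi> (cball 0 e)"
    using hol e(2) unfolding holomorphic_curve_on_def by (meson holomorphic_on_subset)
  ultimately show thesis by (intro that[OF y(1,2) e(1,3)])
qed

lemma limit_map_coefficients:
  assumes y: "\<And>n. y n \<in> S" and e: "e > 0" and lim: "uniform_limit (cball 0 e) (\<lambda>n. \<psi> (y n)) \<phi> sequentially"
    and hol: "holomorphic_curve_on \<phi> (cball 0 e)"
  shows "(\<lambda>n. (deriv ^^ m) (\<lambda>z. poly2 P (\<psi> (y n) z)) 0) \<longlonglongrightarrow> (deriv ^^ m) (\<lambda>z. poly2 P (\<phi> z)) 0"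
proof (rule higher_deriv_uniform_limit[OF e])
  have hc: "(\<lambda>z. fst (\<phi> z)) holomorphic_on cball 0 e" "(\<lambda>z. snd (\<phi> z)) holomorphic_on cball 0 e"
    using hol by (auto simp: holomorphic_curve_on_def)
  have "continuous_on (cball 0 e) (\<lambda>z. (fst (\<phi> z), snd (\<phi> z)))"
    by (intro continuous_on_Pair holomorphic_on_imp_continuous_on hc)
  then have "compact (\<phi> ` cball 0 e)" by (intro compact_continuous_image) auto
  then show "uniform_limit (cball 0 e) (\<lambda>n z. poly2 P (\<psi> (y n) z)) (\<lambda>z. poly2 P (\<phi> z)) sequentially"
    by (intro uniform_limit_continuous_compose[OF lim] compact_imp_bounded poly2_continuous continuous_on_id)
  show "(\<lambda>z. poly2 P (\<psi> (y n) z)) holomorphic_on UNIV" for n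
    using poly2_holomorphic[of "\<lambda>z. fst (\<psi> (y n) z)" UNIV "\<lambda>z. snd (\<psi> (y n) z)" P] family_curve(2)[OF y]
    by (simp add: holomorphic_curve_on_def)
  show "(\<lambda>z. poly2 P (\<phi> z)) holomorphic_on ball 0 e"
    using holomorphic_on_subset[OF poly2_holomorphic[OF hc, of P], of "ball 0 e"] by simp
qed

text \<open>Hence all nonconstant limit maps at a point define the same germ.\<close>
lemma limit_maps_same_germ:
  assumes phi1: "\<phi>1 \<in> limit_maps d h S \<psi> x" and phi2: "\<phi>2 \<in> limit_maps d h S \<psi> x"
    and nc: "\<exists>m\<ge>1. curve_deriv m \<phi>2 0 \<noteq> 0" and rho: "\<rho> > 0"
  shows "\<exists>\<epsilon>>0. \<phi>1 ` ball 0 \<epsilon> \<subseteq> \<phi>2 ` ball 0 \<rho>"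
proof -
  obtain y e1 where y: "\<And>n. y n \<in> S" "e1 > 0" "uniform_limit (cball 0 e1) (\<lambda>n. \<psi> (y n)) \<phi>1 sequentially"
    "holomorphic_curve_on \<phi>1 (cball 0 e1)" "\<phi>1 0 = x"
    by (rule limit_map_near_0[OF phi1]) (rule that)
  obtain y' e2 where y': "\<And>n. y' n \<in> S" "e2 > 0" "uniform_limit (cball 0 e2) (\<lambda>n. \<psi> (y' n)) \<phi>2 sequentially"
    "holomorphic_curve_on \<phi>2 (cball 0 e2)" "\<phi>2 0 = x"
    by (rule limit_map_near_0[OF phi2]) (rule that)
  define R where "R = min e1 e2"
  have R: "R > 0" "ball 0 R \<subseteq> cball (0::complex) e1" "ball 0 R \<subseteq> cball (0::complex) e2" using y y' by (auto simp: R_def)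
  have hol1: "(\<lambda>z. fst (\<phi>1 z)) holomorphic_on ball 0 R" "(\<lambda>z. snd (\<phi>1 z)) holomorphic_on ball 0 R"
    using y(4) R(2) by (auto simp: holomorphic_curve_on_def intro: holomorphic_on_subset)
  have hol2: "(\<lambda>z. fst (\<phi>2 z)) holomorphic_on ball 0 R" "(\<lambda>z. snd (\<phi>2 z)) holomorphic_on ball 0 R"
    using y'(4) R(3) by (auto simp: holomorphic_curve_on_def intro: holomorphic_on_subset)
  have n1: "(\<lambda>z. fst (\<psi> (y n) z)) holomorphic_on UNIV" "(\<lambda>z. snd (\<psi> (y n) z)) holomorphic_on UNIV" for n
    using family_curve(2)[OF y(1)] by (auto simp: holomorphic_curve_on_def)
  have n2: "(\<lambda>z. fst (\<psi> (y' n) z)) holomorphic_on UNIV" "(\<lambda>z. snd (\<psi> (y' n) z)) holomorphic_on UNIV" for n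
    using family_curve(2)[OF y'(1)] by (auto simp: holomorphic_curve_on_def)
  have l1: "uniform_limit (ball 0 R) (\<lambda>n. \<psi> (y n)) \<phi>1 sequentially" by (rule uniform_limit_on_subset[OF y(3) R(2)])
  have l2: "uniform_limit (ball 0 R) (\<lambda>n. \<psi> (y' n)) \<phi>2 sequentially" by (rule uniform_limit_on_subset[OF y'(3) R(3)])
  note lf1 = bounded_linear.uniform_limit[OF bounded_linear_fst l1] bounded_linear.uniform_limit[OF bounded_linear_snd l1]
  note lf2 = bounded_linear.uniform_limit[OF bounded_linear_fst l2] bounded_linear.uniform_limit[OF bounded_linear_snd l2]
  have eq0: "\<phi>1 0 = \<phi>2 0" using y(5) y'(5) by simp
  have "\<not> (\<lambda>z. fst (\<phi>2 z)) constant_on ball 0 R \<or> \<not> (\<lambda>z. snd (\<phi>2 z)) constant_on ball 0 R"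
  proof (rule ccontr)
    assume neg: "\<not> ?thesis"
    have z: "(deriv ^^ m) g 0 = 0" if g: "g constant_on ball 0 R" and m: "m \<ge> 1" for g :: "complex \<Rightarrow> complex" and m
    proof -
      obtain c where c: "\<forall>z\<in>ball 0 R. g z = c" using g unfolding constant_on_def by blast
      have "(deriv ^^ m) g 0 = (deriv ^^ m) (\<lambda>_. c) 0"
        by (rule higher_deriv_cong_ev) (use eventually_nhds_in_open[of "ball 0 R" 0] R(1) c in \<open>auto elim!: eventually_mono\<close>)
      then show ?thesis using m by simp
    qed
    have "curve_deriv m \<phi>2 0 = 0" if "m \<ge> 1" for m
      unfolding curve_deriv_def zero_prod_def using z[OF _ that] neg by simp
    then show False using nc by blast
  qed
  then have "\<exists>\<epsilon>>0. \<forall>a\<in>ball 0 \<epsilon>. \<exists>b\<in>ball 0 \<rho>. fst (\<phi>2 b) = fst (\<phi>1 a) \<and> snd (\<phi>2 b) = snd (\<phi>1 a)"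
  proof
    assume nconst: "\<not> (\<lambda>z. fst (\<phi>2 z)) constant_on ball 0 R"
    show ?thesis
    proof (rule limit_germ_scalar[OF R(1) hol2 hol1 n2 n1 lf2 lf1 _ _ nconst _ rho])
      fix n a b assume "fst (\<psi> (y' n) b) = fst (\<psi> (y n) a)" "snd (\<psi> (y' n) b) = snd (\<psi> (y n) a)"
      then have "\<psi> (y' n) b = \<psi> (y n) a" by (rule prod_eqI)
      from family_leaf[OF y(1) y'(1) this]
      show "\<exists>\<alpha> \<beta>. b = \<alpha> * a + \<beta> \<and> (\<forall>t. fst (\<psi> (y' n) (\<alpha> * t + \<beta>)) = fst (\<psi> (y n) t) \<and> snd (\<psi> (y' n) (\<alpha> * t + \<beta>)) = snd (\<psi> (y n) t))"
        by (elim exE conjE) (intro exI conjI, assumption, simp)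
    qed (simp_all add: eq0)
  next
    assume nconst: "\<not> (\<lambda>z. snd (\<phi>2 z)) constant_on ball 0 R"
    have "\<exists>\<epsilon>>0. \<forall>a\<in>ball 0 \<epsilon>. \<exists>b\<in>ball 0 \<rho>. snd (\<phi>2 b) = snd (\<phi>1 a) \<and> fst (\<phi>2 b) = fst (\<phi>1 a)"
    proof (rule limit_germ_scalar[OF R(1) hol2(2,1) hol1(2,1) n2(2,1) n1(2,1) lf2(2,1) lf1(2,1) _ _ nconst _ rho])
      fix n a b assume "snd (\<psi> (y' n) b) = snd (\<psi> (y n) a)" "fst (\<psi> (y' n) b) = fst (\<psi> (y n) a)"
      then have "\<psi> (y' n) b = \<psi> (y n) a" by (intro prod_eqI)
      from family_leaf[OF y(1) y'(1) this]
      show "\<exists>\<alpha> \<beta>. b = \<alpha> * a + \<beta> \<and> (\<forall>t. snd (\<psi> (y' n) (\<alpha> * t + \<beta>)) = snd (\<psi> (y n) t) \<and> fst (\<psi> (y' n) (\<alpha> * t + \<beta>)) = fst (\<psi> (y n) t))"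
        by (elim exE conjE) (intro exI conjI, assumption, simp)
    qed (simp_all add: eq0)
    then show ?thesis by (simp add: conj_commute)
  qed
  then obtain \<epsilon> where eps: "\<epsilon> > 0" "\<forall>a\<in>ball 0 \<epsilon>. \<exists>b\<in>ball 0 \<rho>. fst (\<phi>2 b) = fst (\<phi>1 a) \<and> snd (\<phi>2 b) = snd (\<phi>1 a)" by blast
  have "\<phi>1 ` ball 0 \<epsilon> \<subseteq> \<phi>2 ` ball 0 \<rho>"
  proof
    fix p assume "p \<in> \<phi>1 ` ball 0 \<epsilon>"
    then obtain a where a: "a \<in> ball 0 \<epsilon>" "p = \<phi>1 a" by blast
    obtain b where b: "b \<in> ball 0 \<rho>" "fst (\<phi>2 b) = fst (\<phi>1 a) \<and> snd (\<phi>2 b) = snd (\<phi>1 a)" using eps(2) a(1) by blast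
    then have "p = \<phi>2 b" using a(2) by (simp add: prod_eq_iff)
    then show "p \<in> \<phi>2 ` ball 0 \<rho>" using b(1) by blast
  qed
  then show ?thesis using eps(1) by blast
qed

text \<open>Curves of the family whose base points converge subconverge to a limit map.\<close>
lemma limit_map_compactness:
  assumes y: "\<And>n. y n \<in> S" "y \<longlonglongrightarrow> x"
    and bd: "\<And>C. bounded {p \<in> Jplus (inv h). green d h p \<le> C}"
  shows "\<exists>\<phi> r. strict_mono (r :: nat \<Rightarrow> nat) \<and> \<phi> \<in> limit_maps d h S \<psi> x \<and>
     (\<exists>e>0. uniform_limit (cball 0 e) (\<lambda>n. \<psi> (y (r n))) \<phi> sequentially \<and> holomorphic_curve_on \<phi> (cball 0 e))"
proof -
  let ?D = "limit_disk d h S \<psi> x"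
  have hc: "(\<lambda>z. fst (\<psi> (y n) z)) holomorphic_on ?D" "(\<lambda>z. snd (\<psi> (y n) z)) holomorphic_on ?D" for n
    using family_curve(2)[OF y(1)] by (auto simp: holomorphic_curve_on_def intro: holomorphic_on_subset)
  have fl: "filterlim y (tends_within x S) sequentially"
    unfolding tends_within_def filterlim_inf filterlim_principal using y by auto
  \<comment> \<open>On compact subsets of the limit disk the Green function is bounded along the sequence, so the curves are bounded too.\<close>
  have loc: "\<exists>B. \<forall>n. \<forall>z\<in>K. norm (\<psi> (y n) z) \<le> B" if K: "compact K" "K \<subseteq> ?D" for K
  proof (cases "K = {}")
    case False
    obtain z0 where z0: "z0 \<in> K" "\<And>z. z \<in> K \<Longrightarrow> norm z \<le> norm z0"
      using continuous_attains_sup[OF K(1) False, of norm] by (auto intro: continuous_intros)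
    define \<rho> where "\<rho> = norm z0"
    have "ereal \<rho> < limit_radius d h S \<psi> x" using z0(1) K(2) by (auto simp: \<rho>_def limit_disk_def)
    moreover have "limit_radius d h S \<psi> x \<le> ereal \<rho>" if "ereal \<rho> \<in> ereal ` {r. 0 \<le> r \<and> local_green_max d h S \<psi> x r = \<infinity>}"
      unfolding limit_radius_def by (rule Inf_lower[OF that])
    ultimately have "ereal \<rho> \<notin> ereal ` {r. 0 \<le> r \<and> local_green_max d h S \<psi> x r = \<infinity>}"
      unfolding not_le[symmetric] by (intro notI) simp
    then have "local_green_max d h S \<psi> x \<rho> \<noteq> \<infinity>" by (auto simp: \<rho>_def)
    then have "local_green_max d h S \<psi> x \<rho> < \<infinity>" by simp
    from ereal_dense2[OF this] obtain C where C: "local_green_max d h S \<psi> x \<rho> < ereal C" by (elim exE conjE)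
    have "eventually (\<lambda>y. green_max d h (\<psi> y) \<rho> < ereal C) (tends_within x S)"
      by (rule Limsup_lessD) (use C in \<open>simp add: local_green_max_def\<close>)
    then have "eventually (\<lambda>n. green_max d h (\<psi> (y n)) \<rho> < ereal C) sequentially"
      by (rule eventually_compose_filterlim[OF _ fl])
    then obtain N where N: "\<And>n. n \<ge> N \<Longrightarrow> green_max d h (\<psi> (y n)) \<rho> < ereal C"
      unfolding eventually_sequentially by blast
    obtain B where B: "\<And>p. p \<in> Jplus (inv h) \<Longrightarrow> green d h p \<le> C \<Longrightarrow> norm p \<le> B"
      using bd[of C] unfolding bounded_iff by blast
    have b1: "norm (\<psi> (y n) z) \<le> B" if "n \<ge> N" "z \<in> K" for n z
    proof (rule B[OF family_curve(5)[OF y(1)]])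
      show "green d h (\<psi> (y n) z) \<le> C"
        by (rule family_green_le[OF y(1), of z \<rho>]) (use N[OF that(1)] z0(2)[OF that(2)] in \<open>auto simp: \<rho>_def\<close>)
    qed
    have "bounded (\<Union>n<N. \<psi> (y n) ` K)"
    proof (rule bounded_UN)
      show "\<forall>n\<in>{..<N}. bounded (\<psi> (y n) ` K)"
      proof
        fix n
        have "continuous_on K (\<lambda>z. (fst (\<psi> (y n) z), snd (\<psi> (y n) z)))"
          by (intro continuous_on_Pair holomorphic_on_imp_continuous_on holomorphic_on_subset[OF hc(1) K(2)] holomorphic_on_subset[OF hc(2) K(2)])
        then have "compact (\<psi> (y n) ` K)" by (intro compact_continuous_image K(1)) simp
        then show "bounded (\<psi> (y n) ` K)" by (rule compact_imp_bounded)
      qed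
    qed simp
    then obtain B' where B': "\<forall>p\<in>(\<Union>n<N. \<psi> (y n) ` K). norm p \<le> B'" unfolding bounded_iff by (elim exE)
    have "norm (\<psi> (y n) z) \<le> max B B'" if z: "z \<in> K" for n z
    proof (cases "n \<ge> N")
      case True then show ?thesis using b1[OF True z] by simp
    next
      case False
      then have "\<psi> (y n) z \<in> (\<Union>n<N. \<psi> (y n) ` K)" using z by auto
      from bspec[OF B' this] show ?thesis by simp
    qed
    then show ?thesis by blast
  qed simp
  have loc1: "\<exists>B. \<forall>g\<in>range (\<lambda>n z. fst (\<psi> (y (q n)) z)). \<forall>z\<in>K. norm (g z) \<le> B"
    and loc2: "\<exists>B. \<forall>g\<in>range (\<lambda>n z. snd (\<psi> (y (q n)) z)). \<forall>z\<in>K. norm (g z) \<le> B"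
    if K: "compact K" "K \<subseteq> ?D" for K and q :: "nat \<Rightarrow> nat"
  proof -
    obtain B where B: "\<forall>n. \<forall>z\<in>K. norm (\<psi> (y n) z) \<le> B" using loc[OF K] by (elim exE)
    have "norm (fst (\<psi> (y n) z)) \<le> B \<and> norm (snd (\<psi> (y n) z)) \<le> B" if "z \<in> K" for n z
      using B that norm_pair_bounds(1,2)[of "\<psi> (y n) z"] by (meson order_trans)
    then show "\<exists>B. \<forall>g\<in>range (\<lambda>n z. fst (\<psi> (y (q n)) z)). \<forall>z\<in>K. norm (g z) \<le> B"
      "\<exists>B. \<forall>g\<in>range (\<lambda>n z. snd (\<psi> (y (q n)) z)). \<forall>z\<in>K. norm (g z) \<le> B" by auto
  qed
  obtain g1 r1 where g1: "g1 holomorphic_on ?D" "strict_mono (r1 :: nat \<Rightarrow> nat)"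
    "\<And>K. compact K \<Longrightarrow> K \<subseteq> ?D \<Longrightarrow> uniform_limit K ((\<lambda>n z. fst (\<psi> (y n) z)) \<circ> r1) g1 sequentially"
  proof (rule Montel[OF open_limit_disk[of x], of "range (\<lambda>n z. fst (\<psi> (y n) z))" "\<lambda>n z. fst (\<psi> (y n) z)"])
    show "g holomorphic_on ?D" if "g \<in> range (\<lambda>n z. fst (\<psi> (y n) z))" for g using that hc(1) by (elim imageE) simp
  qed (rule loc1[where q="\<lambda>n. n"], assumption, assumption, rule subset_refl, rule that)
  obtain g2 r2 where g2: "g2 holomorphic_on ?D" "strict_mono (r2 :: nat \<Rightarrow> nat)"
    "\<And>K. compact K \<Longrightarrow> K \<subseteq> ?D \<Longrightarrow> uniform_limit K ((\<lambda>n z. snd (\<psi> (y (r1 n)) z)) \<circ> r2) g2 sequentially"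
  proof (rule Montel[OF open_limit_disk[of x], of "range (\<lambda>n z. snd (\<psi> (y (r1 n)) z))" "\<lambda>n z. snd (\<psi> (y (r1 n)) z)"])
    show "g holomorphic_on ?D" if "g \<in> range (\<lambda>n z. snd (\<psi> (y (r1 n)) z))" for g using that hc(2) by (elim imageE) simp
  qed (rule loc2[where q=r1], assumption, assumption, rule subset_refl, rule that)
  define r where "r = r1 \<circ> r2"
  define \<phi> where "\<phi> = (\<lambda>z. (g1 z, g2 z))"
  have r: "strict_mono r" unfolding r_def by (rule strict_mono_o[OF g1(2) g2(2)])
  have ul: "uniform_limit K (\<lambda>n. \<psi> (y (r n))) \<phi> sequentially" if K: "compact K" "K \<subseteq> ?D" for K
  proof -
    have u1: "uniform_limit K (\<lambda>n z. fst (\<psi> (y (r n)) z)) g1 sequentially"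
      using filterlim_compose[OF g1(3)[OF K, unfolded o_def] filterlim_subseq[OF g2(2)]] by (simp add: r_def o_def)
    have u2: "uniform_limit K (\<lambda>n z. snd (\<psi> (y (r n)) z)) g2 sequentially"
      using g2(3)[OF K] by (simp add: r_def o_def)
    from uniform_limit_pair[OF u1 u2] show ?thesis unfolding \<phi>_def by simp
  qed
  have hphi: "holomorphic_curve_on \<phi> ?D" using g1(1) g2(1) by (simp add: holomorphic_curve_on_def \<phi>_def)
  have nb: "\<exists>e>0. cball z e \<subseteq> ?D \<and> uniform_limit (cball z e) (\<lambda>n. \<psi> (y (r n))) \<phi> sequentially" if zD: "z \<in> ?D" for z
  proof -
    obtain e where e: "e > 0" "cball z e \<subseteq> ?D"
      using bspec[OF iffD1[OF open_contains_cball open_limit_disk] zD] by (elim exE conjE)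
    show ?thesis by (intro exI[of _ e] conjI e ul compact_cball)
  qed
  have "(\<lambda>n. y (r n)) \<longlonglongrightarrow> x" using LIMSEQ_subseq_LIMSEQ[OF y(2) r] by (simp add: o_def)
  then have mem: "\<phi> \<in> limit_maps d h S \<psi> x"
    unfolding limit_maps_def by (intro CollectI conjI exI[of _ "\<lambda>n. y (r n)"] allI ballI hphi nb y(1))
  obtain e where e: "e > 0" "cball 0 e \<subseteq> ?D" "uniform_limit (cball 0 e) (\<lambda>n. \<psi> (y (r n))) \<phi> sequentially"
    using nb[OF zero_limit_disk] by (elim exE conjE)
  have "holomorphic_curve_on \<phi> (cball 0 e)"
    using hphi e(2) unfolding holomorphic_curve_on_def by (meson holomorphic_on_subset)
  then show ?thesis
    by (intro exI[of _ \<phi>] exI[of _ r] exI[of _ e] conjI r mem e(1,3))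
qed

end

section \<open>Jets along backward orbits\<close>

lemma curve_deriv_polynomial_pair:
  assumes "\<And>p. H p = (poly2 P p, poly2 Q p)"
  shows "curve_deriv m (\<lambda>z. H (\<phi> z)) 0 = ((deriv ^^ m) (\<lambda>z. poly2 P (\<phi> z)) 0, (deriv ^^ m) (\<lambda>z. poly2 Q (\<phi> z)) 0)"
  by (simp only: curve_deriv_def assms fst_conv snd_conv)

lemma polynomial_map_continuous:
  assumes "polynomial_map H" shows "continuous_on UNIV H"
proof -
  obtain P Q where H: "\<forall>p. H p = (poly2 P p, poly2 Q p)" using assms unfolding polynomial_map_def by (elim exE)
  have "H = (\<lambda>p. (poly2 P p, poly2 Q p))" using H by (intro ext) (simp only:)
  moreover have "continuous_on UNIV (\<lambda>p. (poly2 P p, poly2 Q p))"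
    by (intro continuous_on_Pair poly2_continuous continuous_on_id)
  ultimately show ?thesis by (simp only:)
qed

text \<open>Cauchy's inequality for both components.\<close>
lemma norm_curve_deriv_le:
  assumes "holomorphic_curve_on \<phi> UNIV" "r > 0" "\<And>z. norm z = r \<Longrightarrow> norm (\<phi> z) \<le> B"
  shows "norm (curve_deriv m \<phi> 0) \<le> 2 * (fact m * B / r ^ m)"
proof -
  have *: "norm ((deriv ^^ m) g 0) \<le> fact m * B / r ^ m"
    if g: "g holomorphic_on UNIV" "\<And>z. norm (g z) \<le> norm (\<phi> z)" for g
  proof (rule Cauchy_inequality)
    show "g holomorphic_on ball 0 r" using g(1) by (rule holomorphic_on_subset) simp
    show "continuous_on (cball 0 r) g"
      using holomorphic_on_imp_continuous_on[OF g(1)] by (rule continuous_on_subset) simp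
    show "norm (g z) \<le> B" if "norm (0 - z) = r" for z
      using order_trans[OF g(2) assms(3)] that by simp
  qed (rule assms)
  have "norm (curve_deriv m \<phi> 0) \<le> norm ((deriv ^^ m) (\<lambda>z. fst (\<phi> z)) 0) + norm ((deriv ^^ m) (\<lambda>z. snd (\<phi> z)) 0)"
    unfolding curve_deriv_def norm_Pair by (rule sqrt_sum_squares_le_sum) simp_all
  also have "\<dots> \<le> fact m * B / r ^ m + fact m * B / r ^ m"
    by (intro add_mono *) (use assms(1) in \<open>simp_all add: holomorphic_curve_on_def norm_pair_bounds\<close>)
  finally show ?thesis by (simp only: mult_2)
qed

lemma curve_deriv_scale:
  assumes "holomorphic_curve_on \<phi> UNIV"
  shows "curve_deriv m (\<lambda>z. \<phi> (c * z)) 0 = cscale (c ^ m) (curve_deriv m \<phi> 0)"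
proof -
  have "(deriv ^^ m) (\<lambda>z. g (c * z)) 0 = c ^ m * (deriv ^^ m) g 0" if "g holomorphic_on UNIV" for g
    using higher_deriv_compose_linear[of g UNIV UNIV 0 c m] that by simp
  from this[of "\<lambda>z. fst (\<phi> z)"] this[of "\<lambda>z. snd (\<phi> z)"]
  show ?thesis using assms by (simp add: curve_deriv_def cscale_def holomorphic_curve_on_def)
qed

lemma norm_cscale: "norm (cscale c v) = norm c * norm v"
proof -
  have "norm (cscale c v) = sqrt (norm c ^ 2 * (norm (fst v) ^ 2 + norm (snd v) ^ 2))"
    unfolding cscale_def norm_Pair norm_mult by (simp add: power_mult_distrib algebra_simps)
  also have "\<dots> = norm c * norm v" by (simp add: real_sqrt_mult norm_prod_def)
  finally show ?thesis .
qed

text \<open>The lemma \<open>jet_transfer\<close> for both components of polynomial maps.\<close>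
lemma jet_transfer_maps:
  assumes co: "holomorphic_coordinates x U F" and t: "t > 0" and r: "r > 0"
    and hu: "holomorphic_curve_on \<phi> (ball 0 r)" "\<phi> 0 = x"
    and bu: "\<And>z. z \<in> ball 0 r \<Longrightarrow> \<phi> z \<in> U \<and> norm (fst (F (\<phi> z))) \<le> norm (snd (F (\<phi> z))) powr t"
    and hs: "holomorphic_curve_on \<psi> (ball 0 r)" "\<psi> 0 = x"
    and bs: "\<And>z. z \<in> ball 0 r \<Longrightarrow> \<psi> z \<in> U \<and> norm (fst (F (\<psi> z))) \<le> norm (snd (F (\<psi> z))) powr t"
    and nc: "\<exists>m\<ge>1. curve_deriv m \<phi> 0 \<noteq> 0"
    and j: "j \<ge> 1" and vs: "\<And>m. 1 \<le> m \<Longrightarrow> m < j \<Longrightarrow> curve_deriv m \<psi> 0 = 0"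
    and pol: "\<And>n. polynomial_map (H n)"
    and lim: "\<And>m. 1 \<le> m \<Longrightarrow> (\<lambda>n. curve_deriv m (\<lambda>z. H n (\<phi> z)) 0) \<longlonglongrightarrow> 0"
    and m: "1 \<le> m" "real m < real j * t"
  shows "(\<lambda>n. curve_deriv m (\<lambda>z. H n (\<psi> z)) 0) \<longlonglongrightarrow> 0"
proof -
  have "\<forall>n. \<exists>PQ. \<forall>p. H n p = (poly2 (fst PQ) p, poly2 (snd PQ) p)"
  proof
    fix n
    obtain P Q where "\<forall>p. H n p = (poly2 P p, poly2 Q p)" using pol[of n] unfolding polynomial_map_def by (elim exE)
    then show "\<exists>PQ. \<forall>p. H n p = (poly2 (fst PQ) p, poly2 (snd PQ) p)" by (intro exI[of _ "(P, Q)"]) simp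
  qed
  from choice[OF this] obtain PQ where PQ: "\<forall>n p. H n p = (poly2 (fst (PQ n)) p, poly2 (snd (PQ n)) p)" by (elim exE)
  note eq = curve_deriv_polynomial_pair[OF PQ[rule_format]]
  have l: "(\<lambda>n. (deriv ^^ m) (\<lambda>z. poly2 (fst (PQ n)) (\<phi> z)) 0) \<longlonglongrightarrow> 0"
    "(\<lambda>n. (deriv ^^ m) (\<lambda>z. poly2 (snd (PQ n)) (\<phi> z)) 0) \<longlonglongrightarrow> 0" if "1 \<le> m" for m
    using tendsto_fst[OF lim[OF that]] tendsto_snd[OF lim[OF that]] unfolding eq by simp_all
  have "(\<lambda>n. (deriv ^^ m) (\<lambda>z. poly2 (fst (PQ n)) (\<psi> z)) 0) \<longlonglongrightarrow> 0"
    by (rule jet_transfer[OF co t r hu bu hs bs nc j vs l(1) m])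
  moreover have "(\<lambda>n. (deriv ^^ m) (\<lambda>z. poly2 (snd (PQ n)) (\<psi> z)) 0) \<longlonglongrightarrow> 0"
    by (rule jet_transfer[OF co t r hu bu hs bs nc j vs l(2) m])
  ultimately show ?thesis unfolding eq zero_prod_def by (rule tendsto_Pair)
qed

lemma limit_map_curve_deriv:
  assumes fam: "unstable_family d h S \<psi>" and pol: "polynomial_map H"
    and y: "\<And>n. y n \<in> S" and e: "e > 0" and lim: "uniform_limit (cball 0 e) (\<lambda>n. \<psi> (y n)) \<phi> sequentially"
    and hol: "holomorphic_curve_on \<phi> (cball 0 e)"
  shows "(\<lambda>n. curve_deriv m (\<lambda>z. H (\<psi> (y n) z)) 0) \<longlonglongrightarrow> curve_deriv m (\<lambda>z. H (\<phi> z)) 0"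
proof -
  obtain P Q where H: "\<forall>p. H p = (poly2 P p, poly2 Q p)" using pol unfolding polynomial_map_def by (elim exE)
  note l = limit_map_coefficients[OF fam y e lim hol, of m]
  show ?thesis unfolding curve_deriv_polynomial_pair[OF H[rule_format]]
    by (rule tendsto_Pair[OF l[of P] l[of Q]])
qed

text \<open>This includes the case \<open>lambda_hat S lam p = \<infinity>\<close>, in which the inverse is 0.\<close>
lemma inverse_multiplier_bound:
  fixes lam :: "C2 \<Rightarrow> complex"
  assumes L: "1 \<le> lambda_hat S lam p" and lam: "\<And>y. y \<in> S \<Longrightarrow> 1 \<le> norm (lam y)"
    and u: "\<And>i. u i \<in> S" "u \<longlonglongrightarrow> p" and e: "e > 0"
  shows "eventually (\<lambda>i. norm (inverse (lam (u i))) \<le> real_of_ereal (inverse (lambda_hat S lam p)) + e) sequentially"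
proof -
  define b where "b = real_of_ereal (inverse (lambda_hat S lam p))"
  have fl: "filterlim u (tends_within p S) sequentially"
    unfolding tends_within_def filterlim_inf filterlim_principal using u by auto
  have "b \<ge> 0 \<and> ereal (1 / (b + e)) < lambda_hat S lam p"
  proof (cases "lambda_hat S lam p")
    case (real r)
    then have r: "r \<ge> 1" using L by (simp add: one_ereal_def)
    then have b: "b = inverse r" by (simp add: b_def real)
    have "1 / (b + e) < 1 / b" by (rule divide_strict_left_mono) (use r e in \<open>simp_all add: b add_pos_pos\<close>)
    also have "1 / b = r" by (simp add: b inverse_eq_divide)
    finally have "1 / (b + e) < r" .
    then show ?thesis using r b by (simp add: real)
  next
    case PInf
    then show ?thesis by (simp add: b_def)
  qed (use L in simp)
  then have b: "b \<ge> 0" "ereal (1 / (b + e)) < Liminf (tends_within p S) (\<lambda>y. ereal (norm (lam y)))"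
    by (auto simp: lambda_hat_def)
  have "eventually (\<lambda>i. ereal (1 / (b + e)) < ereal (norm (lam (u i)))) sequentially"
    by (rule eventually_compose_filterlim[OF less_LiminfD[OF b(2)] fl])
  then show ?thesis unfolding b_def[symmetric]
  proof eventually_elim
    case (elim i)
    then have "1 / (b + e) < norm (lam (u i))" by simp
    then have "1 \<le> (b + e) * norm (lam (u i))" using b(1) e by (simp add: pos_divide_less_eq mult.commute)
    moreover have "1 \<le> norm (lam (u i))" by (rule lam[OF u(1)])
    ultimately have "inverse (norm (lam (u i))) \<le> b + e" unfolding inverse_eq_divide by (subst pos_divide_le_eq) auto
    then show ?case by (simp only: norm_inverse)
  qed
qed

lemma lambda_hat_ge_1:
  assumes "\<And>y. y \<in> S \<Longrightarrow> 1 \<le> norm (lam y)"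
  shows "1 \<le> lambda_hat S lam p"
  unfolding lambda_hat_def
proof (rule Liminf_bounded)
  show "eventually (\<lambda>y. 1 \<le> ereal (norm (lam y))) (tends_within p S)"
    unfolding tends_within_def eventually_inf_principal
    by (rule always_eventually) (use assms in \<open>simp add: one_ereal_def\<close>)
qed

text \<open>On \<open>\<psi> y\<close>, the iterate \<open>inv f ^^ n\<close> acts as multiplication of the parameter by a product of \<open>n\<close> inverse
  multipliers. As the curves are uniformly bounded on the unit disk, this product bounds the coefficients
  of positive order; as \<open>y\<close> tends to \<open>x\<close>, it is asymptotically at most \<open>lambda_hat_back f S lam x n\<close>.\<close>
lemma unstable_jets_vanish:
  assumes fam: "unstable_family d f S \<psi>" and mult: "multipliers f S \<psi> lam" and d: "d > 1"
    and bij: "bij f" and pol: "polynomial_map (inv f)"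
    and green: "\<And>p. p \<in> Jplus (inv f) \<Longrightarrow> green d f (f p) = d * green d f p"
    and bd: "bounded {p \<in> Jplus (inv f). green d f p \<le> 1}"
    and bc: "backward_contraction f S lam x"
    and phi: "\<phi> \<in> limit_maps d f S \<psi> x" and m: "m \<ge> 1"
  shows "(\<lambda>n. curve_deriv m (\<lambda>z. (inv f ^^ n) (\<phi> z)) 0) \<longlonglongrightarrow> 0"
proof -
  have fS: "f ` S = S" using fam by (simp add: unstable_family_def)
  have TS: "inv f y \<in> S" if yS: "y \<in> S" for y
  proof -
    obtain y0 where "y0 \<in> S" "y = f y0" using fS yS by blast
    then show ?thesis by (simp add: bij_is_inj[OF bij])
  qed
  have ml: "f (\<psi> y z) = \<psi> (f y) (lam y * z)" if "y \<in> S" for y z using mult that by (simp add: multipliers_def)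
  have l1: "1 \<le> norm (lam y)" if "y \<in> S" for y
    by (rule multiplier_norm_ge_1[OF fam that ml[OF that] d green])
  define A where "A = (\<lambda>y. inverse (lam (inv f y)))"
  have A1: "norm (A y) \<le> 1" if "y \<in> S" for y
    using l1[OF TS[OF that]] by (simp add: A_def norm_inverse inverse_le_1_iff)
  have bwd: "inv f (\<psi> y z) = \<psi> (inv f y) (A y * z)" if yS: "y \<in> S" for y z
  proof -
    have "lam (inv f y) \<noteq> 0" using l1[OF TS[OF yS]] by auto
    then have "f (\<psi> (inv f y) (A y * z)) = \<psi> y z"
      using ml[OF TS[OF yS], of "A y * z"] by (simp add: A_def surj_f_inv_f[OF bij_is_surj[OF bij]] mult.assoc[symmetric])
    then show ?thesis by (metis bij bij_is_inj inv_f_f)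
  qed
  define \<nu> where "\<nu> = (\<lambda>n y. \<Prod>i<n. A ((inv f ^^ i) y))"
  have chain: "(inv f ^^ n) u \<in> S" "(inv f ^^ n) (\<psi> u z) = \<psi> ((inv f ^^ n) u) (\<nu> n u * z)" if u: "u \<in> S" for n u z
    unfolding \<nu>_def by (rule chain_of_curves[where S=S and T="inv f"], erule TS, erule bwd, rule u)+
  obtain B where B: "\<And>p. p \<in> Jplus (inv f) \<Longrightarrow> green d f p \<le> 1 \<Longrightarrow> norm p \<le> B"
    using bd unfolding bounded_iff by blast
  have Bc: "norm (\<psi> y z) \<le> B" if "y \<in> S" "norm z \<le> 1" for y z
    by (rule B[OF family_curve(5)[OF fam that(1)] family_green_1[OF fam that]])
  obtain y e where y: "\<And>i. y i \<in> S" "y \<longlonglongrightarrow> x" "e > 0" "uniform_limit (cball 0 e) (\<lambda>i. \<psi> (y i)) \<phi> sequentially"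
    "holomorphic_curve_on \<phi> (cball 0 e)" "\<phi> 0 = x"
    by (rule limit_map_near_0[OF fam phi]) (rule that)
  have "norm (\<psi> (y 0) 0) \<le> B" by (rule Bc[OF y(1)]) simp
  then have B0: "B \<ge> 0" using norm_ge_zero order_trans by blast
  define b where "b = (\<lambda>l. real_of_ereal (inverse (lambda_hat S lam ((inv f ^^ Suc l) x))))"
  have L: "1 \<le> lambda_hat S lam p" for p by (rule lambda_hat_ge_1[OF l1])
  have Lb: "inverse (lambda_hat S lam p) = ereal (real_of_ereal (inverse (lambda_hat S lam p))) \<and>
      0 \<le> real_of_ereal (inverse (lambda_hat S lam p))" for p
    using L[of p] by (cases "lambda_hat S lam p") (auto simp: one_ereal_def)
  have b0: "0 \<le> b l" for l using Lb by (simp add: b_def)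
  have back_b: "lambda_hat_back f S lam x n = ereal (\<Prod>l<n. b l)" for n
  proof -
    have "lambda_hat_back f S lam x n = (\<Prod>l<n. ereal (b l))"
      unfolding lambda_hat_back_def b_def One_nat_def prod.atLeast1_atMost_eq by (intro prod.cong refl conjunct1[OF Lb])
    then show ?thesis by (simp add: prod_ereal)
  qed
  have "(\<lambda>n. ereal (\<Prod>l<n. b l)) \<longlonglongrightarrow> ereal 0"
    using bc unfolding backward_contraction_def back_b zero_ereal_def .
  then have blim: "(\<lambda>n. \<Prod>l<n. b l) \<longlonglongrightarrow> 0" by simp
  define C where "C = 2 * (fact m * B)"
  have C0: "C \<ge> 0" using B0 by (simp add: C_def)
  have cf: "norm (curve_deriv m (\<lambda>z. (inv f ^^ n) (\<psi> u z)) 0) \<le> C * norm (\<nu> n u)" if u: "u \<in> S" for n u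
  proof -
    have un: "(inv f ^^ n) u \<in> S" by (rule chain(1)[OF u])
    have "norm (\<nu> n u) \<le> 1"
      unfolding \<nu>_def prod_norm[symmetric]
      by (intro prod_le_1 conjI norm_ge_zero A1 chain(1)[OF u])
    then have nu: "norm (\<nu> n u) ^ m \<le> norm (\<nu> n u)"
      using power_decreasing[of 1 m "norm (\<nu> n u)"] m by simp
    have hol: "holomorphic_curve_on (\<psi> ((inv f ^^ n) u)) UNIV" by (rule family_curve(2)[OF fam un])
    have "curve_deriv m (\<lambda>z. (inv f ^^ n) (\<psi> u z)) 0 = cscale (\<nu> n u ^ m) (curve_deriv m (\<psi> ((inv f ^^ n) u)) 0)"
      unfolding chain(2)[OF u] by (rule curve_deriv_scale[OF hol])
    then have "norm (curve_deriv m (\<lambda>z. (inv f ^^ n) (\<psi> u z)) 0) = norm (\<nu> n u) ^ m * norm (curve_deriv m (\<psi> ((inv f ^^ n) u)) 0)"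
      by (simp add: norm_cscale norm_power)
    also have "\<dots> \<le> norm (\<nu> n u) * C"
    proof (rule mult_mono[OF nu])
      show "norm (curve_deriv m (\<psi> ((inv f ^^ n) u)) 0) \<le> C"
        using norm_curve_deriv_le[OF hol zero_less_one, of B m] Bc[OF un] by (simp add: C_def)
    qed simp_all
    finally show ?thesis by (simp only: mult.commute)
  qed
  have contT: "continuous_on UNIV (inv f ^^ n)" for n
    by (rule polynomial_map_continuous[OF polynomial_map_funpow[OF pol]])
  have Ty: "(\<lambda>i. (inv f ^^ n) (y i)) \<longlonglongrightarrow> (inv f ^^ n) x" for n
    by (rule continuous_on_tendsto_compose[OF contT y(2)]) simp_all
  \<comment> \<open>The multipliers near x are only bounded up to an arbitrary error \<epsilon>, which is removed in the end.\<close>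
  have key: "norm (curve_deriv m (\<lambda>z. (inv f ^^ n) (\<phi> z)) 0) \<le> C * (\<Prod>l<n. b l)" for n
  proof -
    have le: "norm (curve_deriv m (\<lambda>z. (inv f ^^ n) (\<phi> z)) 0) \<le> C * (\<Prod>l<n. b l + \<epsilon>)" if eps: "\<epsilon> > 0" for \<epsilon>
    proof (rule tendsto_upperbound)
      show "(\<lambda>i. norm (curve_deriv m (\<lambda>z. (inv f ^^ n) (\<psi> (y i) z)) 0)) \<longlonglongrightarrow> norm (curve_deriv m (\<lambda>z. (inv f ^^ n) (\<phi> z)) 0)"
        by (intro tendsto_norm limit_map_curve_deriv[OF fam polynomial_map_funpow[OF pol] y(1,3,4,5)])
      have "eventually (\<lambda>i. \<forall>l\<in>{..<n}. norm (A ((inv f ^^ l) (y i))) \<le> b l + \<epsilon>) sequentially"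
      proof (rule eventually_ball_finite)
        show "\<forall>l\<in>{..<n}. eventually (\<lambda>i. norm (A ((inv f ^^ l) (y i))) \<le> b l + \<epsilon>) sequentially"
        proof
          fix l
          show "eventually (\<lambda>i. norm (A ((inv f ^^ l) (y i))) \<le> b l + \<epsilon>) sequentially"
            using inverse_multiplier_bound[OF L l1 chain(1)[OF y(1)] Ty eps, of "Suc l"] by (simp add: A_def b_def)
        qed
      qed simp
      then show "eventually (\<lambda>i. norm (curve_deriv m (\<lambda>z. (inv f ^^ n) (\<psi> (y i) z)) 0) \<le> C * (\<Prod>l<n. b l + \<epsilon>)) sequentially"
      proof eventually_elim
        case (elim i)
        have "norm (\<nu> n (y i)) \<le> (\<Prod>l<n. b l + \<epsilon>)"
          unfolding \<nu>_def prod_norm[symmetric] by (rule prod_mono) (use elim in simp)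
        then have "C * norm (\<nu> n (y i)) \<le> C * (\<Prod>l<n. b l + \<epsilon>)" by (rule mult_left_mono[OF _ C0])
        then show ?case using cf[OF y(1), of n i] by (rule order_trans[rotated])
      qed
    qed simp
    show ?thesis
    proof (rule tendsto_lowerbound)
      show "((\<lambda>\<epsilon>. C * (\<Prod>l<n. b l + \<epsilon>)) \<longlongrightarrow> C * (\<Prod>l<n. b l)) (at_right 0)"
      proof -
        have "((\<lambda>\<epsilon>. C * (\<Prod>l<n. b l + \<epsilon>)) \<longlongrightarrow> C * (\<Prod>l<n. b l + 0)) (at_right 0)"
          by (intro tendsto_mult tendsto_prod tendsto_const tendsto_add tendsto_ident_at)
        then show ?thesis by simp
      qed
      show "eventually (\<lambda>\<epsilon>. norm (curve_deriv m (\<lambda>z. (inv f ^^ n) (\<phi> z)) 0) \<le> C * (\<Prod>l<n. b l + \<epsilon>)) (at_right 0)"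
        using eventually_at_right_less[of 0] by eventually_elim (rule le)
    qed simp
  qed
  show ?thesis
  proof (rule tendsto_norm_zero_cancel, rule tendsto_sandwich[OF _ _ tendsto_const])
    show "(\<lambda>n. C * (\<Prod>l<n. b l)) \<longlonglongrightarrow> 0" using tendsto_mult_right_zero[OF blim] .
  qed (simp_all add: key)
qed

text \<open>For the family of the map \<open>h\<close> itself all multipliers have modulus at least 1, so the coefficients of
  \<open>\<psi> ((h ^^ n) y)\<close> are not larger than those of \<open>(h ^^ n) \<circ> \<psi> y\<close>.\<close>
lemma stable_jets_shrink:
  assumes fam: "unstable_family d h S \<psi>" and d: "d > 1" and bij: "bij h" and pol: "polynomial_map h"
    and green: "\<And>p. p \<in> Jplus (inv h) \<Longrightarrow> green d h (h p) = d * green d h p"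
    and y: "y \<in> S"
  shows "(h ^^ n) y \<in> S"
    "norm (curve_deriv m (\<psi> ((h ^^ n) y)) 0) \<le> norm (curve_deriv m (\<lambda>z. (h ^^ n) (\<psi> y z)) 0)"
proof -
  have "\<exists>l. norm l \<ge> 1 \<and> (\<forall>z. h (\<psi> u z) = \<psi> (h u) (l * z))" if u: "u \<in> S" for u
  proof -
    obtain l where l: "\<forall>z. h (\<psi> u z) = \<psi> (h u) (l * z)" using multiplier_exists[OF fam u bij pol] by (elim exE conjE)
    have "norm l \<ge> 1" by (rule multiplier_norm_ge_1[OF fam u l[rule_format] d green])
    then show ?thesis using l by (intro exI[of _ l] conjI)
  qed
  then have "\<forall>u\<in>S. \<exists>l. norm l \<ge> 1 \<and> (\<forall>z. h (\<psi> u z) = \<psi> (h u) (l * z))" by (rule ballI)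
  from bchoice[OF this] obtain \<mu> where mu: "\<forall>u\<in>S. norm (\<mu> u) \<ge> 1 \<and> (\<forall>z. h (\<psi> u z) = \<psi> (h u) (\<mu> u * z))"
    by (elim exE)
  have hS: "h u \<in> S" if "u \<in> S" for u using fam that by (auto simp: unstable_family_def)
  have st: "h (\<psi> u z) = \<psi> (h u) (\<mu> u * z)" if "u \<in> S" for u z using mu that by blast
  have chain: "(h ^^ n) y \<in> S" "(h ^^ n) (\<psi> y z) = \<psi> ((h ^^ n) y) ((\<Prod>i<n. \<mu> ((h ^^ i) y)) * z)" for n z
    by (rule chain_of_curves[where S=S and T=h], erule hS, erule st, rule y)+
  show yn: "(h ^^ n) y \<in> S" by (rule chain(1))
  define \<nu> where "\<nu> = (\<Prod>i<n. \<mu> ((h ^^ i) y))"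
  have "1 \<le> norm \<nu>"
    unfolding \<nu>_def prod_norm[symmetric] by (rule prod_ge_1) (use mu chain(1) in blast)
  then have nu: "1 \<le> norm \<nu> ^ m" by (rule one_le_power)
  have "curve_deriv m (\<lambda>z. (h ^^ n) (\<psi> y z)) 0 = cscale (\<nu> ^ m) (curve_deriv m (\<psi> ((h ^^ n) y)) 0)"
    unfolding chain(2) \<nu>_def[symmetric] by (rule curve_deriv_scale[OF family_curve(2)[OF fam yn]])
  then have "norm (curve_deriv m (\<lambda>z. (h ^^ n) (\<psi> y z)) 0) = norm \<nu> ^ m * norm (curve_deriv m (\<psi> ((h ^^ n) y)) 0)"
    by (simp add: norm_cscale norm_power)
  then show "norm (curve_deriv m (\<psi> ((h ^^ n) y)) 0) \<le> norm (curve_deriv m (\<lambda>z. (h ^^ n) (\<psi> y z)) 0)"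
    using mult_right_mono[OF nu norm_ge_zero[of "curve_deriv m (\<psi> ((h ^^ n) y)) 0"]] by simp
qed

lemma max_order_finite_nonconstant:
  assumes "max_order d h S \<psi> x = enat k" "\<phi> \<in> limit_maps d h S \<psi> x"
  shows "\<exists>m\<ge>1. m \<le> k \<and> curve_deriv m \<phi> 0 \<noteq> 0"
proof -
  have le: "curve_order \<phi> \<le> enat k" unfolding assms(1)[symmetric] max_order_def by (rule SUP_upper[OF assms(2)])
  let ?A = "{n. 1 \<le> n \<and> curve_deriv n \<phi> 0 \<noteq> 0}"
  have "enat ` ?A \<noteq> {}"
  proof
    assume "enat ` ?A = {}"
    then have "curve_order \<phi> = Inf {}" unfolding curve_order_def by (simp only:)
    then have "curve_order \<phi> = \<infinity>" by (simp add: Inf_enat_def)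
    then show False using le by simp
  qed
  then have "curve_order \<phi> \<in> enat ` ?A" unfolding curve_order_def by (rule wellorder_InfI[OF ex_in_conv[THEN iffD2, THEN someI_ex]])
  then show ?thesis using le by auto
qed

lemma max_order_attained:
  assumes "max_order d h S \<psi> x = enat j" "j \<ge> 1"
  shows "\<exists>\<phi>\<in>limit_maps d h S \<psi> x. \<forall>m. 1 \<le> m \<longrightarrow> m < j \<longrightarrow> curve_deriv m \<phi> 0 = 0"
proof -
  have "enat (j - 1) < max_order d h S \<psi> x" using assms by simp
  then obtain \<phi> where phi: "\<phi> \<in> limit_maps d h S \<psi> x" "enat (j - 1) < curve_order \<phi>"
    unfolding max_order_def less_SUP_iff by (elim bexE)
  have "curve_deriv m \<phi> 0 = 0" if m: "1 \<le> m" "m < j" for m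
  proof (rule ccontr)
    assume "curve_deriv m \<phi> 0 \<noteq> 0"
    then have "curve_order \<phi> \<le> enat m" unfolding curve_order_def using m by (intro Inf_lower) simp
    then have "enat (j - 1) < enat m" using phi(2) by order
    then show False using m by simp
  qed
  then show ?thesis using phi(1) by (intro bexI[of _ \<phi>] allI impI)
qed

text \<open>Near 0, every limit map takes values in any given representative of the germ.\<close>
lemma germ_representative:
  assumes fam: "unstable_family d h S \<psi>" and V: "V \<in> variety_germ d h S \<psi> x"
    and phi: "\<phi> \<in> limit_maps d h S \<psi> x"
    and nc: "\<forall>\<phi>\<in>limit_maps d h S \<psi> x. \<exists>m\<ge>1. curve_deriv m \<phi> 0 \<noteq> 0"
    and U: "open U" "x \<in> U"
  shows "\<exists>r>0. holomorphic_curve_on \<phi> (ball 0 r) \<and> \<phi> 0 = x \<and> (\<forall>z\<in>ball 0 r. \<phi> z \<in> U \<inter> V)"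
proof -
  obtain \<phi>' where p': "\<phi>' \<in> limit_maps d h S \<psi> x"
      "eventually (\<lambda>e. \<forall>\<^sub>F p in nhds x. p \<in> V \<longleftrightarrow> p \<in> \<phi>' ` ball 0 e) (at_right 0)"
    using V unfolding variety_germ_def mem_Collect_eq by (elim bexE conjE)
  have "eventually (\<lambda>e. e > 0 \<and> (\<forall>\<^sub>F p in nhds x. p \<in> V \<longleftrightarrow> p \<in> \<phi>' ` ball 0 e)) (at_right (0::real))"
    using eventually_at_right_less p'(2) by (rule eventually_conj)
  from eventually_happens[OF this] obtain \<rho> where rho: "\<rho> > 0" "\<forall>\<^sub>F p in nhds x. p \<in> V \<longleftrightarrow> p \<in> \<phi>' ` ball 0 \<rho>"
    by auto
  from rho(2) obtain N where N: "open N" "x \<in> N" "\<forall>p\<in>N. p \<in> V \<longleftrightarrow> p \<in> \<phi>' ` ball 0 \<rho>"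
    unfolding eventually_nhds by (elim exE conjE)
  obtain \<epsilon> where eps: "\<epsilon> > 0" "\<phi> ` ball 0 \<epsilon> \<subseteq> \<phi>' ` ball 0 \<rho>"
    using limit_maps_same_germ[OF fam phi p'(1) bspec[OF nc p'(1)] rho(1)] by (elim exE conjE)
  obtain y e where y: "e > 0" "holomorphic_curve_on \<phi> (cball 0 e)" "\<phi> 0 = x"
    by (rule limit_map_near_0[OF fam phi]) (rule that)
  have "continuous_on (cball 0 e) (\<lambda>z. (fst (\<phi> z), snd (\<phi> z)))"
    using y(2) by (intro continuous_on_Pair holomorphic_on_imp_continuous_on) (simp_all add: holomorphic_curve_on_def)
  then have "continuous_on (ball 0 e) \<phi>" using continuous_on_subset[OF _ ball_subset_cball] by simp
  then have "open (ball 0 e \<inter> \<phi> -` (U \<inter> N))"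
    by (rule continuous_open_preimage[OF _ open_ball open_Int[OF U(1) N(1)]])
  moreover have "0 \<in> ball 0 e \<inter> \<phi> -` (U \<inter> N)" using y U N by simp
  ultimately obtain s where s: "s > 0" "ball 0 s \<subseteq> ball 0 e \<inter> \<phi> -` (U \<inter> N)"
    using open_contains_ball by meson
  define r where "r = min s \<epsilon>"
  have r: "r > 0" "ball 0 r \<subseteq> ball (0::complex) s" "ball 0 r \<subseteq> ball (0::complex) \<epsilon>" using s eps by (auto simp: r_def)
  have "ball 0 r \<subseteq> cball (0::complex) e" using r(2) s(2) ball_subset_cball by blast
  then have "holomorphic_curve_on \<phi> (ball 0 r)"
    using y(2) unfolding holomorphic_curve_on_def by (meson holomorphic_on_subset)
  moreover have "\<phi> z \<in> U \<inter> V" if z: "z \<in> ball 0 r" for z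
  proof -
    have "\<phi> z \<in> U" "\<phi> z \<in> N" using s(2) r(2) z by blast+
    moreover have "\<phi> z \<in> \<phi>' ` ball 0 \<rho>" using eps(2) r(3) z by blast
    ultimately show ?thesis using N(3) by blast
  qed
  ultimately show ?thesis using r(1) y(3) by (intro exI[of _ r] conjI ballI)
qed

text \<open>If the coefficients in \<open>I\<close> of \<open>(h ^^ n) \<circ> \<phi>\<close> tend to 0 for one limit map \<open>\<phi>\<close> at \<open>x\<close>, then at every cluster point
  of the orbit of \<open>x\<close> some limit map has vanishing coefficients in \<open>I\<close>.\<close>
lemma vanishing_jet_in_limit:
  assumes fam: "unstable_family d h S \<psi>" and d: "d > 1" and bij: "bij h" and pol: "polynomial_map h"
    and green: "\<And>p. p \<in> Jplus (inv h) \<Longrightarrow> green d h (h p) = d * green d h p"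
    and bd: "\<And>C. bounded {p \<in> Jplus (inv h). green d h p \<le> C}"
    and phi: "\<phi> \<in> limit_maps d h S \<psi> x" and I: "finite I"
    and lim: "\<And>m. m \<in> I \<Longrightarrow> (\<lambda>n. curve_deriv m (\<lambda>z. (h ^^ n) (\<phi> z)) 0) \<longlonglongrightarrow> 0"
    and xh: "strict_mono r" "(\<lambda>n. (h ^^ r n) x) \<longlonglongrightarrow> xh"
  shows "\<exists>\<phi>'\<in>limit_maps d h S \<psi> xh. \<forall>m\<in>I. curve_deriv m \<phi>' 0 = 0"
proof -
  obtain y e where y: "\<And>i. y i \<in> S" "y \<longlonglongrightarrow> x" "e > 0" "uniform_limit (cball 0 e) (\<lambda>i. \<psi> (y i)) \<phi> sequentially"
    "holomorphic_curve_on \<phi> (cball 0 e)" "\<phi> 0 = x"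
    by (rule limit_map_near_0[OF fam phi]) (rule that)
  define D where "D = (\<lambda>m n \<gamma>. curve_deriv m (\<lambda>z. (h ^^ n) (\<gamma> z)) 0)"
  \<comment> \<open>A diagonal choice: y i with base point and coefficients, after r q iterates, close to those of x and \<phi>.\<close>
  have "\<exists>i. dist ((h ^^ r q) (y i)) ((h ^^ r q) x) < 1 / Suc q \<and> (\<forall>m\<in>I. dist (D m (r q) (\<psi> (y i))) (D m (r q) \<phi>) < 1 / Suc q)" for q
  proof -
    have "(\<lambda>i. (h ^^ r q) (y i)) \<longlonglongrightarrow> (h ^^ r q) x"
      by (rule continuous_on_tendsto_compose[OF polynomial_map_continuous[OF polynomial_map_funpow[OF pol]] y(2)]) simp_all
    then have 1: "eventually (\<lambda>i. dist ((h ^^ r q) (y i)) ((h ^^ r q) x) < 1 / Suc q) sequentially"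
      by (rule tendstoD) simp
    have 2: "eventually (\<lambda>i. \<forall>m\<in>I. dist (D m (r q) (\<psi> (y i))) (D m (r q) \<phi>) < 1 / Suc q) sequentially"
    proof (rule eventually_ball_finite[OF I], rule ballI)
      fix m
      have "(\<lambda>i. D m (r q) (\<psi> (y i))) \<longlonglongrightarrow> D m (r q) \<phi>"
        unfolding D_def by (rule limit_map_curve_deriv[OF fam polynomial_map_funpow[OF pol] y(1,3,4,5)])
      then show "eventually (\<lambda>i. dist (D m (r q) (\<psi> (y i))) (D m (r q) \<phi>) < 1 / Suc q) sequentially"
        by (rule tendstoD) simp
    qed
    from eventually_happens[OF eventually_conj[OF 1 2]] show ?thesis by simp
  qed
  then have "\<forall>q. \<exists>i. dist ((h ^^ r q) (y i)) ((h ^^ r q) x) < 1 / Suc q \<and> (\<forall>m\<in>I. dist (D m (r q) (\<psi> (y i))) (D m (r q) \<phi>) < 1 / Suc q)"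
    by (rule allI)
  from choice[OF this] obtain i where i: "\<forall>q. dist ((h ^^ r q) (y (i q))) ((h ^^ r q) x) < 1 / Suc q \<and>
      (\<forall>m\<in>I. dist (D m (r q) (\<psi> (y (i q)))) (D m (r q) \<phi>) < 1 / Suc q)" by (elim exE)
  define Y where "Y = (\<lambda>q. (h ^^ r q) (y (i q)))"
  have inv0: "(\<lambda>q. 1 / real (Suc q)) \<longlonglongrightarrow> 0" by (rule LIMSEQ_Suc[OF lim_1_over_n])
  have YS: "Y q \<in> S" for q unfolding Y_def by (rule stable_jets_shrink(1)[OF fam d bij pol green y(1)])
  have "(\<lambda>q. dist (Y q) ((h ^^ r q) x)) \<longlonglongrightarrow> 0"
    by (rule tendsto_sandwich[OF _ _ tendsto_const inv0]) (use i in \<open>auto simp: Y_def intro!: always_eventually less_imp_le\<close>)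
  then have "(\<lambda>q. Y q - (h ^^ r q) x) \<longlonglongrightarrow> 0" unfolding dist_norm by (rule tendsto_norm_zero_cancel)
  from tendsto_add[OF this xh(2)] have Yx: "Y \<longlonglongrightarrow> xh" by simp
  obtain \<phi>' s e' where phi': "strict_mono (s :: nat \<Rightarrow> nat)" "\<phi>' \<in> limit_maps d h S \<psi> xh" "e' > 0"
    "uniform_limit (cball 0 e') (\<lambda>n. \<psi> (Y (s n))) \<phi>' sequentially" "holomorphic_curve_on \<phi>' (cball 0 e')"
    using limit_map_compactness[OF fam YS Yx bd] by (elim exE conjE)
  have "curve_deriv m \<phi>' 0 = 0" if m: "m \<in> I" for m
  proof (rule LIMSEQ_unique)
    have pid: "polynomial_map (h ^^ 0)" by (rule polynomial_map_funpow[OF pol])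
    have "(\<lambda>n. curve_deriv m (\<lambda>z. (h ^^ 0) (\<psi> (Y (s n)) z)) 0) \<longlonglongrightarrow> curve_deriv m (\<lambda>z. (h ^^ 0) (\<phi>' z)) 0"
      by (rule limit_map_curve_deriv[OF fam pid YS phi'(3,4,5)])
    then show "(\<lambda>n. curve_deriv m (\<psi> (Y (s n))) 0) \<longlonglongrightarrow> curve_deriv m \<phi>' 0" by simp
    have "(\<lambda>q. D m (r q) \<phi>) \<longlonglongrightarrow> 0"
      using LIMSEQ_subseq_LIMSEQ[OF lim[OF m] xh(1)] by (simp add: D_def o_def)
    from tendsto_add[OF tendsto_norm_zero[OF this] inv0]
    have b0: "(\<lambda>q. norm (D m (r q) \<phi>) + 1 / real (Suc q)) \<longlonglongrightarrow> 0" by simp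
    have "(\<lambda>q. curve_deriv m (\<psi> (Y q)) 0) \<longlonglongrightarrow> 0"
    proof (rule Lim_null_comparison[OF always_eventually b0], rule allI)
      fix q
      have "norm (curve_deriv m (\<psi> (Y q)) 0) \<le> norm (D m (r q) (\<psi> (y (i q))))"
        unfolding Y_def D_def by (rule stable_jets_shrink(2)[OF fam d bij pol green y(1)])
      also have "\<dots> \<le> norm (D m (r q) \<phi>) + dist (D m (r q) (\<psi> (y (i q)))) (D m (r q) \<phi>)"
        unfolding dist_norm by (rule norm_triangle_sub)
      also have "dist (D m (r q) (\<psi> (y (i q)))) (D m (r q) \<phi>) < 1 / Suc q" using i m by blast
      finally show "norm (curve_deriv m (\<psi> (Y q)) 0) \<le> norm (D m (r q) \<phi>) + 1 / real (Suc q)" by simp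
    qed
    from LIMSEQ_subseq_LIMSEQ[OF this phi'(1)]
    show "(\<lambda>n. curve_deriv m (\<psi> (Y (s n))) 0) \<longlonglongrightarrow> 0" by (simp add: o_def)
  qed
  then show ?thesis using phi'(2) by (intro bexI[of _ \<phi>'] ballI)
qed

theorem theorem7p3:
  fixes f :: "C2 \<Rightarrow> C2" and d :: real
    and Su Ss :: "C2 set" and \<psi>u \<psi>s :: "C2 \<Rightarrow> complex \<Rightarrow> C2" and lam :: "C2 \<Rightarrow> complex"
    and j k :: nat and x :: C2 and \<tau> :: enat
  assumes "polynomial_diffeomorphism f"
    and "has_dynamical_degree f d" and "d > 1"
    and "unstable_family d f Su \<psi>u" and "multipliers f Su \<psi>u lam"
    and "unstable_family d (inv f) Ss \<psi>s"
    and "j \<ge> 1" and "k \<ge> 1"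
    and "x \<in> stratum' d f Ss \<psi>s Su \<psi>u j k"
    and "backward_contraction f Su lam x"
    and "\<tau> = greatest_integer (contact_order x
               (variety_germ d f Su \<psi>u x) (variety_germ d (inv f) Ss \<psi>s x))"
  shows "\<forall>xh \<in> alpha_limit f x. max_order d (inv f) Ss \<psi>s xh \<ge> enat j * \<tau>"
proof
  fix xh assume "xh \<in> alpha_limit f x"
  then obtain r where r: "strict_mono r" "(\<lambda>n. (inv f ^^ r n) x) \<longlonglongrightarrow> xh"
    unfolding alpha_limit_def mem_Collect_eq by (elim exE conjE)
  have bij: "bij f" "bij (inv f)" and pol: "polynomial_map (inv f)"
    using assms(1) by (auto simp: polynomial_diffeomorphism_def bij_imp_bij_inv)
  have iif: "inv (inv f) = f" by (rule inv_inv_eq[OF bij(1)])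
  note G = green_structure[OF assms(1-3)]
  have gs: "green d (inv f) (inv f p) = d * green d (inv f) p" if "p \<in> Jplus (inv (inv f))" for p
    using that unfolding iif by (rule G(3))
  have gb: "bounded {p \<in> Jplus (inv (inv f)). green d (inv f) p \<le> C}" for C
    unfolding iif by (rule G(4))
  have so: "max_order d (inv f) Ss \<psi>s x = enat j" "max_order d f Su \<psi>u x = enat k"
    using assms(9) by (simp_all add: stratum'_def stratum_def)
  have ncu: "\<forall>\<phi>\<in>limit_maps d f Su \<psi>u x. \<exists>m\<ge>1. curve_deriv m \<phi> 0 \<noteq> 0"
    by (rule ballI, drule max_order_finite_nonconstant[OF so(2)], elim exE conjE, intro exI conjI)
  have ncs: "\<forall>\<phi>\<in>limit_maps d (inv f) Ss \<psi>s x. \<exists>m\<ge>1. curve_deriv m \<phi> 0 \<noteq> 0"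
    by (rule ballI, drule max_order_finite_nonconstant[OF so(1)], elim exE conjE, intro exI conjI)
  obtain \<phi>s where phis: "\<phi>s \<in> limit_maps d (inv f) Ss \<psi>s x" "\<forall>m. 1 \<le> m \<longrightarrow> m < j \<longrightarrow> curve_deriv m \<phi>s 0 = 0"
    using max_order_attained[OF so(1) assms(7)] by (elim bexE)
  let ?V = "variety_germ d f Su \<psi>u x" and ?W = "variety_germ d (inv f) Ss \<psi>s x"
  show "enat j * \<tau> \<le> max_order d (inv f) Ss \<psi>s xh"
  proof (cases "max_order d (inv f) Ss \<psi>s xh")
    case (enat M)
    \<comment> \<open>For an exponent t of contact, some stable limit map at xh has order at least j * t.\<close>
    have tM: "real j * t \<le> real M"
      if t: "0 < t" and V: "V \<in> ?V" and W: "W \<in> ?W" and co: "holomorphic_coordinates x U F"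
        and bound: "\<forall>p\<in>U \<inter> (V \<union> W). norm (fst (F p)) \<le> norm (snd (F p)) powr t" for t U F V W
    proof -
      have U: "open U" "x \<in> U" using co by (simp_all add: holomorphic_coordinates_def)
      obtain \<phi>u where phiu: "\<phi>u \<in> limit_maps d f Su \<psi>u x"
        using V unfolding variety_germ_def mem_Collect_eq by (elim bexE)
      obtain ru where ru: "ru > 0" "holomorphic_curve_on \<phi>u (ball 0 ru)" "\<phi>u 0 = x" "\<forall>z\<in>ball 0 ru. \<phi>u z \<in> U \<inter> V"
        using germ_representative[OF assms(4) V phiu ncu U] by (elim exE conjE)
      obtain rs where rs: "rs > 0" "holomorphic_curve_on \<phi>s (ball 0 rs)" "\<phi>s 0 = x" "\<forall>z\<in>ball 0 rs. \<phi>s z \<in> U \<inter> W"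
        using germ_representative[OF assms(6) W phis(1) ncs U] by (elim exE conjE)
      define \<rho> where "\<rho> = min ru rs"
      have rho: "\<rho> > 0" "ball 0 \<rho> \<subseteq> ball (0::complex) ru" "ball 0 \<rho> \<subseteq> ball (0::complex) rs"
        using ru rs by (auto simp: \<rho>_def)
      have hol: "holomorphic_curve_on \<phi>u (ball 0 \<rho>)" "holomorphic_curve_on \<phi>s (ball 0 \<rho>)"
        using ru(2) rs(2) rho unfolding holomorphic_curve_on_def by (meson holomorphic_on_subset)+
      have bu: "\<phi>u z \<in> U \<and> norm (fst (F (\<phi>u z))) \<le> norm (snd (F (\<phi>u z))) powr t"
        and bs: "\<phi>s z \<in> U \<and> norm (fst (F (\<phi>s z))) \<le> norm (snd (F (\<phi>s z))) powr t" if "z \<in> ball 0 \<rho>" for z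
        using bspec[OF ru(4) subsetD[OF rho(2) that]] bspec[OF rs(4) subsetD[OF rho(3) that]] bound by blast+
      define I where "I = {m. 1 \<le> m \<and> real m < real j * t}"
      have fin: "finite I"
      proof (rule finite_subset)
        show "I \<subseteq> {..nat \<lceil>real j * t\<rceil>}" unfolding I_def by (auto simp: le_nat_iff) linarith
      qed simp
      have "(\<lambda>n. curve_deriv m (\<lambda>z. (inv f ^^ n) (\<phi>u z)) 0) \<longlonglongrightarrow> 0" if "1 \<le> m" for m
        by (rule unstable_jets_vanish[OF assms(4,5,3) bij(1) pol G(1) G(2) assms(10) phiu that])
      then have lim: "(\<lambda>n. curve_deriv m (\<lambda>z. (inv f ^^ n) (\<phi>s z)) 0) \<longlonglongrightarrow> 0" if "m \<in> I" for m
        using that unfolding I_def mem_Collect_eq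
        by (elim conjE) (rule jet_transfer_maps[OF co t rho(1) hol(1) ru(3) bu hol(2) rs(3) bs bspec[OF ncu phiu] assms(7)
            phis(2)[rule_format] polynomial_map_funpow[OF pol]])
      have "\<exists>\<phi>'\<in>limit_maps d (inv f) Ss \<psi>s xh. \<forall>m\<in>I. curve_deriv m \<phi>' 0 = 0"
        by (rule vanishing_jet_in_limit[OF assms(6,3) bij(2) pol _ gb phis(1) fin _ r], erule gs, erule lim)
      then obtain \<phi>' where phi': "\<phi>' \<in> limit_maps d (inv f) Ss \<psi>s xh" "\<forall>m\<in>I. curve_deriv m \<phi>' 0 = 0"
        by (elim bexE)
      obtain m where m: "1 \<le> m" "m \<le> M" "curve_deriv m \<phi>' 0 \<noteq> 0"
        using max_order_finite_nonconstant[OF enat phi'(1)] by (elim exE conjE)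
      have "m \<notin> I" using phi'(2) m(3) by blast
      then show ?thesis using m(1,2) by (simp add: I_def)
    qed
    have "contact_order x ?V ?W \<le> ereal (real M / real j)"
      unfolding contact_order_def
    proof (rule Sup_least, elim imageE, unfold mem_Collect_eq, elim conjE exE bexE)
      fix u t U F V W
      assume a: "u = ereal t" "0 < t" "V \<in> ?V" "W \<in> ?W" "holomorphic_coordinates x U F"
        "\<forall>p\<in>U \<inter> (V \<union> W). norm (fst (F p)) \<le> norm (snd (F p)) powr t"
      from tM[OF a(2-)] show "u \<le> ereal (real M / real j)" using assms(7) a(1) by (simp add: field_simps)
    qed
    \<comment> \<open>If there is no exponent of contact, the contact order is - \<infinity>, and c = 0.\<close>
    moreover define c where "c = real_of_ereal (contact_order x ?V ?W)"
    ultimately have c: "\<tau> = enat (nat \<lfloor>c\<rfloor>)" "c \<le> real M / real j"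
      unfolding assms(11) by (cases "contact_order x ?V ?W"; simp add: greatest_integer_def)+
    have "real_of_int \<lfloor>c\<rfloor> \<le> real M / real j" using c(2) of_int_floor_le order_trans by blast
    then have "real (nat \<lfloor>c\<rfloor>) \<le> real M / real j" by (cases "\<lfloor>c\<rfloor> \<ge> 0") simp_all
    then have "real (j * nat \<lfloor>c\<rfloor>) \<le> real M" using assms(7) by (simp add: field_simps)
    then have "j * nat \<lfloor>c\<rfloor> \<le> M" unfolding of_nat_le_iff .
    then show ?thesis unfolding c(1) enat by simp
  qed simp
qed

end
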